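(* Let $\ell\ge 3$ be an integer and put $d_\ell:=(2\ell)^{4\ell}$. Then for Lebesgue-almost every $\alpha\in\mathbb{R}$, the sequence $\mathcal{X}_\alpha^d=\{\alpha n^d \bmod 1\}_{n\ge 1}$ has Poissonian $\ell$-point correlation for every integer $d$ with $d>d_\ell$.
   Context: For an integer $d>1$ and a real $\alpha\neq 0$, let $x(n)=\alpha n^d \bmod 1$ and $\mathcal{X}_\alpha^d=\{x(n)\}_{n>0}$. Write $[N]=\{1,\dots,N\}$. For $f\in C_c^\infty(\mathbb{R}^{\ell-1})$ define $$R_\ell^N(\mathcal{X}_\alpha^d,f)=\frac1N\sum^{*}_{\mathbf{n}\in[N]^\ell}\sum_{\mathbf{k}\in\mathbb{Z}^{\ell-1}} f\big(N(x(n_1)-x(n_2)+k_1),\dots,N(x(n_{\ell-1})-x(n_\ell)+k_{\ell-1})\big),$$ where $\sum^*$ means the coordinates of $\mathbf{n}=(n_1,\dots,n_\ell)$ are pairwise distinct. The sequence has Poissonian $\ell$-point correlation if for every $f\in C_c^\infty(\mathbb{R}^{\ell-1})$ the limit $\lim_{N\to\infty}R_\ell^N(\mathcal{X}_\alpha^d,f)$ exists and equals $\int_{\mathbb{R}^{\ell-1}}f(\mathbf{x})\,d\mathbf{x}$. *)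

theory Defs
  imports "HOL-Analysis.Analysis"
begin

text \<open>C-infinity functions on a Euclidean space: f lies in a family S of functions
  each of which is Frechet differentiable everywhere with all first-order
  partial derivatives again in S (greatest fixed point formulation).\<close>
definition smooth_fun :: "('a::euclidean_space \<Rightarrow> real) \<Rightarrow> bool" where
  "smooth_fun f \<longleftrightarrow> (\<exists>S. f \<in> S \<and>
     (\<forall>g\<in>S. \<exists>Dg. (\<forall>i\<in>Basis. Dg i \<in> S) \<and>
        (\<forall>x. (g has_derivative (\<lambda>v. \<Sum>i\<in>Basis. (v \<bullet> i) * Dg i x)) (at x))))"

definition Cc_infty :: "('a::euclidean_space \<Rightarrow> real) set" where
  "Cc_infty = {f. smooth_fun f \<and> compact (closure {x. f x \<noteq> 0})}"

definition xseq :: "real \<Rightarrow> nat \<Rightarrow> nat \<Rightarrow> real" where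
  "xseq \<alpha> d n = frac (\<alpha> * real n ^ d)"

text \<open>The l-point correlation sum. Coordinates of R^(l-1) are the type 'n,
  enumerated by the bijection b : {0..<l-1} -> 'n; tuples n in [N]^l are
  functions on {0..<l} (entry j is n_(j+1)) with pairwise distinct values.\<close>
definition corr_R ::
  "nat \<Rightarrow> (nat \<Rightarrow> 'n::finite) \<Rightarrow> real \<Rightarrow> nat \<Rightarrow> (real^'n \<Rightarrow> real) \<Rightarrow> nat \<Rightarrow> real" where
  "corr_R l b \<alpha> d f N = (1 / real N) *
     (\<Sum>n\<in>{n \<in> {0..<l} \<rightarrow>\<^sub>E {1..N}. inj_on n {0..<l}}.
        infsum (\<lambda>k::int^'n. f (\<chi> i. real N *
            (xseq \<alpha> d (n (inv_into {..<l-1} b i)) - xseq \<alpha> d (n (inv_into {..<l-1} b i + 1))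
             + of_int (k $ i)))) UNIV)"

definition poissonian_corr :: "nat \<Rightarrow> (nat \<Rightarrow> 'n::finite) \<Rightarrow> real \<Rightarrow> nat \<Rightarrow> bool" where
  "poissonian_corr l b \<alpha> d \<longleftrightarrow>
     (\<forall>f::real^'n \<Rightarrow> real. f \<in> Cc_infty \<longrightarrow>
        (\<lambda>N. corr_R l b \<alpha> d f N) \<longlonglongrightarrow> integral UNIV f)"

end

theory Submission
  imports Defs "HOL-Complex_Analysis.Complex_Analysis"
    "HOL-Computational_Algebra.Fundamental_Theorem_Algebra"
begin

text \<open>A continuous test function, periodised and rescaled, is a combination of translated Fejer
  kernels up to an error dominated by a product of Fejer kernels, so it suffices to treat Fejer
  products along \<open>N = j\<^bsup>q\<^esup>\<close> and to interpolate between consecutive such \<open>N\<close>. For a Fejer product the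
  frequency \<open>0\<close> gives the main term, and by orthogonality and Borel--Cantelli the remainder tends to
  \<open>0\<close> almost surely once there are \<open>O(N\<^bsup>2l - \<delta>\<^esup>)\<close> nontrivial pairs \<open>(n, h)\<close> with \<open>n\<^sub>i \<le> N\<close>,
  \<open>\<bar>h\<^sub>i\<bar> \<lless> N\<close> and \<open>\<Sum> h\<^sub>i n\<^sub>i\<^sup>d = 0\<close>, the \<open>h\<^sub>i\<close> summing to \<open>0\<close> on each half.

  Fix \<open>n\<close>, let \<open>r\<close> be the rank of the lattice of admissible \<open>h\<close>, with pivot coordinates \<open>J\<close>. If the
  lattice is spanned by very short vectors, there are few such lattices, and each one forces \<open>r\<close>
  independent diagonal equations on \<open>n\<close>, which save more than \<open>N\<^sup>r\<close>. Otherwise it contains fewer than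
  \<open>N\<^sup>r\<close> vectors by a power of \<open>N\<close>, while every \<open>n\<^sub>j\<^sup>d\<close> with \<open>j \<in> J\<close> is a rational combination of
  polynomial height of the \<open>n\<^sub>i\<^sup>d\<close> with \<open>i \<notin> J\<close>; such \<open>n\<^sub>j\<close> are shown to be at most \<open>N\<^sup>\<epsilon>\<close> in number.

  For the latter, write \<open>x\<^sup>d = \<Sum> c\<^sub>i u\<^sub>i(x)\<close> on the exceptional set \<open>Z\<close> and consider the monomials in \<open>u\<close>
  of degree at most \<open>e\<close> modulo polynomial relations in \<open>x\<close> of bounded degree; let \<open>g(e)\<close> be their
  rank. On a subset \<open>Z'\<close> that loses only a factor \<open>N\<^sup>\<epsilon>\<close>, these monomials have, with respect to a frame
  of size \<open>g(e)\<close>, rational coefficients with rapidly converging Taylor expansions. Since \<open>d\<close> is large,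
  the powers \<open>x\<^bsup>di + j\<^esup>\<close> produce about \<open>\<Sum>\<^bsub>i \<le> e\<^esub> g'(i)\<close> times as many independent integer-valued
  functions as there are \<open>j\<close>, and Siegel's pigeonhole argument gives \<open>\<Sum>\<^bsub>i \<le> e\<^esub> g'(i) \<lless> g(e)\<close>. If
  \<open>Z\<close> is so large that this can be iterated many times, the initial \<open>g\<close> exceeds the number of monomials.\<close>

section \<open>Linear algebra with bounded coefficients\<close>

text \<open>The exponents, with s = 2l: vectors count as very short up to length R = N^(1/(4sr)). Up
  to constants, R^(sr) = N^(1/4) sets of such vectors can span, and the equations forced by one of
  them save N^(1/3) beyond N^r. A lattice not so spanned loses a factor of about R, so the r pivot
  entries together may cost N^(1/(5sr)), that is N^(1/(5sr^2)) each. The obstacle is this last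
  count: the coefficients expressing x^d are arbitrary reals, and only the integrality and height of
  the h_i are available. Summing n times turns the constant 1 into a binomial coefficient of size at
  least (E/n)^n, which has to beat all constants and the trivial bound (E+1)^k. This forces E to be
  a fixed power of s; E = s^11 suffices for every rank. The powers x^(di+j) with j up to rE+1 must
  not overlap, so d > rE+1 is required, and rE+1 is at most s^12, hence at most (2l)^(4l) for l at
  least 3.\<close>

lemma underdetermined_real:
  fixes A :: "'i \<Rightarrow> 'j \<Rightarrow> real"
  assumes "finite I" "finite J" "card I < card J"
  shows "\<exists>y. (\<exists>j\<in>J. y j \<noteq> 0) \<and> (\<forall>i\<in>I. (\<Sum>j\<in>J. A i j * y j) = 0)"
  using assms
proof (induction I arbitrary: A J rule: finite_induct)
  case empty
  then have "J \<noteq> {}" by auto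
  then show ?case by (intro exI[of _ "\<lambda>_. 1"]) auto
next
  case (insert i0 I)
  show ?case
  proof (cases "\<forall>j\<in>J. A i0 j = 0")
    case True
    have "card I < card J" using insert by simp
    from insert.IH[OF insert.prems(1) this, of A] obtain y
      where "\<exists>j\<in>J. y j \<noteq> 0" "\<forall>i\<in>I. (\<Sum>j\<in>J. A i j * y j) = 0" by auto
    then show ?thesis using True by (intro exI[of _ y]) auto
  next
    case False
    then obtain j0 where j0: "j0 \<in> J" "A i0 j0 \<noteq> 0" by auto
    define J' where "J' = J - {j0}"
    have J': "finite J'" "card I < card J'" "j0 \<notin> J'" "J = insert j0 J'"
      using insert j0 by (auto simp: J'_def)
    from insert.IH[OF J'(1,2), of "\<lambda>i j. A i j - A i j0 * A i0 j / A i0 j0"] obtain y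
      where y: "\<exists>j\<in>J'. y j \<noteq> 0"
        "\<forall>i\<in>I. (\<Sum>j\<in>J'. (A i j - A i j0 * A i0 j / A i0 j0) * y j) = 0" by auto
    define Y where "Y = (\<Sum>j\<in>J'. A i0 j * y j)"
    define z where "z = y(j0 := - Y / A i0 j0)"
    have zJ: "(\<Sum>j\<in>J. A i j * z j) = A i j0 * (- Y / A i0 j0) + (\<Sum>j\<in>J'. A i j * y j)" for i
    proof -
      have "(\<Sum>j\<in>J'. A i j * z j) = (\<Sum>j\<in>J'. A i j * y j)"
        using J'(3) by (intro sum.cong) (auto simp: z_def)
      then show ?thesis using J'(1,3) unfolding J'(4) by (simp add: z_def)
    qed
    have "(\<Sum>j\<in>J. A i0 j * z j) = 0" using j0(2) by (simp add: zJ Y_def)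
    moreover have "(\<Sum>j\<in>J. A i j * z j) = 0" if "i \<in> I" for i
    proof -
      have "0 = (\<Sum>j\<in>J'. A i j * y j - A i j0 / A i0 j0 * (A i0 j * y j))"
        using y(2) that by (simp add: left_diff_distrib mult.assoc)
      also have "\<dots> = (\<Sum>j\<in>J'. A i j * y j) - A i j0 / A i0 j0 * Y"
        by (simp only: sum_subtractf sum_distrib_left[symmetric] Y_def)
      finally show ?thesis by (simp add: zJ)
    qed
    moreover have "\<exists>j\<in>J. z j \<noteq> 0"
      using y(1) J'(3,4) by (auto simp: z_def)
    ultimately show ?thesis by auto
  qed
qed

text \<open>Comparing coefficients turns the system into one over the reals. With the degree bound
  \<open>n = card I * \<delta>\<close> there are \<open>card J * (n + 1)\<close> real unknowns
  against \<open>card I * (n + \<delta> + 1)\<close> equations, and this \<open>n\<close> makes the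
  former exceed the latter.\<close>

lemma underdetermined_poly:
  fixes A :: "'i \<Rightarrow> 'j \<Rightarrow> real poly"
  assumes I: "finite I" and J: "finite J" "card I < card J"
    and deg: "\<And>i j. i \<in> I \<Longrightarrow> j \<in> J \<Longrightarrow> degree (A i j) \<le> \<delta>"
  shows "\<exists>y. (\<exists>j\<in>J. y j \<noteq> 0) \<and> (\<forall>j\<in>J. degree (y j) \<le> card I * \<delta>) \<and>
    (\<forall>i\<in>I. (\<Sum>j\<in>J. A i j * y j) = 0)"
proof -
  define n where "n = card I * \<delta>"
  have "card I * (n + \<delta> + 1) < card J * (n + 1)"
  proof -
    have "card I * (n + \<delta> + 1) < (card I + 1) * (n + 1)"
      by (simp add: n_def algebra_simps)
    also have "\<dots> \<le> card J * (n + 1)" using J by (intro mult_right_mono) auto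
    finally show ?thesis .
  qed
  then have c: "card (I \<times> {..n+\<delta>}) < card (J \<times> {..n})" by (simp add: card_cartesian_product)
  obtain z where z: "\<exists>q\<in>J \<times> {..n}. z q \<noteq> 0"
    "\<forall>p\<in>I \<times> {..n+\<delta>}. (\<Sum>q\<in>J \<times> {..n}. (if snd q \<le> snd p then
       coeff (A (fst p) (fst q)) (snd p - snd q) else 0) * z q) = 0"
    using underdetermined_real[OF _ _ c, of "\<lambda>p q. if snd q \<le> snd p then
       coeff (A (fst p) (fst q)) (snd p - snd q) else 0"] I J by auto
  define y where "y j = (\<Sum>u\<le>n. monom (z (j,u)) u)" for j
  have cy: "coeff (y j) u = (if u \<le> n then z (j,u) else 0)" for j u
    by (simp add: y_def coeff_sum)
  have dy: "degree (y j) \<le> n" for j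
    by (rule degree_le) (simp add: cy)
  have "(\<Sum>j\<in>J. A i j * y j) = 0" if i: "i \<in> I" for i
  proof (rule poly_eqI)
    fix t
    have "coeff (\<Sum>j\<in>J. A i j * y j) t
      = (\<Sum>j\<in>J. \<Sum>u\<le>n. (if u \<le> t then coeff (A i j) (t - u) else 0) * z (j,u))"
      unfolding coeff_sum y_def sum_distrib_left
      by (intro sum.cong refl) (auto simp: coeff_monom_mult mult.commute[of _ "monom _ _"])
    also have "\<dots> = 0"
    proof (cases "t \<le> n + \<delta>")
      case True
      then show ?thesis using z(2)[rule_format, of "(i,t)"] i
        by (simp add: sum.cartesian_product case_prod_beta cong: if_cong)
    next
      case False
      have "coeff (A i j) (t - u) = 0" if "j \<in> J" "u \<le> n" for j u
        using deg[OF i that(1)] that False by (intro coeff_eq_0) auto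
      then show ?thesis by (intro sum.neutral ballI) (auto intro!: sum.neutral)
    qed
    finally show "coeff (\<Sum>j\<in>J. A i j * y j) t = coeff 0 t" by simp
  qed
  moreover have "\<exists>j\<in>J. y j \<noteq> 0"
  proof -
    obtain j u where "j \<in> J" "u \<le> n" "z (j,u) \<noteq> 0" using z(1) by auto
    then have "coeff (y j) u \<noteq> 0" by (simp add: cy)
    then show ?thesis using \<open>j \<in> J\<close> by (metis coeff_0)
  qed
  ultimately show ?thesis using dy by (auto simp: n_def)
qed

text \<open>Independence of an indexed family: equal rows with different indices are dependent, and
  with no columns only the empty family is independent. Columns may be evaluation points, which
  turns functions into rows.\<close>

definition row_indep :: "('m \<Rightarrow> 'g \<Rightarrow> real) \<Rightarrow> 'g set \<Rightarrow> 'm set \<Rightarrow> bool" where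
  "row_indep v G M \<longleftrightarrow>
     (\<forall>c. (\<forall>g\<in>G. (\<Sum>m\<in>M. c m * v m g) = 0) \<longrightarrow> (\<forall>m\<in>M. c m = 0))"

lemma row_indepD:
  "row_indep v G M \<Longrightarrow> (\<And>g. g \<in> G \<Longrightarrow> (\<Sum>m\<in>M. c m * v m g) = 0) \<Longrightarrow> m \<in> M \<Longrightarrow> c m = 0"
  by (auto simp: row_indep_def)

lemma not_row_indep:
  "\<not> row_indep v G M \<Longrightarrow> \<exists>c. (\<forall>g\<in>G. (\<Sum>m\<in>M. c m * v m g) = 0) \<and> (\<exists>m\<in>M. c m \<noteq> 0)"
  by (simp add: row_indep_def)

lemma row_indep_card_le:
  assumes "row_indep v G M" "finite G" "finite M"
  shows "card M \<le> card G"
proof (rule ccontr)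
  assume "\<not> card M \<le> card G"
  then have "card G < card M" by simp
  from underdetermined_real[OF assms(2,3) this, of "\<lambda>g m. v m g"] obtain y
    where "\<exists>j\<in>M. y j \<noteq> 0" "\<forall>g\<in>G. (\<Sum>m\<in>M. v m g * y m) = 0" by auto
  then show False using row_indepD[OF assms(1), of y] by (auto simp: mult.commute)
qed

text \<open>Repeatedly drop a row carrying the largest coefficient of some linear relation: it is a
  combination of the remaining rows with coefficients at most 1 in modulus.\<close>

lemma conditioned_rows:
  fixes v :: "'m \<Rightarrow> 'g \<Rightarrow> real"
  assumes "finite M"
  shows "\<exists>\<Gamma> b. \<Gamma> \<subseteq> M \<and> row_indep v G \<Gamma> \<and>
    (\<forall>m\<in>M. \<forall>g\<in>G. v m g = (\<Sum>\<gamma>\<in>\<Gamma>. b m \<gamma> * v \<gamma> g)) \<and>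
    (\<forall>m\<in>M. \<forall>\<gamma>\<in>\<Gamma>. \<bar>b m \<gamma>\<bar> \<le> fact (card M))"
  using assms
proof (induction "card M" arbitrary: M)
  case 0
  then show ?case by (intro exI[of _ "{}"]) (auto simp: row_indep_def)
next
  case (Suc n)
  show ?case
  proof (cases "row_indep v G M")
    case True
    show ?thesis
    proof (intro exI[of _ M] exI[of _ "\<lambda>m \<gamma>. if m = \<gamma> then 1 else 0"] conjI ballI)
      fix m g assume "m \<in> M"
      have "(\<Sum>\<gamma>\<in>M. (if m = \<gamma> then 1 else 0) * v \<gamma> g) = (\<Sum>\<gamma>\<in>M. if m = \<gamma> then v \<gamma> g else 0)"
        by (intro sum.cong) auto
      also have "\<dots> = v m g" using \<open>m \<in> M\<close> Suc.prems by simp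
      finally show "v m g = (\<Sum>\<gamma>\<in>M. (if m = \<gamma> then 1 else 0) * v \<gamma> g)" by simp
    qed (use True in auto)
  next
    case False
    from not_row_indep[OF this] obtain c where
      c: "\<forall>g\<in>G. (\<Sum>m\<in>M. c m * v m g) = 0" "\<exists>m\<in>M. c m \<noteq> 0"
      by (elim exE conjE)
    have ne: "M \<noteq> {}" using c(2) by auto
    obtain m0 where m0: "m0 \<in> M" "\<And>m. m \<in> M \<Longrightarrow> \<bar>c m\<bar> \<le> \<bar>c m0\<bar>"
    proof -
      have f: "finite ((\<lambda>m. \<bar>c m\<bar>) ` M)" "(\<lambda>m. \<bar>c m\<bar>) ` M \<noteq> {}" using Suc.prems ne by auto
      from Max_in[OF f] obtain m0 where "m0 \<in> M" "\<bar>c m0\<bar> = Max ((\<lambda>m. \<bar>c m\<bar>) ` M)" by auto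
      then show ?thesis using that Max_ge[OF f(1)] by auto
    qed
    have c0: "c m0 \<noteq> 0" using c(2) m0(2) by fastforce
    define M' where "M' = M - {m0}"
    have M': "finite M'" "n = card M'" "M = insert m0 M'" "m0 \<notin> M'"
      using Suc m0(1) by (auto simp: M'_def)
    obtain \<Gamma> b where G: "\<Gamma> \<subseteq> M'" "row_indep v G \<Gamma>"
      and b: "\<And>m g. m \<in> M' \<Longrightarrow> g \<in> G \<Longrightarrow> v m g = (\<Sum>\<gamma>\<in>\<Gamma>. b m \<gamma> * v \<gamma> g)"
      and bb: "\<And>m \<gamma>. m \<in> M' \<Longrightarrow> \<gamma> \<in> \<Gamma> \<Longrightarrow> \<bar>b m \<gamma>\<bar> \<le> fact n"
      using Suc.hyps(1)[OF M'(2,1)] unfolding M'(2)[symmetric] by blast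
    define b0 where "b0 \<gamma> = (\<Sum>m\<in>M'. (- c m / c m0) * b m \<gamma>)" for \<gamma>
    define b' where "b' m \<gamma> = (if m = m0 then b0 \<gamma> else b m \<gamma>)" for m \<gamma>
    have cM: "fact (card M) = (1 + real n) * fact n" using M' by simp
    have f0: "(fact n :: real) \<le> (1 + real n) * fact n"
      using mult_right_mono[of 1 "1 + real n" "fact n"] by simp
    have v0: "v m0 g = (\<Sum>\<gamma>\<in>\<Gamma>. b0 \<gamma> * v \<gamma> g)" if "g \<in> G" for g
    proof -
      have "c m0 * v m0 g + (\<Sum>m\<in>M'. c m * v m g) = 0"
        using c(1) that M' by simp
      then have "v m0 g = - (\<Sum>m\<in>M'. c m * v m g) / c m0"
        using c0 by (simp add: field_simps)
      also have "\<dots> = (\<Sum>m\<in>M'. (- c m / c m0) * v m g)"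
        by (simp add: sum_negf sum_divide_distrib)
      also have "\<dots> = (\<Sum>m\<in>M'. \<Sum>\<gamma>\<in>\<Gamma>. (- c m / c m0) * b m \<gamma> * v \<gamma> g)"
        using b[OF _ that] by (intro sum.cong refl) (simp add: sum_distrib_left mult.assoc)
      also have "\<dots> = (\<Sum>\<gamma>\<in>\<Gamma>. b0 \<gamma> * v \<gamma> g)"
        by (subst sum.swap) (simp add: b0_def sum_distrib_right)
      finally show ?thesis .
    qed
    have bb0: "\<bar>b0 \<gamma>\<bar> \<le> fact (card M)" if "\<gamma> \<in> \<Gamma>" for \<gamma>
    proof -
      \<comment> \<open>Maximality of \<open>c m0\<close> bounds each quotient by 1, so the new
        coefficient is a sum of \<open>n\<close> numbers of size at most \<open>fact n\<close>; this
        is where the factorial comes from.\<close>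
      have "\<bar>b0 \<gamma>\<bar> \<le> (\<Sum>m\<in>M'. fact n)"
        unfolding b0_def
      proof (rule order_trans[OF sum_abs], rule sum_mono)
        fix m assume m: "m \<in> M'"
        have "\<bar>c m / c m0\<bar> \<le> 1" using m0(2)[of m] m M' c0 by (simp add: field_simps)
        then show "\<bar>- c m / c m0 * b m \<gamma>\<bar> \<le> fact n"
          using mult_mono[of "\<bar>c m / c m0\<bar>" 1 "\<bar>b m \<gamma>\<bar>" "fact n"] bb[OF m that]
          by (simp add: abs_mult)
      qed
      also have "\<dots> \<le> fact (card M)" unfolding cM using M' by (simp add: algebra_simps)
      finally show ?thesis .
    qed
    have bb1: "\<bar>b m \<gamma>\<bar> \<le> fact (card M)" if "\<gamma> \<in> \<Gamma>" "m \<in> M'" for \<gamma> m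
      unfolding cM using bb[OF that(2,1)] f0 by linarith
    show ?thesis
    proof (intro exI[of _ \<Gamma>] exI[of _ b'] conjI ballI)
      fix m \<gamma> assume "m \<in> M" "\<gamma> \<in> \<Gamma>"
      then show "\<bar>b' m \<gamma>\<bar> \<le> fact (card M)"
        using bb0 bb1 M'(3) by (cases "m = m0") (auto simp: b'_def)
    next
      fix m g assume "m \<in> M" "g \<in> G"
      then show "v m g = (\<Sum>\<gamma>\<in>\<Gamma>. b' m \<gamma> * v \<gamma> g)"
        using v0 b[of m g] M'(3) by (cases "m = m0") (simp_all add: b'_def)
    qed (use G M'(3) in auto)
  qed
qed

lemma row_indep_extend:
  assumes "finite M" "G0 \<subseteq> M" "row_indep v X G0"
  shows "\<exists>G. G0 \<subseteq> G \<and> G \<subseteq> M \<and> row_indep v X G \<and>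
    (\<forall>m\<in>M. \<exists>b. \<forall>x\<in>X. v m x = (\<Sum>g\<in>G. b g * v g x))"
proof -
  define P where "P G \<longleftrightarrow> G0 \<subseteq> G \<and> G \<subseteq> M \<and> row_indep v X G" for G
  have "\<exists>G. P G \<and> (\<forall>G'. P G' \<longrightarrow> card G' \<le> card G)"
  proof (rule ex_has_greatest_nat)
    show "P G0" using assms by (simp add: P_def)
    show "\<forall>G. P G \<longrightarrow> card G < Suc (card M)"
      using assms(1) by (simp add: P_def card_mono less_Suc_eq_le)
  qed
  then obtain G where G: "P G" "\<And>G'. P G' \<Longrightarrow> card G' \<le> card G" by auto
  have fG: "finite G" using G(1) assms(1) by (auto simp: P_def intro: finite_subset)
  have "\<exists>b. \<forall>x\<in>X. v m x = (\<Sum>g\<in>G. b g * v g x)" if m: "m \<in> M" for m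
  proof (cases "m \<in> G")
    case True
    have "(\<Sum>g\<in>G. (if g = m then 1 else 0) * v g x) = (\<Sum>g\<in>G. if g = m then v g x else 0)" for x
      by (intro sum.cong) auto
    then have "v m x = (\<Sum>g\<in>G. (if g = m then 1 else 0) * v g x)" for x
      using True fG by simp
    then show ?thesis by (intro exI[of _ "\<lambda>g. if g = m then 1 else 0"]) simp
  next
    case False
    have "\<not> P (insert m G)" using G(2)[of "insert m G"] False fG by auto
    then have "\<not> row_indep v X (insert m G)" using G(1) m by (auto simp: P_def)
    from not_row_indep[OF this] obtain c where
      c: "\<forall>x\<in>X. (\<Sum>g\<in>insert m G. c g * v g x) = 0" "\<exists>g\<in>insert m G. c g \<noteq> 0"
      by (elim exE conjE)
    have c': "c m * v m x + (\<Sum>g\<in>G. c g * v g x) = 0" if "x \<in> X" for x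
      using c(1) that False fG by simp
    have "c m \<noteq> 0"
    proof
      assume "c m = 0"
      then have "(\<Sum>g\<in>G. c g * v g x) = 0" if "x \<in> X" for x using c'[OF that] by simp
      moreover have "row_indep v X G" using G(1) by (simp add: P_def)
      ultimately have "c g = 0" if "g \<in> G" for g using row_indepD[of v X G c g] that by auto
      then show False using c(2) \<open>c m = 0\<close> by auto
    qed
    have "v m x = (\<Sum>g\<in>G. (- c g / c m) * v g x)" if "x \<in> X" for x
    proof -
      have "v m x = - (\<Sum>g\<in>G. c g * v g x) / c m"
        using c'[OF that] \<open>c m \<noteq> 0\<close> by (simp add: field_simps)
      then show ?thesis by (simp add: sum_negf sum_divide_distrib)
    qed
    then show ?thesis by (intro exI[of _ "\<lambda>g. - c g / c m"]) simp
  qed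
  then show ?thesis using G(1) by (intro exI[of _ G]) (simp add: P_def)
qed

text \<open>Steinitz exchange: an independent family in the span of \<open>F\<close> is traded for
  an equally large independent subfamily of \<open>F\<close>. It matters that the new functions
  belong to \<open>F\<close>, where integrality and approximations are available.\<close>

lemma row_indep_in_span_card_le:
  assumes "finite A" "finite F" "row_indep w X A"
    and span: "\<And>a. a \<in> A \<Longrightarrow> \<exists>b. \<forall>x\<in>X. w a x = (\<Sum>f\<in>F. b f * v f x)"
  shows "\<exists>F'\<subseteq>F. row_indep v X F' \<and> card A \<le> card F'"
proof -
  have "row_indep v X {}" by (simp add: row_indep_def)
  from row_indep_extend[OF assms(2) _ this] obtain F' where F': "F' \<subseteq> F" "row_indep v X F'"
    "\<forall>m\<in>F. \<exists>b. \<forall>x\<in>X. v m x = (\<Sum>g\<in>F'. b g * v g x)" by auto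
  from bchoice[OF F'(3)] obtain b where b: "\<forall>m\<in>F. \<forall>x\<in>X. v m x = (\<Sum>g\<in>F'. b m g * v g x)" by auto
  have "\<forall>a\<in>A. \<exists>c. \<forall>x\<in>X. w a x = (\<Sum>f\<in>F. c f * v f x)" using span by auto
  from bchoice[OF this] obtain c where c: "\<forall>a\<in>A. \<forall>x\<in>X. w a x = (\<Sum>f\<in>F. c a f * v f x)" by auto
  have fF': "finite F'" using F'(1) assms(2) finite_subset by auto
  define e where "e a g = (\<Sum>f\<in>F. c a f * b f g)" for a g
  have we: "w a x = (\<Sum>g\<in>F'. e a g * v g x)" if "a \<in> A" "x \<in> X" for a x
  proof -
    have "w a x = (\<Sum>f\<in>F. c a f * (\<Sum>g\<in>F'. b f g * v g x))"
      using c b that by (simp cong: sum.cong)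
    also have "\<dots> = (\<Sum>f\<in>F. \<Sum>g\<in>F'. c a f * b f g * v g x)"
      by (simp add: sum_distrib_left mult.assoc)
    also have "\<dots> = (\<Sum>g\<in>F'. e a g * v g x)"
      by (subst sum.swap) (simp add: e_def sum_distrib_right)
    finally show ?thesis .
  qed
  have "row_indep e F' A"
    unfolding row_indep_def
  proof (intro allI impI)
    fix y assume y: "\<forall>g\<in>F'. (\<Sum>a\<in>A. y a * e a g) = 0"
    have "(\<Sum>a\<in>A. y a * w a x) = 0" if "x \<in> X" for x
    proof -
      have "(\<Sum>a\<in>A. y a * w a x) = (\<Sum>a\<in>A. \<Sum>g\<in>F'. y a * e a g * v g x)"
        using we that by (intro sum.cong refl) (simp add: sum_distrib_left mult.assoc)
      also have "\<dots> = (\<Sum>g\<in>F'. (\<Sum>a\<in>A. y a * e a g) * v g x)"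
        by (subst sum.swap) (simp add: sum_distrib_right)
      also have "\<dots> = 0" using y by simp
      finally show ?thesis .
    qed
    then show "\<forall>a\<in>A. y a = 0" using row_indepD[OF assms(3), of y] by simp
  qed
  then have "card A \<le> card F'" by (rule row_indep_card_le[OF _ fF' assms(1)])
  then show ?thesis using F'(1,2) by blast
qed

section \<open>Rational functions near integer points\<close>

text \<open>Factor out the roots one at a time: the distances of a root from \<open>x\<close> and
  from \<open>y\<close> differ by a factor at most 2, because the root is at least \<rho> away from
  \<open>x\<close>.\<close>

lemma poly_zero_free_bound:
  fixes p :: "complex poly"
  assumes "p \<noteq> 0" "\<rho> > 0" "\<And>z. poly p z = 0 \<Longrightarrow> \<rho> \<le> norm (x - z)" "norm (y - x) \<le> \<rho> / 2"
  shows "norm (poly p y) \<le> 2 ^ degree p * norm (poly p x) \<and>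
         norm (poly p x) \<le> 2 ^ degree p * norm (poly p y)"
  using assms
proof (induction "degree p" arbitrary: p)
  case 0
  then obtain c where "p = [:c:]" by (metis degree_eq_zeroE)
  then show ?case by simp
next
  case (Suc n)
  obtain z where z: "poly p z = 0" 
    using fundamental_theorem_of_algebra[of p] constant_degree[of p] Suc.hyps(2) by auto
  then obtain q where q: "p = [:-z, 1:] * q" by (metis dvdE poly_eq_0_iff_dvd)
  have "q \<noteq> 0" using q Suc.prems(1) by auto
  then have dp: "degree p = Suc (degree q)" unfolding q by (subst degree_mult_eq) auto
  have IH: "norm (poly q y) \<le> 2 ^ degree q * norm (poly q x)"
       "norm (poly q x) \<le> 2 ^ degree q * norm (poly q y)"
    using Suc.hyps(1)[of q] Suc.prems Suc.hyps(2) dp \<open>q \<noteq> 0\<close> by (auto simp: q)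
  have zx: "\<rho> \<le> norm (x - z)" by (rule Suc.prems(3)[OF z])
  have "norm (y - z) \<le> norm (y - x) + norm (x - z)" "norm (x - z) \<le> norm (x - y) + norm (y - z)"
    using norm_triangle_ineq[of "y - x" "x - z"] norm_triangle_ineq[of "x - y" "y - z"] by auto
  then have a: "norm (y - z) \<le> 2 * norm (x - z)" "norm (x - z) \<le> 2 * norm (y - z)"
    using zx Suc.prems(4) Suc.prems(2) by (auto simp: norm_minus_commute)
  have "norm (poly p u) = norm (u - z) * norm (poly q u)" for u
    by (simp add: q norm_mult[symmetric] algebra_simps)
  then show ?case
    using mult_mono[OF a(1) IH(1)] mult_mono[OF a(2) IH(2)] dp by (simp add: ac_simps)
qed

lemma poly_map_of_real [simp]:
  "poly (map_poly of_real p) (of_real x :: 'a :: {real_algebra_1,comm_ring_1}) = of_real (poly p x)"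
  by (induction p) (simp_all add: map_poly_pCons)

text \<open>Cauchy's inequality on the circle of radius \<open>R\<close> bounds the coefficients
  normalised by \<open>R ^ t\<close>. Since \<eta> is at most 1/2, the tail from \<open>T\<close> on
  is dominated by a geometric series of ratio 1/2, which gives the factor 2.\<close>

lemma holomorphic_taylor_bound:
  fixes f :: "complex \<Rightarrow> complex"
  assumes hol: "f holomorphic_on ball z0 (2 * R)" and "R > 0"
    and bd: "\<And>z. z \<in> ball z0 (2 * R) \<Longrightarrow> norm (f z) \<le> B"
    and \<eta>: "0 \<le> \<eta>" "\<eta> \<le> 1 / 2"
  shows "\<exists>c. (\<forall>t. norm (c t) \<le> B) \<and>
    (\<forall>w. norm w \<le> \<eta> \<longrightarrow> norm (f (z0 + of_real R * w) - (\<Sum>t<T. c t * w ^ t)) \<le> 2 * B * \<eta> ^ T)"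
proof -
  define c where "c t = (deriv ^^ t) f z0 / fact t * of_real R ^ t" for t
  have sub: "cball z0 R \<subseteq> ball z0 (2 * R)" using \<open>R > 0\<close> by auto
  have B0: "B \<ge> 0" using bd[of z0] \<open>R > 0\<close> norm_ge_zero[of "f z0"] by (smt (verit) centre_in_ball)
  have cB: "norm (c t) \<le> B" for t
  proof -
    have "norm ((deriv ^^ t) f z0) \<le> fact t * B / R ^ t"
    proof (rule Cauchy_inequality)
      show "f holomorphic_on ball z0 R" using hol by (rule holomorphic_on_subset) (use \<open>R > 0\<close> in auto)
      show "continuous_on (cball z0 R) f"
        using hol sub holomorphic_on_imp_continuous_on continuous_on_subset by blast
      fix z assume "norm (z0 - z) = R"
      then show "norm (f z) \<le> B" using \<open>R > 0\<close> by (intro bd) (auto simp: dist_norm)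
    qed fact
    then show ?thesis using \<open>R > 0\<close>
      by (simp add: c_def norm_mult norm_divide norm_power field_simps)
  qed
  have "norm (f (z0 + of_real R * w) - (\<Sum>t<T. c t * w ^ t)) \<le> 2 * B * \<eta> ^ T" if w: "norm w \<le> \<eta>" for w
  proof -
    have "R * norm w < 2 * R" using w \<eta> \<open>R > 0\<close> by simp
    then have "z0 + of_real R * w \<in> ball z0 (2 * R)" using \<open>R > 0\<close> by (simp add: dist_norm norm_mult)
    from holomorphic_power_series[OF hol this]
    have s: "(\<lambda>n. c n * w ^ n) sums f (z0 + of_real R * w)"
      by (simp add: c_def power_mult_distrib mult.assoc)
    have "f (z0 + of_real R * w) - (\<Sum>t<T. c t * w ^ t) = (\<Sum>n. c (n + T) * w ^ (n + T))"
      using suminf_minus_initial_segment[OF sums_summable[OF s], of T] sums_unique[OF s] by simp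
    also have "norm \<dots> \<le> (\<Sum>n. B * \<eta> ^ T * (1/2) ^ n)"
    proof (rule norm_suminf_le)
      fix n
      have "norm (w ^ (n + T)) = norm w ^ T * norm w ^ n"
        by (simp add: norm_power norm_mult power_add)
      also have "\<dots> \<le> \<eta> ^ T * (1/2) ^ n"
        using w \<eta> by (intro mult_mono power_mono) auto
      finally have "norm (w ^ (n + T)) \<le> \<eta> ^ T * (1/2) ^ n" .
      then show "norm (c (n + T) * w ^ (n + T)) \<le> B * \<eta> ^ T * (1/2) ^ n"
        unfolding norm_mult using cB[of "n + T"] B0 \<eta>
          mult_mono[of "norm (c (n + T))" B "norm (w ^ (n + T))" "\<eta> ^ T * (1/2) ^ n"]
        by (simp add: mult.assoc)
    qed (simp add: summable_geometric summable_mult)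
    also have "\<dots> = B * \<eta> ^ T * 2"
      by (subst suminf_mult) (simp_all add: summable_geometric suminf_geometric)
    finally show ?thesis by (simp add: mult_ac)
  qed
  then show ?thesis using cB by blast
qed

text \<open>Complex zeros also of real polynomials, because the complex ones limit the discs on
  which quotients are holomorphic.\<close>

definition czeros :: "real poly \<Rightarrow> complex set" where
  "czeros p = {z. poly (map_poly of_real p) z = 0}"

lemma finite_czeros: "p \<noteq> 0 \<Longrightarrow> finite (czeros p)"
  unfolding czeros_def by (intro poly_roots_finite) (simp add: map_poly_eq_0_iff)

lemma card_czeros_le: "p \<noteq> 0 \<Longrightarrow> card (czeros p) \<le> degree p"
  unfolding czeros_def
  using card_poly_roots_bound[of "map_poly complex_of_real p"]
  by (simp add: map_poly_eq_0_iff degree_map_poly)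

text \<open>Numerator and denominator have no zeros near the disc of radius \<open>2 * R\<close>, so
  each stays within a factor \<open>2 ^ n\<close> of its value at \<open>x0\<close>, and a bound for
  the quotient at the single point \<open>x0\<close> extends to the disc at the price
  \<open>4 ^ n\<close>. The power \<open>x ^ j\<close> accounts for
  \<open>(2 * N) ^ D\<close>.\<close>

lemma rational_taylor:
  fixes P Q :: "real poly"
  assumes Q0: "Q \<noteq> 0" and deg: "degree P \<le> n" "degree Q \<le> n"
    and R: "R > 0" "4 * R \<le> N" "\<bar>x0\<bar> \<le> N" "N \<ge> 1"
    and zQ: "\<And>z. z \<in> czeros Q \<Longrightarrow> 4 * R \<le> norm (of_real x0 - z)"
    and zP: "\<And>z. P \<noteq> 0 \<Longrightarrow> z \<in> czeros P \<Longrightarrow> 4 * R \<le> norm (of_real x0 - z)"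
    and C: "\<bar>poly P x0\<bar> \<le> C * \<bar>poly Q x0\<bar>"
    and \<eta>: "0 \<le> \<eta>" "\<eta> \<le> 1 / 2" and j: "j \<le> D"
  shows "\<exists>c::nat \<Rightarrow> real. (\<forall>t. \<bar>c t\<bar> \<le> 4 ^ n * C * (2 * N) ^ D) \<and>
    (\<forall>w. \<bar>w\<bar> \<le> \<eta> \<longrightarrow> \<bar>(x0 + R * w) ^ j * (poly P (x0 + R * w) / poly Q (x0 + R * w)) - (\<Sum>t<T. c t * w ^ t)\<bar>
       \<le> 2 * (4 ^ n * C * (2 * N) ^ D) * \<eta> ^ T)"
proof -
  define p q where "p = map_poly complex_of_real P" and "q = map_poly complex_of_real Q"
  define f where "f z = z ^ j * (poly p z / poly q z)" for z
  have q0: "q \<noteq> 0" using Q0 by (simp add: q_def map_poly_eq_0_iff)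
  have qz: "poly q z = 0 \<Longrightarrow> 4 * R \<le> norm (of_real x0 - z)" for z
    using zQ[of z] by (simp add: czeros_def q_def)
  have nz: "poly q z \<noteq> 0" if "z \<in> ball (of_real x0) (2 * R)" for z
    using qz[of z] that R by (auto simp: dist_norm)
  have Qx0: "poly Q x0 \<noteq> 0" using nz[of "of_real x0"] R by (simp add: q_def)
  have C0: "C \<ge> 0" using C Qx0 by (smt (verit) abs_ge_zero mult_neg_pos zero_less_abs_iff)
  have hol: "f holomorphic_on ball (of_real x0) (2 * R)"
    unfolding f_def using nz by (intro holomorphic_intros) auto
  have bd: "norm (f z) \<le> 4 ^ n * C * (2 * N) ^ D" if z: "z \<in> ball (of_real x0) (2 * R)" for z
  proof -
    have d: "norm (z - of_real x0) \<le> (4 * R) / 2" using z by (simp add: dist_norm norm_minus_commute)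
    have "norm z \<le> norm (z - of_real x0) + norm (complex_of_real x0)"
      using norm_triangle_ineq[of "z - of_real x0" "of_real x0"] by simp
    then have "norm z \<le> 2 * N" using d R by simp
    then have "norm (z ^ j) \<le> (2 * N) ^ j" unfolding norm_power by (intro power_mono) auto
    also have "\<dots> \<le> (2 * N) ^ D" using j R by (intro power_increasing) auto
    finally have zj: "norm (z ^ j) \<le> (2 * N) ^ D" .
    have "norm (poly p z) \<le> 2 ^ n * norm (poly p (of_real x0))"
    proof (cases "P = 0")
      case False
      have "norm (poly p z) \<le> 2 ^ degree p * norm (poly p (of_real x0))"
        using poly_zero_free_bound[of p "4 * R" "of_real x0" z] d R False zP[OF False]
        by (auto simp: p_def map_poly_eq_0_iff czeros_def)
      also have "\<dots> \<le> 2 ^ n * norm (poly p (of_real x0))"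
        using deg by (intro mult_right_mono power_increasing) (auto simp: p_def degree_map_poly)
      finally show ?thesis .
    qed (simp add: p_def)
    also have "norm (poly p (of_real x0)) \<le> C * norm (poly q (of_real x0))"
      using C by (simp add: p_def q_def)
    also have "norm (poly q (of_real x0)) \<le> 2 ^ degree q * norm (poly q z)"
      using poly_zero_free_bound[of q "4 * R" "of_real x0" z] d R q0 qz by auto
    also have "\<dots> \<le> 2 ^ n * norm (poly q z)"
      using deg by (intro mult_right_mono power_increasing) (auto simp: q_def degree_map_poly)
    finally have "norm (poly p z) \<le> 2 ^ n * (C * (2 ^ n * norm (poly q z)))"
      using C0 by (simp add: mult_left_mono)
    also have "\<dots> = 4 ^ n * C * norm (poly q z)"
      using power_mult_distrib[of 2 "2::real" n] by simp
    finally have "norm (poly p z / poly q z) \<le> 4 ^ n * C"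
      using nz[OF z] by (simp add: norm_divide pos_divide_le_eq)
    then show ?thesis unfolding f_def norm_mult
      using mult_mono[OF zj, of "norm (poly p z / poly q z)" "4 ^ n * C"] R by (simp add: mult_ac)
  qed
  have "\<exists>c. (\<forall>t. norm (c t) \<le> 4 ^ n * C * (2 * N) ^ D) \<and>
      (\<forall>w. norm w \<le> \<eta> \<longrightarrow> norm (f (of_real x0 + of_real R * w) - (\<Sum>t<T. c t * w ^ t))
        \<le> 2 * (4 ^ n * C * (2 * N) ^ D) * \<eta> ^ T)"
    by (rule holomorphic_taylor_bound[OF hol R(1) bd \<eta>])
  then obtain c where
    c: "\<forall>t. norm (c t) \<le> 4 ^ n * C * (2 * N) ^ D"
      "\<forall>w. norm w \<le> \<eta> \<longrightarrow> norm (f (of_real x0 + of_real R * w) - (\<Sum>t<T. c t * w ^ t))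
        \<le> 2 * (4 ^ n * C * (2 * N) ^ D) * \<eta> ^ T"
    by (elim exE conjE)
  show ?thesis
  proof (intro exI[of _ "\<lambda>t. Re (c t)"] conjI allI impI)
    fix t show "\<bar>Re (c t)\<bar> \<le> 4 ^ n * C * (2 * N) ^ D"
      by (rule order_trans[OF abs_Re_le_cmod]) (use c(1) in blast)
  next
    fix w :: real assume w: "\<bar>w\<bar> \<le> \<eta>"
    let ?x = "x0 + R * w"
    have fx: "f (of_real x0 + of_real R * of_real w) = of_real (?x ^ j * (poly P ?x / poly Q ?x))"
      unfolding f_def p_def q_def of_real_mult[symmetric] of_real_add[symmetric] poly_map_of_real
      by simp
    have "\<bar>?x ^ j * (poly P ?x / poly Q ?x) - (\<Sum>t<T. Re (c t) * w ^ t)\<bar>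
      = \<bar>Re (f (of_real x0 + of_real R * of_real w) - (\<Sum>t<T. c t * of_real w ^ t))\<bar>"
      unfolding fx by (simp flip: of_real_power)
    also have "\<dots> \<le> 2 * (4 ^ n * C * (2 * N) ^ D) * \<eta> ^ T"
      by (rule order_trans[OF abs_Re_le_cmod], rule c(2)[rule_format]) (use w in simp)
    finally show "\<bar>?x ^ j * (poly P ?x / poly Q ?x) - (\<Sum>t<T. Re (c t) * w ^ t)\<bar>
       \<le> 2 * (4 ^ n * C * (2 * N) ^ D) * \<eta> ^ T" .
  qed
qed

lemma ex_power_two_ivl:
  fixes \<delta> :: real
  assumes "1 \<le> \<delta>"
  shows "\<exists>i. 2 ^ i \<le> \<delta> \<and> \<delta> < 2 ^ Suc i"
proof -
  obtain n where "\<delta> < 2 ^ n" using real_arch_pow[of 2 \<delta>] by auto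
  then have "\<delta> < 2 ^ (LEAST n. \<delta> < 2 ^ n)" by (rule LeastI)
  moreover have "(LEAST n. \<delta> < 2 ^ n) \<noteq> 0" using calculation assms by (metis not_le power_0)
  ultimately obtain i where i: "(LEAST n. \<delta> < 2 ^ n) = Suc i" "\<delta> < 2 ^ Suc i"
    by (metis not0_implies_Suc)
  then have "\<not> \<delta> < 2 ^ i" using not_less_Least[of i "\<lambda>n. \<delta> < 2 ^ n"] by simp
  then show ?thesis using i(2) by (intro exI[of _ i]) auto
qed

lemma finite_ex_minimizer:
  fixes f :: "'a \<Rightarrow> 'b::linorder"
  assumes "finite A" "A \<noteq> {}"
  shows "\<exists>a\<in>A. \<forall>b\<in>A. f a \<le> f b"
proof -
  have "Min (f ` A) \<in> f ` A" using assms by (intro Min_in) auto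
  then obtain a where "a \<in> A" "f a = Min (f ` A)" by auto
  then show ?thesis using assms by (intro bexI[of _ a]) auto
qed

text \<open>An open disc of radius 1 contains at most two integers, so discarding the points near
  \<open>W\<close> costs a bounded multiple of \<open>card W\<close>. The remaining points have
  distance at least 1, where the dyadic scales of the decomposition start.\<close>

lemma card_near_le:
  fixes W :: "complex set" and Z :: "nat set"
  assumes "finite W" "finite Z"
  shows "card Z \<le> card {x\<in>Z. \<forall>\<zeta>\<in>W. 1 \<le> norm (of_nat x - \<zeta>)} + 3 * card W"
proof -
  let ?Z = "{x\<in>Z. \<forall>\<zeta>\<in>W. 1 \<le> norm (of_nat x - \<zeta>)}"
  have "card {x::nat. norm (of_nat x - \<zeta>) < 1} \<le> 3 \<and> finite {x::nat. norm (of_nat x - \<zeta>) < 1}" for \<zeta> :: complex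
  proof -
    define m where "m = nat \<lfloor>Re \<zeta>\<rfloor>"
    have "{x::nat. norm (of_nat x - \<zeta>) < 1} \<subseteq> {m, m + 1}"
    proof
      fix x :: nat assume "x \<in> {x::nat. norm (of_nat x - \<zeta>) < 1}"
      then have "\<bar>Re (of_nat x - \<zeta>)\<bar> < 1" using abs_Re_le_cmod le_less_trans by blast
      then have "\<bar>real x - Re \<zeta>\<bar> < 1" by simp
      then have "int x \<le> \<lfloor>Re \<zeta>\<rfloor> + 1" "int x \<ge> \<lfloor>Re \<zeta>\<rfloor>" by linarith+
      then show "x \<in> {m, m + 1}" unfolding m_def by auto
    qed
    moreover have "card {m, m + 1} = 2" "finite {m, m + 1}" by auto
    ultimately have "card {x::nat. norm (of_nat x - \<zeta>) < 1} \<le> 2" "finite {x::nat. norm (of_nat x - \<zeta>) < 1}"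
      using card_mono[OF \<open>finite {m, m + 1}\<close>, of "{x::nat. norm (of_nat x - \<zeta>) < 1}"]
        finite_subset[OF _ \<open>finite {m, m + 1}\<close>] by metis+
    then show ?thesis by simp
  qed
  note f = conjunct1[OF this] conjunct2[OF this]
  have "Z \<subseteq> ?Z \<union> (\<Union>\<zeta>\<in>W. {x::nat. norm (of_nat x - \<zeta>) < 1})" by auto
  then have "card Z \<le> card (?Z \<union> (\<Union>\<zeta>\<in>W. {x::nat. norm (of_nat x - \<zeta>) < 1}))"
    using assms f by (intro card_mono) auto
  also have "\<dots> \<le> card ?Z + card (\<Union>\<zeta>\<in>W. {x::nat. norm (of_nat x - \<zeta>) < 1})" by (rule card_Un_le)
  also have "card (\<Union>\<zeta>\<in>W. {x::nat. norm (of_nat x - \<zeta>) < 1}) \<le> (\<Sum>\<zeta>\<in>W. card {x::nat. norm (of_nat x - \<zeta>) < 1})"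
    by (rule card_UN_le[OF assms(1)])
  also have "\<dots> \<le> (\<Sum>\<zeta>\<in>W. 3)" using f by (intro sum_mono) auto
  finally show ?thesis by simp
qed

text \<open>A Whitney decomposition of the integer points: the cell of a point at distance about
  \<open>2\<^sup>i\<close> from the nearest zero has length \<open>2\<^sup>i / \<mu>\<close>. Having \<open>0 \<in> W\<close> keeps all distances below \<open>N\<close>.\<close>

lemma whitney_piece:
  fixes W :: "complex set" and Z :: "nat set"
  assumes W: "finite W" "0 \<in> W" and Z: "Z \<subseteq> {1..N}" "Z \<noteq> {}"
    and sep: "\<And>x \<zeta>. x \<in> Z \<Longrightarrow> \<zeta> \<in> W \<Longrightarrow> 1 \<le> norm (of_nat x - \<zeta>)"
    and L: "N < 2 ^ Suc L" and \<mu>: "\<mu> \<ge> (1::nat)"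
  shows "\<exists>x0\<in>Z. \<exists>\<rho>. 1 \<le> \<rho> \<and> \<rho> \<le> real N \<and> (\<forall>\<zeta>\<in>W. \<rho> \<le> norm (of_nat x0 - \<zeta>)) \<and>
    card Z \<le> card W * (Suc L * (5 * \<mu>)) * card {x\<in>Z. \<bar>real x - real x0\<bar> \<le> \<rho> / real \<mu>}"
proof -
  have fZ: "finite Z" using Z finite_subset by blast
  have "\<exists>\<zeta> i. \<zeta> \<in> W \<and> (\<forall>\<xi>\<in>W. norm (of_nat x - \<zeta>) \<le> norm (of_nat x - \<xi>)) \<and>
      2 ^ i \<le> norm (of_nat x - \<zeta>) \<and> norm (of_nat x - \<zeta>) < 2 ^ Suc i" if "x \<in> Z" for x
  proof -
    have "\<exists>\<zeta>\<in>W. \<forall>\<xi>\<in>W. norm (of_nat x - \<zeta>) \<le> norm (of_nat x - \<xi>)"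
      by (rule finite_ex_minimizer) (use W in auto)
    then obtain \<zeta> where "\<zeta> \<in> W" "\<forall>\<xi>\<in>W. norm (of_nat x - \<zeta>) \<le> norm (of_nat x - \<xi>)" by auto
    then show ?thesis using ex_power_two_ivl[OF sep[OF that, of \<zeta>]] by blast
  qed
  then obtain \<zeta> i where \<zeta>: "\<And>x. x \<in> Z \<Longrightarrow> \<zeta> x \<in> W"
    "\<And>x \<xi>. x \<in> Z \<Longrightarrow> \<xi> \<in> W \<Longrightarrow> norm (of_nat x - \<zeta> x) \<le> norm (of_nat x - \<xi>)"
    "\<And>x. x \<in> Z \<Longrightarrow> 2 ^ i x \<le> norm (of_nat x - \<zeta> x)"
    "\<And>x. x \<in> Z \<Longrightarrow> norm (of_nat x - \<zeta> x) < 2 ^ Suc (i x)" by metis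
  define J where "J x = \<lfloor>(real x - Re (\<zeta> x)) * \<mu> / 2 ^ i x\<rfloor>" for x
  \<comment> \<open>Labels: nearest zero, dyadic distance, cell number. As the distance is below
    \<open>2 ^ Suc i\<close>, the cells of length \<open>2 ^ i / \<mu>\<close> are numbered from
    -2\<mu> to 2\<mu>, which makes at most 5\<mu> of them. Pigeonhole finds a crowded label.\<close>
  define B where "B = W \<times> {..L} \<times> {-2 * int \<mu>..2 * int \<mu>}"
  have i2: "2 ^ i x \<le> real N" if "x \<in> Z" for x
  proof -
    have "norm (of_nat x - \<zeta> x) \<le> real x" using \<zeta>(2)[OF that W(2)] by simp
    moreover have "real x \<le> real N" using Z that by auto
    ultimately show ?thesis using \<zeta>(3)[OF that] by linarith
  qed
  have iL: "i x \<le> L" if "x \<in> Z" for x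
  proof -
    have "real (2 ^ i x) \<le> real N" using i2[OF that] by simp
    then have "2 ^ i x < (2::nat) ^ Suc L" using L unfolding of_nat_le_iff by linarith
    then show ?thesis by (simp add: power_strict_increasing_iff del: power_Suc)
  qed
  have JB: "J x \<in> {-2 * int \<mu>..2 * int \<mu>}" if "x \<in> Z" for x
  proof -
    have "\<bar>Re (of_nat x - \<zeta> x)\<bar> < 2 ^ Suc (i x)"
      using \<zeta>(4)[OF that] abs_Re_le_cmod le_less_trans by blast
    then have "\<bar>real x - Re (\<zeta> x)\<bar> / 2 ^ i x < 2" by (simp add: field_simps)
    then have "\<bar>real x - Re (\<zeta> x)\<bar> / 2 ^ i x * \<mu> \<le> 2 * real \<mu>" by (intro mult_right_mono) auto
    then have "\<bar>(real x - Re (\<zeta> x)) * \<mu> / 2 ^ i x\<bar> \<le> 2 * real \<mu>" by (simp add: abs_mult)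
    then have "- (2 * real \<mu>) \<le> (real x - Re (\<zeta> x)) * \<mu> / 2 ^ i x" "(real x - Re (\<zeta> x)) * \<mu> / 2 ^ i x < 2 * real \<mu> + 1"
      using abs_le_D1 abs_le_D2 by (smt (verit))+
    then show ?thesis unfolding J_def by (simp add: floor_le_iff le_floor_iff)
  qed
  define lab where "lab x = (\<zeta> x, i x, J x)" for x
  have "lab \<in> Z \<rightarrow> B" using \<zeta>(1) iL JB by (auto simp: lab_def B_def)
  moreover have fB: "finite B" "B \<noteq> {}" using W by (auto simp: B_def)
  ultimately obtain y where y: "y \<in> B" "card Z \<le> card (lab -` {y} \<inter> Z) * card B"
    using pigeonhole_card[of lab Z B] fZ by blast
  have cB: "card B \<le> card W * (Suc L * (5 * \<mu>))"
  proof -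
    have "nat (4 * int \<mu> + 1) \<le> 5 * \<mu>" using \<mu> by simp
    then have "Suc L * nat (4 * int \<mu> + 1) \<le> Suc L * (5 * \<mu>)" by (rule mult_left_mono) simp
    then show ?thesis by (simp add: B_def card_cartesian_product)
  qed
  have "card Z > 0" using Z fZ by (simp add: card_gt_0_iff)
  then have "lab -` {y} \<inter> Z \<noteq> {}" using y(2) by (metis card.empty less_le_trans mult_0 not_less_zero)
  then obtain x0 where x0: "x0 \<in> Z" "lab x0 = y" by auto
  have "lab -` {y} \<inter> Z \<subseteq> {x\<in>Z. \<bar>real x - real x0\<bar> \<le> 2 ^ i x0 / real \<mu>}"
  proof
    fix x assume "x \<in> lab -` {y} \<inter> Z"
    then have x: "x \<in> Z" "lab x = lab x0" using x0 by auto
    then have e: "\<zeta> x = \<zeta> x0" "i x = i x0" "J x = J x0" by (auto simp: lab_def)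
    let ?c = "2 ^ i x0 / real \<mu>"
    have c0: "?c > 0" using \<mu> by simp
    have "\<bar>(real x - Re (\<zeta> x0)) * \<mu> / 2 ^ i x0 - (real x0 - Re (\<zeta> x0)) * \<mu> / 2 ^ i x0\<bar> \<le> 1"
      using e(3) unfolding J_def e(1,2) by linarith
    also have "(real x - Re (\<zeta> x0)) * \<mu> / 2 ^ i x0 - (real x0 - Re (\<zeta> x0)) * \<mu> / 2 ^ i x0 = (real x - real x0) / ?c"
      by (simp add: field_simps)
    finally have "\<bar>real x - real x0\<bar> / ?c \<le> 1" using c0 unfolding abs_divide by simp
    then have "\<bar>real x - real x0\<bar> \<le> ?c" using c0 by (simp only: divide_le_eq_1_pos)
    then show "x \<in> {x\<in>Z. \<bar>real x - real x0\<bar> \<le> 2 ^ i x0 / real \<mu>}" using x by simp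
  qed
  then have "card (lab -` {y} \<inter> Z) \<le> card {x\<in>Z. \<bar>real x - real x0\<bar> \<le> 2 ^ i x0 / real \<mu>}"
    using fZ by (intro card_mono) auto
  then have "card Z \<le> card {x\<in>Z. \<bar>real x - real x0\<bar> \<le> 2 ^ i x0 / real \<mu>} * (card W * (Suc L * (5 * \<mu>)))"
    using y(2) cB by (meson mult_le_mono order_trans)
  moreover have "\<forall>\<xi>\<in>W. 2 ^ i x0 \<le> norm (of_nat x0 - \<xi>)"
    using \<zeta>(2,3) x0(1) order_trans by blast
  ultimately show ?thesis using x0(1) i2[OF x0(1)]
    by (intro bexI[of _ x0] exI[of _ "2 ^ i x0"]) (auto simp: mult_ac)
qed

section \<open>Frames for polynomial relations, conditioned at a given point\<close>

lemma row_indep_reindex: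
  assumes "row_indep v X M" "finite M" "inj_on f A" "f ` A \<subseteq> M"
  shows "row_indep (\<lambda>a. v (f a)) X A"
  unfolding row_indep_def
proof (intro allI impI ballI)
  fix c a assume c: "\<forall>x\<in>X. (\<Sum>a\<in>A. c a * v (f a) x) = 0" and a: "a \<in> A"
  define C where "C m = (if m \<in> f ` A then c (the_inv_into A f m) else 0)" for m
  have Cf: "C (f a) = c a" if "a \<in> A" for a
    using that assms(3) by (simp add: C_def the_inv_into_f_f)
  have "(\<Sum>m\<in>M. C m * v m x) = 0" if "x \<in> X" for x
  proof -
    have "(\<Sum>m\<in>M. C m * v m x) = (\<Sum>m\<in>f ` A. C m * v m x)"
      using assms by (intro sum.mono_neutral_right) (auto simp: C_def)
    also have "\<dots> = (\<Sum>a\<in>A. C (f a) * v (f a) x)" using assms(3) by (simp add: sum.reindex)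
    also have "\<dots> = 0" using c that Cf by simp
    finally show ?thesis .
  qed
  from row_indepD[OF assms(1) this] a assms(4) Cf show "c a = 0" by force
qed

lemma row_indep_scale:
  assumes "row_indep v X M" "\<And>x. x \<in> X \<Longrightarrow> s x \<noteq> 0"
  shows "row_indep (\<lambda>m x. s x * v m x) X M"
  unfolding row_indep_def
proof (intro allI impI)
  fix c assume c: "\<forall>x\<in>X. (\<Sum>m\<in>M. c m * (s x * v m x)) = 0"
  have "(\<Sum>m\<in>M. c m * v m x) = 0" if "x \<in> X" for x
  proof -
    have "s x * (\<Sum>m\<in>M. c m * v m x) = (\<Sum>m\<in>M. c m * (s x * v m x))"
      by (simp add: sum_distrib_left mult_ac)
    then show ?thesis using c assms(2) that by simp
  qed
  then show "\<forall>m\<in>M. c m = 0" using row_indepD[OF assms(1), of c] by simp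
qed

text \<open>Descent on the order of vanishing at \<open>x0\<close>: if all \<open>y \<gamma>\<close>
  are divisible by the \<open>n\<close>-th power of \<open>X - x0\<close>, cancel it and evaluate at
  \<open>x0\<close>; independence there makes the quotients vanish at \<open>x0\<close> too. So each
  \<open>y \<gamma>\<close> is divisible by every power of \<open>X - x0\<close>.\<close>

lemma poly_relation_trivial:
  fixes P :: "'m \<Rightarrow> 'g \<Rightarrow> real poly"
  assumes ind: "row_indep (\<lambda>m g. poly (P m g) x0) G \<Gamma>" and "finite \<Gamma>"
    and rel: "\<And>g. g \<in> G \<Longrightarrow> (\<Sum>\<gamma>\<in>\<Gamma>. y \<gamma> * P \<gamma> g) = 0" and "\<gamma> \<in> \<Gamma>"
  shows "y \<gamma> = 0"
proof -
  have "\<forall>\<gamma>\<in>\<Gamma>. [:- x0, 1:] ^ n dvd y \<gamma>" for n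
  proof (induction n)
    case (Suc n)
    then have "\<forall>\<gamma>\<in>\<Gamma>. \<exists>z. y \<gamma> = [:- x0, 1:] ^ n * z" by (auto simp: dvd_def)
    from bchoice[OF this] obtain z where z: "\<forall>\<gamma>\<in>\<Gamma>. y \<gamma> = [:- x0, 1:] ^ n * z \<gamma>" by auto
    have "(\<Sum>\<gamma>\<in>\<Gamma>. poly (z \<gamma>) x0 * poly (P \<gamma> g) x0) = 0" if "g \<in> G" for g
    proof -
      have "[:- x0, 1:] ^ n * (\<Sum>\<gamma>\<in>\<Gamma>. z \<gamma> * P \<gamma> g) = (\<Sum>\<gamma>\<in>\<Gamma>. y \<gamma> * P \<gamma> g)"
        unfolding sum_distrib_left using z by (intro sum.cong) (auto simp: mult.assoc)
      also have "\<dots> = 0" using rel[OF that] .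
      finally have "(\<Sum>\<gamma>\<in>\<Gamma>. z \<gamma> * P \<gamma> g) = 0" by simp
      then have "poly (\<Sum>\<gamma>\<in>\<Gamma>. z \<gamma> * P \<gamma> g) x0 = 0" by simp
      then show ?thesis by (simp add: poly_sum)
    qed
    then have z0: "poly (z \<gamma>) x0 = 0" if "\<gamma> \<in> \<Gamma>" for \<gamma>
      using row_indepD[OF ind, of "\<lambda>\<gamma>. poly (z \<gamma>) x0" \<gamma>] that by simp
    show ?case
    proof
      fix \<gamma> assume g: "\<gamma> \<in> \<Gamma>"
      have "[:- x0, 1:] dvd z \<gamma>" using z0[OF g] by (simp add: poly_eq_0_iff_dvd)
      then have "[:- x0, 1:] ^ n * [:- x0, 1:] dvd y \<gamma>" using z g by (metis mult_dvd_mono dvd_refl)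
      then show "[:- x0, 1:] ^ Suc n dvd y \<gamma>" by (simp only: power_Suc2)
    qed
  qed simp
  then have "y \<gamma> = 0 \<or> Suc (degree (y \<gamma>)) \<le> order x0 (y \<gamma>)" using assms(4) order_divides by blast
  then show ?thesis using order_degree[of "y \<gamma>" x0] by fastforce
qed

text \<open>Cramer's rule without determinants: \<open>card G\<close> equations in
  \<open>card G + 1\<close> unknowns, namely \<open>a\<close> and the \<open>b \<gamma>\<close>. The
  coefficient \<open>a\<close> cannot vanish because the rows of \<Gamma> are free over the
  polynomials.\<close>

lemma solve_in_frame:
  fixes P :: "'m \<Rightarrow> 'g \<Rightarrow> real poly"
  assumes fin: "finite G" "finite \<Gamma>" "card \<Gamma> = card G"
    and deg: "\<And>m g. degree (P m g) \<le> \<Delta>"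
    and free: "\<And>y. (\<forall>g\<in>G. (\<Sum>\<gamma>\<in>\<Gamma>. y \<gamma> * P \<gamma> g) = 0) \<Longrightarrow> (\<forall>\<gamma>\<in>\<Gamma>. y \<gamma> = 0)"
  shows "\<exists>a b. a \<noteq> 0 \<and> degree a \<le> card G * \<Delta> \<and> (\<forall>\<gamma>\<in>\<Gamma>. degree (b \<gamma>) \<le> card G * \<Delta>) \<and>
     (\<forall>g\<in>G. a * P m g = (\<Sum>\<gamma>\<in>\<Gamma>. b \<gamma> * P \<gamma> g))"
proof -
  define J where "J = insert None (Some ` \<Gamma>)"
  define A where "A g j = (case j of None \<Rightarrow> P m g | Some \<gamma> \<Rightarrow> - P \<gamma> g)" for g j
  have J: "finite J" "card G < card J" using fin by (auto simp: J_def card_image)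
  have dA: "degree (A g j) \<le> \<Delta>" for g j using deg by (auto simp: A_def split: option.split)
  have "\<exists>y. (\<exists>j\<in>J. y j \<noteq> 0) \<and> (\<forall>j\<in>J. degree (y j) \<le> card G * \<Delta>) \<and>
    (\<forall>g\<in>G. (\<Sum>j\<in>J. A g j * y j) = 0)"
    by (rule underdetermined_poly[OF fin(1) J dA])
  then obtain y where y: "\<exists>j\<in>J. y j \<noteq> 0" "\<forall>j\<in>J. degree (y j) \<le> card G * \<Delta>"
    "\<forall>g\<in>G. (\<Sum>j\<in>J. A g j * y j) = 0" by (elim exE conjE)
  have sJ: "(\<Sum>j\<in>J. A g j * y j) = P m g * y None - (\<Sum>\<gamma>\<in>\<Gamma>. P \<gamma> g * y (Some \<gamma>))" for g
    unfolding J_def using fin(2) by (subst sum.insert) (auto simp: sum.reindex A_def sum_negf)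
  have rel: "y None * P m g = (\<Sum>\<gamma>\<in>\<Gamma>. y (Some \<gamma>) * P \<gamma> g)" if "g \<in> G" for g
    using y(3) that unfolding sJ by (simp add: mult.commute)
  have "y None \<noteq> 0"
  proof
    assume 0: "y None = 0"
    then have "\<forall>g\<in>G. (\<Sum>\<gamma>\<in>\<Gamma>. y (Some \<gamma>) * P \<gamma> g) = 0" using rel by simp
    then have "\<forall>\<gamma>\<in>\<Gamma>. y (Some \<gamma>) = 0" by (rule free)
    then show False using y(1) 0 by (auto simp: J_def)
  qed
  then show ?thesis using y(2) rel
    by (intro exI[of _ "y None"] exI[of _ "\<lambda>\<gamma>. y (Some \<gamma>)"]) (auto simp: J_def)
qed

text \<open>Applying \<open>conditioned_rows\<close> to the matrix evaluated at \<open>x0\<close>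
  gives a frame whose coefficients are bounded at that point. The frame varies with
  \<open>x0\<close>, but \<open>W\<close> must not; so the zeros of the coefficients for all
  possible frames, at most \<open>2 ^ card M\<close> in number, are put into
  \<open>W\<close>.\<close>

lemma conditioned_frames:
  fixes P :: "'m \<Rightarrow> 'm \<Rightarrow> real poly" and U :: "'m \<Rightarrow> nat \<Rightarrow> real"
  assumes M: "finite M" "G \<subseteq> M" and q: "q \<noteq> 0" "degree q \<le> \<Delta>"
    and deg: "\<And>m g. degree (P m g) \<le> \<Delta>"
    and PG: "\<And>g g'. g \<in> G \<Longrightarrow> g' \<in> G \<Longrightarrow> P g g' = (if g = g' then q else 0)"
    and rel: "\<And>m x. m \<in> M \<Longrightarrow> x \<in> Z \<Longrightarrow> poly q (real x) * U m x = (\<Sum>g\<in>G. poly (P m g) (real x) * U g x)"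
  shows "\<exists>W. finite W \<and> (0::complex) \<in> W \<and>
    card W \<le> 1 + \<Delta> + 2 ^ card M * (card M * ((1 + card M) * (card M * \<Delta>))) \<and>
    (\<forall>x0. of_nat x0 \<notin> W \<longrightarrow> (\<exists>\<Gamma> a b. \<Gamma> \<subseteq> M \<and> card \<Gamma> = card G \<and>
       (\<forall>m\<in>M. a m \<noteq> 0 \<and> degree (a m) \<le> card M * \<Delta> \<and> czeros (a m) \<subseteq> W \<and>
          (\<forall>\<gamma>\<in>\<Gamma>. degree (b m \<gamma>) \<le> card M * \<Delta> \<and> (b m \<gamma> \<noteq> 0 \<longrightarrow> czeros (b m \<gamma>) \<subseteq> W) \<and>
             \<bar>poly (b m \<gamma>) (real x0)\<bar> \<le> fact (card M) * \<bar>poly (a m) (real x0)\<bar>) \<and>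
          (\<forall>x\<in>Z. of_nat x \<notin> W \<longrightarrow>
             poly (a m) (real x) * U m x = (\<Sum>\<gamma>\<in>\<Gamma>. poly (b m \<gamma>) (real x) * U \<gamma> x)))))"
proof -
  have fG: "finite G" using M finite_subset by auto
  define good where "good = {\<Gamma>. \<Gamma> \<subseteq> M \<and> card \<Gamma> = card G \<and>
    (\<forall>y. (\<forall>g\<in>G. (\<Sum>\<gamma>\<in>\<Gamma>. y \<gamma> * P \<gamma> g) = 0) \<longrightarrow> (\<forall>\<gamma>\<in>\<Gamma>. y \<gamma> = 0))}"
  define ok where "ok \<Gamma> m a b \<longleftrightarrow> a \<noteq> 0 \<and> degree a \<le> card G * \<Delta> \<and> (\<forall>\<gamma>\<in>\<Gamma>. degree (b \<gamma>) \<le> card G * \<Delta>) \<and>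
     (\<forall>g\<in>G. a * P m g = (\<Sum>\<gamma>\<in>\<Gamma>. b \<gamma> * P \<gamma> g))" for \<Gamma> m a b
  have ex: "\<exists>a b. ok \<Gamma> m a b" if "\<Gamma> \<in> good" for \<Gamma> m
    unfolding ok_def
    by (rule solve_in_frame) (use that fG M deg in \<open>auto simp: good_def intro: finite_subset\<close>)
  \<comment> \<open>Chosen once for each frame and \<open>m\<close>, independently of
    \<open>x0\<close>, so that \<open>W\<close> contains the zeros of exactly the polynomials used
    at every point.\<close>
  define a where "a \<Gamma> m = (SOME a. \<exists>b. ok \<Gamma> m a b)" for \<Gamma> m
  define b where "b \<Gamma> m = (SOME b. ok \<Gamma> m (a \<Gamma> m) b)" for \<Gamma> m
  have ok: "ok \<Gamma> m (a \<Gamma> m) (b \<Gamma> m)" if "\<Gamma> \<in> good" for \<Gamma> m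
  proof -
    have "\<exists>b. ok \<Gamma> m (a \<Gamma> m) b" unfolding a_def by (rule someI_ex[OF ex[OF that]])
    then show ?thesis unfolding b_def by (rule someI_ex)
  qed
  define n where "n = card M * \<Delta>"
  have nG: "card G * \<Delta> \<le> n" unfolding n_def using M by (intro mult_right_mono card_mono) auto
  define Wb where "Wb \<Gamma> m \<gamma> = (if b \<Gamma> m \<gamma> \<noteq> 0 then czeros (b \<Gamma> m \<gamma>) else {})" for \<Gamma> m \<gamma>
  define Wm where "Wm \<Gamma> m = czeros (a \<Gamma> m) \<union> (\<Union>\<gamma>\<in>\<Gamma>. Wb \<Gamma> m \<gamma>)" for \<Gamma> m
  define W where "W = insert 0 (czeros q \<union> (\<Union>\<Gamma>\<in>good. \<Union>m\<in>M. Wm \<Gamma> m))"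
  have fgood: "finite good" unfolding good_def using M by auto
  have cgood: "card good \<le> 2 ^ card M"
  proof -
    have "card good \<le> card (Pow M)" using M by (intro card_mono) (auto simp: good_def)
    then show ?thesis using M by (simp add: card_Pow)
  qed
  have Wb: "finite (Wb \<Gamma> m \<gamma>)" "card (Wb \<Gamma> m \<gamma>) \<le> n" if "\<Gamma> \<in> good" "\<gamma> \<in> \<Gamma>" for \<Gamma> m \<gamma>
  proof -
    have "degree (b \<Gamma> m \<gamma>) \<le> n" using ok[OF that(1), of m] that(2) nG by (auto simp: ok_def)
    then show "finite (Wb \<Gamma> m \<gamma>)" "card (Wb \<Gamma> m \<gamma>) \<le> n"
      using card_czeros_le[of "b \<Gamma> m \<gamma>"] finite_czeros[of "b \<Gamma> m \<gamma>"] by (auto simp: Wb_def)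
  qed
  have Wm: "finite (Wm \<Gamma> m)" "card (Wm \<Gamma> m) \<le> (1 + card M) * n" if "\<Gamma> \<in> good" for \<Gamma> m
  proof -
    have G: "finite \<Gamma>" "card \<Gamma> \<le> card M"
      using that M by (auto simp: good_def intro: finite_subset card_mono)
    have a: "a \<Gamma> m \<noteq> 0" "degree (a \<Gamma> m) \<le> n" using ok[OF that, of m] nG by (auto simp: ok_def)
    show "finite (Wm \<Gamma> m)" using G a Wb(1)[OF that] by (auto simp: Wm_def finite_czeros)
    have "card (Wm \<Gamma> m) \<le> card (czeros (a \<Gamma> m)) + card (\<Union>\<gamma>\<in>\<Gamma>. Wb \<Gamma> m \<gamma>)"
      unfolding Wm_def by (rule card_Un_le)
    also have "card (czeros (a \<Gamma> m)) \<le> n" using card_czeros_le[OF a(1)] a(2) by simp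
    also have "card (\<Union>\<gamma>\<in>\<Gamma>. Wb \<Gamma> m \<gamma>) \<le> (\<Sum>\<gamma>\<in>\<Gamma>. card (Wb \<Gamma> m \<gamma>))" by (rule card_UN_le[OF G(1)])
    also have "\<dots> \<le> (\<Sum>\<gamma>\<in>\<Gamma>. n)" using Wb(2)[OF that] by (intro sum_mono) auto
    also have "\<dots> \<le> card M * n" using G by simp
    finally show "card (Wm \<Gamma> m) \<le> (1 + card M) * n" by simp
  qed
  have fW: "finite W" unfolding W_def using fgood M Wm(1) q by (auto simp: finite_czeros)
  have cW: "card W \<le> 1 + \<Delta> + 2 ^ card M * (card M * ((1 + card M) * n))"
  proof -
    have "card W \<le> Suc (card (czeros q \<union> (\<Union>\<Gamma>\<in>good. \<Union>m\<in>M. Wm \<Gamma> m)))"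
      unfolding W_def by (rule card_insert_le_m1) auto
    also have "card (czeros q \<union> (\<Union>\<Gamma>\<in>good. \<Union>m\<in>M. Wm \<Gamma> m))
       \<le> card (czeros q) + card (\<Union>\<Gamma>\<in>good. \<Union>m\<in>M. Wm \<Gamma> m)" by (rule card_Un_le)
    also have "card (czeros q) \<le> \<Delta>" using card_czeros_le[OF q(1)] q(2) by simp
    also have "card (\<Union>\<Gamma>\<in>good. \<Union>m\<in>M. Wm \<Gamma> m) \<le> (\<Sum>\<Gamma>\<in>good. card (\<Union>m\<in>M. Wm \<Gamma> m))"
      by (rule card_UN_le[OF fgood])
    also have "\<dots> \<le> (\<Sum>\<Gamma>\<in>good. card M * ((1 + card M) * n))"
    proof (rule sum_mono)
      fix \<Gamma> assume G: "\<Gamma> \<in> good"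
      have "card (\<Union>m\<in>M. Wm \<Gamma> m) \<le> (\<Sum>m\<in>M. card (Wm \<Gamma> m))" by (rule card_UN_le[OF M(1)])
      also have "\<dots> \<le> (\<Sum>m\<in>M. (1 + card M) * n)" using Wm(2)[OF G] by (intro sum_mono) auto
      finally show "card (\<Union>m\<in>M. Wm \<Gamma> m) \<le> card M * ((1 + card M) * n)" by simp
    qed
    also have "\<dots> \<le> 2 ^ card M * (card M * ((1 + card M) * n))"
      using cgood by simp
    finally show ?thesis by simp
  qed
  have main: "\<exists>\<Gamma> a b. \<Gamma> \<subseteq> M \<and> card \<Gamma> = card G \<and>
       (\<forall>m\<in>M. a m \<noteq> 0 \<and> degree (a m) \<le> n \<and> czeros (a m) \<subseteq> W \<and>
          (\<forall>\<gamma>\<in>\<Gamma>. degree (b m \<gamma>) \<le> n \<and> (b m \<gamma> \<noteq> 0 \<longrightarrow> czeros (b m \<gamma>) \<subseteq> W) \<and>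
             \<bar>poly (b m \<gamma>) (real x0)\<bar> \<le> fact (card M) * \<bar>poly (a m) (real x0)\<bar>) \<and>
          (\<forall>x\<in>Z. of_nat x \<notin> W \<longrightarrow>
             poly (a m) (real x) * U m x = (\<Sum>\<gamma>\<in>\<Gamma>. poly (b m \<gamma>) (real x) * U \<gamma> x)))"
    if x0: "of_nat x0 \<notin> W" for x0
  proof -
    have qnz: "poly q (real x) \<noteq> 0" if "of_nat x \<notin> W" for x
    proof
      assume "poly q (real x) = 0"
      then have "of_nat x \<in> czeros q"
        using poly_map_of_real[of q "real x", where 'a = complex] by (simp add: czeros_def)
      then show False using that by (simp add: W_def)
    qed
    define v where "v m g = poly (P m g) (real x0)" for m g
    have "\<exists>\<Gamma> c. \<Gamma> \<subseteq> M \<and> row_indep v G \<Gamma> \<and>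
      (\<forall>m\<in>M. \<forall>g\<in>G. v m g = (\<Sum>\<gamma>\<in>\<Gamma>. c m \<gamma> * v \<gamma> g)) \<and>
      (\<forall>m\<in>M. \<forall>\<gamma>\<in>\<Gamma>. \<bar>c m \<gamma>\<bar> \<le> fact (card M))"
      by (rule conditioned_rows[OF M(1)])
    then obtain \<Gamma> c where G: "\<Gamma> \<subseteq> M" "row_indep v G \<Gamma>"
      and vc: "\<forall>m\<in>M. \<forall>g\<in>G. v m g = (\<Sum>\<gamma>\<in>\<Gamma>. c m \<gamma> * v \<gamma> g)"
      and cb: "\<forall>m\<in>M. \<forall>\<gamma>\<in>\<Gamma>. \<bar>c m \<gamma>\<bar> \<le> fact (card M)"
      by (elim exE conjE)
    have fGa: "finite \<Gamma>" using G M finite_subset by auto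
    \<comment> \<open>By \<open>PG\<close> the rows of \<open>G\<close> form \<open>q\<close> times
      the identity, and \<open>q\<close> does not vanish at \<open>x0\<close>; hence the matrix has
      rank \<open>card G\<close> there and the frame has full size.\<close>
    have "row_indep v G G"
      unfolding row_indep_def
    proof (intro allI impI ballI)
      fix d g assume d: "\<forall>g\<in>G. (\<Sum>m\<in>G. d m * v m g) = 0" and g: "g \<in> G"
      have "(\<Sum>m\<in>G. d m * v m g) = (\<Sum>m\<in>G. if m = g then d m * poly q (real x0) else 0)"
        using g by (intro sum.cong) (auto simp: v_def PG)
      also have "\<dots> = d g * poly q (real x0)" using g fG by simp
      finally show "d g = 0" using d g qnz[OF x0] by auto
    qed
    then have "\<exists>F'\<subseteq>\<Gamma>. row_indep v G F' \<and> card G \<le> card F'"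
      by (rule row_indep_in_span_card_le[OF fG fGa]) (use vc M in blast)
    then have "card G \<le> card \<Gamma>" using fGa by (meson card_mono order_trans)
    then have cG: "card \<Gamma> = card G" using row_indep_card_le[OF G(2) fG fGa] by simp
    have free: "\<forall>y. (\<forall>g\<in>G. (\<Sum>\<gamma>\<in>\<Gamma>. y \<gamma> * P \<gamma> g) = 0) \<longrightarrow> (\<forall>\<gamma>\<in>\<Gamma>. y \<gamma> = 0)"
      using poly_relation_trivial[of P "real x0" G \<Gamma>] G(2) fGa unfolding v_def by blast
    have gd: "\<Gamma> \<in> good" using G(1) cG free by (simp add: good_def)
    note o = ok[OF gd, unfolded ok_def]
    have cz: "czeros (a \<Gamma> m) \<subseteq> W" "\<gamma> \<in> \<Gamma> \<Longrightarrow> b \<Gamma> m \<gamma> \<noteq> 0 \<Longrightarrow> czeros (b \<Gamma> m \<gamma>) \<subseteq> W" if "m \<in> M" for m \<gamma>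
    proof -
      have "Wm \<Gamma> m \<subseteq> W" using gd that by (auto simp: W_def)
      then show "czeros (a \<Gamma> m) \<subseteq> W" "\<gamma> \<in> \<Gamma> \<Longrightarrow> b \<Gamma> m \<gamma> \<noteq> 0 \<Longrightarrow> czeros (b \<Gamma> m \<gamma>) \<subseteq> W"
        by (auto simp: Wm_def Wb_def)
    qed
    have bd: "\<bar>poly (b \<Gamma> m \<gamma>) (real x0)\<bar> \<le> fact (card M) * \<bar>poly (a \<Gamma> m) (real x0)\<bar>"
      if "m \<in> M" "\<gamma> \<in> \<Gamma>" for m \<gamma>
    proof -
      let ?d = "\<lambda>\<gamma>. poly (b \<Gamma> m \<gamma>) (real x0) - poly (a \<Gamma> m) (real x0) * c m \<gamma>"
      \<comment> \<open>Two expansions of row \<open>m\<close> over \<Gamma> at \<open>x0\<close>,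
        one from the polynomial identity and one with the bounded coefficients \<open>c\<close>,
        must agree.\<close>
      have "(\<Sum>\<gamma>\<in>\<Gamma>. ?d \<gamma> * v \<gamma> g) = 0" if g: "g \<in> G" for g
      proof -
        have "poly (a \<Gamma> m * P m g) (real x0) = poly (\<Sum>\<gamma>\<in>\<Gamma>. b \<Gamma> m \<gamma> * P \<gamma> g) (real x0)"
          using o[of m] g by simp
        then have "poly (a \<Gamma> m) (real x0) * v m g = (\<Sum>\<gamma>\<in>\<Gamma>. poly (b \<Gamma> m \<gamma>) (real x0) * v \<gamma> g)"
          by (simp add: poly_sum v_def)
        moreover have "poly (a \<Gamma> m) (real x0) * v m g = (\<Sum>\<gamma>\<in>\<Gamma>. poly (a \<Gamma> m) (real x0) * c m \<gamma> * v \<gamma> g)"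
          using vc \<open>m \<in> M\<close> g by (simp add: sum_distrib_left mult.assoc)
        ultimately show ?thesis by (simp add: left_diff_distrib sum_subtractf)
      qed
      from row_indepD[OF G(2) this that(2)]
      have "poly (b \<Gamma> m \<gamma>) (real x0) = poly (a \<Gamma> m) (real x0) * c m \<gamma>" by simp
      moreover have "\<bar>c m \<gamma>\<bar> \<le> fact (card M)" using cb that by blast
      ultimately show ?thesis by (simp add: abs_mult mult.commute mult_right_mono)
    qed
    have rl: "poly (a \<Gamma> m) (real x) * U m x = (\<Sum>\<gamma>\<in>\<Gamma>. poly (b \<Gamma> m \<gamma>) (real x) * U \<gamma> x)"
      if m: "m \<in> M" and x: "x \<in> Z" "of_nat x \<notin> W" for m x
    proof -
      let ?e = "\<lambda>p. poly p (real x)"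
      have "?e q * (?e (a \<Gamma> m) * U m x) = ?e (a \<Gamma> m) * (\<Sum>g\<in>G. ?e (P m g) * U g x)"
        using rel[OF m x(1)] by (simp add: mult_ac)
      also have "\<dots> = (\<Sum>g\<in>G. ?e (a \<Gamma> m * P m g) * U g x)"
        by (simp add: sum_distrib_left mult.assoc)
      also have "\<dots> = (\<Sum>g\<in>G. ?e (\<Sum>\<gamma>\<in>\<Gamma>. b \<Gamma> m \<gamma> * P \<gamma> g) * U g x)"
        using o[of m] by (intro sum.cong) auto
      also have "\<dots> = (\<Sum>g\<in>G. \<Sum>\<gamma>\<in>\<Gamma>. ?e (b \<Gamma> m \<gamma>) * (?e (P \<gamma> g) * U g x))"
        by (simp add: poly_sum sum_distrib_right mult.assoc)
      also have "\<dots> = (\<Sum>\<gamma>\<in>\<Gamma>. ?e (b \<Gamma> m \<gamma>) * (?e q * U \<gamma> x))"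
        using rel[OF _ x(1)] G(1) by (subst sum.swap) (auto simp: sum_distrib_left[symmetric] intro!: sum.cong)
      also have "\<dots> = ?e q * (\<Sum>\<gamma>\<in>\<Gamma>. ?e (b \<Gamma> m \<gamma>) * U \<gamma> x)"
        by (simp add: sum_distrib_left mult_ac)
      finally show ?thesis using qnz[OF x(2)] by simp
    qed
    show ?thesis
    proof (intro exI[of _ \<Gamma>] exI[of _ "a \<Gamma>"] exI[of _ "b \<Gamma>"] conjI ballI impI)
      fix m assume m: "m \<in> M"
      show "a \<Gamma> m \<noteq> 0" "degree (a \<Gamma> m) \<le> n" using o[of m] nG by auto
      show "czeros (a \<Gamma> m) \<subseteq> W" by (rule cz(1)[OF m])
      fix x assume "x \<in> Z" "of_nat x \<notin> W"
      then show "poly (a \<Gamma> m) (real x) * U m x = (\<Sum>\<gamma>\<in>\<Gamma>. poly (b \<Gamma> m \<gamma>) (real x) * U \<gamma> x)"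
        by (rule rl[OF m])
    next
      fix m \<gamma> assume m: "m \<in> M" "\<gamma> \<in> \<Gamma>"
      show "degree (b \<Gamma> m \<gamma>) \<le> n" using o[of m] m nG by auto
      show "\<bar>poly (b \<Gamma> m \<gamma>) (real x0)\<bar> \<le> fact (card M) * \<bar>poly (a \<Gamma> m) (real x0)\<bar>" by (rule bd[OF m])
      assume "b \<Gamma> m \<gamma> \<noteq> 0"
      then show "czeros (b \<Gamma> m \<gamma>) \<subseteq> W" by (rule cz(2)[OF m])
    qed (use G cG in auto)
  qed
  show ?thesis
    by (intro exI[of _ W] conjI allI impI fW cW[unfolded n_def] main[unfolded n_def])
       (auto simp: W_def)
qed

lemma maximal_extension:
  assumes "finite M" "G0 \<subseteq> M" "Q G0"
  shows "\<exists>G. G0 \<subseteq> G \<and> G \<subseteq> M \<and> Q G \<and> (\<forall>m\<in>M. m \<notin> G \<longrightarrow> \<not> Q (insert m G))"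
proof -
  define P where "P G \<longleftrightarrow> G0 \<subseteq> G \<and> G \<subseteq> M \<and> Q G" for G
  have "\<exists>G. P G \<and> (\<forall>G'. P G' \<longrightarrow> card G' \<le> card G)"
  proof (rule ex_has_greatest_nat)
    show "P G0" using assms by (simp add: P_def)
    show "\<forall>G. P G \<longrightarrow> card G < Suc (card M)"
      using assms(1) by (simp add: P_def card_mono less_Suc_eq_le)
  qed
  then obtain G where G: "P G" "\<And>G'. P G' \<Longrightarrow> card G' \<le> card G" by auto
  have "finite G" using G(1) assms(1) by (auto simp: P_def intro: finite_subset)
  then have "\<not> Q (insert m G)" if "m \<in> M" "m \<notin> G" for m
    using G(2)[of "insert m G"] G(1) that by (auto simp: P_def)
  then show ?thesis using G(1) by (auto simp: P_def)
qed

section \<open>Polynomial relations and entropy\<close>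

text \<open>Independence over the polynomials in \<open>x\<close> of degree at most \<Delta>, as
  functions on \<open>Z\<close>. The degree has to be capped: on a finite set suitable nonzero
  polynomials of large degree vanish identically.\<close>

definition poly_indep :: "('m \<Rightarrow> nat \<Rightarrow> real) \<Rightarrow> nat \<Rightarrow> nat set \<Rightarrow> 'm set \<Rightarrow> bool" where
  "poly_indep U \<Delta> Z G \<longleftrightarrow> row_indep (\<lambda>p x. real x ^ snd p * U (fst p) x) Z (G \<times> {..\<Delta>})"

text \<open>The sets are built upwards in \<open>e\<close>, each extending its predecessor, because
  \<open>many_independent\<close> mixes basis elements of different degrees and needs them inside
  one basis.\<close>

lemma ex_independent_chain:
  assumes "\<And>e. finite (M e)" "\<And>e. M e \<subseteq> M (Suc e)"
  shows "\<exists>G. \<forall>e. G e \<subseteq> M e \<and> G e \<subseteq> G (Suc e) \<and> poly_indep U \<Delta> Z (G e) \<and>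
    (\<forall>m\<in>M e. m \<notin> G e \<longrightarrow> \<not> poly_indep U \<Delta> Z (insert m (G e)))"
proof -
  let ?P = "\<lambda>e G. G \<subseteq> M e \<and> poly_indep U \<Delta> Z G \<and> (\<forall>m\<in>M e. m \<notin> G \<longrightarrow> \<not> poly_indep U \<Delta> Z (insert m G))"
  have "\<exists>G. \<forall>e. ?P e (G e) \<and> G e \<subseteq> G (Suc e)"
  proof (rule dependent_nat_choice)
    have "poly_indep U \<Delta> Z {}" by (simp add: poly_indep_def row_indep_def)
    from maximal_extension[where Q = "poly_indep U \<Delta> Z", OF assms(1) _ this, of 0]
    show "\<exists>G. ?P 0 G" by auto
  next
    fix G e assume G: "?P e G"
    then have "G \<subseteq> M (Suc e)" "poly_indep U \<Delta> Z G" using assms(2) by auto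
    from maximal_extension[where Q = "poly_indep U \<Delta> Z", OF assms(1) this] show "\<exists>H. ?P (Suc e) H \<and> G \<subseteq> H" by auto
  qed
  then obtain G where G: "\<forall>e. ?P e (G e) \<and> G e \<subseteq> G (Suc e)" by (elim exE)
  show ?thesis by (rule exI[of _ G], rule allI) (use G in blast)
qed

text \<open>The polynomial in front of \<open>m\<close> is nonzero, as otherwise the relation would
  live inside \<open>G\<close>.\<close>

lemma poly_relation_of_dependent:
  assumes "finite G" "m \<notin> G" "poly_indep U \<Delta> Z G" "\<not> poly_indep U \<Delta> Z (insert m G)"
  shows "\<exists>p r. p \<noteq> 0 \<and> degree p \<le> \<Delta> \<and> (\<forall>g\<in>G. degree (r g) \<le> \<Delta>) \<and>
    (\<forall>x\<in>Z. poly p (real x) * U m x = (\<Sum>g\<in>G. poly (r g) (real x) * U g x))"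
proof -
  from not_row_indep[OF assms(4)[unfolded poly_indep_def]] obtain c where
    c: "\<forall>x\<in>Z. (\<Sum>p\<in>insert m G \<times> {..\<Delta>}. c p * (real x ^ snd p * U (fst p) x)) = 0"
      "\<exists>p\<in>insert m G \<times> {..\<Delta>}. c p \<noteq> 0" by (elim exE conjE)
  define y where "y g = (\<Sum>t\<le>\<Delta>. monom (c (g,t)) t)" for g
  have dy: "degree (y g) \<le> \<Delta>" for g
    by (rule degree_le) (simp add: y_def coeff_sum)
  have py: "poly (y g) x = (\<Sum>t\<le>\<Delta>. c (g,t) * x ^ t)" for g x
    by (simp add: y_def poly_sum poly_monom)
  have S: "(\<Sum>p\<in>H \<times> {..\<Delta>}. c p * (real x ^ snd p * U (fst p) x)) = (\<Sum>g\<in>H. poly (y g) (real x) * U g x)"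
    for H :: "'a set" and x
    by (simp add: py sum_distrib_right mult.assoc sum.cartesian_product case_prod_beta)
  have "y m \<noteq> 0"
  proof
    assume 0: "y m = 0"
    have "(\<Sum>p\<in>G \<times> {..\<Delta>}. c p * (real x ^ snd p * U (fst p) x)) = 0" if "x \<in> Z" for x
    proof -
      have "(\<Sum>g\<in>insert m G. poly (y g) (real x) * U g x) = 0" using c(1) that unfolding S by blast
      then show ?thesis unfolding S using assms(1,2) 0 by simp
    qed
    then have G0: "c p = 0" if "p \<in> G \<times> {..\<Delta>}" for p
      using row_indepD[OF assms(3)[unfolded poly_indep_def], of c p] that by simp
    have "c (m,t) = 0" if "t \<le> \<Delta>" for t
    proof -
      have "coeff (y m) t = c (m,t)" using that by (simp add: y_def coeff_sum)
      then show ?thesis using 0 by simp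
    qed
    then show False using c(2) G0 by auto
  qed
  moreover have "poly (y m) (real x) * U m x = (\<Sum>g\<in>G. poly (- y g) (real x) * U g x)" if "x \<in> Z" for x
  proof -
    have "(\<Sum>g\<in>insert m G. poly (y g) (real x) * U g x) = 0" using c(1) that unfolding S by blast
    then show ?thesis using assms(1,2) by (simp add: sum_negf eq_neg_iff_add_eq_0)
  qed
  ultimately show ?thesis using dy by (intro exI[of _ "y m"] exI[of _ "\<lambda>g. - y g"]) simp
qed

text \<open>Each \<open>m\<close> outside \<open>G\<close> has a relation with its own leading
  polynomial; the product \<open>q\<close> of these is a common denominator. Elements of
  \<open>G\<close> get the trivial relation, so that \<open>P\<close> restricted to \<open>G\<close>
  is \<open>q\<close> times the identity.\<close>

lemma maximal_relations:
  assumes M: "finite M" "G \<subseteq> M" and ind: "poly_indep U \<Delta> Z G"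
    and max: "\<And>m. m \<in> M \<Longrightarrow> m \<notin> G \<Longrightarrow> \<not> poly_indep U \<Delta> Z (insert m G)"
  shows "\<exists>q P. q \<noteq> 0 \<and> degree q \<le> card M * \<Delta> \<and> (\<forall>m g. degree (P m g) \<le> card M * \<Delta>) \<and>
    (\<forall>g\<in>G. \<forall>g'\<in>G. P g g' = (if g = g' then q else 0)) \<and>
    (\<forall>m\<in>M. \<forall>x\<in>Z. poly q (real x) * U m x = (\<Sum>g\<in>G. poly (P m g) (real x) * U g x))"
proof -
  have fG: "finite G" using M finite_subset by auto
  define ok where "ok m p r \<longleftrightarrow> p \<noteq> 0 \<and> degree p \<le> \<Delta> \<and> (\<forall>g\<in>G. degree (r g) \<le> \<Delta>) \<and>
    (\<forall>x\<in>Z. poly p (real x) * U m x = (\<Sum>g\<in>G. poly (r g) (real x) * U g x)) \<and>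
    (m \<in> G \<longrightarrow> p = 1 \<and> (\<forall>g\<in>G. r g = (if m = g then 1 else 0)))" for m and p :: "real poly" and r
  have "\<forall>m\<in>M. \<exists>p r. ok m p r"
  proof
    fix m assume m: "m \<in> M"
    show "\<exists>p r. ok m p r"
    proof (cases "m \<in> G")
      case True
      have "(\<Sum>g\<in>G. poly (if m = g then 1 else 0) (real x) * U g x) = (\<Sum>g\<in>G. if m = g then U g x else 0)" for x
        by (intro sum.cong) auto
      then have "ok m 1 (\<lambda>g. if m = g then 1 else 0)" using True fG by (simp add: ok_def)
      then show ?thesis by blast
    next
      case False
      have "\<exists>p r. p \<noteq> 0 \<and> degree p \<le> \<Delta> \<and> (\<forall>g\<in>G. degree (r g) \<le> \<Delta>) \<and>
        (\<forall>x\<in>Z. poly p (real x) * U m x = (\<Sum>g\<in>G. poly (r g) (real x) * U g x))"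
        by (rule poly_relation_of_dependent[OF fG False ind max[OF m False]])
      then obtain p r where "p \<noteq> 0" "degree p \<le> \<Delta>" "\<forall>g\<in>G. degree (r g) \<le> \<Delta>"
        "\<forall>x\<in>Z. poly p (real x) * U m x = (\<Sum>g\<in>G. poly (r g) (real x) * U g x)"
        by (elim exE conjE)
      then have "ok m p r" unfolding ok_def using False by (intro conjI impI) auto
      then show ?thesis by blast
    qed
  qed
  from bchoice[OF this] obtain p where "\<forall>m\<in>M. \<exists>r. ok m (p m) r" by (elim exE)
  from bchoice[OF this] obtain r where ok: "\<forall>m\<in>M. ok m (p m) (r m)" by (elim exE)
  have okm: "ok m (p m) (r m)" if "m \<in> M" for m using ok that by blast
  have p0: "p m \<noteq> 0" if "m \<in> M" for m using okm[OF that] unfolding ok_def by (elim conjE)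
  have pd: "degree (p m) \<le> \<Delta>" if "m \<in> M" for m using okm[OF that] unfolding ok_def by (elim conjE)
  have rd: "\<forall>g\<in>G. degree (r m g) \<le> \<Delta>" if "m \<in> M" for m using okm[OF that] unfolding ok_def by (elim conjE)
  have pr: "\<forall>x\<in>Z. poly (p m) (real x) * U m x = (\<Sum>g\<in>G. poly (r m g) (real x) * U g x)"
    if "m \<in> M" for m using okm[OF that] unfolding ok_def by (elim conjE)
  define q where "q = (\<Prod>m\<in>M. p m)"
  define P where "P m g = (if m \<in> M \<and> g \<in> G then (\<Prod>m'\<in>M - {m}. p m') * r m g else 0)" for m g
  have dp: "degree (\<Prod>m\<in>N. p m) \<le> card N * \<Delta>" if "N \<subseteq> M" for N
  proof -
    have "degree (\<Prod>m\<in>N. p m) \<le> (\<Sum>m\<in>N. degree (p m))"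
      using degree_prod_sum_le[of N p] that M finite_subset by (auto simp: o_def)
    also have "\<dots> \<le> (\<Sum>m\<in>N. \<Delta>)" using pd that by (intro sum_mono) auto
    finally show ?thesis by simp
  qed
  have qm: "q = p m * (\<Prod>m'\<in>M - {m}. p m')" if "m \<in> M" for m
    unfolding q_def using M that by (simp add: prod.remove)
  have f1: "q \<noteq> 0" unfolding q_def using M p0 by auto
  have f2: "degree q \<le> card M * \<Delta>" unfolding q_def by (rule dp) simp
  have f3: "degree (P m g) \<le> card M * \<Delta>" for m g
  proof (cases "m \<in> M \<and> g \<in> G")
    case True
    have "degree (P m g) \<le> degree (\<Prod>m'\<in>M - {m}. p m') + degree (r m g)"
      using True by (simp add: P_def degree_mult_le)
    also have "\<dots> \<le> card (M - {m}) * \<Delta> + \<Delta>"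
      using dp[of "M - {m}"] rd True by (intro add_mono) auto
    also have "\<dots> = Suc (card (M - {m})) * \<Delta>" by simp
    also have "Suc (card (M - {m})) = card M" using True M by (intro card_Suc_Diff1) auto
    finally show ?thesis .
  qed (auto simp: P_def)
  have f4: "P g g' = (if g = g' then q else 0)" if "g \<in> G" "g' \<in> G" for g g'
  proof -
    have g: "g \<in> M" using that M by auto
    have "ok g (p g) (r g)" using ok g by blast
    then have "g \<in> G \<longrightarrow> p g = 1 \<and> (\<forall>g'\<in>G. r g g' = (if g = g' then 1 else 0))"
      unfolding ok_def by (elim conjE)
    then have r: "p g = 1" "r g g' = (if g = g' then 1 else 0)" using that by auto
    have "P g g' = (\<Prod>m'\<in>M - {g}. p m') * r g g'" using g that by (simp add: P_def)
    then show ?thesis using qm[OF g] r by simp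
  qed
  have f5: "poly q (real x) * U m x = (\<Sum>g\<in>G. poly (P m g) (real x) * U g x)"
    if m: "m \<in> M" and x: "x \<in> Z" for m x
  proof -
    have "poly q (real x) * U m x = poly (\<Prod>m'\<in>M - {m}. p m') (real x) * (poly (p m) (real x) * U m x)"
      by (simp add: qm[OF m])
    also have "poly (p m) (real x) * U m x = (\<Sum>g\<in>G. poly (r m g) (real x) * U g x)"
      using pr[OF m] x by blast
    also have "poly (\<Prod>m'\<in>M - {m}. p m') (real x) * \<dots> = (\<Sum>g\<in>G. poly (P m g) (real x) * U g x)"
      using m by (simp add: sum_distrib_left P_def mult.assoc)
    finally show ?thesis .
  qed
  show ?thesis
    by (intro exI[of _ q] exI[of _ P] conjI allI ballI f1 f2 f3 f4 f5)
qed

text \<open>Siegel's pigeonhole argument: integer-valued functions that are well approximated by a space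
  of small dimension satisfy an integer relation, since a small integer combination must vanish.\<close>

lemma approximation_entropy:
  fixes f :: "'a \<Rightarrow> 'x \<Rightarrow> real" and c :: "'a \<Rightarrow> 'y \<Rightarrow> real"
  assumes fin: "finite F" "finite Y" and ind: "row_indep f X F"
    and int: "\<And>a x. a \<in> F \<Longrightarrow> x \<in> X \<Longrightarrow> f a x \<in> \<int>"
    and A: "A \<ge> 1" "\<And>y x. y \<in> Y \<Longrightarrow> x \<in> X \<Longrightarrow> \<bar>\<psi> y x\<bar> \<le> A"
    and B: "B \<ge> 0" "\<And>a y. a \<in> F \<Longrightarrow> y \<in> Y \<Longrightarrow> \<bar>c a y\<bar> \<le> B"
    and err: "\<And>a x. a \<in> F \<Longrightarrow> x \<in> X \<Longrightarrow> \<bar>f a x - (\<Sum>y\<in>Y. c a y * \<psi> y x)\<bar> \<le> \<epsilon>"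
    and small: "real (card F) * real Q * \<epsilon> \<le> 1 / 2"
  shows "(real Q + 1) ^ card F \<le> (4 * card F * real Q * B * (card Y + 1) * A + 5) ^ card Y"
proof (rule ccontr)
  assume neg: "\<not> ?thesis"
  define K L where "K = card F" and "L = card Y"
  \<comment> \<open>Mesh for rounding: for two coefficient vectors in the same cell the
    \<open>L\<close> approximating functions, each at most \<open>A\<close>, contribute
    \<open>L * \<eta> * A < 1/2\<close> to the difference. The other half of the budget is
    \<open>small\<close>.\<close>
  define \<eta> where "\<eta> = 1 / (2 * (real L + 1) * A)"
  have \<eta>: "\<eta> > 0" using A by (simp add: \<eta>_def)
  define R where "R = real K * real Q * B / \<eta>"
  have R0: "R \<ge> 0" using B \<eta> by (simp add: R_def)
  define nb where "nb = \<lfloor>R\<rfloor> + 1"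
  define S where "S = PiE F (\<lambda>_. {0..int Q})"
  define cq where "cq q y = (\<Sum>a\<in>F. of_int (q a) * c a y)" for q :: "'a \<Rightarrow> int" and y
  define \<Phi> where "\<Phi> q = (\<lambda>y\<in>Y. \<lfloor>cq q y / \<eta>\<rfloor>)" for q
  define T where "T = PiE Y (\<lambda>_. {-nb..nb})"
  have "\<Phi> q \<in> T" if q: "q \<in> S" for q
  proof -
    have "\<lfloor>cq q y / \<eta>\<rfloor> \<in> {-nb..nb}" if y: "y \<in> Y" for y
    proof -
      have "\<bar>cq q y\<bar> \<le> (\<Sum>a\<in>F. real Q * B)"
        unfolding cq_def
      proof (rule order_trans[OF sum_abs], rule sum_mono)
        fix a assume a: "a \<in> F"
        then have "\<bar>real_of_int (q a)\<bar> \<le> real Q" using q by (auto simp: S_def PiE_def Pi_def)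
        then show "\<bar>of_int (q a) * c a y\<bar> \<le> real Q * B"
          unfolding abs_mult using B(2)[OF a y] by (intro mult_mono) auto
      qed
      then have "\<bar>cq q y\<bar> \<le> real K * real Q * B" by (simp add: K_def)
      then have "\<bar>cq q y / \<eta>\<bar> \<le> R" unfolding R_def abs_divide using \<eta> by (simp add: divide_right_mono)
      then have "- R \<le> cq q y / \<eta>" "cq q y / \<eta> \<le> R" by (simp_all only: abs_le_iff) auto
      then show ?thesis unfolding nb_def by (simp add: le_floor_iff floor_le_iff) linarith
    qed
    then show ?thesis by (auto simp: T_def \<Phi>_def)
  qed
  then have sub: "\<Phi> ` S \<subseteq> T" by auto
  have fT: "finite T" using fin by (simp add: T_def finite_PiE)
  have nb0: "nb \<ge> 0" using R0 by (simp add: nb_def)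
  have "real (card T) = real (nat (2 * nb + 1)) ^ L"
    using fin by (simp add: T_def card_PiE L_def algebra_simps)
  also have "real (nat (2 * nb + 1)) \<le> 4 * K * real Q * B * (L + 1) * A + 5"
  proof -
    have "real (nat (2 * nb + 1)) = 2 * real_of_int nb + 1" using nb0 by simp
    also have "\<dots> \<le> 2 * R + 3" using of_int_floor_le[of R] unfolding nb_def by simp
    also have "R = 2 * K * real Q * B * (L + 1) * A" by (simp add: R_def \<eta>_def)
    finally show ?thesis by (simp add: algebra_simps)
  qed
  then have "real (nat (2 * nb + 1)) ^ L \<le> (4 * K * real Q * B * (L + 1) * A + 5) ^ L"
    by (intro power_mono) auto
  also have "\<dots> < (real Q + 1) ^ K" using neg by (simp add: K_def L_def)
  also have "\<dots> = real (card S)" using fin by (simp add: S_def card_PiE K_def)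
  finally have "card T < card S" by simp
  then have "card (\<Phi> ` S) < card S" using card_mono[OF fT sub] by simp
  then have "\<not> inj_on \<Phi> S" by (rule pigeonhole)
  \<comment> \<open>Two integer vectors with the same rounded approximation: their difference gives
    a combination of the \<open>f a\<close> that is integral and below 1 in modulus, hence 0,
    against independence.\<close>
  then obtain q q' where q: "q \<in> S" "q' \<in> S" "q \<noteq> q'" "\<Phi> q = \<Phi> q'" unfolding inj_on_def by blast
  define p where "p a = q a - q' a" for a
  have close: "\<bar>cq p y\<bar> \<le> \<eta>" if y: "y \<in> Y" for y
  proof -
    have "\<lfloor>cq q y / \<eta>\<rfloor> = \<lfloor>cq q' y / \<eta>\<rfloor>" using fun_cong[OF q(4), of y] y by (simp add: \<Phi>_def)
    then have "\<bar>cq q y / \<eta> - cq q' y / \<eta>\<bar> \<le> 1" by linarith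
    moreover have "cq p y = cq q y - cq q' y" by (simp add: cq_def p_def left_diff_distrib sum_subtractf)
    ultimately have "\<bar>cq p y / \<eta>\<bar> \<le> 1" by (simp add: diff_divide_distrib)
    then show ?thesis using \<eta> by (simp add: abs_divide)
  qed
  have "(\<Sum>a\<in>F. of_int (p a) * f a x) = 0" if x: "x \<in> X" for x
  proof -
    let ?g = "\<lambda>a. \<Sum>y\<in>Y. c a y * \<psi> y x"
    have "(\<Sum>a\<in>F. of_int (p a) * f a x) \<in> \<int>" using int x by (intro Ints_sum Ints_mult) auto
    moreover have "\<bar>\<Sum>a\<in>F. of_int (p a) * f a x\<bar> < 1"
    proof -
      have e1: "\<bar>\<Sum>a\<in>F. of_int (p a) * (f a x - ?g a)\<bar> \<le> (\<Sum>a\<in>F. real Q * \<epsilon>)"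
      proof (rule order_trans[OF sum_abs], rule sum_mono)
        fix a assume a: "a \<in> F"
        have "q a \<in> {0..int Q}" "q' a \<in> {0..int Q}" using q a by (auto simp: S_def PiE_def Pi_def)
        then have "\<bar>p a\<bar> \<le> int Q" unfolding p_def by auto
        then have "\<bar>real_of_int (p a)\<bar> \<le> real Q" by linarith
        then show "\<bar>of_int (p a) * (f a x - ?g a)\<bar> \<le> real Q * \<epsilon>"
          unfolding abs_mult using err[OF a x] by (intro mult_mono) auto
      qed
      have "(\<Sum>a\<in>F. of_int (p a) * ?g a) = (\<Sum>a\<in>F. \<Sum>y\<in>Y. of_int (p a) * c a y * \<psi> y x)"
        by (simp add: sum_distrib_left mult.assoc)
      also have "\<dots> = (\<Sum>y\<in>Y. cq p y * \<psi> y x)"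
        by (subst sum.swap) (simp add: cq_def sum_distrib_right)
      also have "\<bar>\<dots>\<bar> \<le> (\<Sum>y\<in>Y. \<eta> * A)"
      proof (rule order_trans[OF sum_abs], rule sum_mono)
        fix y assume "y \<in> Y"
        then show "\<bar>cq p y * \<psi> y x\<bar> \<le> \<eta> * A"
          unfolding abs_mult using close A(2)[OF _ x] \<eta> by (intro mult_mono) auto
      qed
      also have "\<dots> = real L / (2 * (real L + 1))" using A by (simp add: L_def \<eta>_def)
      also have "\<dots> < 1 / 2" by (simp add: field_simps)
      finally have e2: "\<bar>\<Sum>a\<in>F. of_int (p a) * ?g a\<bar> < 1 / 2" .
      have "(\<Sum>a\<in>F. of_int (p a) * f a x) = (\<Sum>a\<in>F. of_int (p a) * (f a x - ?g a)) + (\<Sum>a\<in>F. of_int (p a) * ?g a)"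
        by (simp add: sum.distrib[symmetric] right_diff_distrib)
      moreover have "(\<Sum>a\<in>F. real Q * \<epsilon>) \<le> 1 / 2" using small by (simp add: mult.assoc)
      ultimately show ?thesis using e1 e2 by linarith
    qed
    ultimately show ?thesis by (rule Ints_nonzero_abs_less1)
  qed
  then have "of_int (p a) = (0::real)" if "a \<in> F" for a
    using row_indepD[OF ind, of "\<lambda>a. of_int (p a)" a] that by simp
  then have "q a = q' a" if "a \<in> F" for a using that by (simp add: p_def)
  then have "q = q'" using q(1,2) unfolding S_def by (intro PiE_ext) auto
  then show False using q(3) by simp
qed

section \<open>Monomials in the u_i and the supply of independent functions\<close>

definition mons :: "nat \<Rightarrow> nat \<Rightarrow> (nat \<Rightarrow> nat) set" where
  "mons k e = {\<beta>. (\<forall>i\<ge>k. \<beta> i = 0) \<and> (\<Sum>i<k. \<beta> i) \<le> e}"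

definition mon_val :: "nat \<Rightarrow> (nat \<Rightarrow> 'x \<Rightarrow> real) \<Rightarrow> (nat \<Rightarrow> nat) \<Rightarrow> 'x \<Rightarrow> real" where
  "mon_val k u \<beta> x = (\<Prod>i<k. u i x ^ \<beta> i)"

lemma mons_finite_card: "finite (mons k e) \<and> card (mons k e) \<le> (e + 1) ^ k"
proof -
  let ?T = "PiE {..<k} (\<lambda>_. {..e})"
  have inj: "inj_on (\<lambda>\<beta>. restrict \<beta> {..<k}) (mons k e)"
  proof (rule inj_onI)
    fix \<beta> \<gamma> assume a: "\<beta> \<in> mons k e" "\<gamma> \<in> mons k e" "restrict \<beta> {..<k} = restrict \<gamma> {..<k}"
    show "\<beta> = \<gamma>"
    proof
      fix i show "\<beta> i = \<gamma> i"
        using a(1,2) fun_cong[OF a(3), of i] by (cases "i < k") (auto simp: mons_def restrict_def)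
    qed
  qed
  have sub: "(\<lambda>\<beta>. restrict \<beta> {..<k}) ` mons k e \<subseteq> ?T"
  proof
    fix f assume "f \<in> (\<lambda>\<beta>. restrict \<beta> {..<k}) ` mons k e"
    then obtain \<beta> where b: "\<beta> \<in> mons k e" "f = restrict \<beta> {..<k}" by auto
    have "\<beta> i \<le> e" if "i < k" for i
    proof -
      have "\<beta> i \<le> (\<Sum>i<k. \<beta> i)" using that by (intro member_le_sum) auto
      then show ?thesis using b(1) by (simp add: mons_def)
    qed
    then show "f \<in> ?T" using b(2) by auto
  qed
  have fT: "finite ?T" by (simp add: finite_PiE)
  have "finite (mons k e)" using inj_on_finite[OF inj sub fT] .
  moreover have "card (mons k e) \<le> card ?T" using card_inj_on_le[OF inj sub fT] .
  ultimately show ?thesis by (simp add: card_PiE)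
qed

lemmas finite_mons = mons_finite_card[THEN conjunct1]
lemmas card_mons_le = mons_finite_card[THEN conjunct2]

lemma mons_mono: "e \<le> e' \<Longrightarrow> mons k e \<subseteq> mons k e'"
  by (auto simp: mons_def)

lemma mons_0: "mons k 0 = {\<lambda>_. 0}"
proof (intro set_eqI iffI)
  fix \<beta> assume b: "\<beta> \<in> mons k 0"
  have "\<beta> i = 0" for i using b by (cases "i < k") (auto simp: mons_def)
  then show "\<beta> \<in> {\<lambda>_. 0}" by auto
qed (auto simp: mons_def)

lemma mons_inc:
  assumes "\<beta> \<in> mons k e" "i < k"
  shows "\<beta>(i := Suc (\<beta> i)) \<in> mons k (Suc e)"
proof -
  have "(\<Sum>j<k. (\<beta>(i := Suc (\<beta> i))) j) = Suc (\<beta> i) + (\<Sum>j\<in>{..<k} - {i}. \<beta> j)"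
    using assms(2) by (subst sum.remove[of _ i]) auto
  also have "\<dots> = Suc (\<Sum>j<k. \<beta> j)" using assms(2) by (subst (2) sum.remove[of _ i]) auto
  finally show ?thesis using assms by (auto simp: mons_def)
qed

lemma mon_val_inc:
  assumes "i < k"
  shows "mon_val k u (\<beta>(i := Suc (\<beta> i))) x = u i x * mon_val k u \<beta> x"
proof -
  have "mon_val k u (\<beta>(i := Suc (\<beta> i))) x = u i x ^ Suc (\<beta> i) * (\<Prod>j\<in>{..<k} - {i}. u j x ^ \<beta> j)"
    unfolding mon_val_def using assms by (subst prod.remove[of _ i]) auto
  also have "\<dots> = u i x * (u i x ^ \<beta> i * (\<Prod>j\<in>{..<k} - {i}. u j x ^ \<beta> j))" by simp
  also have "u i x ^ \<beta> i * (\<Prod>j\<in>{..<k} - {i}. u j x ^ \<beta> j) = mon_val k u \<beta> x"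
    unfolding mon_val_def using assms by (subst prod.remove[of _ i]) auto
  finally show ?thesis .
qed

text \<open>Each factor \<open>x\<^sup>d = \<Sum> c\<^sub>i u\<^sub>i\<close> raises the degree in \<open>u\<close> by one.\<close>

lemma power_times_mon_in_span:
  assumes rel: "\<And>x. x \<in> Z \<Longrightarrow> real x ^ d = (\<Sum>i<k. c i * u i x)"
    and "g \<in> mons k e'" "e' + v \<le> e"
  shows "\<exists>b. \<forall>x\<in>Z. real x ^ (d * v) * mon_val k u g x = (\<Sum>m\<in>mons k e. b m * mon_val k u m x)"
  using assms(2,3)
proof (induction v arbitrary: g e')
  case 0
  then have g: "g \<in> mons k e" using mons_mono[of e' e] by auto
  have "(\<Sum>m\<in>mons k e. (if m = g then 1 else 0) * mon_val k u m x)
     = (\<Sum>m\<in>mons k e. if m = g then mon_val k u m x else 0)" for x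
    by (intro sum.cong) auto
  then have "(\<Sum>m\<in>mons k e. (if m = g then 1 else 0) * mon_val k u m x) = mon_val k u g x" for x
    using g finite_mons[of k e] by simp
  then show ?case by (intro exI[of _ "\<lambda>m. if m = g then 1 else 0"]) simp
next
  case (Suc v)
  have "\<forall>i\<in>{..<k}. \<exists>b. \<forall>x\<in>Z. real x ^ (d * v) * mon_val k u (g(i := Suc (g i))) x
      = (\<Sum>m\<in>mons k e. b m * mon_val k u m x)"
  proof
    fix i assume "i \<in> {..<k}"
    then have "i < k" by simp
    show "\<exists>b. \<forall>x\<in>Z. real x ^ (d * v) * mon_val k u (g(i := Suc (g i))) x
      = (\<Sum>m\<in>mons k e. b m * mon_val k u m x)"
      by (rule Suc.IH[OF mons_inc[OF Suc.prems(1) \<open>i < k\<close>]]) (use Suc.prems(2) in simp)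
  qed
  from bchoice[OF this] obtain b where
    b: "\<forall>i\<in>{..<k}. \<forall>x\<in>Z. real x ^ (d * v) * mon_val k u (g(i := Suc (g i))) x
      = (\<Sum>m\<in>mons k e. b i m * mon_val k u m x)" by (elim exE)
  have "real x ^ (d * Suc v) * mon_val k u g x = (\<Sum>m\<in>mons k e. (\<Sum>i<k. c i * b i m) * mon_val k u m x)"
    if x: "x \<in> Z" for x
  proof -
    have "real x ^ (d * Suc v) * mon_val k u g x = real x ^ (d * v) * ((\<Sum>i<k. c i * u i x) * mon_val k u g x)"
      unfolding rel[OF x, symmetric] by (simp add: power_add)
    also have "\<dots> = (\<Sum>i<k. c i * (real x ^ (d * v) * mon_val k u (g(i := Suc (g i))) x))"
      unfolding sum_distrib_right sum_distrib_left
      by (intro sum.cong refl) (simp add: mon_val_inc)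
    also have "\<dots> = (\<Sum>i<k. \<Sum>m\<in>mons k e. c i * b i m * mon_val k u m x)"
      using b x by (intro sum.cong refl) (simp add: sum_distrib_left mult.assoc)
    also have "\<dots> = (\<Sum>m\<in>mons k e. (\<Sum>i<k. c i * b i m) * mon_val k u m x)"
      by (subst sum.swap) (simp add: sum_distrib_right)
    finally show ?thesis .
  qed
  then show ?case by (intro exI[of _ "\<lambda>m. \<Sum>i<k. c i * b i m"]) simp
qed

text \<open>The functions \<open>x ^ (d * v + j)\<close> times a monomial from
  \<open>G (e - v)\<close>, for \<open>v \<le> e\<close> and \<open>j \<le> D\<close>, have distinct
  indices because \<open>D < d\<close>, and their exponents of \<open>x\<close> are at most
  \<Delta>; so they are independent. Trading each \<open>x ^ d\<close> for the \<open>u i\<close>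
  puts them into the span of \<open>x ^ j\<close> times monomials of degree at most
  \<open>e\<close>, and the exchange lemma selects as many functions from there. The factor
  \<open>h\<close> will clear denominators.\<close>

lemma many_independent:
  assumes rel: "\<And>x. x \<in> Z \<Longrightarrow> real x ^ d = (\<Sum>i<k. c i * u i x)"
    and G: "\<And>i. G i \<subseteq> mons k i" "\<And>i. G i \<subseteq> G (Suc i)"
    and ind: "poly_indep (mon_val k u) \<Delta> Z (G e)"
    and D: "D < d" "d * e + D \<le> \<Delta>"
    and h: "\<And>x. x \<in> Z \<Longrightarrow> h x \<noteq> 0"
  shows "\<exists>F\<subseteq>mons k e \<times> {..D}.
    row_indep (\<lambda>p x. h x * (real x ^ snd p * mon_val k u (fst p) x)) Z F \<and>
    (D + 1) * (\<Sum>i\<le>e. card (G i)) \<le> card F"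
proof -
  have Gm: "G i \<subseteq> G j" if "i \<le> j" for i j using G(2) that by (rule lift_Suc_mono_le)
  have fG: "finite (G i)" for i using G(1) finite_mons finite_subset by blast
  define A where "A = (SIGMA v:{..e}. G (e - v) \<times> {..D})"
  define f where "f p = (fst (snd p), d * fst p + snd (snd p))" for p :: "nat \<times> (nat \<Rightarrow> nat) \<times> nat"
  have fA: "finite A" unfolding A_def using fG by auto
  have "inj_on f A"
  proof (rule inj_onI)
    fix p q assume pq: "p \<in> A" "q \<in> A" "f p = f q"
    obtain v g j v' g' j' where e: "p = (v,g,j)" "q = (v',g',j')" by (metis prod_cases3)
    have j: "j < d" "j' < d" using pq D by (auto simp: A_def e)
    have "d * v + j = d * v' + j'" "g = g'" using pq(3) by (auto simp: f_def e)
    moreover have "(d * v + j) div d = v" "(d * v' + j') div d = v'" using j by auto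
    ultimately show "p = q" by (auto simp: e)
  qed
  moreover have "f ` A \<subseteq> G e \<times> {..\<Delta>}"
  proof
    fix p assume "p \<in> f ` A"
    then obtain v g j where p: "p = (g, d * v + j)" "v \<le> e" "g \<in> G (e - v)" "j \<le> D"
      by (auto simp: A_def f_def)
    have "d * v \<le> d * e" using p(2) by simp
    then have "d * v + j \<le> \<Delta>" using D p by linarith
    then show "p \<in> G e \<times> {..\<Delta>}" using p Gm[of "e - v" e] by auto
  qed
  ultimately have "row_indep (\<lambda>a x. real x ^ snd (f a) * mon_val k u (fst (f a)) x) Z A"
    using row_indep_reindex[OF ind[unfolded poly_indep_def]] fG by simp
  from row_indep_scale[OF this, of h] h
  have indA: "row_indep (\<lambda>a x. h x * (real x ^ snd (f a) * mon_val k u (fst (f a)) x)) Z A" by simp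
  have fF: "finite (mons k e \<times> {..D})" using finite_mons by simp
  have ex: "\<exists>F\<subseteq>mons k e \<times> {..D}.
    row_indep (\<lambda>p x. h x * (real x ^ snd p * mon_val k u (fst p) x)) Z F \<and> card A \<le> card F"
  proof (rule row_indep_in_span_card_le[OF fA fF indA])
    fix a assume a: "a \<in> A"
    obtain v g j where e: "a = (v,g,j)" by (metis prod_cases3)
    have vgj: "v \<le> e" "g \<in> G (e - v)" "j \<le> D" using a by (auto simp: A_def e)
    have "\<exists>b. \<forall>x\<in>Z. real x ^ (d * v) * mon_val k u g x = (\<Sum>m\<in>mons k e. b m * mon_val k u m x)"
      by (rule power_times_mon_in_span[where c = c and e' = "e - v"]) (use rel vgj G(1) in auto)
    then obtain b where b: "\<forall>x\<in>Z. real x ^ (d * v) * mon_val k u g x = (\<Sum>m\<in>mons k e. b m * mon_val k u m x)"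
      by (elim exE)
    define B where "B p = (if snd p = j then b (fst p) else 0)" for p :: "(nat \<Rightarrow> nat) \<times> nat"
    have "h x * (real x ^ snd (f a) * mon_val k u (fst (f a)) x) =
       (\<Sum>p\<in>mons k e \<times> {..D}. B p * (h x * (real x ^ snd p * mon_val k u (fst p) x)))" if x: "x \<in> Z" for x
    proof -
      have "(\<Sum>p\<in>mons k e \<times> {..D}. B p * (h x * (real x ^ snd p * mon_val k u (fst p) x)))
        = (\<Sum>m\<in>mons k e. \<Sum>j'\<le>D. if j' = j then b m * (h x * (real x ^ j' * mon_val k u m x)) else 0)"
        unfolding sum.cartesian_product
        by (intro sum.cong refl) (auto simp: B_def)
      also have "\<dots> = (\<Sum>m\<in>mons k e. h x * real x ^ j * (b m * mon_val k u m x))"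
        using vgj(3) by (intro sum.cong refl) simp
      also have "\<dots> = h x * real x ^ j * (real x ^ (d * v) * mon_val k u g x)"
        using b x by (simp add: sum_distrib_left)
      also have "\<dots> = h x * (real x ^ snd (f a) * mon_val k u (fst (f a)) x)"
        by (simp add: f_def e power_add)
      finally show ?thesis by simp
    qed
    then show "\<exists>b. \<forall>x\<in>Z. h x * (real x ^ snd (f a) * mon_val k u (fst (f a)) x) =
       (\<Sum>p\<in>mons k e \<times> {..D}. b p * (h x * (real x ^ snd p * mon_val k u (fst p) x)))"
      by (intro exI[of _ B]) simp
  qed
  have cA: "card A = (D + 1) * (\<Sum>i\<le>e. card (G i))"
  proof -
    have "card A = (\<Sum>v\<le>e. card (G (e - v)) * (D + 1))"
      unfolding A_def using fG by (simp add: card_SigmaI card_cartesian_product)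
    also have "\<dots> = (\<Sum>i\<le>e. card (G i) * (D + 1))"
      by (rule sum.reindex_bij_witness[of _ "\<lambda>i. e - i" "\<lambda>i. e - i"]) auto
    also have "\<dots> = (D + 1) * (\<Sum>i\<le>e. card (G i))"
      by (simp only: sum_distrib_right[symmetric] mult.commute)
    finally show ?thesis .
  qed
  show ?thesis using ex unfolding cA .
qed

text \<open>With \<open>w = (x - x0) / R\<close> the approximating functions are
  \<open>w ^ t * h x * U \<gamma> x\<close> for \<gamma> in the frame and \<open>t < T\<close>, so
  there are \<open>card \<Gamma> * T\<close> of them: each \<open>x ^ j * U m x\<close> is a
  combination of the \<open>U \<gamma> x\<close> with rational functions of \<open>x\<close> as
  coefficients, and these are replaced by Taylor polynomials at \<open>x0\<close>.\<close>

lemma piece_entropy: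
  fixes U :: "'m \<Rightarrow> nat \<Rightarrow> real" and h :: "nat \<Rightarrow> real" and \<eta> B A R N Cf x0 :: real
  assumes M: "finite M" "\<Gamma> \<subseteq> M" "F \<subseteq> M \<times> {..D}"
    and ind: "row_indep (\<lambda>p x. h x * (real x ^ snd p * U (fst p) x)) Z F"
    and int: "\<And>m x. m \<in> M \<Longrightarrow> x \<in> Z \<Longrightarrow> h x * U m x \<in> \<int>"
    and A: "A \<ge> 1" "\<And>m x. m \<in> M \<Longrightarrow> x \<in> Z \<Longrightarrow> \<bar>h x * U m x\<bar> \<le> A"
    and a: "\<And>m. m \<in> M \<Longrightarrow> a m \<noteq> 0 \<and> degree (a m) \<le> n \<and> (\<forall>z\<in>czeros (a m). 4 * R \<le> norm (of_real x0 - z))"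
    and b: "\<And>m \<gamma>. m \<in> M \<Longrightarrow> \<gamma> \<in> \<Gamma> \<Longrightarrow> degree (b m \<gamma>) \<le> n \<and>
       (b m \<gamma> \<noteq> 0 \<longrightarrow> (\<forall>z\<in>czeros (b m \<gamma>). 4 * R \<le> norm (of_real x0 - z))) \<and>
       \<bar>poly (b m \<gamma>) x0\<bar> \<le> Cf * \<bar>poly (a m) x0\<bar>"
    and U: "\<And>m x. m \<in> M \<Longrightarrow> x \<in> Z \<Longrightarrow> poly (a m) (real x) \<noteq> 0 \<and>
       poly (a m) (real x) * U m x = (\<Sum>\<gamma>\<in>\<Gamma>. poly (b m \<gamma>) (real x) * U \<gamma> x)"
    and R: "R > 0" "4 * R \<le> N" "\<bar>x0\<bar> \<le> N" "N \<ge> 1" "Cf \<ge> 0"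
    and Z: "\<And>x. x \<in> Z \<Longrightarrow> \<bar>real x - x0\<bar> \<le> \<eta> * R" and \<eta>: "0 \<le> \<eta>" "\<eta> \<le> 1 / 2"
    and B: "B = 4 ^ n * Cf * (2 * N) ^ D"
    and small: "real (card F) * real Q * (card \<Gamma> * (2 * B * \<eta> ^ T * A)) \<le> 1 / 2"
  shows "(real Q + 1) ^ card F \<le> (4 * card F * real Q * B * (card \<Gamma> * T + 1) * A + 5) ^ (card \<Gamma> * T)"
proof -
  have fG: "finite \<Gamma>" using M finite_subset by auto
  have fF: "finite F" using M finite_subset by blast
  have B0: "B \<ge> 0" using R by (simp add: B)
  define w where "w x = (real x - x0) / R" for x :: nat
  have xw: "real x = x0 + R * w x" for x using R by (simp add: w_def)
  have wb: "\<bar>w x\<bar> \<le> \<eta>" if "x \<in> Z" for x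
    using Z[OF that] R by (simp add: w_def abs_divide pos_divide_le_eq)
  define ok where "ok m \<gamma> j c \<longleftrightarrow> (\<forall>t. \<bar>c t\<bar> \<le> B) \<and>
     (\<forall>w. \<bar>w\<bar> \<le> \<eta> \<longrightarrow> \<bar>(x0 + R * w) ^ j * (poly (b m \<gamma>) (x0 + R * w) / poly (a m) (x0 + R * w)) - (\<Sum>t<T. c t * w ^ t)\<bar>
       \<le> 2 * B * \<eta> ^ T)" for m \<gamma> j and c :: "nat \<Rightarrow> real"
  have ex: "\<exists>c. ok m \<gamma> j c" if "m \<in> M" "\<gamma> \<in> \<Gamma>" "j \<le> D" for m \<gamma> j
    unfolding ok_def B
    by (rule rational_taylor) (use a[OF that(1)] b[OF that(1,2)] that(3) R \<eta> in auto)
  define c where "c m \<gamma> j = (SOME c. ok m \<gamma> j c)" for m \<gamma> j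
  have ok: "ok m \<gamma> j (c m \<gamma> j)" if "m \<in> M" "\<gamma> \<in> \<Gamma>" "j \<le> D" for m \<gamma> j
    unfolding c_def by (rule someI_ex[OF ex[OF that]])
  define \<psi> where "\<psi> y x = w x ^ snd y * (h x * U (fst y) x)" for y :: "'m \<times> nat" and x
  define cc where "cc p y = c (fst p) (fst y) (snd p) (snd y)" for p :: "'m \<times> nat" and y :: "'m \<times> nat"
  have "(real Q + 1) ^ card F \<le> (4 * card F * real Q * B * (card (\<Gamma> \<times> {..<T}) + 1) * A + 5) ^ card (\<Gamma> \<times> {..<T})"
  proof (rule approximation_entropy[OF fF _ ind])
    show "finite (\<Gamma> \<times> {..<T})" using fG by simp
    show "A \<ge> 1" "B \<ge> 0" by fact+
    show "h x * (real x ^ snd p * U (fst p) x) \<in> \<int>" if "p \<in> F" "x \<in> Z" for p x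
    proof -
      have "h x * U (fst p) x \<in> \<int>" using that M by (intro int) auto
      then have "real x ^ snd p * (h x * U (fst p) x) \<in> \<int>"
        by (rule Ints_mult[rotated]) simp
      then show ?thesis by (simp add: mult_ac)
    qed
    show "\<bar>\<psi> y x\<bar> \<le> A" if "y \<in> \<Gamma> \<times> {..<T}" "x \<in> Z" for y x
    proof -
      have "\<bar>w x ^ snd y\<bar> \<le> 1" unfolding power_abs using wb[OF that(2)] \<eta> by (intro power_le_one) auto
      moreover have "\<bar>h x * U (fst y) x\<bar> \<le> A" using that M by (intro A(2)) auto
      ultimately have "\<bar>w x ^ snd y\<bar> * \<bar>h x * U (fst y) x\<bar> \<le> 1 * A" by (intro mult_mono) auto
      then show ?thesis by (simp add: \<psi>_def abs_mult)
    qed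
    show "\<bar>cc p y\<bar> \<le> B" if "p \<in> F" "y \<in> \<Gamma> \<times> {..<T}" for p y
      using ok[of "fst p" "fst y" "snd p"] that M unfolding ok_def cc_def by auto
    show "\<bar>h x * (real x ^ snd p * U (fst p) x) - (\<Sum>y\<in>\<Gamma> \<times> {..<T}. cc p y * \<psi> y x)\<bar>
       \<le> card \<Gamma> * (2 * B * \<eta> ^ T * A)" if p: "p \<in> F" and x: "x \<in> Z" for p x
    proof -
      obtain m j where e: "p = (m,j)" by (cases p)
      have mj: "m \<in> M" "j \<le> D" using p M e by auto
      have Um: "U m x = (\<Sum>\<gamma>\<in>\<Gamma>. poly (b m \<gamma>) (real x) / poly (a m) (real x) * U \<gamma> x)"
        using U[OF mj(1) x] by (simp add: sum_divide_distrib[symmetric] field_simps)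
      have "h x * (real x ^ j * U m x) - (\<Sum>y\<in>\<Gamma> \<times> {..<T}. cc p y * \<psi> y x)
        = (\<Sum>\<gamma>\<in>\<Gamma>. (real x ^ j * (poly (b m \<gamma>) (real x) / poly (a m) (real x)) - (\<Sum>t<T. c m \<gamma> j t * w x ^ t)) * (h x * U \<gamma> x))"
      proof -
        have "(\<Sum>y\<in>\<Gamma> \<times> {..<T}. cc p y * \<psi> y x) = (\<Sum>\<gamma>\<in>\<Gamma>. \<Sum>t<T. c m \<gamma> j t * w x ^ t * (h x * U \<gamma> x))"
          unfolding sum.cartesian_product by (intro sum.cong refl) (auto simp: cc_def \<psi>_def e mult_ac)
        also have "\<dots> = (\<Sum>\<gamma>\<in>\<Gamma>. (\<Sum>t<T. c m \<gamma> j t * w x ^ t) * (h x * U \<gamma> x))"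
          by (simp add: sum_distrib_right)
        finally have 1: "(\<Sum>y\<in>\<Gamma> \<times> {..<T}. cc p y * \<psi> y x) = (\<Sum>\<gamma>\<in>\<Gamma>. (\<Sum>t<T. c m \<gamma> j t * w x ^ t) * (h x * U \<gamma> x))" .
        have 2: "h x * (real x ^ j * U m x) = (\<Sum>\<gamma>\<in>\<Gamma>. (real x ^ j * (poly (b m \<gamma>) (real x) / poly (a m) (real x))) * (h x * U \<gamma> x))"
          unfolding Um sum_distrib_left by (intro sum.cong refl) (simp add: mult_ac)
        show ?thesis unfolding 1 2 by (simp only: left_diff_distrib sum_subtractf)
      qed
      also have "\<bar>\<dots>\<bar> \<le> (\<Sum>\<gamma>\<in>\<Gamma>. (2 * B * \<eta> ^ T) * A)"
      proof (rule order_trans[OF sum_abs], rule sum_mono)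
        fix \<gamma> assume g: "\<gamma> \<in> \<Gamma>"
        have "\<bar>real x ^ j * (poly (b m \<gamma>) (real x) / poly (a m) (real x)) - (\<Sum>t<T. c m \<gamma> j t * w x ^ t)\<bar> \<le> 2 * B * \<eta> ^ T"
          using ok[OF mj(1) g mj(2), unfolded ok_def, THEN conjunct2, rule_format, OF wb[OF x]]
          unfolding xw[symmetric] .
        moreover have "\<bar>h x * U \<gamma> x\<bar> \<le> A" using g M x by (intro A(2)) auto
        ultimately show "\<bar>(real x ^ j * (poly (b m \<gamma>) (real x) / poly (a m) (real x)) - (\<Sum>t<T. c m \<gamma> j t * w x ^ t)) * (h x * U \<gamma> x)\<bar>
           \<le> (2 * B * \<eta> ^ T) * A"
          unfolding abs_mult using B0 \<eta> by (intro mult_mono) auto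
      qed
      finally show ?thesis by (simp add: e)
    qed
  qed (use small in simp)
  then show ?thesis using fG by (simp add: card_cartesian_product)
qed

text \<open>Bookkeeping for \<open>Q = N ^ (2 * D)\<close>, \<open>A\<close> of size
  \<open>N ^ (D - 1)\<close> and \<open>B\<close> of size \<open>N ^ D\<close>. Their product has
  size \<open>N ^ (4 * D - 1)\<close>; the missing factor \<open>N\<close> absorbs all constants,
  and an accuracy of order \<open>N powr (- (4 * D + 1))\<close> makes the error small.\<close>

lemma entropy_numeric:
  fixes A1 Cf :: real and D T X n :: nat
  assumes "D \<ge> 1" "A1 \<ge> 0" "Cf \<ge> 0"
  shows "\<exists>N0\<ge>2. \<forall>N\<ge>N0. \<forall>K g. \<forall>\<epsilon>::real. K \<le> X * (D + 1) \<longrightarrow> g \<le> X \<longrightarrow> 0 \<le> \<epsilon> \<longrightarrow> \<epsilon> * real N ^ (4 * D + 1) \<le> 1 \<longrightarrow>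
    real K * real (N ^ (2 * D)) * (real g * (2 * (4 ^ n * Cf * (2 * real N) ^ D) * \<epsilon> * (A1 * real N ^ (D - 1)))) \<le> 1 / 2 \<and>
    4 * real K * real (N ^ (2 * D)) * (4 ^ n * Cf * (2 * real N) ^ D) * (real g * T + 1) * (A1 * real N ^ (D - 1)) + 5
      \<le> real N ^ (4 * D)"
proof -
  define q where "q = 4 ^ n * Cf * 2 ^ D * A1"
  have q0: "q \<ge> 0" using assms by (simp add: q_def)
  define c2 where "c2 = real X * real (D + 1) * real X * 2 * q"
  define c3 where "c3 = 4 * (real X * real (D + 1)) * q * (real X * T + 1)"
  have c0: "c2 \<ge> 0" "c3 \<ge> 0" using q0 by (auto simp: c2_def c3_def)
  define N0 where "N0 = nat \<lceil>2 * c2 + c3 + 5\<rceil> + 2"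
  have "real K * real (N ^ (2 * D)) * (real g * (2 * (4 ^ n * Cf * (2 * real N) ^ D) * \<epsilon> * (A1 * real N ^ (D - 1)))) \<le> 1 / 2 \<and>
    4 * real K * real (N ^ (2 * D)) * (4 ^ n * Cf * (2 * real N) ^ D) * (real g * T + 1) * (A1 * real N ^ (D - 1)) + 5
      \<le> real N ^ (4 * D)"
    if N: "N \<ge> N0" and K: "K \<le> X * (D + 1)" and g: "g \<le> X" and e: "0 \<le> \<epsilon>" "\<epsilon> * real N ^ (4 * D + 1) \<le> 1"
    for N K g \<epsilon>
  proof
    let ?x = "real N"
    have Nr: "?x \<ge> 2 * c2 + c3 + 5" "?x \<ge> 1" using N unfolding N0_def by linarith+
    have Kr: "real K \<le> real X * real (D + 1)" using K by (metis of_nat_le_iff of_nat_mult)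
    have gr: "real g \<le> real X" using g by simp
    have pw: "?x ^ (2 * D) * (?x ^ D * ?x ^ (D - 1)) = ?x ^ (4 * D - 1)"
      using assms(1) by (simp add: power_add[symmetric])
    have "real K * real (N ^ (2 * D)) * (real g * (2 * (4 ^ n * Cf * (2 * ?x) ^ D) * \<epsilon> * (A1 * ?x ^ (D - 1))))
       = real K * real g * (2 * q) * (?x ^ (2 * D) * (?x ^ D * ?x ^ (D - 1)) * \<epsilon>)"
      by (simp add: q_def power_mult_distrib)
    also have "\<dots> \<le> (real X * real (D + 1)) * real X * (2 * q) * (?x ^ (2 * D) * (?x ^ D * ?x ^ (D - 1)) * \<epsilon>)"
      using Kr gr q0 e(1) by (intro mult_right_mono mult_mono) auto
    also have "\<dots> = c2 * (?x ^ (4 * D - 1) * \<epsilon>)" by (simp only: pw c2_def mult.assoc)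
    also have "\<dots> \<le> 1 / 2"
    proof -
      have "?x ^ (4 * D + 1) = ?x ^ 2 * ?x ^ (4 * D - 1)" using assms(1) by (simp add: power_add[symmetric])
      then have "?x ^ 2 * (?x ^ (4 * D - 1) * \<epsilon>) \<le> 1" using e(2) by (simp add: mult_ac)
      moreover have "?x * (?x ^ (4 * D - 1) * \<epsilon>) \<le> ?x ^ 2 * (?x ^ (4 * D - 1) * \<epsilon>)"
        using Nr e(1) by (intro mult_right_mono) (auto simp: power2_eq_square)
      moreover have "2 * c2 * (?x ^ (4 * D - 1) * \<epsilon>) \<le> ?x * (?x ^ (4 * D - 1) * \<epsilon>)"
        using Nr c0 e(1) by (intro mult_right_mono) auto
      ultimately show ?thesis by linarith
    qed
    finally show "real K * real (N ^ (2 * D)) * (real g * (2 * (4 ^ n * Cf * (2 * ?x) ^ D) * \<epsilon> * (A1 * ?x ^ (D - 1)))) \<le> 1 / 2" .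
    have "4 * real K * real (N ^ (2 * D)) * (4 ^ n * Cf * (2 * ?x) ^ D) * (real g * T + 1) * (A1 * ?x ^ (D - 1))
       = 4 * real K * q * (real g * T + 1) * (?x ^ (2 * D) * (?x ^ D * ?x ^ (D - 1)))"
      by (simp add: q_def power_mult_distrib)
    also have "\<dots> \<le> 4 * (real X * real (D + 1)) * q * (real X * T + 1) * (?x ^ (2 * D) * (?x ^ D * ?x ^ (D - 1)))"
      using Kr gr q0 by (intro mult_right_mono mult_mono add_right_mono) auto
    also have "\<dots> = c3 * ?x ^ (4 * D - 1)" by (simp only: pw c3_def)
    finally have "4 * real K * real (N ^ (2 * D)) * (4 ^ n * Cf * (2 * ?x) ^ D) * (real g * T + 1) * (A1 * ?x ^ (D - 1)) + 5
       \<le> c3 * ?x ^ (4 * D - 1) + 5 * 1" by simp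
    also have "\<dots> \<le> c3 * ?x ^ (4 * D - 1) + 5 * ?x ^ (4 * D - 1)"
      using Nr by (intro add_left_mono mult_left_mono one_le_power) auto
    also have "\<dots> = (c3 + 5) * ?x ^ (4 * D - 1)" by (simp add: distrib_right)
    also have "\<dots> \<le> ?x * ?x ^ (4 * D - 1)" using Nr c0 by (intro mult_right_mono) auto
    also have "\<dots> = ?x ^ (4 * D)" using assms(1) by (simp add: power_Suc[symmetric] del: power_Suc)
    finally show "4 * real K * real (N ^ (2 * D)) * (4 ^ n * Cf * (2 * ?x) ^ D) * (real g * T + 1) * (A1 * ?x ^ (D - 1)) + 5
       \<le> ?x ^ (4 * D)" .
  qed
  then show ?thesis by (intro exI[of _ N0] conjI) (auto simp: N0_def)
qed

text \<open>The number of dyadic scales is logarithmic in \<open>N\<close>; the inequality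
  \<open>1 + x \<le> exp x\<close> bounds it by a small power of \<open>N\<close> with an explicit
  constant.\<close>

lemma dyadic_level_bound:
  assumes "N \<ge> 1" "\<nu> \<ge> (1::nat)"
  shows "\<exists>L. N < 2 ^ Suc L \<and> real (Suc L) \<le> 2 * real \<nu> * real N powr (1 / \<nu>)"
proof -
  obtain L where L: "2 ^ L \<le> real N" "real N < 2 ^ Suc L" using ex_power_two_ivl[of "real N"] assms by auto
  have "real L * (1 / 2) \<le> real L * ln 2"
    using ln2_ge_two_thirds by (intro mult_left_mono) auto
  then have "real L * (1 / 2) / \<nu> \<le> real L * ln 2 / \<nu>" by (rule divide_right_mono) simp
  then have "1 + real L / (2 * real \<nu>) \<le> 1 + real L * ln 2 / \<nu>" by (simp add: mult.commute)
  also have "\<dots> \<le> exp (real L * ln 2 / \<nu>)" by (rule exp_ge_add_one_self)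
  also have "\<dots> = (2 ^ L) powr (1 / \<nu>)"
    by (simp add: powr_def ln_realpow)
  also have "\<dots> \<le> real N powr (1 / \<nu>)" using L by (intro powr_mono2) auto
  finally have "1 + real L / (2 * real \<nu>) \<le> real N powr (1 / \<nu>)" .
  then have a: "2 * real \<nu> * (1 + real L / (2 * real \<nu>)) \<le> 2 * real \<nu> * real N powr (1 / \<nu>)"
    by (intro mult_left_mono) auto
  have "real (Suc L) \<le> 2 * real \<nu> + real L" using assms by simp
  also have "\<dots> = 2 * real \<nu> * (1 + real L / (2 * real \<nu>))" using assms by (simp add: field_simps)
  also note a
  finally have "real (Suc L) \<le> 2 * real \<nu> * real N powr (1 / \<nu>)" .
  moreover have "N < 2 ^ Suc L" using L(2) by (metis of_nat_less_iff of_nat_numeral of_nat_power)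
  ultimately show ?thesis by blast
qed

section \<open>Sparsity of powers in a rational span\<close>

text \<open>There are \<open>k\<close> spanning functions, integer coefficients of height about
  \<open>N ^ r\<close>, and monomials of degree at most \<open>E\<close>. Monomials then have height
  about \<open>N ^ (r * E)\<close>, an exponent that \<open>D\<close> exceeds by one, and \<Delta>
  is the largest exponent \<open>d * e + j\<close> that occurs. A refinement will cost a factor of
  order \<open>N powr (2 / \<nu>)\<close>.\<close>

locale power_relations =
  fixes k r d E \<nu> A0 D \<Delta> :: nat
  assumes \<nu>: "\<nu> \<ge> 1" and A0: "A0 \<ge> 1" and D_def: "D = r * E + 1" and Dd: "D < d"
    and Delta_def: "\<Delta> = d * E + D"
begin

text \<open>The real vector \<open>c\<close> is common to all points; only the integers
  \<open>h0 x\<close> and \<open>h i x\<close> vary. Their quotients are the functions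
  \<open>u i\<close>.\<close>

definition related :: "nat \<Rightarrow> (nat \<Rightarrow> real) \<Rightarrow> (nat \<Rightarrow> int) \<Rightarrow> (nat \<Rightarrow> nat \<Rightarrow> int) \<Rightarrow> nat set \<Rightarrow> bool" where
  "related N c h0 h Z \<longleftrightarrow> Z \<subseteq> {1..N} \<and> (\<forall>x\<in>Z. h0 x \<noteq> 0 \<and> \<bar>real_of_int (h0 x)\<bar> \<le> A0 * real N ^ r \<and>
     (\<forall>i<k. \<bar>real_of_int (h i x)\<bar> \<le> A0 * real N ^ r) \<and>
     of_int (h0 x) * real x ^ d = (\<Sum>i<k. c i * of_int (h i x)))"

definition mon :: "(nat \<Rightarrow> int) \<Rightarrow> (nat \<Rightarrow> nat \<Rightarrow> int) \<Rightarrow> (nat \<Rightarrow> nat) \<Rightarrow> nat \<Rightarrow> real" where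
  "mon h0 h = mon_val k (\<lambda>i x. of_int (h i x) / of_int (h0 x))"

text \<open>\<open>G e\<close> is a basis of the monomials of degree at most \<open>e\<close> modulo relations on \<open>Z\<close> whose
  coefficients are polynomials in \<open>x\<close> of degree at most \<open>\<Delta>\<close>.\<close>

definition chain_on :: "((nat \<Rightarrow> nat) \<Rightarrow> nat \<Rightarrow> real) \<Rightarrow> nat set \<Rightarrow> (nat \<Rightarrow> (nat \<Rightarrow> nat) set) \<Rightarrow> bool" where
  "chain_on U Z G \<longleftrightarrow> (\<forall>e. G e \<subseteq> mons k e \<and> G e \<subseteq> G (Suc e) \<and> poly_indep U \<Delta> Z (G e) \<and>
    (\<forall>m\<in>mons k e. m \<notin> G e \<longrightarrow> \<not> poly_indep U \<Delta> Z (insert m (G e))))"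

lemma ex_chain_on: "\<exists>G. chain_on U Z G"
  unfolding chain_on_def
  by (rule ex_independent_chain) (auto simp: finite_mons mons_mono[THEN subsetD, rotated])

lemma related_power:
  assumes "related N c h0 h Z" "x \<in> Z"
  shows "real x ^ d = (\<Sum>i<k. c i * (of_int (h i x) / of_int (h0 x)))"
proof -
  have "h0 x \<noteq> 0" "of_int (h0 x) * real x ^ d = (\<Sum>i<k. c i * of_int (h i x))"
    using assms by (auto simp: related_def)
  then have "real x ^ d = (\<Sum>i<k. c i * of_int (h i x)) / of_int (h0 x)" by (simp add: field_simps)
  then show ?thesis by (simp add: sum_divide_distrib)
qed

text \<open>One factor \<open>h0 x ^ e\<close> clears the denominators of all monomials of degree at
  most \<open>e\<close>. What remains is a product of \<open>e\<close> integers of size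
  \<open>A0 * N ^ r\<close>, and \<open>r * E = D - 1\<close>.\<close>

lemma mon_integral_bounded:
  assumes "related N c h0 h Z" "x \<in> Z" "m \<in> mons k e" "e \<le> E"
  shows "of_int (h0 x) ^ e * mon h0 h m x \<in> \<int>"
    and "\<bar>of_int (h0 x) ^ e * mon h0 h m x\<bar> \<le> real A0 ^ E * real N ^ (D - 1)"
proof -
  define s where "s = (\<Sum>i<k. m i)"
  have s: "s \<le> e" using assms(3) by (simp add: mons_def s_def)
  have h0: "h0 x \<noteq> 0" "\<bar>real_of_int (h0 x)\<bar> \<le> A0 * real N ^ r" "\<And>i. i < k \<Longrightarrow> \<bar>real_of_int (h i x)\<bar> \<le> A0 * real N ^ r"
    using assms(1,2) by (auto simp: related_def)
  have N1: "N \<ge> 1" using assms(1,2) by (force simp: related_def)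
  have H1: "A0 * real N ^ r \<ge> 1" using A0 N1 by (simp add: mult_ge1_I)
  have "mon h0 h m x = (\<Prod>i<k. of_int (h i x) ^ m i) / of_int (h0 x) ^ s"
    by (simp add: mon_def mon_val_def power_divide prod_dividef power_sum s_def)
  then have eq: "of_int (h0 x) ^ e * mon h0 h m x = of_int (h0 x) ^ (e - s) * (\<Prod>i<k. of_int (h i x) ^ m i)"
    using h0(1) s by (simp add: power_diff)
  show "of_int (h0 x) ^ e * mon h0 h m x \<in> \<int>"
    unfolding eq by (intro Ints_mult Ints_prod Ints_power) auto
  have "\<bar>of_int (h0 x) ^ e * mon h0 h m x\<bar> = \<bar>real_of_int (h0 x)\<bar> ^ (e - s) * (\<Prod>i<k. \<bar>real_of_int (h i x)\<bar> ^ m i)"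
    unfolding eq by (simp add: abs_mult abs_prod power_abs)
  also have "\<dots> \<le> (A0 * real N ^ r) ^ (e - s) * (\<Prod>i<k. (A0 * real N ^ r) ^ m i)"
    using h0 by (intro mult_mono power_mono prod_mono conjI prod_nonneg) auto
  also have "\<dots> = (A0 * real N ^ r) ^ e"
    using s by (simp add: power_sum[symmetric] s_def[symmetric] power_add[symmetric])
  also have "\<dots> \<le> (A0 * real N ^ r) ^ E" using H1 assms(4) by (intro power_increasing) auto
  also have "\<dots> = real A0 ^ E * real N ^ (D - 1)"
    by (simp add: power_mult_distrib D_def power_mult)
  finally show "\<bar>of_int (h0 x) ^ e * mon h0 h m x\<bar> \<le> real A0 ^ E * real N ^ (D - 1)" .
qed

text \<open>Bounds uniform in \<open>N\<close>, \<open>Z\<close> and \<open>e \<le> E\<close>: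
  \<open>Mx\<close> for the number of monomials, \<open>nx\<close> for the degrees in a frame,
  \<open>Wx\<close> for the zeros collected over all \<open>e\<close>.\<close>

definition Mx :: nat where "Mx = (E + 1) ^ k"
definition nx :: nat where "nx = Mx * (Mx * \<Delta>)"
definition Wx :: nat where "Wx = (E + 1) * (1 + Mx * \<Delta> + 2 ^ Mx * (Mx * ((1 + Mx) * nx)))"

lemma card_mons_Mx: "e \<le> E \<Longrightarrow> card (mons k e) \<le> Mx"
  unfolding Mx_def using card_mons_le[of k e] power_mono[of "e + 1" "E + 1" k] by simp

definition framed :: "((nat \<Rightarrow> nat) \<Rightarrow> nat \<Rightarrow> real) \<Rightarrow> nat set \<Rightarrow> (nat \<Rightarrow> (nat \<Rightarrow> nat) set) \<Rightarrow> complex set \<Rightarrow> nat \<Rightarrow> nat \<Rightarrow> bool" where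
  "framed U Z G W e x0 \<longleftrightarrow> (\<exists>\<Gamma> a b. \<Gamma> \<subseteq> mons k e \<and> card \<Gamma> = card (G e) \<and>
       (\<forall>m\<in>mons k e. a m \<noteq> 0 \<and> degree (a m) \<le> nx \<and> czeros (a m) \<subseteq> W \<and>
          (\<forall>\<gamma>\<in>\<Gamma>. degree (b m \<gamma>) \<le> nx \<and> (b m \<gamma> \<noteq> 0 \<longrightarrow> czeros (b m \<gamma>) \<subseteq> W) \<and>
             \<bar>poly (b m \<gamma>) (real x0)\<bar> \<le> fact Mx * \<bar>poly (a m) (real x0)\<bar>) \<and>
          (\<forall>x\<in>Z. of_nat x \<notin> W \<longrightarrow>
             poly (a m) (real x) * U m x = (\<Sum>\<gamma>\<in>\<Gamma>. poly (b m \<gamma>) (real x) * U \<gamma> x))))"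

lemma ex_frames_level:
  assumes ch: "chain_on U Z G" and e: "e \<le> E"
  shows "\<exists>W. finite W \<and> 0 \<in> W \<and> card W \<le> 1 + Mx * \<Delta> + 2 ^ Mx * (Mx * ((1 + Mx) * nx)) \<and>
    (\<forall>x0. of_nat x0 \<notin> W \<longrightarrow> framed U Z G W e x0)"
proof -
  let ?M = "mons k e"
  let ?c = "card ?M"
  have c: "?c \<le> Mx" by (rule card_mons_Mx[OF e])
  have "\<exists>q P. q \<noteq> 0 \<and> degree q \<le> ?c * \<Delta> \<and> (\<forall>m g. degree (P m g) \<le> ?c * \<Delta>) \<and>
    (\<forall>g\<in>G e. \<forall>g'\<in>G e. P g g' = (if g = g' then q else 0)) \<and>
    (\<forall>m\<in>?M. \<forall>x\<in>Z. poly q (real x) * U m x = (\<Sum>g\<in>G e. poly (P m g) (real x) * U g x))"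
    by (rule maximal_relations[OF finite_mons]) (use ch in \<open>auto simp: chain_on_def\<close>)
  then obtain q P where qP: "q \<noteq> 0" "degree q \<le> ?c * \<Delta>" "\<forall>m g. degree (P m g) \<le> ?c * \<Delta>"
    "\<forall>g\<in>G e. \<forall>g'\<in>G e. P g g' = (if g = g' then q else 0)"
    "\<forall>m\<in>?M. \<forall>x\<in>Z. poly q (real x) * U m x = (\<Sum>g\<in>G e. poly (P m g) (real x) * U g x)"
    by (elim exE conjE)
  have Ge: "G e \<subseteq> ?M" using ch by (simp add: chain_on_def)
  have "\<exists>W. finite W \<and> (0::complex) \<in> W \<and>
    card W \<le> 1 + ?c * \<Delta> + 2 ^ ?c * (?c * ((1 + ?c) * (?c * (?c * \<Delta>)))) \<and>
    (\<forall>x0. of_nat x0 \<notin> W \<longrightarrow> (\<exists>\<Gamma> a b. \<Gamma> \<subseteq> ?M \<and> card \<Gamma> = card (G e) \<and>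
       (\<forall>m\<in>?M. a m \<noteq> 0 \<and> degree (a m) \<le> ?c * (?c * \<Delta>) \<and> czeros (a m) \<subseteq> W \<and>
          (\<forall>\<gamma>\<in>\<Gamma>. degree (b m \<gamma>) \<le> ?c * (?c * \<Delta>) \<and> (b m \<gamma> \<noteq> 0 \<longrightarrow> czeros (b m \<gamma>) \<subseteq> W) \<and>
             \<bar>poly (b m \<gamma>) (real x0)\<bar> \<le> fact ?c * \<bar>poly (a m) (real x0)\<bar>) \<and>
          (\<forall>x\<in>Z. of_nat x \<notin> W \<longrightarrow>
             poly (a m) (real x) * U m x = (\<Sum>\<gamma>\<in>\<Gamma>. poly (b m \<gamma>) (real x) * U \<gamma> x)))))"
    by (rule conditioned_frames[OF finite_mons Ge qP(1,2)]) (use qP(3,4,5) in blast)+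
  then obtain W where W: "finite W" "0 \<in> W"
    "card W \<le> 1 + ?c * \<Delta> + 2 ^ ?c * (?c * ((1 + ?c) * (?c * (?c * \<Delta>))))"
    "\<forall>x0. of_nat x0 \<notin> W \<longrightarrow> (\<exists>\<Gamma> a b. \<Gamma> \<subseteq> ?M \<and> card \<Gamma> = card (G e) \<and>
       (\<forall>m\<in>?M. a m \<noteq> 0 \<and> degree (a m) \<le> ?c * (?c * \<Delta>) \<and> czeros (a m) \<subseteq> W \<and>
          (\<forall>\<gamma>\<in>\<Gamma>. degree (b m \<gamma>) \<le> ?c * (?c * \<Delta>) \<and> (b m \<gamma> \<noteq> 0 \<longrightarrow> czeros (b m \<gamma>) \<subseteq> W) \<and>
             \<bar>poly (b m \<gamma>) (real x0)\<bar> \<le> fact ?c * \<bar>poly (a m) (real x0)\<bar>) \<and>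
          (\<forall>x\<in>Z. of_nat x \<notin> W \<longrightarrow>
             poly (a m) (real x) * U m x = (\<Sum>\<gamma>\<in>\<Gamma>. poly (b m \<gamma>) (real x) * U \<gamma> x))))"
    by (elim exE conjE)
  have cn: "?c * (?c * \<Delta>) \<le> nx" unfolding nx_def using c by (intro mult_le_mono) auto
  have "1 + ?c * \<Delta> + 2 ^ ?c * (?c * ((1 + ?c) * (?c * (?c * \<Delta>)))) \<le>
     1 + Mx * \<Delta> + 2 ^ Mx * (Mx * ((1 + Mx) * nx))"
    using c cn by (intro add_mono mult_le_mono power_increasing) auto
  with W(3) have cW: "card W \<le> 1 + Mx * \<Delta> + 2 ^ Mx * (Mx * ((1 + Mx) * nx))" by linarith
  have fc: "(fact ?c :: real) \<le> fact Mx" using c by (rule fact_mono)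
  have "framed U Z G W e x0" if x0: "of_nat x0 \<notin> W" for x0
  proof -
    from W(4) x0 obtain \<Gamma> a b where G: "\<Gamma> \<subseteq> ?M" "card \<Gamma> = card (G e)" and
       ab: "\<forall>m\<in>?M. a m \<noteq> 0 \<and> degree (a m) \<le> ?c * (?c * \<Delta>) \<and> czeros (a m) \<subseteq> W \<and>
          (\<forall>\<gamma>\<in>\<Gamma>. degree (b m \<gamma>) \<le> ?c * (?c * \<Delta>) \<and> (b m \<gamma> \<noteq> 0 \<longrightarrow> czeros (b m \<gamma>) \<subseteq> W) \<and>
             \<bar>poly (b m \<gamma>) (real x0)\<bar> \<le> fact ?c * \<bar>poly (a m) (real x0)\<bar>) \<and>
          (\<forall>x\<in>Z. of_nat x \<notin> W \<longrightarrow>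
             poly (a m) (real x) * U m x = (\<Sum>\<gamma>\<in>\<Gamma>. poly (b m \<gamma>) (real x) * U \<gamma> x))"
      by (elim allE impE exE conjE)
    show ?thesis
      unfolding framed_def
    proof (intro exI[of _ \<Gamma>] exI[of _ a] exI[of _ b] conjI ballI impI)
      fix m assume m: "m \<in> ?M"
      note abm = ab[rule_format, OF m]
      show "a m \<noteq> 0" "czeros (a m) \<subseteq> W" using abm by blast+
      show "degree (a m) \<le> nx" using abm cn by linarith
      show "poly (a m) (real x) * U m x = (\<Sum>\<gamma>\<in>\<Gamma>. poly (b m \<gamma>) (real x) * U \<gamma> x)"
        if "x \<in> Z" "of_nat x \<notin> W" for x using abm that by blast
      fix \<gamma> assume g: "\<gamma> \<in> \<Gamma>"
      have abg: "degree (b m \<gamma>) \<le> ?c * (?c * \<Delta>) \<and> (b m \<gamma> \<noteq> 0 \<longrightarrow> czeros (b m \<gamma>) \<subseteq> W) \<and>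
             \<bar>poly (b m \<gamma>) (real x0)\<bar> \<le> fact ?c * \<bar>poly (a m) (real x0)\<bar>" using abm g by blast
      show "degree (b m \<gamma>) \<le> nx" using abg cn by linarith
      show "czeros (b m \<gamma>) \<subseteq> W" if "b m \<gamma> \<noteq> 0" using abg that by blast
      show "\<bar>poly (b m \<gamma>) (real x0)\<bar> \<le> fact Mx * \<bar>poly (a m) (real x0)\<bar>"
        using abg mult_right_mono[OF fc, of "\<bar>poly (a m) (real x0)\<bar>"] by linarith
    qed (use G in auto)
  qed
  then show ?thesis using W(1,2) cW by blast
qed

text \<open>The sets for the different \<open>e\<close> are united, so that one exceptional set, and
  hence one Whitney cell, serves all degrees; the growth argument compares the ranks for all
  \<open>e\<close> on the same subset.\<close>

lemma ex_frames:
  assumes ch: "chain_on U Z G"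
  shows "\<exists>W. finite W \<and> 0 \<in> W \<and> card W \<le> Wx \<and>
    (\<forall>x0. of_nat x0 \<notin> W \<longrightarrow> (\<forall>e\<le>E. framed U Z G W e x0))"
proof -
  have "\<forall>e\<in>{..E}. \<exists>W. finite W \<and> 0 \<in> W \<and> card W \<le> 1 + Mx * \<Delta> + 2 ^ Mx * (Mx * ((1 + Mx) * nx)) \<and>
    (\<forall>x0. of_nat x0 \<notin> W \<longrightarrow> framed U Z G W e x0)"
    using ex_frames_level[OF ch] by blast
  from bchoice[OF this] obtain W where
    W: "\<forall>e\<in>{..E}. finite (W e) \<and> 0 \<in> W e \<and> card (W e) \<le> 1 + Mx * \<Delta> + 2 ^ Mx * (Mx * ((1 + Mx) * nx)) \<and>
    (\<forall>x0. of_nat x0 \<notin> W e \<longrightarrow> framed U Z G (W e) e x0)" by (elim exE)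
  define W' where "W' = (\<Union>e\<le>E. W e)"
  have "card W' \<le> (\<Sum>e\<le>E. card (W e))" unfolding W'_def by (rule card_UN_le) simp
  also have "\<dots> \<le> (\<Sum>e\<le>E. 1 + Mx * \<Delta> + 2 ^ Mx * (Mx * ((1 + Mx) * nx)))"
    using W by (intro sum_mono) auto
  also have "\<dots> = Wx" by (simp add: Wx_def)
  finally have "card W' \<le> Wx" .
  moreover have "framed U Z G W' e x0" if x0: "of_nat x0 \<notin> W'" and e: "e \<le> E" for x0 e
  proof -
    have sub: "W e \<subseteq> W'" using e by (auto simp: W'_def)
    have "of_nat x0 \<notin> W e" using x0 sub by auto
    then have fr: "framed U Z G (W e) e x0" using W e by blast
    show ?thesis
      using fr unfolding framed_def
    proof (elim exE conjE, goal_cases)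
      case (1 \<Gamma> a b)
      show ?case
      proof (intro exI[of _ \<Gamma>] exI[of _ a] exI[of _ b] conjI ballI impI)
        fix m assume m: "m \<in> mons k e"
        note abm = 1(3)[rule_format, OF m]
        show "a m \<noteq> 0" "degree (a m) \<le> nx" using abm by blast+
        show "czeros (a m) \<subseteq> W'" using abm sub by blast
        show "poly (a m) (real x) * U m x = (\<Sum>\<gamma>\<in>\<Gamma>. poly (b m \<gamma>) (real x) * U \<gamma> x)"
          if "x \<in> Z" "of_nat x \<notin> W'" for x using abm that sub by blast
        fix \<gamma> assume g: "\<gamma> \<in> \<Gamma>"
        show "degree (b m \<gamma>) \<le> nx" "\<bar>poly (b m \<gamma>) (real x0)\<bar> \<le> fact Mx * \<bar>poly (a m) (real x0)\<bar>"
          using abm g by blast+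
        show "czeros (b m \<gamma>) \<subseteq> W'" if "b m \<gamma> \<noteq> 0" using abm g that sub by blast
      qed (use 1 in auto)
    qed
  qed
  moreover have "finite W'" "0 \<in> W'" using W by (auto simp: W'_def)
  ultimately show ?thesis by blast
qed

text \<open>Taylor length: the relative radius will be at most half of
  \<open>N powr (- 1 / \<nu>)\<close>, so its power with exponent \<open>Tx\<close> is at most
  \<open>N powr (- (4 * D + 1))\<close>, the accuracy demanded by
  \<open>entropy_numeric\<close>.\<close>

definition Tx :: nat where "Tx = \<nu> * (4 * D + 1)"

text \<open>The hypothesis \<open>N0\<close> is the numerical input of \<open>piece_entropy\<close>; it holds for all large \<open>N\<close>.\<close>

lemma piece_dimension:
  assumes N0: "\<forall>K g. \<forall>\<epsilon>::real. K \<le> Mx * (D + 1) \<longrightarrow> g \<le> Mx \<longrightarrow> 0 \<le> \<epsilon> \<longrightarrow> \<epsilon> * real N ^ (4 * D + 1) \<le> 1 \<longrightarrow>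
      real K * real (N ^ (2 * D)) * (real g * (2 * (4 ^ nx * fact Mx * (2 * real N) ^ D) * \<epsilon> * (real A0 ^ E * real N ^ (D - 1)))) \<le> 1 / 2 \<and>
      4 * real K * real (N ^ (2 * D)) * (4 ^ nx * fact Mx * (2 * real N) ^ D) * (real g * Tx + 1) * (real A0 ^ E * real N ^ (D - 1)) + 5
        \<le> real N ^ (4 * D)"
    and N: "N \<ge> 2"
    and rel: "related N c h0 h Z" and ch: "chain_on (mon h0 h) Z G"
    and fr: "framed (mon h0 h) Z G W e x0" and e: "e \<le> E"
    and Z': "Z' \<subseteq> Z" "\<And>x. x \<in> Z' \<Longrightarrow> of_nat x \<notin> W" and ch': "chain_on (mon h0 h) Z' G'"
    and x0: "x0 \<in> Z" "0 < \<rho>" "\<rho> \<le> real N" "\<And>\<zeta>. \<zeta> \<in> W \<Longrightarrow> \<rho> \<le> norm (of_nat x0 - \<zeta>)"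
    and near: "\<And>x. x \<in> Z' \<Longrightarrow> \<bar>real x - real x0\<bar> \<le> \<rho> / \<mu>" and \<mu>: "real \<mu> \<ge> 8 * real N powr (1 / \<nu>)"
  shows "(\<Sum>i\<le>e. card (G' i)) \<le> 8 * \<nu> * card (G e)"
proof -
  let ?M = "mons k e" and ?U = "mon h0 h"
  from fr obtain \<Gamma> a b where G: "\<Gamma> \<subseteq> ?M" "card \<Gamma> = card (G e)" and
    ab: "\<forall>m\<in>?M. a m \<noteq> 0 \<and> degree (a m) \<le> nx \<and> czeros (a m) \<subseteq> W \<and>
          (\<forall>\<gamma>\<in>\<Gamma>. degree (b m \<gamma>) \<le> nx \<and> (b m \<gamma> \<noteq> 0 \<longrightarrow> czeros (b m \<gamma>) \<subseteq> W) \<and>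
             \<bar>poly (b m \<gamma>) (real x0)\<bar> \<le> fact Mx * \<bar>poly (a m) (real x0)\<bar>) \<and>
          (\<forall>x\<in>Z. of_nat x \<notin> W \<longrightarrow>
             poly (a m) (real x) * ?U m x = (\<Sum>\<gamma>\<in>\<Gamma>. poly (b m \<gamma>) (real x) * ?U \<gamma> x))"
    unfolding framed_def by (elim exE conjE)
  define A where "A = real A0 ^ E * real N ^ (D - 1)"
  define B where "B = 4 ^ nx * fact Mx * (2 * real N) ^ D"
  \<comment> \<open>Points of the cell are within \<rho> / \<mu> of \<open>x0\<close>, while the
    Taylor expansion is normalised by the radius \<rho> / 4.\<close>
  define \<eta> where "\<eta> = 4 / real \<mu>"
  have Np: "real N powr (1 / \<nu>) \<ge> 1" using N by (intro ge_one_powr_ge_zero) auto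
  have mu8: "real \<mu> \<ge> 8" using \<mu> Np by linarith
  have \<eta>: "0 \<le> \<eta>" "\<eta> \<le> 1 / 2" using mu8 by (auto simp: \<eta>_def field_simps)
  have \<eta>T: "\<eta> ^ Tx * real N ^ (4 * D + 1) \<le> 1"
  proof -
    have "\<eta> * real N powr (1 / \<nu>) \<le> 1"
      unfolding \<eta>_def using \<mu> mu8 Np by (simp add: field_simps)
    then have "(\<eta> * real N powr (1 / \<nu>)) ^ Tx \<le> 1" using \<eta> by (intro power_le_one) auto
    moreover have "(real N powr (1 / \<nu>)) ^ Tx = real N ^ (4 * D + 1)"
    proof -
      have "(real N powr (1 / \<nu>)) ^ \<nu> = real N"
        using N \<nu> by (simp add: powr_powr powr_realpow[symmetric] del: powr_realpow)
      then show ?thesis unfolding Tx_def power_mult by simp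
    qed
    ultimately show ?thesis by (simp add: power_mult_distrib)
  qed
  have relZ': "related N c h0 h Z'" using rel Z'(1) unfolding related_def by blast
  have "\<exists>F\<subseteq>?M \<times> {..D}.
    row_indep (\<lambda>p x. real_of_int (h0 x) ^ e * (real x ^ snd p * mon_val k (\<lambda>i x. of_int (h i x) / of_int (h0 x)) (fst p) x)) Z' F \<and>
    (D + 1) * (\<Sum>i\<le>e. card (G' i)) \<le> card F"
  proof (rule many_independent[where c = c and \<Delta> = \<Delta>])
    show "real x ^ d = (\<Sum>i<k. c i * (of_int (h i x) / of_int (h0 x)))" if "x \<in> Z'" for x
      by (rule related_power[OF relZ' that])
    show "D < d" by (rule Dd)
    show "d * e + D \<le> \<Delta>" using e by (simp add: Delta_def)
    show "real_of_int (h0 x) ^ e \<noteq> 0" if "x \<in> Z'" for x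
      using relZ' that by (auto simp: related_def)
  qed (use ch' in \<open>auto simp: chain_on_def mon_def\<close>)
  then obtain F where F: "F \<subseteq> ?M \<times> {..D}"
    "row_indep (\<lambda>p x. real_of_int (h0 x) ^ e * (real x ^ snd p * ?U (fst p) x)) Z' F"
    "(D + 1) * (\<Sum>i\<le>e. card (G' i)) \<le> card F" unfolding mon_def by (elim exE conjE bexE) auto
  have cM: "card ?M \<le> Mx" by (rule card_mons_Mx[OF e])
  have cF: "card F \<le> Mx * (D + 1)"
  proof -
    have "card F \<le> card (?M \<times> {..D})" using F(1) finite_mons by (intro card_mono) auto
    also have "\<dots> = card ?M * (D + 1)" by (simp add: card_cartesian_product)
    also have "\<dots> \<le> Mx * (D + 1)" using cM by (intro mult_le_mono1)
    finally show ?thesis .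
  qed
  have cG: "card \<Gamma> \<le> Mx" using G(1) finite_mons[of k e] cM card_mono[of ?M \<Gamma>] by linarith
  have "0 \<le> \<eta> ^ Tx" using \<eta> by simp
  note num = N0[rule_format, OF cF cG this \<eta>T, folded A_def B_def]
  have N1: "real N \<ge> 1" using N by simp
  have A1: "A \<ge> 1"
    unfolding A_def using A0 N1 by (intro mult_ge1_I one_le_power) auto
  have x0N: "real x0 \<le> real N" using rel x0(1) by (auto simp: related_def)
  have cz: "4 * (\<rho> / 4) \<le> norm (of_real (real x0) - z)" if "z \<in> W" for z using x0(4)[OF that] by simp
  have "(real (N ^ (2 * D)) + 1) ^ card F \<le>
     (4 * card F * real (N ^ (2 * D)) * B * (card \<Gamma> * Tx + 1) * A + 5) ^ (card \<Gamma> * Tx)"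
  proof (rule piece_entropy[OF finite_mons G(1) F(1,2), where a = a and b = b and n = nx and R = "\<rho> / 4"
        and ?x0.0 = "real x0" and Cf = "fact Mx" and \<eta> = \<eta> and N = "real N"])
    show "of_int (h0 x) ^ e * ?U m x \<in> \<int>" "\<bar>of_int (h0 x) ^ e * ?U m x\<bar> \<le> A" if "m \<in> ?M" "x \<in> Z'" for m x
      using mon_integral_bounded[OF relZ' that(2,1) e] by (simp_all add: A_def)
    show "a m \<noteq> 0 \<and> degree (a m) \<le> nx \<and> (\<forall>z\<in>czeros (a m). 4 * (\<rho> / 4) \<le> norm (of_real (real x0) - z))" if "m \<in> ?M" for m
      using ab[rule_format, OF that] cz by blast
    show "degree (b m \<gamma>) \<le> nx \<and> (b m \<gamma> \<noteq> 0 \<longrightarrow> (\<forall>z\<in>czeros (b m \<gamma>). 4 * (\<rho> / 4) \<le> norm (of_real (real x0) - z))) \<and>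
       \<bar>poly (b m \<gamma>) (real x0)\<bar> \<le> fact Mx * \<bar>poly (a m) (real x0)\<bar>" if "m \<in> ?M" "\<gamma> \<in> \<Gamma>" for m \<gamma>
      using ab[rule_format, OF that(1)] that(2) cz by blast
    show "poly (a m) (real x) \<noteq> 0 \<and> poly (a m) (real x) * ?U m x = (\<Sum>\<gamma>\<in>\<Gamma>. poly (b m \<gamma>) (real x) * ?U \<gamma> x)"
      if m: "m \<in> ?M" and x: "x \<in> Z'" for m x
    proof
      have "of_nat x \<notin> czeros (a m)" using ab[rule_format, OF m] Z'(2)[OF x] by blast
      then show "poly (a m) (real x) \<noteq> 0"
        using poly_map_of_real[of "a m" "real x", where 'a = complex] by (auto simp: czeros_def)
      show "poly (a m) (real x) * ?U m x = (\<Sum>\<gamma>\<in>\<Gamma>. poly (b m \<gamma>) (real x) * ?U \<gamma> x)"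
        using ab[rule_format, OF m] Z'(2)[OF x] Z'(1) x by blast
    qed
    show "\<bar>real x - real x0\<bar> \<le> \<eta> * (\<rho> / 4)" if "x \<in> Z'" for x
      using near[OF that] by (simp add: \<eta>_def)
    show "real (card F) * real (N ^ (2 * D)) * (card \<Gamma> * (2 * B * \<eta> ^ Tx * A)) \<le> 1 / 2"
      using num by (simp add: mult_ac)
  qed (use A1 x0 x0N N1 \<eta> B_def in auto)
  also have "\<dots> \<le> (real N ^ (4 * D)) ^ (card \<Gamma> * Tx)"
  proof (rule power_mono)
    show "4 * card F * real (N ^ (2 * D)) * B * (card \<Gamma> * Tx + 1) * A + 5 \<le> real N ^ (4 * D)"
      using num[THEN conjunct2] by (simp add: add.commute[of 1])
    show "0 \<le> 4 * card F * real (N ^ (2 * D)) * B * (card \<Gamma> * Tx + 1) * A + 5"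
      using A1 by (simp add: B_def)
  qed
  finally have "(real (N ^ (2 * D)) + 1) ^ card F \<le> (real N ^ (4 * D)) ^ (card \<Gamma> * Tx)" .
  moreover have "(real (N ^ (2 * D))) ^ card F \<le> (real (N ^ (2 * D)) + 1) ^ card F"
    by (intro power_mono) auto
  ultimately have "real N ^ (2 * D * card F) \<le> real N ^ (4 * D * (card \<Gamma> * Tx))"
    by (simp add: power_mult)
  then have "2 * D * card F \<le> 4 * D * (card \<Gamma> * Tx)"
    using N by (simp add: power_increasing_iff)
  then have "2 * D * card F \<le> 2 * D * (2 * (card \<Gamma> * Tx))" by simp
  moreover have "2 * D > 0" by (simp add: D_def)
  ultimately have "card F \<le> 2 * (card \<Gamma> * Tx)" by (simp only: nat_mult_le_cancel1)
  \<comment> \<open>\<open>Tx\<close> is proportional to \<open>4 * D + 1\<close>, so the factor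
    \<open>D + 1\<close> in the number of functions cancels. The resulting constant
    \<open>8 * \<nu>\<close> is free of \<open>D\<close>, which allows \<open>E\<close>, and with it
    \<open>D\<close>, to be chosen large.\<close>
  also have "\<dots> = 2 * \<nu> * card \<Gamma> * (4 * D + 1)" by (simp add: Tx_def algebra_simps)
  also have "\<dots> \<le> 2 * \<nu> * card \<Gamma> * (4 * (D + 1))" by (intro mult_left_mono) auto
  finally have "(D + 1) * (\<Sum>i\<le>e. card (G' i)) \<le> (D + 1) * (8 * \<nu> * card (G e))"
    using F(3) unfolding G(2) by (simp add: algebra_simps)
  then show ?thesis by (simp only: mult_le_cancel1)
qed

text \<open>The cost is \<open>N powr (1 / \<nu>)\<close> twice: for the number of dyadic scales and
  for the cells per scale. The \<open>+ 1\<close> covers the case that all points lie near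
  \<open>W\<close>, where the empty set is taken; on it nothing is independent and all ranks
  vanish.\<close>

lemma refinement_step:
  "\<exists>C\<ge>1. \<exists>N0\<ge>2. \<forall>N\<ge>N0. \<forall>c h0 h Z G. related N c h0 h Z \<longrightarrow> chain_on (mon h0 h) Z G \<longrightarrow>
    (\<exists>Z'\<subseteq>Z. real (card Z) \<le> C * real N powr (2 / \<nu>) * (real (card Z') + 1) \<and>
      (\<forall>G'. chain_on (mon h0 h) Z' G' \<longrightarrow> (\<forall>e\<le>E. (\<Sum>i\<le>e. card (G' i)) \<le> 8 * \<nu> * card (G e))))"
proof -
  have "D \<ge> 1" by (simp add: D_def)
  from entropy_numeric[OF this, of "real A0 ^ E" "fact Mx" Mx nx Tx] obtain N0 where N0: "N0 \<ge> 2"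
    "\<forall>N\<ge>N0. \<forall>K g. \<forall>\<epsilon>::real. K \<le> Mx * (D + 1) \<longrightarrow> g \<le> Mx \<longrightarrow> 0 \<le> \<epsilon> \<longrightarrow> \<epsilon> * real N ^ (4 * D + 1) \<le> 1 \<longrightarrow>
      real K * real (N ^ (2 * D)) * (real g * (2 * (4 ^ nx * fact Mx * (2 * real N) ^ D) * \<epsilon> * (real A0 ^ E * real N ^ (D - 1)))) \<le> 1 / 2 \<and>
      4 * real K * real (N ^ (2 * D)) * (4 ^ nx * fact Mx * (2 * real N) ^ D) * (real g * Tx + 1) * (real A0 ^ E * real N ^ (D - 1)) + 5
        \<le> real N ^ (4 * D)" by (elim meta_impE exE conjE) simp_all
  define C where "C = real Wx * (90 * real \<nu> + 3) + 1"
  have "\<exists>Z'\<subseteq>Z. real (card Z) \<le> C * real N powr (2 / \<nu>) * (real (card Z') + 1) \<and>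
      (\<forall>G'. chain_on (mon h0 h) Z' G' \<longrightarrow> (\<forall>e\<le>E. (\<Sum>i\<le>e. card (G' i)) \<le> 8 * \<nu> * card (G e)))"
    if N: "N \<ge> N0" and rel: "related N c h0 h Z" and ch: "chain_on (mon h0 h) Z G" for N c h0 h Z G
  proof -
    have N2: "N \<ge> 2" using N N0 by simp
    have ZN: "Z \<subseteq> {1..N}" using rel by (simp add: related_def)
    have fZ: "finite Z" using ZN finite_subset by blast
    from ex_frames[OF ch] obtain W where W: "finite W" "0 \<in> W" "card W \<le> Wx"
      "\<forall>x0. of_nat x0 \<notin> W \<longrightarrow> (\<forall>e\<le>E. framed (mon h0 h) Z G W e x0)" by (elim exE conjE)
    define Z1 where "Z1 = {x\<in>Z. \<forall>\<zeta>\<in>W. 1 \<le> norm (of_nat x - \<zeta>)}"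
    have cZ: "card Z \<le> card Z1 + 3 * card W" unfolding Z1_def by (rule card_near_le[OF W(1) fZ])
    define P where "P = real N powr (1 / \<nu>)"
    have P1: "P \<ge> 1" unfolding P_def using N2 by (intro ge_one_powr_ge_zero) auto
    have PP: "real N powr (2 / \<nu>) = P * P" unfolding P_def by (simp add: powr_add[symmetric])
    have PP1: "P * P \<ge> 1" using mult_mono[of 1 P 1 P] P1 by simp
    show ?thesis
    proof (cases "Z1 = {}")
      case True
      have "real (card Z) \<le> 3 * real Wx" using cZ W(3) True by simp
      also have "\<dots> \<le> C" unfolding C_def by (simp add: algebra_simps)
      also have "\<dots> \<le> C * (P * P)" using PP1 mult_left_mono[of 1 "P * P" C] by (simp add: C_def)
      finally have "real (card Z) \<le> C * real N powr (2 / \<nu>) * (real (card ({}::nat set)) + 1)" by (simp add: PP)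
      moreover have "(\<Sum>i\<le>e. card (G' i)) \<le> 8 * \<nu> * card (G e)" if "chain_on (mon h0 h) {} G'" for G' e
      proof -
        have "G' i = {}" for i
        proof (rule ccontr)
          assume "G' i \<noteq> {}"
          then obtain g where g: "g \<in> G' i" by auto
          have "row_indep (\<lambda>p x. real x ^ snd p * mon h0 h (fst p) x) {} (G' i \<times> {..\<Delta>})"
            using that by (auto simp: chain_on_def poly_indep_def)
          from row_indepD[OF this, of "\<lambda>_. 1" "(g,0)"] show False using g by simp
        qed
        then show ?thesis by simp
      qed
      ultimately show ?thesis by blast
    next
      case False
      define \<mu> where "\<mu> = nat \<lceil>8 * P\<rceil>"
      have \<mu>: "real \<mu> \<ge> 8 * P" "real \<mu> \<le> 9 * P" using P1 unfolding \<mu>_def by linarith+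
      have mu1: "\<mu> \<ge> 1" using \<mu>(1) P1 by linarith
      obtain L where L: "N < 2 ^ Suc L" "real (Suc L) \<le> 2 * real \<nu> * P"
        using dyadic_level_bound[of N \<nu>] N2 \<nu> unfolding P_def by auto
      have Z1N: "Z1 \<subseteq> {1..N}" using ZN by (auto simp: Z1_def)
      have "\<exists>x0\<in>Z1. \<exists>\<rho>. 1 \<le> \<rho> \<and> \<rho> \<le> real N \<and> (\<forall>\<zeta>\<in>W. \<rho> \<le> norm (of_nat x0 - \<zeta>)) \<and>
        card Z1 \<le> card W * (Suc L * (5 * \<mu>)) * card {x\<in>Z1. \<bar>real x - real x0\<bar> \<le> \<rho> / real \<mu>}"
        by (rule whitney_piece[OF W(1,2) Z1N False _ L(1) mu1]) (auto simp: Z1_def)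
      then obtain x0 \<rho> where x0: "x0 \<in> Z1" "1 \<le> \<rho>" "\<rho> \<le> real N" "\<forall>\<zeta>\<in>W. \<rho> \<le> norm (of_nat x0 - \<zeta>)"
        and cZ1: "card Z1 \<le> card W * (Suc L * (5 * \<mu>)) * card {x\<in>Z1. \<bar>real x - real x0\<bar> \<le> \<rho> / real \<mu>}"
        by (elim bexE exE conjE)
      define Z' where "Z' = {x\<in>Z1. \<bar>real x - real x0\<bar> \<le> \<rho> / real \<mu>}"
      have notW: "of_nat x \<notin> W" if "x \<in> Z1" for x using that by (force simp: Z1_def)
      have "real (card Z) \<le> real (card Z1) + 3 * real (card W)" using cZ by linarith
      also have "real (card Z1) \<le> real (card W) * (real (Suc L) * (5 * real \<mu>)) * real (card Z')"
        using cZ1 unfolding Z'_def[symmetric] by (metis of_nat_le_iff of_nat_mult of_nat_numeral)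
      also have "\<dots> \<le> real Wx * ((2 * real \<nu> * P) * (5 * (9 * P))) * real (card Z')"
        using W(3) L(2) \<mu> P1 by (intro mult_right_mono mult_mono) auto
      also have "\<dots> = real Wx * (90 * real \<nu>) * (P * P) * real (card Z')" by simp
      also have "3 * real (card W) \<le> (real Wx * 3) * (P * P)"
        using W(3) PP1 mult_mono[of "3 * real (card W)" "real Wx * 3" 1 "P * P"] by simp
      finally have "real (card Z) \<le> real Wx * (90 * real \<nu>) * (P * P) * real (card Z') + real Wx * 3 * (P * P)" by simp
      also have "\<dots> \<le> C * (P * P) * (real (card Z') + 1)"
      proof -
        have "real Wx * (90 * real \<nu>) * (P * P) * real (card Z') \<le> C * (P * P) * real (card Z')"
          using PP1 by (intro mult_right_mono) (auto simp: C_def algebra_simps)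
        moreover have "real Wx * 3 * (P * P) \<le> C * (P * P)"
          using PP1 by (intro mult_right_mono) (auto simp: C_def algebra_simps)
        ultimately show ?thesis by (simp add: distrib_left)
      qed
      finally have "real (card Z) \<le> C * real N powr (2 / \<nu>) * (real (card Z') + 1)" by (simp add: PP)
      moreover have "(\<Sum>i\<le>e. card (G' i)) \<le> 8 * \<nu> * card (G e)"
        if "chain_on (mon h0 h) Z' G'" "e \<le> E" for G' e
      proof (rule piece_dimension[OF N0(2)[THEN spec, THEN mp, OF N] N2 rel ch _ that(2) _ _ that(1)])
        show "framed (mon h0 h) Z G W e x0" using W(4) notW[OF x0(1)] that(2) by blast
        show "Z' \<subseteq> Z" by (auto simp: Z'_def Z1_def)
        show "of_nat x \<notin> W" if "x \<in> Z'" for x using notW that by (auto simp: Z'_def)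
        show "x0 \<in> Z" using x0(1) by (simp add: Z1_def)
        show "real \<mu> \<ge> 8 * real N powr (1 / \<nu>)" using \<mu>(1) by (simp add: P_def)
        show "\<bar>real x - real x0\<bar> \<le> \<rho> / real \<mu>" if "x \<in> Z'" for x using that by (simp add: Z'_def)
      qed (use x0 in auto)
      moreover have "Z' \<subseteq> Z" by (auto simp: Z'_def Z1_def)
      ultimately show ?thesis by blast
    qed
  qed
  then show ?thesis using N0(1) by (intro exI[of _ C] conjI exI[of _ N0]) (auto simp: C_def)
qed

end

text \<open>Read backwards from index \<open>n\<close>: a sequence of values at least 1 is summed
  repeatedly. By the hockey-stick identity, \<open>i\<close> summations of the constant 1 give
  \<open>e + i choose i\<close>, at the price of one factor \<theta> each.\<close>

lemma iterated_sum_growth: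
  fixes a :: "nat \<Rightarrow> nat \<Rightarrow> nat"
  assumes base: "\<And>e. e \<le> E \<Longrightarrow> a n e \<ge> 1"
    and step: "\<And>i e. i < n \<Longrightarrow> e \<le> E \<Longrightarrow> (\<Sum>j\<le>e. a (Suc i) j) \<le> \<theta> * a i e"
    and "i \<le> n" "e \<le> E"
  shows "(e + i choose i) \<le> \<theta> ^ i * a (n - i) e"
  using assms(3,4)
proof (induction i arbitrary: e)
  case 0
  then show ?case using base[of e] by simp
next
  case (Suc i)
  have n: "Suc (n - Suc i) = n - i" using Suc.prems by simp
  have "(e + Suc i choose Suc i) = (\<Sum>j\<le>e. (i + j choose i))"
  proof -
    have "(\<Sum>j\<le>e. (i + j choose i)) = (\<Sum>j\<le>e. (i + j choose j))"
      by (intro sum.cong refl) (simp add: binomial_symmetric[of i])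
    also have "\<dots> = (Suc (i + e) choose e)" by (rule sum_choose_lower)
    also have "\<dots> = (Suc (i + e) choose Suc i)" by (subst binomial_symmetric) auto
    finally show ?thesis by (simp add: add.commute)
  qed
  also have "\<dots> \<le> (\<Sum>j\<le>e. \<theta> ^ i * a (n - i) j)"
    using Suc.IH Suc.prems by (intro sum_mono) (auto simp: add.commute)
  also have "\<dots> = \<theta> ^ i * (\<Sum>j\<le>e. a (Suc (n - Suc i)) j)" by (simp add: sum_distrib_left n)
  also have "\<dots> \<le> \<theta> ^ i * (\<theta> * a (n - Suc i) e)"
    using Suc.prems by (intro mult_left_mono step) auto
  finally show ?case by (simp only: power_Suc2 mult.assoc)
qed

context power_relations
begin

text \<open>A nonzero polynomial of degree at most \<Delta> has at most \<Delta> zeros, so on more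
  than \<Delta> points the constant monomial satisfies no relation; it lies in \<open>G 0\<close>
  and thus in every \<open>G e\<close>.\<close>

lemma chain_card_ge_1:
  assumes ch: "chain_on (mon h0 h) Z G" and Z: "finite Z" "card Z > \<Delta>"
  shows "card (G e) \<ge> 1"
proof -
  have "G 0 = {\<lambda>_. 0}"
  proof (rule ccontr)
    assume "G 0 \<noteq> {\<lambda>_. 0}"
    then have G0: "G 0 = {}" using ch by (force simp: chain_on_def mons_0)
    have "poly_indep (mon h0 h) \<Delta> Z {\<lambda>_. 0}"
      unfolding poly_indep_def row_indep_def
    proof (intro allI impI ballI)
      fix c :: "(nat \<Rightarrow> nat) \<times> nat \<Rightarrow> real" and p :: "(nat \<Rightarrow> nat) \<times> nat" assume c: "\<forall>x\<in>Z. (\<Sum>p\<in>{\<lambda>_. 0} \<times> {..\<Delta>}. c p * (real x ^ snd p * mon h0 h (fst p) x)) = 0"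
        and p: "p \<in> {\<lambda>_. 0} \<times> {..\<Delta>}"
      define y where "y = (\<Sum>t\<le>\<Delta>. monom (c (\<lambda>_. 0, t)) t)"
      have cy: "coeff y t = (if t \<le> \<Delta> then c (\<lambda>_. 0, t) else 0)" for t by (simp add: y_def coeff_sum)
      have "poly y (real x) = 0" if "x \<in> Z" for x
      proof -
        have "(\<Sum>p\<in>{\<lambda>_. 0} \<times> {..\<Delta>}. c p * (real x ^ snd p * mon h0 h (fst p) x))
          = (\<Sum>t\<le>\<Delta>. c (\<lambda>_. 0, t) * real x ^ t)"
          by (rule sum.reindex_bij_witness[of _ "\<lambda>t. (\<lambda>_. 0, t)" snd]) (auto simp: mon_def mon_val_def)
        then show ?thesis using c that by (simp add: y_def poly_sum poly_monom)
      qed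
      then have sub: "real ` Z \<subseteq> {x. poly y x = 0}" by auto
      have "y = 0"
      proof (rule ccontr)
        assume y: "y \<noteq> 0"
        have "card Z = card (real ` Z)" by (simp add: card_image)
        also have "\<dots> \<le> card {x. poly y x = 0}" by (intro card_mono poly_roots_finite y sub)
        also have "\<dots> \<le> degree y" by (rule card_poly_roots_bound[OF y])
        also have "\<dots> \<le> \<Delta>" by (rule degree_le) (simp add: cy)
        finally show False using Z by simp
      qed
      then show "c p = 0" using cy[of "snd p"] p by auto
    qed
    moreover have "\<forall>m\<in>mons k 0. m \<notin> G 0 \<longrightarrow> \<not> poly_indep (mon h0 h) \<Delta> Z (insert m (G 0))"
      using ch unfolding chain_on_def by blast
    ultimately show False using G0 by (simp add: mons_0)
  qed
  moreover have "G 0 \<subseteq> G e" using lift_Suc_mono_le[of G 0 e] ch by (auto simp: chain_on_def)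
  moreover have "finite (G e)" using ch finite_mons finite_subset unfolding chain_on_def by metis
  ultimately show ?thesis by (metis One_nat_def Suc_leI card_gt_0_iff empty_not_insert subset_empty)
qed

text \<open>Refine \<open>n\<close> times. If more than \<Delta> points survived, the final ranks
  would be at least 1, and the iterated sums would push the initial rank at \<open>E\<close> to
  \<open>(E / n) ^ n / (8 * \<nu>) ^ n\<close> or more, which by \<open>growth\<close> exceeds the
  number \<open>(E + 1) ^ k\<close> available for monomials. So at most \<Delta> points survive, and
  the accumulated loss bounds the initial set.\<close>

lemma related_card_bound:
  assumes growth: "E ^ n > (E + 1) ^ k * (8 * \<nu> * n) ^ n" and n: "n \<ge> 1"
  shows "\<exists>C. \<forall>N\<ge>1. \<forall>c h0 h Z. related N c h0 h Z \<longrightarrow> real (card Z) \<le> C * real N powr (2 * real n / real \<nu>)"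
proof -
  from refinement_step obtain C N0 where C: "C \<ge> 1" "N0 \<ge> 2" and
    step: "\<forall>N\<ge>N0. \<forall>c h0 h Z G. related N c h0 h Z \<longrightarrow> chain_on (mon h0 h) Z G \<longrightarrow>
    (\<exists>Z'\<subseteq>Z. real (card Z) \<le> C * real N powr (2 / \<nu>) * (real (card Z') + 1) \<and>
      (\<forall>G'. chain_on (mon h0 h) Z' G' \<longrightarrow> (\<forall>e\<le>E. (\<Sum>i\<le>e. card (G' i)) \<le> 8 * \<nu> * card (G e))))"
    by (elim exE conjE) blast
  \<comment> \<open>The summand \<open>N0\<close> takes care of \<open>N < N0\<close>, where
    \<open>card Z \<le> N\<close> is enough.\<close>
  define C' where "C' = (2 * C) ^ n * (real \<Delta> + 1) + real N0"
  have main: "real (card S) \<le> (2 * C) ^ n * (real \<Delta> + 1) * real N powr (2 * real n / real \<nu>)"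
    if N: "N \<ge> N0" and rel: "related N c h0 h S" for N c h0 h S
  proof -
    define P where "P = real N powr (2 / \<nu>)"
    have P1: "P \<ge> 1" unfolding P_def using N C by (intro ge_one_powr_ge_zero) auto
    define ch where "ch = (\<lambda>Z. SOME G. chain_on (mon h0 h) Z G)"
    have ch: "chain_on (mon h0 h) Z (ch Z)" for Z unfolding ch_def by (rule someI_ex[OF ex_chain_on])
    have "\<exists>Z. \<forall>i. related N c h0 h (Z i) \<and> (i = 0 \<longrightarrow> Z i = S) \<and>
      (Z (Suc i) \<subseteq> Z i \<and> real (card (Z i)) \<le> C * P * (real (card (Z (Suc i))) + 1) \<and>
       (\<forall>e\<le>E. (\<Sum>j\<le>e. card (ch (Z (Suc i)) j)) \<le> 8 * \<nu> * card (ch (Z i) e)))"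
    proof -
      have "\<exists>Z. \<forall>i. (related N c h0 h (Z i) \<and> (i = 0 \<longrightarrow> Z i = S)) \<and>
      (Z (Suc i) \<subseteq> Z i \<and> real (card (Z i)) \<le> C * P * (real (card (Z (Suc i))) + 1) \<and>
       (\<forall>e\<le>E. (\<Sum>j\<le>e. card (ch (Z (Suc i)) j)) \<le> 8 * \<nu> * card (ch (Z i) e)))"
      proof (rule dependent_nat_choice)
        show "\<exists>Z. related N c h0 h Z \<and> ((0::nat) = 0 \<longrightarrow> Z = S)" using rel by auto
      next
        fix Z and i :: nat assume Z: "related N c h0 h Z \<and> (i = 0 \<longrightarrow> Z = S)"
        have "\<exists>Z'\<subseteq>Z. real (card Z) \<le> C * real N powr (2 / \<nu>) * (real (card Z') + 1) \<and>
          (\<forall>G'. chain_on (mon h0 h) Z' G' \<longrightarrow> (\<forall>e\<le>E. (\<Sum>i\<le>e. card (G' i)) \<le> 8 * \<nu> * card (ch Z e)))"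
          using step N Z ch[of Z] by blast
        then obtain Z' where Z': "Z' \<subseteq> Z" "real (card Z) \<le> C * P * (real (card Z') + 1)"
          "\<forall>G'. chain_on (mon h0 h) Z' G' \<longrightarrow> (\<forall>e\<le>E. (\<Sum>i\<le>e. card (G' i)) \<le> 8 * \<nu> * card (ch Z e))"
          unfolding P_def by (elim exE conjE)
        have "related N c h0 h Z'" using Z Z'(1) unfolding related_def by blast
        moreover have "\<forall>e\<le>E. (\<Sum>j\<le>e. card (ch Z' j)) \<le> 8 * \<nu> * card (ch Z e)"
          using Z'(3) ch[of Z'] by blast
        ultimately show "\<exists>Z'. (related N c h0 h Z' \<and> (Suc i = 0 \<longrightarrow> Z' = S)) \<and>
          Z' \<subseteq> Z \<and> real (card Z) \<le> C * P * (real (card Z') + 1) \<and>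
          (\<forall>e\<le>E. (\<Sum>j\<le>e. card (ch Z' j)) \<le> 8 * \<nu> * card (ch Z e))"
          using Z'(1,2) by (intro exI[of _ Z'] conjI) auto
      qed
      then show ?thesis unfolding conj_assoc .
    qed
    then obtain Z where Z: "\<forall>i. related N c h0 h (Z i) \<and> (i = 0 \<longrightarrow> Z i = S) \<and>
      (Z (Suc i) \<subseteq> Z i \<and> real (card (Z i)) \<le> C * P * (real (card (Z (Suc i))) + 1) \<and>
       (\<forall>e\<le>E. (\<Sum>j\<le>e. card (ch (Z (Suc i)) j)) \<le> 8 * \<nu> * card (ch (Z i) e)))" by (elim exE)
    have Z0: "Z 0 = S" using Z by blast
    have Zc: "real (card (Z i)) \<le> C * P * (real (card (Z (Suc i))) + 1)" for i using Z by blast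
    have Ze: "(\<Sum>j\<le>e. card (ch (Z (Suc i)) j)) \<le> 8 * \<nu> * card (ch (Z i) e)" if "e \<le> E" for i e
      using Z that by blast
    have CP: "C * P \<ge> 1" using C P1 mult_mono[of 1 C 1 P] by simp
    have it: "real (card S) + 1 \<le> (2 * (C * P)) ^ i * (real (card (Z i)) + 1)" for i
    proof (induction i)
      case 0 then show ?case by (simp add: Z0)
    next
      case (Suc i)
      have "real (card (Z i)) + 1 \<le> 2 * (C * P) * (real (card (Z (Suc i))) + 1)"
        using Zc[of i] CP mult_mono[of 1 "C * P" 1 "real (card (Z (Suc i))) + 1"] by (simp add: mult.assoc)
      then have "(2 * (C * P)) ^ i * (real (card (Z i)) + 1) \<le> (2 * (C * P)) ^ i * (2 * (C * P) * (real (card (Z (Suc i))) + 1))"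
        using CP by (intro mult_left_mono) auto
      also have "\<dots> = (2 * (C * P)) ^ Suc i * (real (card (Z (Suc i))) + 1)"
        by (simp only: power_Suc2 mult.assoc)
      finally show ?case using Suc by linarith
    qed
    have "card (Z n) \<le> \<Delta>"
    proof (rule ccontr)
      assume "\<not> card (Z n) \<le> \<Delta>"
      then have cn: "card (Z n) > \<Delta>" by simp
      then have "finite (Z n)" by (metis card.infinite not_less_zero)
      have "(E + n choose n) \<le> (8 * \<nu>) ^ n * card (ch (Z (n - n)) E)"
        by (rule iterated_sum_growth[where a = "\<lambda>i e. card (ch (Z i) e)" and E = E])
           (use chain_card_ge_1[OF ch \<open>finite (Z n)\<close> cn] Ze in auto)
      also have "card (ch (Z (n - n)) E) \<le> (E + 1) ^ k"
        using card_mons_le[of k E] ch[of "Z (n - n)"] card_mono[OF finite_mons, of "ch (Z (n - n)) E" k E]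
        by (auto simp: chain_on_def)
      finally have b: "(E + n choose n) \<le> (8 * \<nu>) ^ n * (E + 1) ^ k" by simp
      have "(real E / real n) ^ n \<le> (real (E + n) / real n) ^ n"
        by (intro power_mono divide_right_mono) auto
      also have "\<dots> \<le> real (E + n choose n)"
        by (rule binomial_ge_n_over_k_pow_k) simp
      also have "\<dots> \<le> real ((8 * \<nu>) ^ n * (E + 1) ^ k)" using b by (simp only: of_nat_le_iff)
      finally have "real E ^ n \<le> real ((8 * \<nu>) ^ n * (E + 1) ^ k) * real n ^ n"
        using n by (simp add: power_divide pos_divide_le_eq)
      also have "\<dots> = real ((E + 1) ^ k * (8 * \<nu> * n) ^ n)" by (simp add: power_mult_distrib mult_ac)
      finally have "real (E ^ n) \<le> real ((E + 1) ^ k * (8 * \<nu> * n) ^ n)" by simp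
      then show False using growth by (simp only: of_nat_le_iff)
    qed
    then have "real (card S) + 1 \<le> (2 * (C * P)) ^ n * (real \<Delta> + 1)"
    proof -
      have "(2 * (C * P)) ^ n * (real (card (Z n)) + 1) \<le> (2 * (C * P)) ^ n * (real \<Delta> + 1)"
        using CP \<open>card (Z n) \<le> \<Delta>\<close> by (intro mult_left_mono) auto
      then show ?thesis using it[of n] by linarith
    qed
    also have "(2 * (C * P)) ^ n = (2 * C) ^ n * P ^ n" by (simp add: power_mult_distrib mult.assoc)
    also have "P ^ n = real N powr (2 * real n / real \<nu>)"
      unfolding P_def using N C by (simp add: powr_realpow[symmetric] powr_powr)
    finally show ?thesis by (simp add: mult_ac)
  qed
  have "real (card Z) \<le> C' * real N powr (2 * real n / real \<nu>)" if N: "N \<ge> 1" and rel: "related N c h0 h Z" for N c h0 h Z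
  proof -
    have p1: "real N powr (2 * real n / real \<nu>) \<ge> 1" using N by (intro ge_one_powr_ge_zero) auto
    have c0: "0 \<le> (2 * C) ^ n * (real \<Delta> + 1)" using C by simp
    show ?thesis
    proof (cases "N \<ge> N0")
      case True
      have "(2 * C) ^ n * (real \<Delta> + 1) * real N powr (2 * real n / real \<nu>) \<le> C' * real N powr (2 * real n / real \<nu>)"
        by (intro mult_right_mono) (auto simp: C'_def)
      then show ?thesis using main[OF True rel] by linarith
    next
      case False
      have "Z \<subseteq> {1..N}" using rel by (simp add: related_def)
      then have "card Z \<le> N" using card_mono[of "{1..N}" Z] by simp
      then have "real (card Z) \<le> C'" using False c0 by (simp add: C'_def)
      also have "\<dots> \<le> C' * real N powr (2 * real n / real \<nu>)"
        using mult_left_mono[OF p1, of C'] c0 by (simp add: C'_def)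
      finally show ?thesis .
    qed
  qed
  then show ?thesis by blast
qed

end

text \<open>Uniformity in the real coefficients \<open>c\<close> is essential: they will be the
  \<open>d\<close>-th powers of the other entries of a tuple.\<close>

lemma sparse_power_span:
  fixes k r d E \<nu> A0 n :: nat
  assumes "\<nu> \<ge> 1" "A0 \<ge> 1" "n \<ge> 1" "r * E + 1 < d" and growth: "E ^ n > (E + 1) ^ k * (8 * \<nu> * n) ^ n"
  shows "\<exists>C. \<forall>N\<ge>1. \<forall>(I::'i set) (c::'i \<Rightarrow> real) S. finite I \<longrightarrow> card I = k \<longrightarrow> S \<subseteq> {1..N} \<longrightarrow>
    (\<forall>x\<in>S. \<exists>(h0::int) h. h0 \<noteq> 0 \<and> \<bar>real_of_int h0\<bar> \<le> A0 * real N ^ r \<and>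
       (\<forall>i\<in>I. \<bar>real_of_int (h i)\<bar> \<le> A0 * real N ^ r) \<and>
       of_int h0 * real x ^ d = (\<Sum>i\<in>I. c i * of_int (h i))) \<longrightarrow>
    real (card S) \<le> C * real N powr (2 * real n / real \<nu>)"
proof -
  interpret power_relations k r d E \<nu> A0 "r * E + 1" "d * E + (r * E + 1)"
    using assms by unfold_locales auto
  obtain C where C: "\<And>N c h0 h Z. N \<ge> 1 \<Longrightarrow> related N c h0 h Z \<Longrightarrow> real (card Z) \<le> C * real N powr (2 * real n / real \<nu>)"
    using related_card_bound[OF growth assms(3)] by blast
  have "real (card S) \<le> C * real N powr (2 * real n / real \<nu>)"
    if N: "N \<ge> 1" and I: "finite I" "card I = k" and S: "S \<subseteq> {1..N}" and
      ex: "\<forall>x\<in>S. \<exists>(h0::int) h. h0 \<noteq> 0 \<and> \<bar>real_of_int h0\<bar> \<le> A0 * real N ^ r \<and>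
       (\<forall>i\<in>I. \<bar>real_of_int (h i)\<bar> \<le> A0 * real N ^ r) \<and>
       of_int h0 * real x ^ d = (\<Sum>i\<in>I. c i * of_int (h i))" for N and I :: "'i set" and c S
  proof -
    obtain f where f: "bij_betw f {..<k} I" using ex_bij_betw_nat_finite[OF I(1)] I(2) by (auto simp: atLeast0LessThan)
    from bchoice[OF ex] obtain h0 where "\<forall>x\<in>S. \<exists>h. h0 x \<noteq> 0 \<and> \<bar>real_of_int (h0 x)\<bar> \<le> A0 * real N ^ r \<and>
       (\<forall>i\<in>I. \<bar>real_of_int (h i)\<bar> \<le> A0 * real N ^ r) \<and>
       of_int (h0 x) * real x ^ d = (\<Sum>i\<in>I. c i * of_int (h i))" by (elim exE)
    from bchoice[OF this] obtain h where h: "\<forall>x\<in>S. h0 x \<noteq> 0 \<and> \<bar>real_of_int (h0 x)\<bar> \<le> A0 * real N ^ r \<and>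
       (\<forall>i\<in>I. \<bar>real_of_int (h x i)\<bar> \<le> A0 * real N ^ r) \<and>
       of_int (h0 x) * real x ^ d = (\<Sum>i\<in>I. c i * of_int (h x i))" by (elim exE)
    have "related N (\<lambda>j. c (f j)) h0 (\<lambda>j x. h x (f j)) S"
      unfolding related_def
    proof (intro conjI ballI allI impI S)
      fix x assume x: "x \<in> S"
      note hx = h[rule_format, OF x]
      show "h0 x \<noteq> 0" "\<bar>real_of_int (h0 x)\<bar> \<le> A0 * real N ^ r" using hx by blast+
      show "\<bar>real_of_int (h x (f i))\<bar> \<le> A0 * real N ^ r" if "i < k" for i
        using hx f that by (auto simp: bij_betw_def)
      have "(\<Sum>i\<in>I. c i * of_int (h x i)) = (\<Sum>j<k. c (f j) * of_int (h x (f j)))"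
        by (rule sum.reindex_bij_betw[OF f, symmetric])
      then show "of_int (h0 x) * real x ^ d = (\<Sum>j<k. c (f j) * of_int (h x (f j)))" using hx by simp
    qed
    then show ?thesis by (rule C[OF N])
  qed
  then show ?thesis by (intro exI[of _ C]) blast
qed

section \<open>Counting additive relations\<close>

lemma separated_card_le:
  fixes \<phi> :: "nat \<Rightarrow> nat"
  assumes "\<And>x y. x \<in> A \<Longrightarrow> y \<in> A \<Longrightarrow> x < y \<Longrightarrow> \<phi> x + q \<le> \<phi> y" "\<And>x. x \<in> A \<Longrightarrow> \<phi> x \<le> N" "q \<ge> 1"
  shows "card A \<le> N div q + 1"
proof -
  have "inj_on (\<lambda>x. \<phi> x div q) A"
  proof (rule linorder_inj_onI)
    fix x y assume "x < y" "x \<in> A" "y \<in> A"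
    then have "\<phi> x + q \<le> \<phi> y" using assms(1) by blast
    then have "(\<phi> x + q) div q \<le> \<phi> y div q" by (rule div_le_mono)
    then show "\<phi> x div q \<noteq> \<phi> y div q" using assms(3) by simp
  qed auto
  then have "card A \<le> card {..N div q}"
    by (rule card_inj_on_le) (use assms(2) in \<open>auto intro: div_le_mono\<close>)
  then show ?thesis by simp
qed

text \<open>The slope is \<kappa> times a power of \<open>x / z\<close>, with \<open>z\<close> the
  root, so equal slopes force equal quotients; as \<open>c \<noteq> 0\<close>, the quotient
  determines \<open>x\<close>. This replaces an explicit discussion of strict convexity.\<close>

lemma power_curve_slope_inj:
  fixes \<kappa> c :: real
  assumes "\<kappa> \<noteq> 0" "c \<noteq> 0" "d \<ge> 2" and xy: "0 < x" "0 < y" "\<kappa> * x ^ d + c > 0" "\<kappa> * y ^ d + c > 0"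
    and eq: "\<kappa> * x ^ (d - 1) / root d (\<kappa> * x ^ d + c) ^ (d - 1) = \<kappa> * y ^ (d - 1) / root d (\<kappa> * y ^ d + c) ^ (d - 1)"
  shows "x = y"
proof -
  let ?f = "\<lambda>x. root d (\<kappa> * x ^ d + c)"
  have f: "?f x > 0" "?f y > 0" "?f x ^ d = \<kappa> * x ^ d + c" "?f y ^ d = \<kappa> * y ^ d + c"
    using xy assms(3) by auto
  have "\<kappa> * (x / ?f x) ^ (d - 1) = \<kappa> * (y / ?f y) ^ (d - 1)" using eq by (simp add: power_divide)
  then have "(x / ?f x) ^ (d - 1) = (y / ?f y) ^ (d - 1)" by (rule mult_left_cancel[OF assms(1), THEN iffD1])
  moreover have "0 \<le> x / ?f x" "0 \<le> y / ?f y" "0 < d - 1" using xy f(1,2) assms(3) by auto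
  ultimately have "x / ?f x = y / ?f y" by (rule power_eq_imp_eq_base)
  then have "(x / ?f x) ^ d = (y / ?f y) ^ d" by simp
  then have "x ^ d / (\<kappa> * x ^ d + c) = y ^ d / (\<kappa> * y ^ d + c)" unfolding power_divide f(3,4) .
  then have "x ^ d * (\<kappa> * y ^ d + c) = y ^ d * (\<kappa> * x ^ d + c)"
    using xy(3,4) by (subst (asm) frac_eq_eq) auto
  then have "c * x ^ d = c * y ^ d" by (simp add: algebra_simps)
  then have "x ^ d = y ^ d" using assms(2) by simp
  then show ?thesis using xy assms(3) by (intro power_eq_imp_eq_base[of x d y]) auto
qed

lemma power_curve_chord:
  fixes \<kappa> c :: real
  assumes "d \<ge> 2" "0 < x" "x < y" "\<kappa> * x ^ d + c > 0" "\<kappa> * y ^ d + c > 0"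
  shows "\<exists>\<xi>. x < \<xi> \<and> \<xi> < y \<and> \<kappa> * \<xi> ^ d + c > 0 \<and>
    root d (\<kappa> * y ^ d + c) - root d (\<kappa> * x ^ d + c) = (y - x) * (\<kappa> * \<xi> ^ (d - 1) / root d (\<kappa> * \<xi> ^ d + c) ^ (d - 1))"
proof -
  \<comment> \<open>A monotone expression that is positive at both ends is positive in between; this
    keeps the root differentiable on the whole interval.\<close>
  have pos: "\<kappa> * t ^ d + c > 0" if "x \<le> t" "t \<le> y" for t
  proof (cases "\<kappa> \<ge> 0")
    case True
    have "x ^ d \<le> t ^ d" using that assms by (intro power_mono) auto
    then have "\<kappa> * x ^ d \<le> \<kappa> * t ^ d" using True by (rule mult_left_mono)
    then show ?thesis using assms(4) by linarith
  next
    case False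
    have "t ^ d \<le> y ^ d" using that assms by (intro power_mono) auto
    then have "\<kappa> * y ^ d \<le> \<kappa> * t ^ d" using False by (intro mult_left_mono_neg) auto
    then show ?thesis using assms(5) by linarith
  qed
  have der: "((\<lambda>t. root d (\<kappa> * t ^ d + c)) has_real_derivative
     \<kappa> * t ^ (d - 1) / root d (\<kappa> * t ^ d + c) ^ (d - 1)) (at t)" if "x \<le> t" "t \<le> y" for t
  proof -
    have "((\<lambda>t. root d (\<kappa> * t ^ d + c)) has_real_derivative
       inverse (real d * root d (\<kappa> * t ^ d + c) ^ (d - Suc 0)) * (\<kappa> * (real d * t ^ (d - 1)))) (at t)"
    proof (rule DERIV_chain2[where f = "root d"])
      show "(root d has_real_derivative inverse (real d * root d (\<kappa> * t ^ d + c) ^ (d - Suc 0))) (at (\<kappa> * t ^ d + c))"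
        using pos[OF that] assms(1) by (intro DERIV_real_root) auto
      show "((\<lambda>t. \<kappa> * t ^ d + c) has_real_derivative \<kappa> * (real d * t ^ (d - 1))) (at t)"
        by (auto intro!: derivative_eq_intros)
    qed
    then show ?thesis using assms(1) by (simp add: field_simps)
  qed
  from MVT2[OF assms(3), of "\<lambda>t. root d (\<kappa> * t ^ d + c)", OF der] obtain \<xi> where
    "x < \<xi>" "\<xi> < y" "root d (\<kappa> * y ^ d + c) - root d (\<kappa> * x ^ d + c) =
       (y - x) * (\<kappa> * \<xi> ^ (d - 1) / root d (\<kappa> * \<xi> ^ d + c) ^ (d - 1))" by blast
  then show ?thesis using pos[of \<xi>] by auto
qed

text \<open>Successive points of a strictly convex arc have distinct difference vectors, so at most about
  \<open>N\<^bsup>2/3\<^esup>\<close> of them fit into a box of side \<open>N\<close>.\<close>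

lemma power_curve_card:
  fixes \<kappa> c :: real
  assumes "\<kappa> \<noteq> 0" "c \<noteq> 0" "d \<ge> 2" "N \<ge> 1"
  shows "real (card {x\<in>{1..N}. \<exists>z\<in>{1..N}. real z ^ d = \<kappa> * real x ^ d + c}) \<le> 14 * real N powr (2/3)"
proof -
  define X where "X = {x\<in>{1..N}. \<exists>z\<in>{1..N}. real z ^ d = \<kappa> * real x ^ d + c}"
  have fX: "finite X" by (simp add: X_def)
  define z where "z x = (SOME z. z \<in> {1..N} \<and> real z ^ d = \<kappa> * real x ^ d + c)" for x
  have z: "z x \<in> {1..N}" "real (z x) ^ d = \<kappa> * real x ^ d + c" if "x \<in> X" for x
  proof -
    have "\<exists>z. z \<in> {1..N} \<and> real z ^ d = \<kappa> * real x ^ d + c" using that by (auto simp: X_def)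
    from someI_ex[OF this] show "z x \<in> {1..N}" "real (z x) ^ d = \<kappa> * real x ^ d + c" by (auto simp: z_def)
  qed
  have xpos: "0 < real x" if "x \<in> X" for x using that by (auto simp: X_def)
  have zpos: "\<kappa> * real x ^ d + c > 0" if "x \<in> X" for x
    using z[OF that] by (metis atLeastAtMost_iff of_nat_0_less_iff zero_less_power less_le_trans zero_less_one)
  have zr: "real (z x) = root d (\<kappa> * real x ^ d + c)" if "x \<in> X" for x
    using z[OF that] assms(3) by (metis of_nat_0_le_iff real_root_power_cancel pos2 less_le_trans)
  define P where "P = real N powr (1/3)"
  \<comment> \<open>Points followed by a gap of at least \<open>q\<close> number about
    \<open>N / q\<close>, those with short difference vectors at most \<open>q * q\<close>; a
    \<open>q\<close> near the cube root of \<open>N\<close> balances the two.\<close>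
  define q where "q = nat \<lceil>P\<rceil>"
  have P1: "P \<ge> 1" unfolding P_def using assms(4) by (intro ge_one_powr_ge_zero) auto
  have q: "real q \<ge> P" "real q \<le> 2 * P" using P1 unfolding q_def by linarith+
  have q1: "q \<ge> 1" using q P1 by linarith
  define A where "A = {x\<in>X. \<forall>y\<in>X. x < y \<longrightarrow> x + q \<le> y}"
  \<comment> \<open>Reflected when the curve descends, so that the second coordinate is
    nondecreasing in both cases.\<close>
  define \<phi> where "\<phi> x = (if \<kappa> > 0 then z x else N - z x)" for x
  have mono: "\<phi> x \<le> \<phi> y" if "x \<in> X" "y \<in> X" "x \<le> y" for x y
  proof (cases "\<kappa> > 0")
    case True
    have "real (z x) ^ d \<le> real (z y) ^ d"
      unfolding z(2)[OF that(1)] z(2)[OF that(2)] using True that(3) by (simp add: power_mono)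
    then have "real (z x) \<le> real (z y)" using assms(3) by (subst (asm) power_mono_iff) auto
    then show ?thesis using True by (simp add: \<phi>_def)
  next
    case False
    have "real (z y) ^ d \<le> real (z x) ^ d"
      unfolding z(2)[OF that(1)] z(2)[OF that(2)] using False that(3)
      by (simp add: power_mono mult_left_mono_neg)
    then have "real (z y) \<le> real (z x)" using assms(3) by (subst (asm) power_mono_iff) auto
    then show ?thesis using False by (simp add: \<phi>_def)
  qed
  define B where "B = {x\<in>X. \<forall>y\<in>X. x < y \<longrightarrow> \<phi> x + q \<le> \<phi> y}"
  have cA: "card A \<le> N div q + 1"
    by (rule separated_card_le[where \<phi> = "\<lambda>x. x"]) (use q1 in \<open>auto simp: A_def X_def\<close>)
  have cB: "card B \<le> N div q + 1"
  proof (rule separated_card_le[where \<phi> = \<phi>])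
    show "\<phi> x \<le> N" if "x \<in> B" for x using z(1)[of x] that by (auto simp: B_def \<phi>_def)
  qed (use q1 in \<open>auto simp: B_def\<close>)
  \<comment> \<open>Points of \<open>C\<close> have a successor, and both coordinates move by less
    than \<open>q\<close> on the way to it. Two equal difference vectors would be chords of equal
    slope over intervals without common interior, giving equal tangent slopes at two different
    points.\<close>
  define C where "C = X - A - B"
  define nx where "nx x = Min {y\<in>X. x < y}" for x
  have nx: "nx x \<in> X" "x < nx x" "\<And>y. y \<in> X \<Longrightarrow> x < y \<Longrightarrow> nx x \<le> y" if "x \<in> C" for x
  proof -
    have "{y\<in>X. x < y} \<noteq> {}" using that by (auto simp: C_def A_def)
    then have "nx x \<in> {y\<in>X. x < y}" unfolding nx_def using fX by (intro Min_in) auto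
    then show "nx x \<in> X" "x < nx x" by auto
    show "nx x \<le> y" if "y \<in> X" "x < y" for y unfolding nx_def using fX that by (intro Min_le) auto
  qed
  have CX: "x \<in> X" if "x \<in> C" for x using that by (simp add: C_def)
  define D where "D x = (nx x - x, \<phi> (nx x) - \<phi> x)" for x
  have "D ` C \<subseteq> {..<q} \<times> {..<q}"
  proof
    fix p assume "p \<in> D ` C"
    then obtain x where x: "x \<in> C" "p = D x" by auto
    from x(1) obtain y where y: "y \<in> X" "x < y" "y < x + q" by (auto simp: C_def A_def not_le)
    from x(1) obtain y' where y': "y' \<in> X" "x < y'" "\<phi> y' < \<phi> x + q" by (auto simp: C_def B_def not_le)
    have "nx x < x + q" using nx(3)[OF x(1) y(1,2)] y(3) by simp
    moreover have "\<phi> (nx x) \<le> \<phi> y'" using mono[OF nx(1)[OF x(1)] y'(1) nx(3)[OF x(1) y'(1,2)]] .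
    ultimately show "p \<in> {..<q} \<times> {..<q}" using x(2) nx(2)[OF x(1)] y'(3) q1 by (auto simp: D_def)
  qed
  moreover have "inj_on D C"
  proof (rule linorder_inj_onI)
    fix x y assume xy: "x < y" "x \<in> C" "y \<in> C"
    show "D x \<noteq> D y"
    proof
      assume eq: "D x = D y"
      have ny: "nx x \<le> y" by (rule nx(3)[OF xy(2) CX[OF xy(3)] xy(1)])
      let ?g = "\<lambda>t. \<kappa> * t ^ (d - 1) / root d (\<kappa> * t ^ d + c) ^ (d - 1)"
      have ch: "\<exists>\<xi>. real u < \<xi> \<and> \<xi> < real (nx u) \<and> \<kappa> * \<xi> ^ d + c > 0 \<and>
         real (z (nx u)) - real (z u) = (real (nx u) - real u) * ?g \<xi>" if u: "u \<in> C" for u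
        using power_curve_chord[OF assms(3) xpos[OF CX[OF u]], of "real (nx u)" \<kappa> c]
          nx(2)[OF u] zpos[OF CX[OF u]] zpos[OF nx(1)[OF u]] zr[OF CX[OF u]] zr[OF nx(1)[OF u]] by simp
      obtain \<xi> where \<xi>: "real x < \<xi>" "\<xi> < real (nx x)" "\<kappa> * \<xi> ^ d + c > 0"
        "real (z (nx x)) - real (z x) = (real (nx x) - real x) * ?g \<xi>" using ch[OF xy(2)] by blast
      obtain \<zeta> where \<zeta>: "real y < \<zeta>" "\<zeta> < real (nx y)" "\<kappa> * \<zeta> ^ d + c > 0"
        "real (z (nx y)) - real (z y) = (real (nx y) - real y) * ?g \<zeta>" using ch[OF xy(3)] by blast
      have a: "nx x - x = nx y - y" "\<phi> (nx x) - \<phi> x = \<phi> (nx y) - \<phi> y" using eq by (auto simp: D_def)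
      have a1: "real (nx x) - real x = real (nx y) - real y"
        using a(1) nx(2)[OF xy(2)] nx(2)[OF xy(3)] by (metis less_imp_le_nat of_nat_diff)
      have b: "real (\<phi> (nx x)) - real (\<phi> x) = real (\<phi> (nx y)) - real (\<phi> y)"
        using a(2) mono[OF CX[OF xy(2)] nx(1)[OF xy(2)]] mono[OF CX[OF xy(3)] nx(1)[OF xy(3)]]
          nx(2)[OF xy(2)] nx(2)[OF xy(3)] by (metis less_imp_le_nat of_nat_diff)
      have \<phi>r: "real (\<phi> u) = (if \<kappa> > 0 then real (z u) else real N - real (z u))" if "u \<in> X" for u
        using z(1)[OF that] by (auto simp: \<phi>_def of_nat_diff)
      have "real (z (nx x)) - real (z x) = real (z (nx y)) - real (z y)"
        using b unfolding \<phi>r[OF CX[OF xy(2)]] \<phi>r[OF CX[OF xy(3)]] \<phi>r[OF nx(1)[OF xy(2)]] \<phi>r[OF nx(1)[OF xy(3)]]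
        by (auto split: if_splits)
      then have "(real (nx x) - real x) * ?g \<xi> = (real (nx x) - real x) * ?g \<zeta>" using \<xi>(4) \<zeta>(4) a1 by simp
      moreover have n0: "real (nx x) - real x \<noteq> 0" using nx(2)[OF xy(2)] by simp
      ultimately have ge: "?g \<xi> = ?g \<zeta>" by (simp only: mult_left_cancel[OF n0])
      have "\<xi> = \<zeta>"
        by (rule power_curve_slope_inj[OF assms(1,2,3) _ _ \<xi>(3) \<zeta>(3) ge])
           (use xpos[OF CX[OF xy(2)]] xpos[OF CX[OF xy(3)]] \<xi>(1) \<zeta>(1) in linarith)+
      then show False using \<xi>(2) \<zeta>(1) ny by linarith
    qed
  qed auto
  ultimately have cC: "card C \<le> q * q"
    using card_inj_on_le[of D C "{..<q} \<times> {..<q}"] by simp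
  have "X \<subseteq> A \<union> B \<union> C" by (auto simp: C_def)
  then have "card X \<le> card (A \<union> B \<union> C)"
    using fX by (intro card_mono) (auto simp: A_def B_def C_def)
  also have "\<dots> \<le> card A + card B + card C"
    using card_Un_le[of "A \<union> B" C] card_Un_le[of A B] by linarith
  also have "\<dots> \<le> (N div q + 1) + (N div q + 1) + q * q" by (intro add_mono cA cB cC)
  finally have "real (card X) \<le> real ((N div q + 1) + (N div q + 1) + q * q)" by (simp only: of_nat_le_iff)
  then have "real (card X) \<le> 2 * real (N div q) + 2 + real q * real q" by simp
  also have "real (N div q) \<le> P * P"
  proof -
    have "real (N div q * q) \<le> real N" by (simp only: of_nat_le_iff div_times_less_eq_dividend)
    then have "real (N div q) \<le> real N / real q" using q1 by (simp add: pos_le_divide_eq)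
    also have "\<dots> \<le> real N / P" using q P1 by (intro divide_left_mono) auto
    also have "real N = P * P * P" unfolding P_def using assms(4) by (simp add: powr_add[symmetric])
    also have "P * P * P / P = P * P" using P1 by simp
    finally show ?thesis .
  qed
  also have "real q * real q \<le> (2 * P) * (2 * P)" using q by (intro mult_mono) auto
  finally have "real (card X) \<le> 6 * (P * P) + 2" by simp
  moreover have "P * P \<ge> 1" using mult_mono[of 1 P 1 P] P1 by simp
  moreover have "P * P = real N powr (2/3)" unfolding P_def by (simp add: powr_add[symmetric])
  ultimately show ?thesis unfolding X_def by linarith
qed

section \<open>Siegel's lemma and the lattice of relations of a tuple\<close>

lemma siegel_integer:
  fixes a :: "'g \<Rightarrow> 'e \<Rightarrow> int"
  assumes fin: "finite E" "finite G" "card E < card G"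
    and a: "\<And>g e. g \<in> G \<Longrightarrow> e \<in> E \<Longrightarrow> \<bar>a g e\<bar> \<le> int B"
  shows "\<exists>q. (\<exists>g\<in>G. q g \<noteq> 0) \<and> (\<forall>g\<in>G. \<bar>q g\<bar> \<le> int ((2 * card G * B + 1) ^ card E)) \<and>
    (\<forall>e\<in>E. (\<Sum>g\<in>G. q g * a g e) = 0)"
proof -
  define r where "r = card G"
  \<comment> \<open>With this \<open>Q\<close> the image box has at most
    \<open>(Q * (2 * r * B + 1)) ^ card E = Q ^ Suc (card E)\<close> points, fewer than the
    \<open>(Q + 1) ^ r\<close> vectors mapped into it.\<close>
  define Q where "Q = (2 * r * B + 1) ^ card E"
  have Q1: "Q \<ge> 1" by (simp add: Q_def)
  define S where "S = PiE G (\<lambda>_. {0..int Q})"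
  define T where "T = PiE E (\<lambda>_. {- int (r * (Q * B))..int (r * (Q * B))})"
  define \<Phi> where "\<Phi> q = (\<lambda>e\<in>E. \<Sum>g\<in>G. q g * a g e)" for q
  have "\<Phi> q \<in> T" if q: "q \<in> S" for q
  proof -
    have "\<bar>\<Sum>g\<in>G. q g * a g e\<bar> \<le> int (r * (Q * B))" if e: "e \<in> E" for e
    proof -
      have "\<bar>\<Sum>g\<in>G. q g * a g e\<bar> \<le> (\<Sum>g\<in>G. int Q * int B)"
      proof (rule order_trans[OF sum_abs], rule sum_mono)
        fix g assume g: "g \<in> G"
        then have "\<bar>q g\<bar> \<le> int Q" using q by (auto simp: S_def PiE_def Pi_def)
        then show "\<bar>q g * a g e\<bar> \<le> int Q * int B" unfolding abs_mult using a[OF g e] by (intro mult_mono) auto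
      qed
      then show ?thesis by (simp add: r_def)
    qed
    then show ?thesis unfolding T_def \<Phi>_def by (fastforce simp: abs_le_iff)
  qed
  then have sub: "\<Phi> ` S \<subseteq> T" by auto
  have fT: "finite T" using fin by (simp add: T_def finite_PiE)
  have "card T = (2 * (r * (Q * B)) + 1) ^ card E"
  proof -
    have "card {- int x..int x} = 2 * x + 1" for x by simp
    from this[of "r * (Q * B)"] show ?thesis using fin(1) unfolding T_def by (simp add: card_PiE)
  qed
  also have "\<dots> \<le> (Q * (2 * r * B + 1)) ^ card E"
    using Q1 by (intro power_mono) (auto simp: algebra_simps)
  also have "\<dots> = Q ^ card E * Q" by (simp only: power_mult_distrib Q_def)
  also have "\<dots> = Q ^ Suc (card E)" by simp
  also have "\<dots> \<le> Q ^ r" using fin(3) Q1 by (intro power_increasing) (auto simp: r_def)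
  also have "\<dots> < (Q + 1) ^ r" using fin(3) by (intro power_strict_mono) (auto simp: r_def)
  also have "\<dots> = card S"
  proof -
    have "card {0..int Q} = Q + 1" by simp
    then show ?thesis using fin(2) unfolding S_def by (simp only: card_PiE prod_constant r_def)
  qed
  finally have "card (\<Phi> ` S) < card S" using card_mono[OF fT sub] by simp
  then have "\<not> inj_on \<Phi> S" by (rule pigeonhole)
  then obtain q q' where q: "q \<in> S" "q' \<in> S" "q \<noteq> q'" "\<Phi> q = \<Phi> q'" unfolding inj_on_def by blast
  show ?thesis
  proof (intro exI[of _ "\<lambda>g. q g - q' g"] conjI ballI)
    show "\<exists>g\<in>G. q g - q' g \<noteq> 0"
    proof (rule ccontr)
      assume "\<not> ?thesis"
      then have "q = q'" using q(1,2) unfolding S_def by (intro PiE_ext) auto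
      then show False using q(3) by simp
    qed
    fix g assume g: "g \<in> G"
    have "q g \<in> {0..int Q}" "q' g \<in> {0..int Q}" using q g by (auto simp: S_def PiE_def Pi_def)
    then show "\<bar>q g - q' g\<bar> \<le> int ((2 * card G * B + 1) ^ card E)" unfolding Q_def r_def by auto
  next
    fix e assume e: "e \<in> E"
    have "(\<Sum>g\<in>G. q g * a g e) = (\<Sum>g\<in>G. q' g * a g e)" using fun_cong[OF q(4), of e] e by (simp add: \<Phi>_def)
    then show "(\<Sum>g\<in>G. (q g - q' g) * a g e) = 0" by (simp add: left_diff_distrib sum_subtractf)
  qed
qed

text \<open>Row rank equals column rank: a basis of the rows with fewer than \<open>card J\<close>
  elements would leave a nonzero vector on \<open>J\<close> orthogonal to all of
  \<open>L\<close>.\<close>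

lemma ex_square_minor:
  assumes ind: "row_indep (\<lambda>j h. f h j) L J" and fin: "finite L" "finite J"
  shows "\<exists>G\<subseteq>L. card G = card J \<and> row_indep f J G"
proof -
  have "row_indep f J {}" by (simp add: row_indep_def)
  from row_indep_extend[OF fin(1) _ this] obtain G where G: "G \<subseteq> L" "row_indep f J G"
    "\<forall>h\<in>L. \<exists>b. \<forall>j\<in>J. f h j = (\<Sum>g\<in>G. b g * f g j)" by auto
  have fG: "finite G" using G(1) fin(1) finite_subset by auto
  have "\<not> card G < card J"
  proof
    assume lt: "card G < card J"
    from underdetermined_real[OF fG fin(2) lt, of f] obtain y where y: "\<exists>j\<in>J. y j \<noteq> 0"
      "\<forall>g\<in>G. (\<Sum>j\<in>J. f g j * y j) = 0" by (elim exE conjE)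
    have "(\<Sum>j\<in>J. y j * f h j) = 0" if h: "h \<in> L" for h
    proof -
      from bspec[OF G(3) h] obtain b where b: "\<forall>j\<in>J. f h j = (\<Sum>g\<in>G. b g * f g j)" by (elim exE)
      have "(\<Sum>j\<in>J. y j * f h j) = (\<Sum>j\<in>J. \<Sum>g\<in>G. b g * (f g j * y j))"
        using b by (intro sum.cong refl) (simp add: sum_distrib_left mult_ac)
      also have "\<dots> = (\<Sum>g\<in>G. b g * (\<Sum>j\<in>J. f g j * y j))"
        by (subst sum.swap) (simp add: sum_distrib_left)
      also have "\<dots> = 0" using y(2) by simp
      finally show ?thesis .
    qed
    then have "y j = 0" if "j \<in> J" for j using row_indepD[OF ind, of y j] that by simp
    then show False using y(1) by blast
  qed
  then have "card G = card J" using row_indep_card_le[OF G(2) fin(2) fG] by simp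
  then show ?thesis using G(1,2) by blast
qed

text \<open>The two halves stem from the two factors of a squared modulus. Each half sums to 0
  because only differences of consecutive terms of the sequence enter the correlation sum.\<close>

definition sol_eqs :: "nat \<Rightarrow> nat \<Rightarrow> (nat \<Rightarrow> nat) \<Rightarrow> (nat \<Rightarrow> int) \<Rightarrow> bool" where
  "sol_eqs l d n h \<longleftrightarrow> (\<Sum>i<l. h i) = 0 \<and> (\<Sum>i=l..<2*l. h i) = 0 \<and> (\<Sum>i<2*l. h i * int (n i) ^ d) = 0"

text \<open>Only the part of sup norm at most \<open>B\<close> of the solution lattice of
  \<open>n\<close>.\<close>

definition lat :: "nat \<Rightarrow> nat \<Rightarrow> nat \<Rightarrow> (nat \<Rightarrow> nat) \<Rightarrow> (nat \<Rightarrow> int) set" where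
  "lat l d B n = {h \<in> PiE {..<2*l} (\<lambda>_. {- int B..int B}). sol_eqs l d n h}"

lemma finite_lat: "finite (lat l d B n)"
  by (rule finite_subset[of _ "PiE {..<2*l} (\<lambda>_. {- int B..int B})"]) (auto simp: lat_def finite_PiE)

lemma lat_abs: "h \<in> lat l d B n \<Longrightarrow> i < 2 * l \<Longrightarrow> \<bar>h i\<bar> \<le> int B"
  by (auto simp: lat_def PiE_def Pi_def)

lemma sol_eqs_comb:
  assumes "\<And>g. g \<in> G \<Longrightarrow> sol_eqs l d n g"
  shows "sol_eqs l d n (\<lambda>i. \<Sum>g\<in>G. q g * g i)"
proof -
  have "(\<Sum>i\<in>I. (\<Sum>g\<in>G. q g * g i) * w i) = (\<Sum>g\<in>G. q g * (\<Sum>i\<in>I. g i * w i))" for I and w :: "nat \<Rightarrow> int"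
    unfolding sum_distrib_right sum_distrib_left by (subst sum.swap) (simp add: mult.assoc)
  from this[where w = "\<lambda>_. 1"] this[where w = "\<lambda>i. int (n i) ^ d"] assms show ?thesis
    by (simp add: sol_eqs_def)
qed

lemma sol_eqs_cong: "(\<And>i. i < 2 * l \<Longrightarrow> h i = h' i) \<Longrightarrow> sol_eqs l d n h \<longleftrightarrow> sol_eqs l d n h'"
proof -
  assume h: "\<And>i. i < 2 * l \<Longrightarrow> h i = h' i"
  have "(\<Sum>i<l. h i) = (\<Sum>i<l. h' i)" "(\<Sum>i=l..<2*l. h i) = (\<Sum>i=l..<2*l. h' i)"
    "(\<Sum>i<2*l. h i * int (n i) ^ d) = (\<Sum>i<2*l. h' i * int (n i) ^ d)"
    by (rule sum.cong; use h in simp)+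
  then show ?thesis by (simp only: sol_eqs_def)
qed

lemma sol_eqs_diff:
  assumes "sol_eqs l d n h" "sol_eqs l d n h'"
  shows "sol_eqs l d n (\<lambda>i. h i - h' i)"
  using assms by (simp add: sol_eqs_def sum_subtractf left_diff_distrib)

text \<open>Siegel's lemma combines \<open>card J\<close> independent solutions into one,
  \<open>H\<close>, that vanishes on \<open>J\<close> except at \<open>j\<close>, where independence
  keeps it nonzero. The equation for \<open>H\<close> expresses \<open>n j ^ d\<close> by the powers
  outside \<open>J\<close>. Passing from the multipliers to \<open>H\<close> costs one more factor
  \<open>2 * r * B + 1\<close>.\<close>

lemma integer_relation:
  assumes J: "J \<subseteq> {..<2*l}" and ind: "row_indep (\<lambda>j h. real_of_int (h j)) (lat l d B n) J" and j: "j \<in> J"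
  shows "\<exists>(h0::int) h. h0 \<noteq> 0 \<and> \<bar>h0\<bar> \<le> int ((2 * card J * B + 1) ^ card J) \<and>
    (\<forall>i\<in>{..<2*l} - J. \<bar>h i\<bar> \<le> int ((2 * card J * B + 1) ^ card J)) \<and>
    h0 * int (n j) ^ d = (\<Sum>i\<in>{..<2*l} - J. h i * int (n i) ^ d)"
proof -
  have fJ: "finite J" using J finite_subset by blast
  define r where "r = card J"
  have r1: "r \<ge> 1" using j fJ by (simp add: r_def Suc_le_eq card_gt_0_iff) blast
  from ex_square_minor[of "\<lambda>h j. real_of_int (h j)", OF ind finite_lat fJ] obtain G where
    G: "G \<subseteq> lat l d B n" "card G = r" "row_indep (\<lambda>h j. real_of_int (h j)) J G" by (auto simp: r_def)
  have fG: "finite G" using G(1) finite_lat finite_subset by blast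
  have cE: "card (J - {j}) = r - 1" using j fJ by (simp add: r_def)
  have "\<exists>q. (\<exists>g\<in>G. q g \<noteq> 0) \<and> (\<forall>g\<in>G. \<bar>q g\<bar> \<le> int ((2 * card G * B + 1) ^ card (J - {j}))) \<and>
    (\<forall>e\<in>J - {j}. (\<Sum>g\<in>G. q g * g e) = 0)"
  proof (rule siegel_integer)
    show "\<bar>g e\<bar> \<le> int B" if "g \<in> G" "e \<in> J - {j}" for g e
      using lat_abs[of g l d B n e] that G(1) J by auto
  qed (use fJ fG G cE r1 in auto)
  then obtain q where q: "\<exists>g\<in>G. q g \<noteq> 0" "\<forall>g\<in>G. \<bar>q g\<bar> \<le> int ((2 * r * B + 1) ^ (r - 1))"
    "\<forall>e\<in>J - {j}. (\<Sum>g\<in>G. q g * g e) = 0" unfolding G(2) cE by (elim exE conjE)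
  define H where "H i = (\<Sum>g\<in>G. q g * g i)" for i
  have eqH: "sol_eqs l d n H" unfolding H_def by (rule sol_eqs_comb) (use G(1) in \<open>auto simp: lat_def\<close>)
  have Hb: "\<bar>H i\<bar> \<le> int ((2 * r * B + 1) ^ r)" if "i < 2 * l" for i
  proof -
    have "\<bar>H i\<bar> \<le> (\<Sum>g\<in>G. int ((2 * r * B + 1) ^ (r - 1)) * int B)"
      unfolding H_def
    proof (rule order_trans[OF sum_abs], rule sum_mono)
      fix g assume g: "g \<in> G"
      have "\<bar>q g\<bar> \<le> int ((2 * r * B + 1) ^ (r - 1))" using q(2) g by blast
      moreover have "\<bar>g i\<bar> \<le> int B" using lat_abs[of g l d B n i] g G(1) that by blast
      ultimately show "\<bar>q g * g i\<bar> \<le> int ((2 * r * B + 1) ^ (r - 1)) * int B"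
        unfolding abs_mult by (intro mult_mono) auto
    qed
    also have "\<dots> = int ((2 * r * B + 1) ^ (r - 1) * (r * B))" by (simp add: G(2))
    also have "\<dots> \<le> int ((2 * r * B + 1) ^ (r - 1) * (2 * r * B + 1))"
      unfolding of_nat_le_iff by (intro mult_le_mono2) auto
    also have "(2 * r * B + 1) ^ (r - 1) * (2 * r * B + 1) = (2 * r * B + 1) ^ r"
      using r1 by (metis power_minus_mult Suc_le_eq One_nat_def)
    finally show ?thesis .
  qed
  have "H j \<noteq> 0"
  proof
    assume 0: "H j = 0"
    have "(\<Sum>g\<in>G. of_int (q g) * real_of_int (g e)) = 0" if "e \<in> J" for e
    proof -
      have "H e = 0" using 0 q(3) that by (cases "e = j") (auto simp: H_def)
      then have "real_of_int (H e) = 0" by simp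
      then show ?thesis by (simp add: H_def)
    qed
    then have "real_of_int (q g) = 0" if "g \<in> G" for g
      using row_indepD[OF G(3), of "\<lambda>g. of_int (q g)" g] that by simp
    then show False using q(1) by auto
  qed
  moreover have "H j * int (n j) ^ d = (\<Sum>i\<in>{..<2*l} - J. (- H i) * int (n i) ^ d)"
  proof -
    have "(\<Sum>i<2*l. H i * int (n i) ^ d) = (\<Sum>i\<in>J. H i * int (n i) ^ d) + (\<Sum>i\<in>{..<2*l} - J. H i * int (n i) ^ d)"
      using J by (simp add: sum.subset_diff add.commute)
    also have "(\<Sum>i\<in>J. H i * int (n i) ^ d) = (\<Sum>i\<in>{j}. H i * int (n i) ^ d)"
      using q(3) j fJ by (intro sum.mono_neutral_right) (auto simp: H_def)
    finally show ?thesis using eqH by (simp add: sol_eqs_def sum_negf)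
  qed
  ultimately show ?thesis
    using Hb J j unfolding r_def by (intro exI[of _ "H j"] exI[of _ "\<lambda>i. - H i"]) auto
qed

text \<open>Cut the box of coordinates in \<open>J\<close> into cubes of side \<open>R\<close>.
  Differences inside a cube satisfy a fixed relation with nonzero coefficient at \<open>j0\<close>,
  so the residues at the other coordinates determine the vector: \<open>R ^ (card J - 1)\<close>
  instead of \<open>R ^ card J\<close> vectors per cube.\<close>

lemma card_thin_le:
  fixes L :: "(nat \<Rightarrow> int) set" and B R :: nat
  assumes fin: "finite J" "finite L" and R: "R \<ge> 1" and j0: "j0 \<in> J" "y j0 \<noteq> (0::real)"
    and bd: "\<And>h j. h \<in> L \<Longrightarrow> j \<in> J \<Longrightarrow> \<bar>h j\<bar> \<le> int B"
    and inj: "\<And>h h'. h \<in> L \<Longrightarrow> h' \<in> L \<Longrightarrow> (\<And>j. j \<in> J \<Longrightarrow> h j = h' j) \<Longrightarrow> h = h'"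
    and thin: "\<And>h h'. h \<in> L \<Longrightarrow> h' \<in> L \<Longrightarrow> (\<And>j. j \<in> J \<Longrightarrow> \<bar>h j - h' j\<bar> \<le> int R) \<Longrightarrow>
       (\<Sum>j\<in>J. y j * real_of_int (h j - h' j)) = 0"
  shows "card L \<le> (2 * (B div R) + 2) ^ card J * R ^ (card J - 1)"
proof -
  \<comment> \<open>The lower end is one further down because division rounds towards minus
    infinity.\<close>
  define T where "T = PiE J (\<lambda>_. {- int (B div R) - 1..int (B div R)}) \<times> PiE (J - {j0}) (\<lambda>_. {0..<int R})"
  define \<Phi> where "\<Phi> h = ((\<lambda>j\<in>J. h j div int R), (\<lambda>j\<in>J - {j0}. h j mod int R))" for h :: "nat \<Rightarrow> int"
  have "\<Phi> ` L \<subseteq> T"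
  proof
    fix p assume "p \<in> \<Phi> ` L"
    then obtain h where h: "h \<in> L" "p = \<Phi> h" by auto
    have "h j div int R \<in> {- int (B div R) - 1..int (B div R)}" if "j \<in> J" for j
    proof -
      have "h j \<le> int B" "- int B \<le> h j" using bd[OF h(1) that] by auto
      then have "h j div int R \<le> int B div int R" "(- int B) div int R \<le> h j div int R"
        using R by (auto intro: zdiv_mono1)
      moreover have "- int (B div R) - 1 \<le> (- int B) div int R"
      proof -
        have "B \<le> R + B div R * R" using dividend_less_div_times[of R B] R by simp
        then have "int B \<le> int (R + B div R * R)" by (simp only: of_nat_le_iff)
        then have "(- int (B div R) - 1) * int R \<le> - int B" by (simp add: algebra_simps)
        then have "((- int (B div R) - 1) * int R) div int R \<le> (- int B) div int R"
          using R by (intro zdiv_mono1) auto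
        then show ?thesis using R by simp
      qed
      ultimately show ?thesis by (auto simp: zdiv_int)
    qed
    then show "p \<in> T" using R unfolding h(2) T_def \<Phi>_def by auto
  qed
  moreover have "inj_on \<Phi> L"
  proof (rule inj_onI)
    fix h h' assume h: "h \<in> L" "h' \<in> L" "\<Phi> h = \<Phi> h'"
    have dv: "h j div int R = h' j div int R" if "j \<in> J" for j
    proof -
      have "fst (\<Phi> h) j = fst (\<Phi> h') j" using h(3) by simp
      then show ?thesis using that by (simp add: \<Phi>_def)
    qed
    have md: "h j mod int R = h' j mod int R" if "j \<in> J" "j \<noteq> j0" for j
    proof -
      have "snd (\<Phi> h) j = snd (\<Phi> h') j" using h(3) by simp
      then show ?thesis using that by (simp add: \<Phi>_def)
    qed
    have eq: "h j = h' j" if "j \<in> J" "j \<noteq> j0" for j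
      using dv[OF that(1)] md[OF that] by (metis div_mult_mod_eq)
    have near: "\<bar>h j - h' j\<bar> \<le> int R" if "j \<in> J" for j
    proof -
      have "h j = int R * (h j div int R) + h j mod int R" "h' j = int R * (h j div int R) + h' j mod int R"
        using dv[OF that] by (metis mult_div_mod_eq)+
      moreover have "0 \<le> h j mod int R" "h j mod int R < int R" "0 \<le> h' j mod int R" "h' j mod int R < int R"
        using R by auto
      ultimately show ?thesis by linarith
    qed
    have "(\<Sum>j\<in>J. y j * real_of_int (h j - h' j)) = (\<Sum>j\<in>{j0}. y j * real_of_int (h j - h' j))"
      using eq j0 fin by (intro sum.mono_neutral_right) auto
    then have "y j0 * real_of_int (h j0 - h' j0) = 0" using thin[OF h(1,2) near] by simp
    then have "h j0 = h' j0" using j0(2) by simp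
    then show "h = h'" using eq by (intro inj[OF h(1,2)]) metis
  qed
  moreover have "finite T" using fin by (auto simp: T_def finite_PiE)
  ultimately have "card L \<le> card T" using card_inj_on_le by blast
  also have "card T = (2 * (B div R) + 2) ^ card J * R ^ (card J - 1)"
  proof -
    have "card {- int (B div R) - 1..int (B div R)} = 2 * (B div R) + 2" by simp
    moreover have "card (J - {j0}) = card J - 1" using j0 fin by simp
    ultimately show ?thesis using fin unfolding T_def card_cartesian_product by (simp add: card_PiE)
  qed
  finally show ?thesis .
qed

text \<open>Take pivots \<open>J\<close> over which all coordinates of solutions expand with
  coefficients at most \<open>fact (2 * l)\<close>. Two solutions within \<open>R\<close> of each
  other on \<open>J\<close> then differ by a solution of norm at most
  \<open>2 * l * fact (2 * l) * R\<close>. Either such short solutions have full rank on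
  \<open>J\<close>, or they satisfy one common relation there and \<open>card_thin_le\<close>
  applies.\<close>

lemma lattice_dichotomy:
  fixes R :: "nat \<Rightarrow> nat"
  assumes l: "l \<ge> 1" and nz: "\<exists>h\<in>lat l d B n. \<exists>i<2*l. h i \<noteq> 0" and R: "\<And>r. R r \<ge> 1"
  shows "\<exists>J. J \<subseteq> {..<2*l} \<and> J \<noteq> {} \<and> J \<noteq> {..<2*l} \<and> card (lat l d B n) \<le> (2 * B + 1) ^ card J \<and>
    (\<forall>j\<in>J. \<exists>(h0::int) h. h0 \<noteq> 0 \<and> \<bar>h0\<bar> \<le> int ((2 * card J * B + 1) ^ card J) \<and>
      (\<forall>i\<in>{..<2*l} - J. \<bar>h i\<bar> \<le> int ((2 * card J * B + 1) ^ card J)) \<and>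
      h0 * int (n j) ^ d = (\<Sum>i\<in>{..<2*l} - J. h i * int (n i) ^ d)) \<and>
    (card (lat l d B n) \<le> (2 * (B div R (card J)) + 2) ^ card J * R (card J) ^ (card J - 1) \<or>
     (\<exists>G\<subseteq>lat l d (2 * l * fact (2 * l) * R (card J)) n. card G = card J \<and> row_indep (\<lambda>g j. real_of_int (g j)) J G))"
proof -
  let ?s = "2 * l" and ?L = "lat l d B n"
  have "\<exists>J \<beta>. J \<subseteq> {..<?s} \<and> row_indep (\<lambda>i h. real_of_int (h i)) ?L J \<and>
    (\<forall>m\<in>{..<?s}. \<forall>g\<in>?L. real_of_int (g m) = (\<Sum>\<gamma>\<in>J. \<beta> m \<gamma> * real_of_int (g \<gamma>))) \<and>
    (\<forall>m\<in>{..<?s}. \<forall>\<gamma>\<in>J. \<bar>\<beta> m \<gamma>\<bar> \<le> fact (card {..<?s}))"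
    by (rule conditioned_rows) simp
  then obtain J \<beta> where J: "J \<subseteq> {..<?s}" and ind: "row_indep (\<lambda>i h. real_of_int (h i)) ?L J"
    and \<beta>: "\<forall>m\<in>{..<?s}. \<forall>g\<in>?L. real_of_int (g m) = (\<Sum>\<gamma>\<in>J. \<beta> m \<gamma> * real_of_int (g \<gamma>))"
    and \<beta>b: "\<forall>m\<in>{..<?s}. \<forall>\<gamma>\<in>J. \<bar>\<beta> m \<gamma>\<bar> \<le> fact (card {..<?s})" by (elim exE conjE)
  have fJ: "finite J" using J finite_subset by blast
  have cJ: "card J \<le> ?s" using card_mono[OF _ J] by simp
  have J0: "J \<noteq> {}" using \<beta> nz by fastforce
  have J1: "J \<noteq> {..<?s}"
  proof
    assume Js: "J = {..<?s}"
    \<comment> \<open>The first half sum is a nontrivial relation among the coordinates, so not all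
      of them are pivots.\<close>
    have "(\<Sum>j\<in>J. (if j < l then 1 else 0) * real_of_int (h j)) = 0" if h: "h \<in> ?L" for h
    proof -
      have "(\<Sum>j\<in>J. (if j < l then 1 else 0) * real_of_int (h j)) = (\<Sum>j<l. real_of_int (h j))"
        unfolding Js by (rule sum.mono_neutral_cong_right) auto
      also have "\<dots> = real_of_int (\<Sum>j<l. h j)" by simp
      also have "\<dots> = 0" using h by (simp add: lat_def sol_eqs_def)
      finally show ?thesis .
    qed
    from row_indepD[OF ind this, of 0] show False using l Js by simp
  qed
  have inj: "h = h'" if "h \<in> ?L" "h' \<in> ?L" "\<And>j. j \<in> J \<Longrightarrow> h j = h' j" for h h'
  proof -
    have "real_of_int (h i) = real_of_int (h' i)" if "i < ?s" for i
      using \<beta> that \<open>h \<in> ?L\<close> \<open>h' \<in> ?L\<close> \<open>\<And>j. j \<in> J \<Longrightarrow> h j = h' j\<close> by (simp cong: sum.cong)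
    then show ?thesis using that(1,2) unfolding lat_def by (intro PiE_ext[of h "{..<?s}" _ h']) auto
  qed
  have c1: "card ?L \<le> (2 * B + 1) ^ card J"
  proof -
    have "inj_on (\<lambda>h. restrict h J) ?L"
    proof (rule inj_onI)
      fix h h' assume h: "h \<in> ?L" "h' \<in> ?L" "restrict h J = restrict h' J"
      have "h j = h' j" if "j \<in> J" for j using fun_cong[OF h(3), of j] that by simp
      then show "h = h'" by (rule inj[OF h(1,2)])
    qed
    moreover have "(\<lambda>h. restrict h J) ` ?L \<subseteq> PiE J (\<lambda>_. {- int B..int B})"
      using J by (auto simp: lat_def PiE_def Pi_def)
    moreover have "finite (PiE J (\<lambda>_. {- int B..int B}))" using fJ by (simp add: finite_PiE)
    ultimately have "card ?L \<le> card (PiE J (\<lambda>_. {- int B..int B}))" by (rule card_inj_on_le)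
    moreover have "card {- int B..int B} = 2 * B + 1" by simp
    ultimately show ?thesis using fJ by (simp add: card_PiE)
  qed
  let ?R = "R (card J)"
  define c where "c = 2 * l * fact (2 * l) * ?R"
  \<comment> \<open>Short solutions obeying the same pivot expansion. Differences of elements of
    \<open>?L\<close> that are close on \<open>J\<close> belong to it, so a relation on \<Lambda> is
    exactly what \<open>card_thin_le\<close> asks for.\<close>
  define \<Lambda> where "\<Lambda> = {g\<in>lat l d c n. \<forall>m<?s. real_of_int (g m) = (\<Sum>\<gamma>\<in>J. \<beta> m \<gamma> * real_of_int (g \<gamma>))}"
  have f\<Lambda>: "finite \<Lambda>" using finite_lat[of l d c n] by (simp add: \<Lambda>_def)
  have "card ?L \<le> (2 * (B div ?R) + 2) ^ card J * ?R ^ (card J - 1) \<or>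
     (\<exists>G\<subseteq>lat l d c n. card G = card J \<and> row_indep (\<lambda>g j. real_of_int (g j)) J G)"
  proof (cases "row_indep (\<lambda>j h. real_of_int (h j)) \<Lambda> J")
    case True
    from ex_square_minor[of "\<lambda>h j. real_of_int (h j)", OF True f\<Lambda> fJ] show ?thesis by (auto simp: \<Lambda>_def)
  next
    case False
    from not_row_indep[OF this] obtain y where y: "\<forall>g\<in>\<Lambda>. (\<Sum>j\<in>J. y j * real_of_int (g j)) = 0"
      "\<exists>j\<in>J. y j \<noteq> 0" by (elim exE conjE)
    obtain j0 where j0: "j0 \<in> J" "y j0 \<noteq> 0" using y(2) by blast
    have "card ?L \<le> (2 * (B div ?R) + 2) ^ card J * ?R ^ (card J - 1)"
    proof (rule card_thin_le[where J = J and ?j0.0 = j0 and y = y, OF fJ finite_lat R j0])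
      show "\<bar>h j\<bar> \<le> int B" if "h \<in> ?L" "j \<in> J" for h j using lat_abs[OF that(1)] that(2) J by auto
      show "h = h'" if "h \<in> ?L" "h' \<in> ?L" "\<And>j. j \<in> J \<Longrightarrow> h j = h' j" for h h' by (rule inj[OF that])
      fix h h' assume h: "h \<in> ?L" "h' \<in> ?L" and near: "\<And>j. j \<in> J \<Longrightarrow> \<bar>h j - h' j\<bar> \<le> int ?R"
      define g where "g = (\<lambda>i\<in>{..<?s}. h i - h' i)"
      have gi: "g i = h i - h' i" if "i < ?s" for i using that by (simp add: g_def)
      have gJ: "g j = h j - h' j" if "j \<in> J" for j using gi that J by auto
      have rel: "real_of_int (g m) = (\<Sum>\<gamma>\<in>J. \<beta> m \<gamma> * real_of_int (g \<gamma>))" if m: "m < ?s" for m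
      proof -
        have "real_of_int (g m) = (\<Sum>\<gamma>\<in>J. \<beta> m \<gamma> * real_of_int (h \<gamma>)) - (\<Sum>\<gamma>\<in>J. \<beta> m \<gamma> * real_of_int (h' \<gamma>))"
          using gi[OF m] \<beta> h m by simp
        also have "\<dots> = (\<Sum>\<gamma>\<in>J. \<beta> m \<gamma> * real_of_int (g \<gamma>))"
          using gJ by (simp add: sum_subtractf[symmetric] right_diff_distrib[symmetric])
        finally show ?thesis .
      qed
      have gb: "\<bar>g m\<bar> \<le> int c" if m: "m < ?s" for m
      proof -
        have "\<bar>real_of_int (g m)\<bar> \<le> (\<Sum>\<gamma>\<in>J. fact ?s * real ?R)"
          unfolding rel[OF m]
        proof (rule order_trans[OF sum_abs], rule sum_mono)
          fix \<gamma> assume g: "\<gamma> \<in> J"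
          have "\<bar>\<beta> m \<gamma>\<bar> \<le> fact ?s" using \<beta>b m g by simp
          moreover have "\<bar>real_of_int (g \<gamma>)\<bar> \<le> real ?R" using near[OF g] gJ[OF g] by linarith
          ultimately show "\<bar>\<beta> m \<gamma> * real_of_int (g \<gamma>)\<bar> \<le> fact ?s * real ?R"
            unfolding abs_mult by (intro mult_mono) auto
        qed
        also have "\<dots> = real (card J) * (fact ?s * real ?R)" by simp
        also have "\<dots> \<le> real ?s * (fact ?s * real ?R)" using cJ by (intro mult_right_mono) auto
        also have "\<dots> = real c" by (simp add: c_def)
        finally show ?thesis by linarith
      qed
      have "sol_eqs l d n g"
        using sol_eqs_diff[of l d n h h'] h sol_eqs_cong[of l g "\<lambda>i. h i - h' i" d n] gi by (simp add: lat_def)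
      moreover have "g \<in> PiE {..<?s} (\<lambda>_. {- int c..int c})"
      proof (rule PiE_I)
        show "g m \<in> {- int c..int c}" if "m \<in> {..<?s}" for m using gb[of m] that by auto
      qed (simp add: g_def)
      ultimately have "g \<in> \<Lambda>" using rel by (simp add: \<Lambda>_def lat_def)
      then have "(\<Sum>j\<in>J. y j * real_of_int (g j)) = 0" using y(1) by blast
      then show "(\<Sum>j\<in>J. y j * real_of_int (h j - h' j)) = 0" using gJ by (simp cong: sum.cong)
    qed
    then show ?thesis by simp
  qed
  then have fin: "card ?L \<le> (2 * (B div ?R) + 2) ^ card J * ?R ^ (card J - 1) \<or>
     (\<exists>G\<subseteq>lat l d (2 * l * fact (2 * l) * ?R) n. card G = card J \<and> row_indep (\<lambda>g j. real_of_int (g j)) J G)"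
    unfolding c_def .
  have rl: "\<forall>j\<in>J. \<exists>(h0::int) h. h0 \<noteq> 0 \<and> \<bar>h0\<bar> \<le> int ((2 * card J * B + 1) ^ card J) \<and>
      (\<forall>i\<in>{..<2*l} - J. \<bar>h i\<bar> \<le> int ((2 * card J * B + 1) ^ card J)) \<and>
      h0 * int (n j) ^ d = (\<Sum>i\<in>{..<2*l} - J. h i * int (n i) ^ d)"
    by (intro ballI integer_relation[OF J ind])
  show ?thesis
    by (intro exI[of _ J] conjI J J0 J1 c1 rl fin)
qed

section \<open>Tuples satisfying several diagonal equations\<close>

lemma ex_dual_coefficients:
  assumes ind: "row_indep f J G" and fin: "finite J" "finite G" "card G = card J" and j: "j \<in> J"
  shows "\<exists>y. \<forall>j'\<in>J. (\<Sum>g\<in>G. y g * f g j') = (if j' = j then 1 else (0::real))"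
proof -
  define I where "I = insert None (Some ` G)"
  define A where "A j' p = (case p of None \<Rightarrow> - (if j' = j then 1 else 0) | Some g \<Rightarrow> f g j')" for j' p
  have I: "finite I" "card J < card I" using fin by (auto simp: I_def card_image)
  from underdetermined_real[OF fin(1) I, of A] obtain y where y: "\<exists>p\<in>I. y p \<noteq> 0"
    "\<forall>j'\<in>J. (\<Sum>p\<in>I. A j' p * y p) = 0" by (elim exE conjE)
  have S: "(\<Sum>p\<in>I. A j' p * y p) = (\<Sum>g\<in>G. y (Some g) * f g j') - (if j' = j then y None else 0)" for j'
    unfolding I_def using fin(2) by (subst sum.insert) (auto simp: sum.reindex A_def mult.commute)
  have rel: "(\<Sum>g\<in>G. y (Some g) * f g j') = (if j' = j then y None else 0)" if "j' \<in> J" for j'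
    using y(2) that unfolding S by simp
  have y0: "y None \<noteq> 0"
  proof
    assume 0: "y None = 0"
    then have "(\<Sum>g\<in>G. y (Some g) * f g j') = 0" if "j' \<in> J" for j' using rel[OF that] by simp
    then have "y (Some g) = 0" if "g \<in> G" for g using row_indepD[OF ind, of "\<lambda>g. y (Some g)" g] that by simp
    then show False using y(1) 0 by (auto simp: I_def)
  qed
  have "(\<Sum>g\<in>G. (y (Some g) / y None) * f g j') = (if j' = j then 1 else 0)" if "j' \<in> J" for j'
  proof -
    have "(\<Sum>g\<in>G. (y (Some g) / y None) * f g j') = (\<Sum>g\<in>G. y (Some g) * f g j') / y None"
      by (simp add: sum_divide_distrib)
    then show ?thesis using rel[OF that] y0 by simp
  qed
  then show ?thesis by (intro exI[of _ "\<lambda>g. y (Some g) / y None"]) simp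
qed

definition adm :: "nat \<Rightarrow> nat \<Rightarrow> (nat \<Rightarrow> nat) set" where
  "adm l N = {n \<in> PiE {..<2*l} (\<lambda>_. {1..N}). inj_on n {..<l} \<and> inj_on n {l..<2*l}}"

lemma finite_adm: "finite (adm l N)"
  by (rule finite_subset[of _ "PiE {..<2*l} (\<lambda>_. {1..N})"]) (auto simp: adm_def finite_PiE)

text \<open>Fix all variables except the one at \<open>i1\<close>. If the constant \<open>c\<close>
  of the remaining curve is nonzero, \<open>power_curve_card\<close> applies. If it is 0, the
  variable at \<open>i2\<close> is determined by the others; this happens for so few choices that
  the trivial bound \<open>N\<close> suffices.\<close>

lemma diagonal_form_card:
  fixes b :: "nat \<Rightarrow> real"
  assumes I: "finite I" "i1 \<in> I" "i2 \<in> I" "i1 \<noteq> i2" "b i1 \<noteq> 0" "b i2 \<noteq> 0" and d: "d \<ge> 2" and N: "N \<ge> 1"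
  shows "real (card {m \<in> PiE I (\<lambda>_. {1..N}). \<exists>z\<in>{1..N}. real z ^ d = (\<Sum>i\<in>I. b i * real (m i) ^ d)})
     \<le> 15 * real N powr (real (card I) - 1/3)"
proof -
  define Y where "Y = {m \<in> PiE I (\<lambda>_. {1..N}). \<exists>z\<in>{1..N}. real z ^ d = (\<Sum>i\<in>I. b i * real (m i) ^ d)}"
  define I1 where "I1 = I - {i1}"
  define c where "c p = (\<Sum>i\<in>I1. b i * real (p i) ^ d)" for p :: "nat \<Rightarrow> nat"
  define Q where "Q = PiE I1 (\<lambda>_. {1..N})"
  define X where "X p = {x\<in>{1..N}. \<exists>z\<in>{1..N}. real z ^ d = b i1 * real x ^ d + c p}" for p
  have fI1: "finite I1" using I by (simp add: I1_def)
  have fQ: "finite Q" using fI1 by (simp add: Q_def finite_PiE)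
  have k2: "card I \<ge> 2" using I card_mono[of I "{i1,i2}"] by simp
  have cI1: "card I1 = card I - 1" using I by (simp add: I1_def)
  define F where "F m = (restrict m I1, m i1)" for m :: "nat \<Rightarrow> nat"
  have "inj_on F Y"
  proof (rule inj_onI)
    fix m m' assume m: "m \<in> Y" "m' \<in> Y" "F m = F m'"
    have "m i = m' i" if "i \<in> I" for i
    proof (cases "i = i1")
      case False
      have "fst (F m) i = fst (F m') i" using m(3) by simp
      then show ?thesis using False that by (simp add: F_def I1_def)
    qed (use m(3) in \<open>simp add: F_def\<close>)
    then show "m = m'" using m(1,2) unfolding Y_def by (intro PiE_ext[of m I _ m']) auto
  qed
  moreover have "F ` Y \<subseteq> (SIGMA p:Q. X p)"
  proof
    fix q assume "q \<in> F ` Y"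
    then obtain m where m: "m \<in> Y" "q = F m" by auto
    then obtain z where z: "z \<in> {1..N}" "real z ^ d = (\<Sum>i\<in>I. b i * real (m i) ^ d)" and mP: "m \<in> PiE I (\<lambda>_. {1..N})"
      by (auto simp: Y_def)
    have "(\<Sum>i\<in>I. b i * real (m i) ^ d) = b i1 * real (m i1) ^ d + (\<Sum>i\<in>I1. b i * real (m i) ^ d)"
      unfolding I1_def by (rule sum.remove[OF I(1,2)])
    also have "(\<Sum>i\<in>I1. b i * real (m i) ^ d) = c (restrict m I1)" by (simp add: c_def)
    finally have "m i1 \<in> X (restrict m I1)" using z mP I(2) by (auto simp: X_def)
    moreover have "restrict m I1 \<in> Q" using mP by (auto simp: Q_def I1_def)
    ultimately show "q \<in> (SIGMA p:Q. X p)" by (simp add: m(2) F_def)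
  qed
  moreover have "finite (SIGMA p:Q. X p)" using fQ by (auto simp: X_def)
  ultimately have "card Y \<le> card (SIGMA p:Q. X p)" by (rule card_inj_on_le)
  also have "\<dots> = (\<Sum>p\<in>Q. card (X p))" using fQ by (intro card_SigmaI) (auto simp: X_def)
  finally have "real (card Y) \<le> (\<Sum>p\<in>Q. real (card (X p)))" by (metis of_nat_le_iff of_nat_sum)
  also have "\<dots> \<le> (\<Sum>p\<in>Q. 14 * real N powr (2/3) + (if c p = 0 then real N else 0))"
  proof (rule sum_mono)
    fix p
    show "real (card (X p)) \<le> 14 * real N powr (2/3) + (if c p = 0 then real N else 0)"
    proof (cases "c p = 0")
      case True
      have "card (X p) \<le> card {1..N}" by (intro card_mono) (auto simp: X_def)
      then show ?thesis using True by (simp add: add_increasing)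
    next
      case False
      then show ?thesis unfolding X_def using power_curve_card[OF I(5) False d N] by simp
    qed
  qed
  also have "\<dots> = real (card Q) * (14 * real N powr (2/3)) + real N * real (card {p\<in>Q. c p = 0})"
    using fQ by (simp add: sum.distrib sum.If_cases Int_def mult.commute)
  also have "real (card Q) = real N ^ (card I - 1)" using fI1 by (simp add: Q_def card_PiE cI1)
  also have "real (card {p\<in>Q. c p = 0}) \<le> real N ^ (card I - 2)"
  proof -
    define I2 where "I2 = I1 - {i2}"
    have cI2: "finite I2" "card I2 = card I - 2" "I1 = insert i2 I2" "i2 \<notin> I2"
      using fI1 cI1 I by (auto simp: I2_def I1_def)
    have "inj_on (\<lambda>p. restrict p I2) {p\<in>Q. c p = 0}"
    proof (rule inj_onI)
      fix p p' assume p: "p \<in> {p\<in>Q. c p = 0}" "p' \<in> {p\<in>Q. c p = 0}" "restrict p I2 = restrict p' I2"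
      have e: "p i = p' i" if "i \<in> I2" for i using fun_cong[OF p(3), of i] that by simp
      have cc: "c q = b i2 * real (q i2) ^ d + (\<Sum>i\<in>I2. b i * real (q i) ^ d)" for q
        unfolding c_def cI2(3) using cI2 by (subst sum.insert) auto
      have "b i2 * real (p i2) ^ d = b i2 * real (p' i2) ^ d"
      proof -
        have "(\<Sum>i\<in>I2. b i * real (p i) ^ d) = (\<Sum>i\<in>I2. b i * real (p' i) ^ d)" using e by simp
        moreover have "c p = 0" "c p' = 0" using p(1,2) by auto
        ultimately show ?thesis using cc[of p] cc[of p'] by linarith
      qed
      then have "real (p i2) ^ d = real (p' i2) ^ d" using I(6) by simp
      then have "real (p i2) = real (p' i2)" using d by (subst (asm) power_eq_iff_eq_base) auto
      then have "p i = p' i" if "i \<in> I1" for i using e that cI2(3) by auto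
      then show "p = p'" using p(1,2) unfolding Q_def by (intro PiE_ext[of p I1 _ p']) auto
    qed
    moreover have "(\<lambda>p. restrict p I2) ` {p\<in>Q. c p = 0} \<subseteq> PiE I2 (\<lambda>_. {1..N})"
    proof
      fix q assume "q \<in> (\<lambda>p. restrict p I2) ` {p\<in>Q. c p = 0}"
      then obtain p where p: "p \<in> Q" "q = restrict p I2" by blast
      have "p i \<in> {1..N}" if "i \<in> I2" for i using p(1) that cI2(3) unfolding Q_def by blast
      then show "q \<in> PiE I2 (\<lambda>_. {1..N})" unfolding p(2) by simp
    qed
    moreover have "finite (PiE I2 (\<lambda>_. {1..N}))" using cI2 by (simp add: finite_PiE)
    ultimately have "card {p\<in>Q. c p = 0} \<le> card (PiE I2 (\<lambda>_. {1..N}))" by (rule card_inj_on_le)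
    then show ?thesis using cI2 by (simp add: card_PiE)
  qed
  finally have "real (card Y) \<le> real N ^ (card I - 1) * (14 * real N powr (2/3)) + real N * real N ^ (card I - 2)"
    using mult_left_mono by fastforce
  also have "real N * real N ^ (card I - 2) = real N ^ (card I - 1)"
  proof -
    have "card I - 1 = Suc (card I - 2)" using k2 by simp
    then show ?thesis by simp
  qed
  also have "real N ^ (card I - 1) * (14 * real N powr (2/3)) + real N ^ (card I - 1)
     \<le> real N ^ (card I - 1) * (15 * real N powr (2/3))"
  proof -
    have "real N powr (2/3) \<ge> 1" using N by (intro ge_one_powr_ge_zero) auto
    then have "real N ^ (card I - 1) * 1 \<le> real N ^ (card I - 1) * real N powr (2/3)" by (intro mult_left_mono) auto
    then show ?thesis by (simp add: algebra_simps)
  qed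
  also have "\<dots> = 15 * real N powr (real (card I) - 1/3)"
  proof -
    have "real N ^ (card I - 1) = real N powr (real (card I) - 1)"
      using N k2 by (subst powr_realpow[symmetric]) (auto simp: of_nat_diff)
    then show ?thesis by (simp add: powr_add[symmetric])
  qed
  finally show ?thesis unfolding Y_def .
qed

text \<open>The extra saving \<open>N\<^bsup>1/3\<^esup>\<close> comes from one equation with at least two free variables:
  if it had only one, the sum conditions on \<open>h\<close> would make two entries of a half of \<open>n\<close> equal.\<close>

lemma spanned_class_card:
  assumes J: "J \<subseteq> {..<2*l}" "J \<noteq> {}" and G: "finite G" "card G = card J" "row_indep (\<lambda>g j. real_of_int (g j)) J G"
    and d: "d \<ge> 2" and N: "N \<ge> 1"
  shows "real (card {n \<in> adm l N. \<forall>g\<in>G. sol_eqs l d n g}) \<le> 15 * real N powr (real (2 * l - card J) - 1/3)"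
proof -
  define NB where "NB = {n \<in> adm l N. \<forall>g\<in>G. sol_eqs l d n g}"
  define I where "I = {..<2*l} - J"
  have fJ: "finite J" using J finite_subset by blast
  have cI: "card I = 2 * l - card J" using J by (simp add: I_def card_Diff_subset fJ)
  show ?thesis
  proof (cases "NB = {}")
    case True then show ?thesis unfolding NB_def[symmetric] by simp
  next
    case False
    then obtain n0 where n0: "n0 \<in> NB" by auto
    define y where "y j = (SOME y. \<forall>j'\<in>J. (\<Sum>g\<in>G. y g * real_of_int (g j')) = (if j' = j then 1 else (0::real)))" for j
    have y: "(\<Sum>g\<in>G. y j g * real_of_int (g j')) = (if j' = j then 1 else 0)" if "j \<in> J" "j' \<in> J" for j j'
      using someI_ex[OF ex_dual_coefficients[OF G(3) fJ G(1,2) that(1)]] that(2) unfolding y_def by blast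
    \<comment> \<open>Dual basis: the combination \<open>b j\<close> of the spanning vectors is 1 at
      \<open>j\<close> and 0 at the other pivots, so every pivot entry of a tuple is determined by
      the entries outside \<open>J\<close>.\<close>
    define b where "b j i = (\<Sum>g\<in>G. y j g * real_of_int (g i))" for j i
    have sw: "(\<Sum>i\<in>H. b j i * w i) = (\<Sum>g\<in>G. y j g * (\<Sum>i\<in>H. real_of_int (g i) * w i))" for j H and w :: "nat \<Rightarrow> real"
      unfolding b_def sum_distrib_right sum_distrib_left by (subst sum.swap) (simp add: mult.assoc)
    have half: "(\<Sum>i<l. b j i) = 0" "(\<Sum>i=l..<2*l. b j i) = 0" for j
    proof -
      have g: "(\<Sum>i<l. real_of_int (g i)) = 0" "(\<Sum>i=l..<2*l. real_of_int (g i)) = 0" if "g \<in> G" for g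
      proof -
        have "sol_eqs l d n0 g" using n0 that by (simp add: NB_def)
        then have "(\<Sum>i<l. g i) = 0" "(\<Sum>i=l..<2*l. g i) = 0" by (simp_all add: sol_eqs_def)
        then have "real_of_int (\<Sum>i<l. g i) = 0" "real_of_int (\<Sum>i=l..<2*l. g i) = 0" by simp_all
        then show "(\<Sum>i<l. real_of_int (g i)) = 0" "(\<Sum>i=l..<2*l. real_of_int (g i)) = 0" by simp_all
      qed
      show "(\<Sum>i<l. b j i) = 0" using sw[where w = "\<lambda>_. 1" and H = "{..<l}" and j = j] g by simp
      show "(\<Sum>i=l..<2*l. b j i) = 0" using sw[where w = "\<lambda>_. 1" and H = "{l..<2*l}" and j = j] g by simp
    qed
    have bJ: "b j j' = (if j' = j then 1 else 0)" if "j \<in> J" "j' \<in> J" for j j' using y[OF that] by (simp add: b_def)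
    have nj: "real (n j) ^ d = (\<Sum>i\<in>I. (- b j i) * real (n i) ^ d)" if j: "j \<in> J" and n: "n \<in> NB" for j n
    proof -
      have "(\<Sum>i<2*l. real_of_int (g i) * real (n i) ^ d) = 0" if "g \<in> G" for g
      proof -
        have "(\<Sum>i<2*l. g i * int (n i) ^ d) = 0" using n that by (simp add: NB_def sol_eqs_def)
        then have "real_of_int (\<Sum>i<2*l. g i * int (n i) ^ d) = 0" by simp
        then show ?thesis by simp
      qed
      then have "(\<Sum>i<2*l. b j i * real (n i) ^ d) = 0" unfolding sw by simp
      moreover have "(\<Sum>i<2*l. b j i * real (n i) ^ d) = (\<Sum>i\<in>J. b j i * real (n i) ^ d) + (\<Sum>i\<in>I. b j i * real (n i) ^ d)"
        unfolding I_def using J by (simp add: sum.subset_diff add.commute)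
      moreover have "(\<Sum>i\<in>J. b j i * real (n i) ^ d) = (\<Sum>i\<in>{j}. b j i * real (n i) ^ d)"
        using bJ[OF j] j fJ by (intro sum.mono_neutral_right) auto
      ultimately show ?thesis using bJ[OF j j] by (simp add: sum_negf)
    qed
    obtain j where j: "j \<in> J" using J(2) by auto
    define H where "H = (if j < l then {..<l} else {l..<2*l})"
    have H: "j \<in> H" "H \<subseteq> {..<2*l}" "(\<Sum>i\<in>H. b j i) = 0" "inj_on n0 H"
      using j J half[of j] n0 by (auto simp: H_def NB_def adm_def)
    have fH: "finite H" using H(2) finite_subset by blast
    have sH: "(\<Sum>i\<in>H. b j i) = (\<Sum>i\<in>H \<inter> J. b j i) + (\<Sum>i\<in>H \<inter> I. b j i)"
      using fH H(2) by (subst sum.union_disjoint[symmetric]) (auto simp: I_def intro!: sum.cong)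
    have "(\<Sum>i\<in>H \<inter> J. b j i) = (\<Sum>i\<in>{j}. b j i)"
      using bJ[OF j] j H(1) fH by (intro sum.mono_neutral_right) auto
    \<comment> \<open>In the half containing \<open>j\<close> the pivots contribute only
      \<open>b j j = 1\<close>, while the whole half sums to 0; so some coefficient outside
      \<open>J\<close> in this half is nonzero.\<close>
    then have s1: "(\<Sum>i\<in>H \<inter> I. b j i) = -1" using sH H(3) bJ[OF j j] by simp
    then have "\<exists>i1\<in>H \<inter> I. b j i1 \<noteq> 0" by (metis sum.neutral neg_equal_0_iff_equal zero_neq_one)
    then obtain i1 where i1: "i1 \<in> H" "i1 \<in> I" "b j i1 \<noteq> 0" by auto
    have "\<exists>i2\<in>I. i2 \<noteq> i1 \<and> b j i2 \<noteq> 0"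
    proof (rule ccontr)
      assume "\<not> ?thesis"
      then have z: "b j i = 0" if "i \<in> I" "i \<noteq> i1" for i using that by auto
      have "(\<Sum>i\<in>H \<inter> I. b j i) = (\<Sum>i\<in>{i1}. b j i)"
        using z i1 fH by (intro sum.mono_neutral_right) auto
      then have "b j i1 = -1" using s1 by simp
      moreover have "(\<Sum>i\<in>I. (- b j i) * real (n0 i) ^ d) = (\<Sum>i\<in>{i1}. (- b j i) * real (n0 i) ^ d)"
        using z i1 by (intro sum.mono_neutral_right) (auto simp: I_def)
      ultimately have "real (n0 j) ^ d = real (n0 i1) ^ d" using nj[OF j n0] by simp
      then have "real (n0 j) = real (n0 i1)" using d by (subst (asm) power_eq_iff_eq_base) auto
      then have "j = i1" using H(1,4) i1(1) by (auto simp: inj_on_def)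
      then show False using i1(2) j by (simp add: I_def)
    qed
    then obtain i2 where i2: "i2 \<in> I" "i2 \<noteq> i1" "b j i2 \<noteq> 0" by auto
    define Y where "Y = {m \<in> PiE I (\<lambda>_. {1..N}). \<exists>z\<in>{1..N}. real z ^ d = (\<Sum>i\<in>I. (- b j i) * real (m i) ^ d)}"
    have "inj_on (\<lambda>n. restrict n I) NB"
    proof (rule inj_onI)
      fix n n' assume n: "n \<in> NB" "n' \<in> NB" "restrict n I = restrict n' I"
      have e: "n i = n' i" if "i \<in> I" for i using fun_cong[OF n(3), of i] that by simp
      have "n i = n' i" if "i < 2 * l" for i
      proof (cases "i \<in> J")
        case True
        have "real (n i) ^ d = real (n' i) ^ d"
          unfolding nj[OF True n(1)] nj[OF True n(2)] using e by simp
        then show ?thesis using d by (subst (asm) power_eq_iff_eq_base) auto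
      qed (use e that in \<open>auto simp: I_def\<close>)
      then show "n = n'" using n(1,2) unfolding NB_def adm_def by (intro PiE_ext[of n "{..<2*l}" _ n']) auto
    qed
    moreover have "(\<lambda>n. restrict n I) ` NB \<subseteq> Y"
    proof
      fix m assume "m \<in> (\<lambda>n. restrict n I) ` NB"
      then obtain n where n: "n \<in> NB" "m = restrict n I" by auto
      have nP: "n \<in> PiE {..<2*l} (\<lambda>_. {1..N})" using n(1) by (simp add: NB_def adm_def)
      have "real (n j) ^ d = (\<Sum>i\<in>I. (- b j i) * real (m i) ^ d)"
        using nj[OF j n(1)] unfolding n(2) by simp
      moreover have "n j \<in> {1..N}" using nP j J by auto
      moreover have "m \<in> PiE I (\<lambda>_. {1..N})" using nP unfolding n(2) by (auto simp: I_def)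
      ultimately show "m \<in> Y" unfolding Y_def by blast
    qed
    moreover have "finite Y" unfolding Y_def
      by (rule finite_subset[of _ "PiE I (\<lambda>_. {1..N})"]) (auto simp: finite_PiE I_def)
    ultimately have "card NB \<le> card Y" by (rule card_inj_on_le)
    also have "real (card Y) \<le> 15 * real N powr (real (card I) - 1/3)"
      unfolding Y_def by (rule diagonal_form_card[OF _ i1(2) i2(1) _ _ _ d N]) (use i1 i2 in \<open>auto simp: I_def\<close>)
    finally show ?thesis unfolding NB_def cI by simp
  qed
qed

section \<open>Choice of parameters and the final count of additive relations\<close>

lemma growth_parameters:
  fixes s r :: nat
  assumes s: "s \<ge> 6" and r: "1 \<le> r" "r < s"
    and k: "k = s - r" and n: "n = 4 * (k + 1)" and \<nu>: "\<nu> = 10 * n * s * r\<^sup>2"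
  shows "(s ^ 11) ^ n > (s ^ 11 + 1) ^ k * (8 * \<nu> * n) ^ n"
proof -
  define t where "t = k + 1"
  have tr: "t + r = s + 1" using k r by (simp add: t_def)
  \<comment> \<open>Since \<open>t + r = s + 1\<close> is fixed, the product \<open>t * r\<close> is
    controlled by \<open>s\<close> alone; this keeps \<open>8 * \<nu> * n\<close> below
    \<open>s ^ 8\<close> for every rank \<open>r\<close>.\<close>
  have "4 * int t * int r \<le> (int t + int r)\<^sup>2"
    using zero_le_power2[of "int t - int r"] by (simp add: power2_eq_square algebra_simps)
  then have "4 * int t * int r \<le> (int (s + 1))\<^sup>2" using tr by (metis of_nat_add)
  then have "int (4 * t * r) \<le> int ((s + 1)\<^sup>2)" by simp
  then have "4 * t * r \<le> (s + 1)\<^sup>2" by (simp only: of_nat_le_iff)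
  then have "(4 * t * r)\<^sup>2 \<le> ((s + 1)\<^sup>2)\<^sup>2" by (rule power_mono) simp
  then have b: "(4 * t * r)\<^sup>2 \<le> (s + 1) ^ 4" by simp
  have "8 * \<nu> * n = 80 * s * (4 * t * r)\<^sup>2" unfolding \<nu> n t_def[symmetric] by (simp add: power2_eq_square)
  also have "\<dots> \<le> 80 * s * (s + 1) ^ 4" using b by (intro mult_left_mono) auto
  also have "\<dots> \<le> s ^ 8"
  proof -
    have "(6 * (s + 1)) ^ 4 \<le> (7 * s) ^ 4" using s by (intro power_mono) auto
    then have "1296 * (s + 1) ^ 4 \<le> 2401 * s ^ 4" unfolding power_mult_distrib by simp
    then have "1296 * (80 * (s + 1) ^ 4) \<le> 192080 * s ^ 4" by simp
    also have "\<dots> \<le> 1296 * (216 * s ^ 4)" by simp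
    also have "216 * s ^ 4 \<le> s ^ 3 * s ^ 4"
    proof -
      have "(6::nat) ^ 3 \<le> s ^ 3" using s by (intro power_mono) auto
      then show ?thesis by (intro mult_right_mono) auto
    qed
    finally have "80 * (s + 1) ^ 4 \<le> s ^ 7" by (simp add: power_add[symmetric])
    then have "s * (80 * (s + 1) ^ 4) \<le> s * s ^ 7" by (rule mult_left_mono) simp
    then show ?thesis by (simp add: mult_ac power_Suc[symmetric] del: power_Suc)
  qed
  finally have a: "8 * \<nu> * n \<le> s ^ 8" .
  have "s ^ 11 + 1 \<le> s ^ 11 + s ^ 11" using s by simp
  also have "\<dots> \<le> s * s ^ 11" using s by (simp add: mult_2[symmetric])
  finally have e: "s ^ 11 + 1 \<le> s ^ 12" by (simp add: power_Suc[symmetric] del: power_Suc)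
  have "(s ^ 11 + 1) ^ k * (8 * \<nu> * n) ^ n \<le> (s ^ 12) ^ k * (s ^ 8) ^ n"
    by (intro mult_le_mono power_mono a e) auto
  also have "\<dots> = s ^ (12 * k + 8 * n)" by (simp add: power_mult[symmetric] power_add)
  \<comment> \<open>The exponents compare because \<open>12 * k < 3 * n = 12 * (k + 1)\<close>; this
    is the reason for \<open>n = 4 * (k + 1)\<close>.\<close>
  also have "\<dots> < s ^ (11 * n)" using s unfolding n by (intro power_strict_increasing) auto
  finally show ?thesis by (simp add: power_mult)
qed

lemma card_Sigma_le:
  assumes "finite M" "\<And>n. n \<in> M \<Longrightarrow> finite (L n) \<and> real (card (L n)) \<le> X"
  shows "real (card (SIGMA n:M. L n)) \<le> real (card M) * X"
proof -
  have "real (card (SIGMA n:M. L n)) = (\<Sum>n\<in>M. real (card (L n)))"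
    using assms by (subst card_SigmaI) auto
  also have "\<dots> \<le> (\<Sum>n\<in>M. X)" using assms by (intro sum_mono) auto
  finally show ?thesis by simp
qed

locale relation_count =
  fixes l d A :: nat
  assumes l: "l \<ge> 3" and d: "d > (2 * l) ^ (4 * l)" and A: "A \<ge> 1"
begin

abbreviation s :: nat where "s \<equiv> 2 * l"
text \<open>Exponent of the cut-off for short vectors: sets of \<open>r\<close> vectors in dimension
  \<open>s\<close> with entries of size \<open>N powr \<sigma> r\<close> number at most a constant
  times \<open>N powr (1/4)\<close>, below the extra saving \<open>N powr (1/3)\<close> of
  \<open>spanned_class_card\<close>.\<close>

abbreviation \<sigma> :: "nat \<Rightarrow> real" where "\<sigma> r \<equiv> 1 / (4 * real s * real r)"

definition Rad :: "nat \<Rightarrow> nat \<Rightarrow> nat" where "Rad N r = nat \<lceil>real N powr \<sigma> r\<rceil>"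

lemma Rad:
  assumes "N \<ge> 1" "r \<ge> 1"
  shows "real N powr \<sigma> r \<le> real (Rad N r)" "real (Rad N r) \<le> 2 * real N powr \<sigma> r" "Rad N r \<ge> 1" "Rad N r \<le> N"
proof -
  have p1: "real N powr \<sigma> r \<ge> 1" using assms by (intro ge_one_powr_ge_zero) auto
  then show "real N powr \<sigma> r \<le> real (Rad N r)" "real (Rad N r) \<le> 2 * real N powr \<sigma> r"
    unfolding Rad_def by linarith+
  then show "Rad N r \<ge> 1" using p1 by linarith
  have "1 * 1 \<le> real s * real r" using l assms by (intro mult_mono) auto
  then have "\<sigma> r \<le> 1" by (simp add: field_simps)
  then have "real N powr \<sigma> r \<le> real N powr 1" using assms by (intro powr_mono) auto
  then have "\<lceil>real N powr \<sigma> r\<rceil> \<le> int N" using assms by (simp add: ceiling_le_iff)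
  then show "Rad N r \<le> N" unfolding Rad_def by (simp only: nat_le_iff)
qed

text \<open>Candidates for a pivot entry of a tuple. They depend on \<open>m\<close> only outside
  \<open>J\<close>, so the other entries can be fixed first.\<close>

definition Srel :: "nat set \<Rightarrow> nat \<Rightarrow> (nat \<Rightarrow> nat) \<Rightarrow> nat set" where
  "Srel J N m = {x\<in>{1..N}. \<exists>(h0::int) h. h0 \<noteq> 0 \<and> \<bar>real_of_int h0\<bar> \<le> ((2 * card J * A + 1) ^ card J) * real N ^ card J \<and>
       (\<forall>i\<in>{..<s} - J. \<bar>real_of_int (h i)\<bar> \<le> ((2 * card J * A + 1) ^ card J) * real N ^ card J) \<and>
       of_int h0 * real x ^ d = (\<Sum>i\<in>{..<s} - J. real (m i) ^ d * of_int (h i))}"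

lemma card_Srel_le:
  assumes J: "J \<subseteq> {..<s}" "J \<noteq> {}" "J \<noteq> {..<s}"
  shows "\<exists>C\<ge>0. \<forall>N\<ge>1. \<forall>m. real (card (Srel J N m)) \<le> C * real N powr (1 / (5 * real s * (real (card J))\<^sup>2))"
proof -
  define r where "r = card J"
  have fJ: "finite J" using J finite_subset by blast
  have r: "1 \<le> r" "r < s" using J fJ psubset_card_mono[of "{..<s}" J]
    by (auto simp: r_def Suc_le_eq card_gt_0_iff)
  define k where "k = s - r"
  define n where "n = 4 * (k + 1)"
  define \<nu> where "\<nu> = 10 * n * s * r\<^sup>2"
  have s6: "s \<ge> 6" using l by simp
  have g: "(s ^ 11) ^ n > (s ^ 11 + 1) ^ k * (8 * \<nu> * n) ^ n"
    by (rule growth_parameters[OF s6 r k_def n_def \<nu>_def])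
  have n1: "n \<ge> 1" by (simp add: n_def)
  have \<nu>1: "\<nu> \<ge> 1" using n1 l r by (simp add: \<nu>_def Suc_le_eq)
  \<comment> \<open>Here the size of \<open>d\<close> enters: with \<open>E = s ^ 11\<close> the
    sparsity bound needs \<open>d > r * E + 1\<close>, and \<open>s ^ 12 \<le> s ^ (4 * l)\<close>
    because \<open>l \<ge> 3\<close>.\<close>
  have "r * s ^ 11 + 1 \<le> (s - 1) * s ^ 11 + s ^ 11" using r s6 by (intro add_mono mult_right_mono) auto
  also have "\<dots> = (Suc (s - 1)) * s ^ 11" by simp
  also have "\<dots> = s ^ 12" using s6 by (simp add: power_Suc[symmetric] del: power_Suc)
  also have "\<dots> \<le> s ^ (4 * l)" using l by (intro power_increasing) auto
  also have "\<dots> < d" using d by simp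
  finally have dd: "r * s ^ 11 + 1 < d" .
  have A0: "(2 * r * A + 1) ^ r \<ge> 1" by simp
  from sparse_power_span[OF \<nu>1 A0 n1 dd g, where 'i = nat] obtain C where
    C: "\<forall>N\<ge>1. \<forall>I c S. finite (I::nat set) \<longrightarrow> card I = k \<longrightarrow> S \<subseteq> {1..N} \<longrightarrow>
    (\<forall>x\<in>S. \<exists>(h0::int) h. h0 \<noteq> 0 \<and> \<bar>real_of_int h0\<bar> \<le> ((2 * r * A + 1) ^ r) * real N ^ r \<and>
       (\<forall>i\<in>I. \<bar>real_of_int (h i)\<bar> \<le> ((2 * r * A + 1) ^ r) * real N ^ r) \<and>
       of_int h0 * real x ^ d = (\<Sum>i\<in>I. c i * of_int (h i))) \<longrightarrow>
    real (card S) \<le> C * real N powr (2 * real n / real \<nu>)" by (elim exE)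
  \<comment> \<open>\<nu> was set to \<open>10 * n * s * r\<^sup>2\<close> to obtain this exponent:
    for all \<open>r\<close> pivots together it amounts to \<open>1 / (5 * s * r)\<close>, just
    below the gain \<open>1 / (4 * s * r)\<close> from a thin lattice.\<close>
  have ex: "2 * real n / real \<nu> = 1 / (5 * real s * (real r)\<^sup>2)" using n1 by (simp add: \<nu>_def)
  have cI: "card ({..<s} - J) = k" using J fJ by (simp add: card_Diff_subset k_def r_def)
  have "real (card (Srel J N m)) \<le> \<bar>C\<bar> * real N powr (1 / (5 * real s * (real r)\<^sup>2))" if N: "N \<ge> 1" for N m
  proof -
    have "real (card (Srel J N m)) \<le> C * real N powr (2 * real n / real \<nu>)"
      by (rule C[rule_format, OF N _ cI, where c = "\<lambda>i. real (m i) ^ d"]) (auto simp: Srel_def r_def)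
    also have "\<dots> \<le> \<bar>C\<bar> * real N powr (2 * real n / real \<nu>)" by (intro mult_right_mono) auto
    finally show ?thesis unfolding ex .
  qed
  then show ?thesis unfolding r_def by (intro exI[of _ "\<bar>C\<bar>"]) auto
qed

definition NA :: "nat set \<Rightarrow> nat \<Rightarrow> (nat \<Rightarrow> nat) set" where
  "NA J N = {n \<in> PiE {..<s} (\<lambda>_. {1..N}). \<forall>j\<in>J. n j \<in> Srel J N n}"

lemma card_NA_le:
  assumes J: "J \<subseteq> {..<s}" "J \<noteq> {}" "J \<noteq> {..<s}"
  shows "\<exists>C\<ge>0. \<forall>N\<ge>1. real (card (NA J N)) \<le> C * real N powr (real (s - card J) + 1 / (5 * real s * real (card J)))"
proof -
  define r where "r = card J"
  define I where "I = {..<s} - J"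
  have fJ: "finite J" using J finite_subset by blast
  have r1: "r \<ge> 1" using J fJ by (simp add: r_def Suc_le_eq card_gt_0_iff)
  have cI: "finite I" "card I = s - r" using J fJ by (auto simp: I_def card_Diff_subset r_def)
  from card_Srel_le[OF J] obtain C where C: "C \<ge> 0"
    "\<forall>N\<ge>1. \<forall>m. real (card (Srel J N m)) \<le> C * real N powr (1 / (5 * real s * (real r)\<^sup>2))"
    unfolding r_def by (elim exE conjE)
  have "real (card (NA J N)) \<le> C ^ r * real N powr (real (s - r) + 1 / (5 * real s * real r))" if N: "N \<ge> 1" for N
  proof -
    let ?T = "SIGMA m:PiE I (\<lambda>_. {1..N}). PiE J (\<lambda>_. Srel J N m)"
    have fS: "finite (Srel J N m)" for m by (simp add: Srel_def)
    have fP: "finite (PiE I (\<lambda>_. {1..N}))" using cI by (simp add: finite_PiE)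
    have "inj_on (\<lambda>n. (restrict n I, restrict n J)) (NA J N)"
    proof (rule inj_onI)
      fix n n' assume n: "n \<in> NA J N" "n' \<in> NA J N" "(restrict n I, restrict n J) = (restrict n' I, restrict n' J)"
      then have e: "restrict n I = restrict n' I" "restrict n J = restrict n' J" by auto
      have "n i = n' i" if "i < s" for i
        using fun_cong[OF e(1), of i] fun_cong[OF e(2), of i] that by (cases "i \<in> J") (auto simp: I_def)
      then show "n = n'" using n(1,2) unfolding NA_def by (intro PiE_ext[of n "{..<s}" _ n']) auto
    qed
    moreover have "(\<lambda>n. (restrict n I, restrict n J)) ` NA J N \<subseteq> ?T"
    proof
      fix p assume "p \<in> (\<lambda>n. (restrict n I, restrict n J)) ` NA J N"
      then obtain n where n: "n \<in> NA J N" "p = (restrict n I, restrict n J)" by auto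
      have "Srel J N (restrict n I) = Srel J N n" unfolding Srel_def I_def by simp
      moreover have "restrict n I \<in> PiE I (\<lambda>_. {1..N})" using n(1) by (auto simp: NA_def I_def)
      moreover have "restrict n J \<in> PiE J (\<lambda>_. Srel J N n)" using n(1) by (auto simp: NA_def)
      ultimately show "p \<in> ?T" by (simp add: n(2))
    qed
    moreover have "finite ?T" using fP fS fJ by (auto simp: finite_PiE)
    ultimately have "card (NA J N) \<le> card ?T" by (rule card_inj_on_le)
    also have "real (card ?T) \<le> real (card (PiE I (\<lambda>_. {1..N}))) * (C * real N powr (1 / (5 * real s * (real r)\<^sup>2))) ^ r"
    proof (rule card_Sigma_le[OF fP], rule conjI)
      fix m
      show "finite (PiE J (\<lambda>_. Srel J N m))" using fJ fS by (simp add: finite_PiE)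
      have "real (card (PiE J (\<lambda>_. Srel J N m))) = real (card (Srel J N m)) ^ r" using fJ by (simp add: card_PiE r_def)
      also have "\<dots> \<le> (C * real N powr (1 / (5 * real s * (real r)\<^sup>2))) ^ r"
        using C(2) N by (intro power_mono) auto
      finally show "real (card (PiE J (\<lambda>_. Srel J N m))) \<le> (C * real N powr (1 / (5 * real s * (real r)\<^sup>2))) ^ r" .
    qed
    also have "real (card (PiE I (\<lambda>_. {1..N}))) = real N powr real (s - r)"
      using cI N by (simp add: card_PiE powr_realpow)
    also have "(C * real N powr (1 / (5 * real s * (real r)\<^sup>2))) ^ r = C ^ r * real N powr (1 / (5 * real s * real r))"
    proof -
      have "(real N powr (1 / (5 * real s * (real r)\<^sup>2))) ^ r = real N powr (1 / (5 * real s * (real r)\<^sup>2) * real r)"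
        using N by (simp add: powr_realpow[symmetric] powr_powr)
      also have "1 / (5 * real s * (real r)\<^sup>2) * real r = 1 / (5 * real s * real r)"
        using r1 l by (simp add: power2_eq_square)
      finally show ?thesis by (simp add: power_mult_distrib)
    qed
    also have "real N powr real (s - r) * (C ^ r * real N powr (1 / (5 * real s * real r)))
      = C ^ r * real N powr (real (s - r) + 1 / (5 * real s * real r))" by (simp add: powr_add)
    finally show ?thesis by simp
  qed
  then show ?thesis using C(1) unfolding r_def by (intro exI[of _ "C ^ card J"]) auto
qed

text \<open>The margin left in the thin case:
  \<open>1 / (4 * s * r) - 1 / (5 * s * r) = 1 / (20 * s * r)\<close>, and
  \<open>r < s\<close>.\<close>

abbreviation \<delta> :: real where "\<delta> \<equiv> 1 / (20 * (real s)\<^sup>2)"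

definition UA :: "nat set \<Rightarrow> nat \<Rightarrow> ((nat \<Rightarrow> nat) \<times> (nat \<Rightarrow> int)) set" where
  "UA J N = (SIGMA n:{n \<in> NA J N. card (lat l d (A * N) n) \<le>
       (2 * ((A * N) div Rad N (card J)) + 2) ^ card J * Rad N (card J) ^ (card J - 1)}. lat l d (A * N) n)"

text \<open>Three exponents add up: \<open>s - r\<close> for the entries outside \<open>J\<close>,
  \<open>1 / (5 * s * r)\<close> for all pivot entries, and \<open>r - \<sigma> r\<close> for the
  vectors of a thin lattice.\<close>

lemma card_UA_le:
  assumes J: "J \<subseteq> {..<s}" "J \<noteq> {}" "J \<noteq> {..<s}"
  shows "\<exists>C\<ge>0. \<forall>N\<ge>1. real (card (UA J N)) \<le> C * real N powr (real s - \<delta>)"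
proof -
  define r where "r = card J"
  have fJ: "finite J" using J finite_subset by blast
  have r: "1 \<le> r" "r < s" using J fJ psubset_card_mono[of "{..<s}" J]
    by (auto simp: r_def Suc_le_eq card_gt_0_iff)
  from card_NA_le[OF J] obtain C where C: "C \<ge> 0"
    "\<forall>N\<ge>1. real (card (NA J N)) \<le> C * real N powr (real (s - r) + 1 / (5 * real s * real r))"
    unfolding r_def by (elim exE conjE)
  have "real (card (UA J N)) \<le> C * (2 * real A + 2) ^ r * real N powr (real s - \<delta>)" if N: "N \<ge> 1" for N
  proof -
    let ?R = "Rad N r"
    note R = Rad[OF N r(1)]
    define X where "X = real ((2 * ((A * N) div ?R) + 2) ^ r * ?R ^ (r - 1))"
    have R0: "real ?R > 0" using R(3) by simp
    have XB: "X \<le> (2 * real A + 2) ^ r * real N powr (real r - \<sigma> r)"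
    proof -
      have "real ((A * N) div ?R * ?R) \<le> real (A * N)" by (simp only: of_nat_le_iff div_times_less_eq_dividend)
      then have "real ((A * N) div ?R) \<le> real A * real N / real ?R" using R0 by (simp add: pos_le_divide_eq)
      moreover have "1 \<le> real N / real ?R" using R(4) R0 by simp
      moreover have "(2 * real A + 2) * (real N / real ?R) = 2 * (real A * real N / real ?R) + 2 * (real N / real ?R)"
        by (simp add: distrib_right add_divide_distrib)
      ultimately have "2 * real ((A * N) div ?R) + 2 \<le> (2 * real A + 2) * (real N / real ?R)"
        by linarith
      then have "(2 * real ((A * N) div ?R) + 2) ^ r \<le> ((2 * real A + 2) * (real N / real ?R)) ^ r"
        by (intro power_mono) auto
      then have "X \<le> ((2 * real A + 2) * (real N / real ?R)) ^ r * real ?R ^ (r - 1)"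
      proof -
        have "X = (2 * real ((A * N) div ?R) + 2) ^ r * real ?R ^ (r - 1)" by (simp add: X_def add.commute)
        then show ?thesis
          using mult_right_mono[OF \<open>(2 * real ((A * N) div ?R) + 2) ^ r \<le> ((2 * real A + 2) * (real N / real ?R)) ^ r\<close>, of "real ?R ^ (r - 1)"]
          by simp
      qed
      also have "\<dots> = (2 * real A + 2) ^ r * real N ^ r * (real ?R ^ (r - 1) / real ?R ^ r)"
        by (simp add: power_mult_distrib power_divide)
      also have "real ?R ^ (r - 1) / real ?R ^ r = 1 / real ?R"
      proof -
        have "real ?R ^ r = real ?R * real ?R ^ (r - 1)" using r by (simp add: power_Suc[symmetric] del: power_Suc)
        then show ?thesis using R0 by simp
      qed
      also have "(2 * real A + 2) ^ r * real N ^ r * (1 / real ?R) \<le> (2 * real A + 2) ^ r * real N ^ r * (1 / real N powr \<sigma> r)"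
        using R(1) R0 N by (intro mult_left_mono divide_left_mono) auto
      also have "\<dots> = (2 * real A + 2) ^ r * real N powr (real r - \<sigma> r)"
        using N by (simp add: powr_diff powr_realpow)
      finally show ?thesis .
    qed
    have fN: "finite (NA J N)"
      by (rule finite_subset[of _ "PiE {..<s} (\<lambda>_. {1..N})"]) (auto simp: NA_def finite_PiE)
    have "real (card (UA J N)) \<le> real (card {n \<in> NA J N. card (lat l d (A * N) n) \<le>
       (2 * ((A * N) div ?R) + 2) ^ r * ?R ^ (r - 1)}) * X"
      unfolding UA_def r_def[symmetric]
    proof (rule card_Sigma_le, goal_cases)
      case 1 then show ?case using fN by simp
    next
      case (2 n)
      then have "card (lat l d (A * N) n) \<le> (2 * ((A * N) div ?R) + 2) ^ r * ?R ^ (r - 1)" by simp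
      then show ?case unfolding X_def using finite_lat by (simp only: of_nat_le_iff)
    qed
    also have "\<dots> \<le> real (card (NA J N)) * X"
      using fN by (intro mult_right_mono) (auto simp: X_def intro: card_mono)
    also have "\<dots> \<le> (C * real N powr (real (s - r) + 1 / (5 * real s * real r))) * ((2 * real A + 2) ^ r * real N powr (real r - \<sigma> r))"
      using C N XB by (intro mult_mono) (auto simp: X_def)
    also have "\<dots> = C * (2 * real A + 2) ^ r * real N powr (real (s - r) + 1 / (5 * real s * real r) + (real r - \<sigma> r))"
      by (simp only: powr_add mult_ac)
    also have "\<dots> \<le> C * (2 * real A + 2) ^ r * real N powr (real s - \<delta>)"
    proof (intro mult_left_mono powr_mono)
      have "real (s - r) = real s - real r" using r by (simp add: of_nat_diff)
      moreover have "1 / (5 * real s * real r) - \<sigma> r = - (1 / (20 * (real s * real r)))"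
        using r l by (simp add: field_simps)
      moreover have "\<delta> \<le> 1 / (20 * (real s * real r))"
        using r l by (intro divide_left_mono) (auto simp: power2_eq_square intro!: mult_left_mono mult_pos_pos)
      ultimately show "real (s - r) + 1 / (5 * real s * real r) + (real r - \<sigma> r) \<le> real s - \<delta>" by linarith
    qed (use C N in auto)
    finally show ?thesis .
  qed
  then show ?thesis using C(1) by (intro exI[of _ "C * (2 * real A + 2) ^ r"]) auto
qed

definition GB :: "nat set \<Rightarrow> nat \<Rightarrow> (nat \<Rightarrow> int) set set" where
  "GB J N = {G. G \<subseteq> PiE {..<s} (\<lambda>_. {- int (2 * l * fact (2 * l) * Rad N (card J))..int (2 * l * fact (2 * l) * Rad N (card J))}) \<and>
     card G = card J \<and> row_indep (\<lambda>g j. real_of_int (g j)) J G}"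

definition UB :: "nat set \<Rightarrow> nat \<Rightarrow> ((nat \<Rightarrow> nat) \<times> (nat \<Rightarrow> int)) set" where
  "UB J N = (SIGMA n:(\<Union>G\<in>GB J N. {n \<in> adm l N. (\<forall>g\<in>G. sol_eqs l d n g)}) \<inter> {n. card (lat l d (A * N) n) \<le>
       (2 * (A * N) + 1) ^ card J}. lat l d (A * N) n)"

text \<open>Exponents: 1/4 for the choice of the spanning set, \<open>s - r - 1/3\<close> for the
  tuples it annihilates, and \<open>r\<close> for the lattice vectors by the trivial bound; in total
  \<open>s - 1/12\<close>.\<close>

lemma card_UB_le:
  assumes J: "J \<subseteq> {..<s}" "J \<noteq> {}" "J \<noteq> {..<s}"
  shows "\<exists>C\<ge>0. \<forall>N\<ge>1. real (card (UB J N)) \<le> C * real N powr (real s - \<delta>)"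
proof -
  define r where "r = card J"
  have fJ: "finite J" using J finite_subset by blast
  have r: "1 \<le> r" "r < s" using J fJ psubset_card_mono[of "{..<s}" J]
    by (auto simp: r_def Suc_le_eq card_gt_0_iff)
  define c0 where "c0 = 2 * l * fact (2 * l)"
  define C where "C = (2 * (2 * real c0 + 1)) ^ (s * r) * 15 * (2 * real A + 1) ^ r"
  have d2: "d \<ge> 2"
  proof -
    have "(2::nat) ^ 1 \<le> (2 * l) ^ (4 * l)" using l by (intro power_mono[THEN order_trans, OF _ _ power_increasing]) auto
    then show ?thesis using d by simp
  qed
  have "real (card (UB J N)) \<le> C * real N powr (real s - \<delta>)" if N: "N \<ge> 1" for N
  proof -
    let ?R = "Rad N r"
    note R = Rad[OF N r(1)]
    let ?P = "PiE {..<s} (\<lambda>_. {- int (c0 * ?R)..int (c0 * ?R)})"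
    have fP: "finite ?P" by (simp add: finite_PiE)
    have cP: "card ?P = (2 * (c0 * ?R) + 1) ^ s"
    proof -
      have "card {- int x..int x} = 2 * x + 1" for x by simp
      from this[of "c0 * ?R"] show ?thesis by (simp only: card_PiE finite_lessThan prod_constant card_lessThan)
    qed
    have GBs: "GB J N \<subseteq> {G. G \<subseteq> ?P \<and> card G = r}" by (auto simp: GB_def c0_def r_def)
    have fsub: "finite {G. G \<subseteq> ?P \<and> card G = r}" using fP by simp
    have fG: "finite (GB J N)" using GBs fsub finite_subset by blast
    have "card (GB J N) \<le> card {G. G \<subseteq> ?P \<and> card G = r}" using GBs fsub by (rule card_mono[rotated])
    also have "\<dots> = card ?P choose r" by (rule n_subsets[OF fP])
    also have "\<dots> \<le> card ?P ^ r"
      by (cases "r \<le> card ?P") (auto simp: binomial_le_pow binomial_eq_0)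
    finally have "real (card (GB J N)) \<le> real (card ?P ^ r)" by (simp only: of_nat_le_iff)
    also have "\<dots> = (2 * (real c0 * real ?R) + 1) ^ (s * r)"
      unfolding cP by (simp only: of_nat_power of_nat_add of_nat_mult of_nat_numeral of_nat_1 power_mult)
    also have "\<dots> \<le> ((2 * (2 * real c0 + 1)) * real N powr \<sigma> r) ^ (s * r)"
    proof (rule power_mono)
      have "2 * (real c0 * real ?R) + 1 \<le> (2 * real c0 + 1) * real ?R" using R(3) by (simp add: algebra_simps)
      also have "\<dots> \<le> (2 * real c0 + 1) * (2 * real N powr \<sigma> r)" using R(2) by (intro mult_left_mono) auto
      finally show "2 * (real c0 * real ?R) + 1 \<le> (2 * (2 * real c0 + 1)) * real N powr \<sigma> r" by (simp only: mult_ac)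
    qed simp
    also have "\<dots> = (2 * (2 * real c0 + 1)) ^ (s * r) * real N powr (1/4)"
    proof -
      have "(real N powr \<sigma> r) ^ (s * r) = real N powr (\<sigma> r * real (s * r))"
        using N by (simp add: powr_realpow[symmetric] powr_powr)
      also have "\<sigma> r * real (s * r) = 1/4" using r l by simp
      finally show ?thesis by (simp only: power_mult_distrib)
    qed
    finally have cG: "real (card (GB J N)) \<le> (2 * (2 * real c0 + 1)) ^ (s * r) * real N powr (1/4)" .
    let ?NB = "\<lambda>G. {n \<in> adm l N. \<forall>g\<in>G. sol_eqs l d n g}"
    let ?M = "(\<Union>G\<in>GB J N. ?NB G) \<inter> {n. card (lat l d (A * N) n) \<le> (2 * (A * N) + 1) ^ r}"
    have fU: "finite (\<Union>G\<in>GB J N. ?NB G)" using fG finite_adm by auto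
    have "card ?M \<le> card (\<Union>G\<in>GB J N. ?NB G)" using fU by (intro card_mono) auto
    also have "\<dots> \<le> (\<Sum>G\<in>GB J N. card (?NB G))" by (rule card_UN_le[OF fG])
    finally have "real (card ?M) \<le> real (\<Sum>G\<in>GB J N. card (?NB G))" by (simp only: of_nat_le_iff)
    also have "\<dots> = (\<Sum>G\<in>GB J N. real (card (?NB G)))" by (simp only: of_nat_sum)
    also have "\<dots> \<le> (\<Sum>G\<in>GB J N. 15 * real N powr (real (s - r) - 1/3))"
    proof (rule sum_mono)
      fix G assume G: "G \<in> GB J N"
      have "G \<subseteq> ?P" using G GBs by blast
      then have fGG: "finite G" using fP finite_subset by blast
      have "card G = card J" "row_indep (\<lambda>g j. real_of_int (g j)) J G" using G unfolding GB_def by blast+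
      from spanned_class_card[OF J(1,2) fGG this d2 N]
      show "real (card (?NB G)) \<le> 15 * real N powr (real (s - r) - 1/3)" unfolding r_def .
    qed
    also have "\<dots> = real (card (GB J N)) * (15 * real N powr (real (s - r) - 1/3))" by simp
    also have "\<dots> \<le> ((2 * (2 * real c0 + 1)) ^ (s * r) * real N powr (1/4)) * (15 * real N powr (real (s - r) - 1/3))"
      using cG by (intro mult_right_mono) auto
    finally have cM: "real (card ?M) \<le> ((2 * (2 * real c0 + 1)) ^ (s * r) * real N powr (1/4)) * (15 * real N powr (real (s - r) - 1/3))" .
    have "real (card (UB J N)) \<le> real (card ?M) * ((2 * real A + 1) ^ r * real N powr (real r))"
      unfolding UB_def r_def[symmetric]
    proof (rule card_Sigma_le, goal_cases)
      case 1 then show ?case using fU by simp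
    next
      case (2 n)
      then have "card (lat l d (A * N) n) \<le> (2 * (A * N) + 1) ^ r" by simp
      then have "real (card (lat l d (A * N) n)) \<le> real ((2 * (A * N) + 1) ^ r)" by (simp only: of_nat_le_iff)
      also have "\<dots> = (2 * (real A * real N) + 1) ^ r" by (simp add: add.commute)
      also have "\<dots> \<le> ((2 * real A + 1) * real N) ^ r" using N by (intro power_mono) (auto simp: algebra_simps)
      also have "\<dots> = (2 * real A + 1) ^ r * real N powr (real r)" using N by (simp add: power_mult_distrib powr_realpow)
      finally show ?case using finite_lat by blast
    qed
    also have "\<dots> \<le> ((2 * (2 * real c0 + 1)) ^ (s * r) * real N powr (1/4)) * (15 * real N powr (real (s - r) - 1/3)) * ((2 * real A + 1) ^ r * real N powr (real r))"
      using cM by (intro mult_right_mono) auto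
    also have "\<dots> = C * real N powr (1/4 + (real (s - r) - 1/3) + real r)"
      by (simp only: C_def powr_add mult_ac)
    also have "\<dots> \<le> C * real N powr (real s - \<delta>)"
    proof (intro mult_left_mono powr_mono)
      have "(1::real) * 1 \<le> real s * real s" using l by (intro mult_mono) auto
      then have "\<delta> \<le> 1/12" by (simp add: field_simps power2_eq_square)
      moreover have "real (s - r) = real s - real r" using r by (simp add: of_nat_diff)
      ultimately show "1/4 + (real (s - r) - 1/3) + real r \<le> real s - \<delta>" by linarith
    qed (use N in \<open>auto simp: C_def\<close>)
    finally show ?thesis .
  qed
  then show ?thesis by (intro exI[of _ C]) (auto simp: C_def)
qed

text \<open>Every nonzero solution falls under \<open>UA\<close> or \<open>UB\<close> for a pivot
  set of its tuple, and the number of possible pivot sets does not depend on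
  \<open>N\<close>.\<close>

theorem card_additive_relations:
  "\<exists>C\<ge>0. \<forall>N\<ge>1. real (card (SIGMA n:adm l N. {h\<in>lat l d (A * N) n. \<exists>i<2*l. h i \<noteq> 0})) \<le> C * real N powr (real s - \<delta>)"
proof -
  define JJ where "JJ = {J. J \<subseteq> {..<s} \<and> J \<noteq> {} \<and> J \<noteq> {..<s}}"
  have fJJ: "finite JJ" by (rule finite_subset[of _ "Pow {..<s}"]) (auto simp: JJ_def)
  have "\<forall>J\<in>JJ. \<exists>C\<ge>0. \<forall>N\<ge>1. real (card (UA J N)) \<le> C * real N powr (real s - \<delta>)"
    using card_UA_le by (simp add: JJ_def)
  from bchoice[OF this] obtain CA where CA: "\<forall>J\<in>JJ. CA J \<ge> 0 \<and> (\<forall>N\<ge>1. real (card (UA J N)) \<le> CA J * real N powr (real s - \<delta>))"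
    by (elim exE)
  have "\<forall>J\<in>JJ. \<exists>C\<ge>0. \<forall>N\<ge>1. real (card (UB J N)) \<le> C * real N powr (real s - \<delta>)"
    using card_UB_le by (simp add: JJ_def)
  from bchoice[OF this] obtain CB where CB: "\<forall>J\<in>JJ. CB J \<ge> 0 \<and> (\<forall>N\<ge>1. real (card (UB J N)) \<le> CB J * real N powr (real s - \<delta>))"
    by (elim exE)
  define C where "C = (\<Sum>J\<in>JJ. CA J + CB J)"
  have "real (card (SIGMA n:adm l N. {h\<in>lat l d (A * N) n. \<exists>i<2*l. h i \<noteq> 0})) \<le> C * real N powr (real s - \<delta>)"
    if N: "N \<ge> 1" for N
  proof -
    let ?B = "A * N"
    let ?Sol = "SIGMA n:adm l N. {h\<in>lat l d ?B n. \<exists>i<2*l. h i \<noteq> 0}"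
    have sub: "?Sol \<subseteq> (\<Union>J\<in>JJ. UA J N \<union> UB J N)"
    proof
      fix p assume p: "p \<in> ?Sol"
      obtain n h where e: "p = (n,h)" by (cases p)
      have n: "n \<in> adm l N" and h: "h \<in> lat l d ?B n" "\<exists>i<2*l. h i \<noteq> 0" using p e by auto
      \<comment> \<open>\<open>Rad\<close> has its lower bound for positive \<open>r\<close>; the
        value 1 at 0 meets the hypothesis of \<open>lattice_dichotomy\<close> for every
        \<open>r\<close>.\<close>
      define Rf where "Rf r = (if r = 0 then 1 else Rad N r)" for r
      have Rf: "Rf r \<ge> 1" for r using Rad(3)[OF N, of r] by (auto simp: Rf_def)
      have nz: "\<exists>h\<in>lat l d ?B n. \<exists>i<2*l. h i \<noteq> 0" using h by blast
      have l1: "l \<ge> 1" using l by simp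
      have "\<exists>J. J \<subseteq> {..<2*l} \<and> J \<noteq> {} \<and> J \<noteq> {..<2*l} \<and> card (lat l d ?B n) \<le> (2 * ?B + 1) ^ card J \<and>
    (\<forall>j\<in>J. \<exists>(h0::int) h. h0 \<noteq> 0 \<and> \<bar>h0\<bar> \<le> int ((2 * card J * ?B + 1) ^ card J) \<and>
      (\<forall>i\<in>{..<2*l} - J. \<bar>h i\<bar> \<le> int ((2 * card J * ?B + 1) ^ card J)) \<and>
      h0 * int (n j) ^ d = (\<Sum>i\<in>{..<2*l} - J. h i * int (n i) ^ d)) \<and>
    (card (lat l d ?B n) \<le> (2 * (?B div Rf (card J)) + 2) ^ card J * Rf (card J) ^ (card J - 1) \<or>
     (\<exists>G\<subseteq>lat l d (2 * l * fact (2 * l) * Rf (card J)) n. card G = card J \<and> row_indep (\<lambda>g j. real_of_int (g j)) J G))"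
        by (rule lattice_dichotomy[OF l1 nz Rf])
      then obtain J where J: "J \<subseteq> {..<s}" "J \<noteq> {}" "J \<noteq> {..<s}"
        and c1: "card (lat l d ?B n) \<le> (2 * ?B + 1) ^ card J"
        and rel: "\<forall>j\<in>J. \<exists>(h0::int) h. h0 \<noteq> 0 \<and> \<bar>h0\<bar> \<le> int ((2 * card J * ?B + 1) ^ card J) \<and>
      (\<forall>i\<in>{..<2*l} - J. \<bar>h i\<bar> \<le> int ((2 * card J * ?B + 1) ^ card J)) \<and>
      h0 * int (n j) ^ d = (\<Sum>i\<in>{..<2*l} - J. h i * int (n i) ^ d)"
        and alt: "card (lat l d ?B n) \<le> (2 * (?B div Rf (card J)) + 2) ^ card J * Rf (card J) ^ (card J - 1) \<or>
     (\<exists>G\<subseteq>lat l d (2 * l * fact (2 * l) * Rf (card J)) n. card G = card J \<and> row_indep (\<lambda>g j. real_of_int (g j)) J G)"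
        by (elim exE conjE)
      have JJ: "J \<in> JJ" using J by (simp add: JJ_def)
      have fJ: "finite J" using J finite_subset by blast
      have RfJ: "Rf (card J) = Rad N (card J)" using J(2) fJ by (simp add: Rf_def)
      have nP: "n \<in> PiE {..<s} (\<lambda>_. {1..N})" using n by (simp add: adm_def)
      have "p \<in> UA J N \<union> UB J N"
        using alt unfolding RfJ
      proof
        assume a: "card (lat l d ?B n) \<le> (2 * (?B div Rad N (card J)) + 2) ^ card J * Rad N (card J) ^ (card J - 1)"
        have "n j \<in> Srel J N n" if j: "j \<in> J" for j
        proof -
          from bspec[OF rel j] obtain h0 :: int and h where h0: "h0 \<noteq> 0" "\<bar>h0\<bar> \<le> int ((2 * card J * ?B + 1) ^ card J)"
            "\<forall>i\<in>{..<2*l} - J. \<bar>h i\<bar> \<le> int ((2 * card J * ?B + 1) ^ card J)"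
            "h0 * int (n j) ^ d = (\<Sum>i\<in>{..<2*l} - J. h i * int (n i) ^ d)" by (elim exE conjE)
          have bound: "real_of_int (int ((2 * card J * ?B + 1) ^ card J)) \<le> real ((2 * card J * A + 1) ^ card J) * real N ^ card J"
          proof -
            have "2 * card J * ?B + 1 \<le> (2 * card J * A + 1) * N" using N by (simp add: algebra_simps)
            then have "(2 * card J * ?B + 1) ^ card J \<le> ((2 * card J * A + 1) * N) ^ card J" by (rule power_mono) simp
            then have "(2 * card J * ?B + 1) ^ card J \<le> (2 * card J * A + 1) ^ card J * N ^ card J"
              by (simp only: power_mult_distrib)
            then have "real ((2 * card J * ?B + 1) ^ card J) \<le> real ((2 * card J * A + 1) ^ card J * N ^ card J)"
              by (simp only: of_nat_le_iff)
            then show ?thesis by simp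
          qed
          have tr: "\<bar>real_of_int x\<bar> \<le> real ((2 * card J * A + 1) ^ card J) * real N ^ card J"
            if "\<bar>x\<bar> \<le> int ((2 * card J * ?B + 1) ^ card J)" for x
          proof -
            have "real_of_int \<bar>x\<bar> \<le> real_of_int (int ((2 * card J * ?B + 1) ^ card J))" using that by (simp only: of_int_le_iff)
            then show ?thesis using bound by (simp only: of_int_abs)
          qed
          have "real_of_int (h0 * int (n j) ^ d) = real_of_int (\<Sum>i\<in>{..<2*l} - J. h i * int (n i) ^ d)" using h0(4) by simp
          then have "of_int h0 * real (n j) ^ d = (\<Sum>i\<in>{..<s} - J. real (n i) ^ d * of_int (h i))"
            by (simp add: mult.commute)
          moreover have "n j \<in> {1..N}" using nP j J by auto
          moreover have "\<forall>i\<in>{..<s} - J. \<bar>real_of_int (h i)\<bar> \<le> real ((2 * card J * A + 1) ^ card J) * real N ^ card J"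
            using h0(3) tr by blast
          ultimately show ?thesis unfolding Srel_def using h0(1) tr[OF h0(2)] by blast
        qed
        then have "n \<in> NA J N" using nP by (simp add: NA_def)
        then show ?thesis using a h(1) by (simp add: UA_def e)
      next
        assume "\<exists>G\<subseteq>lat l d (2 * l * fact (2 * l) * Rad N (card J)) n. card G = card J \<and> row_indep (\<lambda>g j. real_of_int (g j)) J G"
        then obtain G where G: "G \<subseteq> lat l d (2 * l * fact (2 * l) * Rad N (card J)) n" "card G = card J"
          "row_indep (\<lambda>g j. real_of_int (g j)) J G" by (elim exE conjE)
        have "G \<in> GB J N" using G unfolding GB_def lat_def by blast
        moreover have "\<forall>g\<in>G. sol_eqs l d n g" using G(1) by (auto simp: lat_def)
        ultimately have "(n, h) \<in> UB J N" using n c1 h(1) unfolding UB_def by blast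
        then show ?thesis by (simp add: e)
      qed
      then show "p \<in> (\<Union>J\<in>JJ. UA J N \<union> UB J N)" using JJ by blast
    qed
    have fNA: "finite (NA J N)" for J
      by (rule finite_subset[of _ "PiE {..<s} (\<lambda>_. {1..N})"]) (auto simp: NA_def finite_PiE)
    have fUA: "finite (UA J N)" for J unfolding UA_def using fNA[of J] finite_lat by (intro finite_SigmaI) auto
    have fUB: "finite (UB J N)" for J unfolding UB_def
      by (rule finite_SigmaI[OF finite_subset[OF _ finite_adm[of l N]] finite_lat]) auto
    have "card ?Sol \<le> card (\<Union>J\<in>JJ. UA J N \<union> UB J N)"
      using sub fJJ fUA fUB by (intro card_mono) auto
    also have "\<dots> \<le> (\<Sum>J\<in>JJ. card (UA J N \<union> UB J N))" by (rule card_UN_le[OF fJJ])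
    also have "\<dots> \<le> (\<Sum>J\<in>JJ. card (UA J N) + card (UB J N))" by (intro sum_mono card_Un_le)
    finally have "real (card ?Sol) \<le> real (\<Sum>J\<in>JJ. card (UA J N) + card (UB J N))" by (simp only: of_nat_le_iff)
    also have "\<dots> = (\<Sum>J\<in>JJ. real (card (UA J N)) + real (card (UB J N)))" by (simp only: of_nat_sum of_nat_add)
    also have "\<dots> \<le> (\<Sum>J\<in>JJ. (CA J + CB J) * real N powr (real s - \<delta>))"
    proof (rule sum_mono)
      fix J assume "J \<in> JJ"
      then have "real (card (UA J N)) \<le> CA J * real N powr (real s - \<delta>)" "real (card (UB J N)) \<le> CB J * real N powr (real s - \<delta>)"
        using CA CB N by blast+
      then show "real (card (UA J N)) + real (card (UB J N)) \<le> (CA J + CB J) * real N powr (real s - \<delta>)"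
        by (simp add: distrib_right)
    qed
    also have "\<dots> = C * real N powr (real s - \<delta>)" by (simp add: C_def sum_distrib_right)
    finally show ?thesis .
  qed
  moreover have "C \<ge> 0" unfolding C_def using CA CB by (intro sum_nonneg) auto
  ultimately show ?thesis by blast
qed

end

section \<open>Fejer approximation\<close>

text \<open>Normalised to the value 1 at integers, for \<open>M\<close> positive; then the
  \<open>M\<close> translates by multiples of \<open>1 / M\<close> form a partition of
  unity.\<close>

definition fejer :: "nat \<Rightarrow> real \<Rightarrow> real" where
  "fejer M \<phi> = (norm (\<Sum>m<M. cis (2 * pi * real m * \<phi>)))\<^sup>2 / (real M)\<^sup>2"

lemma fejer_nonneg [simp]: "fejer M \<phi> \<ge> 0"
  by (simp add: fejer_def)

lemma cis_2pi_int_add: "cis (2 * pi * (x + of_int k)) = cis (2 * pi * x)"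
proof -
  have "cis (2 * pi * (x + of_int k)) = cis (2 * pi * x) * cis (2 * pi * of_int k)"
    by (simp only: cis_mult distrib_left)
  also have "cis (2 * pi * of_int k) = 1" using cis_multiple_2pi[of "of_int k"] by simp
  finally show ?thesis by simp
qed

lemma fejer_periodic: "fejer M (\<phi> + of_int k) = fejer M \<phi>"
proof -
  have "cis (2 * pi * real m * (\<phi> + of_int k)) = cis (2 * pi * real m * \<phi>)" for m
    using cis_2pi_int_add[of "real m * \<phi>" "int m * k"] by (simp add: algebra_simps)
  then show ?thesis by (simp add: fejer_def)
qed

lemma norm_1_minus_cis: "(norm (1 - cis (2 * t)))\<^sup>2 = 4 * (sin t)\<^sup>2"
proof -
  have "(norm (1 - cis (2 * t)))\<^sup>2 = (1 - cos (2 * t))\<^sup>2 + (sin (2 * t))\<^sup>2" by (simp add: cmod_power2)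
  also have "\<dots> = 2 - 2 * cos (2 * t)"
    using sin_cos_squared_add[of "2 * t"] by (simp add: power2_diff)
  also have "\<dots> = 4 * (sin t)\<^sup>2" by (simp add: cos_double_sin)
  finally show ?thesis .
qed

text \<open>The closed form, multiplied out so that it stays meaningful where the sine
  vanishes.\<close>

lemma fejer_sin:
  assumes "M \<ge> 1"
  shows "fejer M \<phi> * (real M * sin (pi * \<phi>))\<^sup>2 = (sin (pi * real M * \<phi>))\<^sup>2"
proof -
  define z where "z = cis (2 * (pi * \<phi>))"
  have zm: "cis (2 * pi * real m * \<phi>) = z ^ m" for m
    unfolding z_def Complex.DeMoivre by (simp only: mult_ac)
  define S where "S = (\<Sum>m<M. z ^ m)"
  have "(1 - z) * S = 1 - z ^ M" unfolding S_def by (rule one_diff_power_eq[symmetric])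
  then have "(norm (1 - z))\<^sup>2 * (norm S)\<^sup>2 = (norm (1 - z ^ M))\<^sup>2"
    by (metis norm_mult power_mult_distrib)
  moreover have "z ^ M = cis (2 * (pi * real M * \<phi>))" using zm[of M] by (simp add: mult_ac)
  ultimately have "4 * (sin (pi * \<phi>))\<^sup>2 * (norm S)\<^sup>2 = 4 * (sin (pi * real M * \<phi>))\<^sup>2"
    by (simp only: norm_1_minus_cis z_def)
  then have sS: "(norm S)\<^sup>2 * (sin (pi * \<phi>))\<^sup>2 = (sin (pi * real M * \<phi>))\<^sup>2" by (simp add: mult_ac)
  have "fejer M \<phi> = (norm S)\<^sup>2 / (real M)\<^sup>2" unfolding fejer_def S_def zm ..
  then have "fejer M \<phi> * (real M)\<^sup>2 = (norm S)\<^sup>2" using assms by simp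
  then show ?thesis unfolding sS[symmetric] by (simp add: power_mult_distrib)
qed

text \<open>Half of the sharp constant is enough: up to 1/3 the cosine is at least 1/2 and the mean
  value theorem applies, beyond that the sine is monotone.\<close>

lemma abs_sin_pi_ge:
  assumes "\<bar>t\<bar> \<le> 1 / 2"
  shows "\<bar>sin (pi * t)\<bar> \<ge> \<bar>t\<bar>"
proof -
  have *: "sin (pi * t) \<ge> t" if t: "0 \<le> t" "t \<le> 1 / 2" for t :: real
  proof (cases "t \<le> 1 / 3")
    case True
    show ?thesis
    proof (cases "t = 0")
      case False
      then have "0 < pi * t" using t by simp
      from MVT2[OF this, of sin cos] obtain \<xi> where \<xi>: "0 < \<xi>" "\<xi> < pi * t" "sin (pi * t) - sin 0 = (pi * t - 0) * cos \<xi>"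
        by (auto intro: DERIV_sin)
      have "pi * t \<le> pi * (1 / 3)" using True by (intro mult_left_mono) auto
      then have "\<xi> \<le> pi / 3" "0 \<le> \<xi>" "pi / 3 \<le> pi" using \<xi> by linarith+
      then have "cos (pi / 3) \<le> cos \<xi>" by (intro cos_monotone_0_pi_le)
      then have "1 / 2 \<le> cos \<xi>" by (simp add: cos_60)
      then have "pi * t * (1 / 2) \<le> pi * t * cos \<xi>" using t by (intro mult_left_mono) auto
      moreover have "2 * t \<le> pi * t" using t pi_ge_two by (intro mult_right_mono) auto
      moreover have "sin (pi * t) = pi * t * cos \<xi>" using \<xi>(3) by simp
      ultimately show ?thesis by linarith
    qed simp
  next
    case False
    have "pi * t \<ge> pi / 3" "pi * t \<le> pi / 2" using False t by auto
    then have "sin (pi / 3) \<le> sin (pi * t)" by (intro sin_monotone_2pi_le) (use pi_gt_zero in linarith)+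
    moreover have "sin (pi / 3) \<ge> 1 / 2" by (simp add: sin_60)
    ultimately show ?thesis using t by linarith
  qed
  show ?thesis
  proof (cases "t \<ge> 0")
    case True then show ?thesis using *[of t] assms by auto
  next
    case False
    then have "sin (pi * (- t)) \<ge> - t" using *[of "- t"] assms by auto
    then show ?thesis using False by auto
  qed
qed

lemma fejer_upper:
  assumes "M \<ge> 1" "\<rho> \<ge> 0" "\<And>k::int. \<rho> \<le> \<bar>\<phi> - of_int k\<bar>"
  shows "fejer M \<phi> * (real M * \<rho>)\<^sup>2 \<le> 1"
proof -
  define t where "t = \<phi> - of_int (round \<phi>)"
  have t: "\<bar>t\<bar> \<le> 1 / 2" "\<rho> \<le> \<bar>t\<bar>"
    using of_int_round_abs_le[of \<phi>] assms(3)[of "round \<phi>"] by (auto simp: t_def abs_minus_commute)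
  have "fejer M \<phi> = fejer M t" using fejer_periodic[of M t "round \<phi>"] by (simp add: t_def)
  moreover have "(real M * \<rho>)\<^sup>2 \<le> (real M * sin (pi * t))\<^sup>2"
  proof -
    have "\<bar>real M * \<rho>\<bar> \<le> \<bar>real M * sin (pi * t)\<bar>"
      unfolding abs_mult using t abs_sin_pi_ge[OF t(1)] assms(2) by (intro mult_left_mono) auto
    then show ?thesis by (simp only: abs_le_square_iff)
  qed
  ultimately have "fejer M \<phi> * (real M * \<rho>)\<^sup>2 \<le> fejer M t * (real M * sin (pi * t))\<^sup>2"
    by (simp add: mult_left_mono)
  also have "\<dots> \<le> 1" unfolding fejer_sin[OF assms(1)] by (simp add: abs_square_le_1)
  finally show ?thesis .
qed

lemma fejer_lower:
  assumes "M \<ge> 1"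
  shows "(sin (pi * real M * \<phi>))\<^sup>2 \<le> fejer M \<phi> * (pi * real M * \<phi>)\<^sup>2"
proof -
  have "\<bar>real M * sin (pi * \<phi>)\<bar> \<le> \<bar>real M * (pi * \<phi>)\<bar>"
    unfolding abs_mult using abs_sin_x_le_abs_x[of "pi * \<phi>"] by (intro mult_left_mono) (auto simp: abs_mult)
  then have "(real M * sin (pi * \<phi>))\<^sup>2 \<le> (real M * (pi * \<phi>))\<^sup>2" by (simp only: abs_le_square_iff)
  then have "fejer M \<phi> * (real M * sin (pi * \<phi>))\<^sup>2 \<le> fejer M \<phi> * (real M * (pi * \<phi>))\<^sup>2"
    by (rule mult_left_mono) simp
  then show ?thesis unfolding fejer_sin[OF assms] by (simp add: mult_ac)
qed

text \<open>A single Fejer kernel has zeros at the multiples of \<open>1 / N\<close> that are not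
  integers. The shift by half a step exchanges sine and cosine, so that
  \<open>sin^2 + cos^2 = 1\<close> bounds the sum of the two kernels below by an inverse square of
  the distance measured in units of \<open>1 / N\<close>.\<close>

definition env :: "nat \<Rightarrow> real \<Rightarrow> real" where
  "env N \<phi> = fejer N \<phi> + fejer N (\<phi> + 1 / (2 * real N))"

lemma env_nonneg [simp]: "env N \<phi> \<ge> 0"
  by (simp add: env_def)

lemma env_periodic: "env N (\<phi> + of_int k) = env N \<phi>"
  using fejer_periodic[of N \<phi> k] fejer_periodic[of N "\<phi> + 1 / (2 * real N)" k] by (simp add: env_def add_ac)

lemma env_lower:
  assumes "N \<ge> 1"
  shows "1 \<le> env N \<phi> * (pi * (\<bar>real N * \<phi>\<bar> + 1 / 2))\<^sup>2"
proof -
  let ?q = "(pi * (\<bar>real N * \<phi>\<bar> + 1 / 2))\<^sup>2"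
  have "fejer N \<phi> * (pi * real N * \<phi>)\<^sup>2 \<le> fejer N \<phi> * ?q"
  proof (rule mult_left_mono)
    have "\<bar>pi * real N * \<phi>\<bar> \<le> \<bar>pi * (\<bar>real N * \<phi>\<bar> + 1 / 2)\<bar>" by (simp add: abs_mult mult.assoc)
    then show "(pi * real N * \<phi>)\<^sup>2 \<le> ?q" by (simp only: abs_le_square_iff)
  qed simp
  then have 1: "(sin (pi * real N * \<phi>))\<^sup>2 \<le> fejer N \<phi> * ?q" using fejer_lower[OF assms, of \<phi>] by linarith
  let ?\<psi> = "\<phi> + 1 / (2 * real N)"
  have e: "pi * real N * ?\<psi> = pi * real N * \<phi> + pi / 2" using assms by (simp add: field_simps)
  have "fejer N ?\<psi> * (pi * real N * ?\<psi>)\<^sup>2 \<le> fejer N ?\<psi> * ?q"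
  proof (rule mult_left_mono)
    have "pi * real N * ?\<psi> = pi * (real N * \<phi> + 1 / 2)" unfolding e by (simp add: distrib_left)
    moreover have "\<bar>real N * \<phi> + 1 / 2\<bar> \<le> \<bar>real N * \<phi>\<bar> + 1 / 2" by linarith
    ultimately have "\<bar>pi * real N * ?\<psi>\<bar> \<le> \<bar>pi * (\<bar>real N * \<phi>\<bar> + 1 / 2)\<bar>" by (simp add: abs_mult)
    then show "(pi * real N * ?\<psi>)\<^sup>2 \<le> ?q" by (simp only: abs_le_square_iff)
  qed simp
  then have "(sin (pi * real N * ?\<psi>))\<^sup>2 \<le> fejer N ?\<psi> * ?q" using fejer_lower[OF assms, of ?\<psi>] by linarith
  moreover have "sin (pi * real N * ?\<psi>) = cos (pi * real N * \<phi>)" unfolding e by (simp add: sin_add)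
  ultimately have 2: "(cos (pi * real N * \<phi>))\<^sup>2 \<le> fejer N ?\<psi> * ?q" by simp
  show ?thesis unfolding env_def distrib_right using 1 2 sin_cos_squared_add[of "pi * real N * \<phi>"] by linarith
qed

lemma norm_sum_cis_square:
  "complex_of_real ((norm (\<Sum>m<M. cis (2 * pi * real m * \<phi>)))\<^sup>2) =
     (\<Sum>p\<in>{..<M} \<times> {..<M}. cis (2 * pi * ((real (fst p) - real (snd p)) * \<phi>)))"
proof -
  have "complex_of_real ((norm (\<Sum>m<M. cis (2 * pi * real m * \<phi>)))\<^sup>2) =
     (\<Sum>m<M. cis (2 * pi * real m * \<phi>)) * (\<Sum>m<M. cnj (cis (2 * pi * real m * \<phi>)))"
    unfolding complex_norm_square cnj_sum ..
  also have "\<dots> = (\<Sum>p\<in>{..<M} \<times> {..<M}. cis (2 * pi * real (fst p) * \<phi>) * cis (- (2 * pi * real (snd p) * \<phi>)))"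
    by (simp add: sum_product sum.cartesian_product case_prod_beta cis_cnj)
  finally show ?thesis by (simp add: cis_mult algebra_simps)
qed

text \<open>A count of representations as a difference of two indices; it equals (M - |k|) / M^2 for
  |k| at most \<open>M\<close>.\<close>

definition fejer_coeff :: "nat \<Rightarrow> int \<Rightarrow> real" where
  "fejer_coeff M k = real (card {p\<in>{..<M} \<times> {..<M}. int (fst p) - int (snd p) = k}) / (real M)\<^sup>2"

lemma fejer_expansion:
  "complex_of_real (fejer M \<phi>) = (\<Sum>k\<in>{- int M..int M}. fejer_coeff M k * cis (2 * pi * (of_int k * \<phi>)))"
proof -
  let ?S = "{..<M} \<times> {..<M}" and ?g = "\<lambda>p. int (fst p) - int (snd p)"
  let ?h = "\<lambda>p. cis (2 * pi * ((real (fst p) - real (snd p)) * \<phi>))"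
  have "(\<Sum>p\<in>?S. ?h p) = (\<Sum>k\<in>{- int M..int M}. \<Sum>p\<in>{p. p \<in> ?S \<and> ?g p = k}. ?h p)"
    by (rule sum.group[symmetric]) auto
  also have "\<dots> = (\<Sum>k\<in>{- int M..int M}. of_nat (card {p\<in>?S. ?g p = k}) * cis (2 * pi * (of_int k * \<phi>)))"
  proof (rule sum.cong[OF refl])
    fix k
    have "?h p = cis (2 * pi * (of_int k * \<phi>))" if "p \<in> {p. p \<in> ?S \<and> ?g p = k}" for p
      using that by auto
    then have "(\<Sum>p\<in>{p. p \<in> ?S \<and> ?g p = k}. ?h p) = (\<Sum>p\<in>{p. p \<in> ?S \<and> ?g p = k}. cis (2 * pi * (of_int k * \<phi>)))"
      by (rule sum.cong[OF refl])
    then show "(\<Sum>p\<in>{p. p \<in> ?S \<and> ?g p = k}. ?h p) = of_nat (card {p\<in>?S. ?g p = k}) * cis (2 * pi * (of_int k * \<phi>))"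
      by simp
  qed
  finally have "complex_of_real (fejer M \<phi>) = (\<Sum>k\<in>{- int M..int M}. of_nat (card {p\<in>?S. ?g p = k}) * cis (2 * pi * (of_int k * \<phi>))) / (of_nat M)\<^sup>2"
    unfolding fejer_def of_real_divide norm_sum_cis_square by simp
  then show ?thesis by (simp add: fejer_coeff_def sum_divide_distrib)
qed

lemma fejer_coeff_bound: "0 \<le> fejer_coeff M k" "fejer_coeff M k \<le> 1 / real M"
proof -
  show "0 \<le> fejer_coeff M k" by (simp add: fejer_coeff_def)
  have "card {p\<in>{..<M} \<times> {..<M}. int (fst p) - int (snd p) = k} \<le> card {..<M}"
    by (rule card_inj_on_le[where f = fst]) (auto simp: inj_on_def)
  then have "fejer_coeff M k \<le> real M / (real M)\<^sup>2"
    unfolding fejer_coeff_def by (intro divide_right_mono) auto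
  then show "fejer_coeff M k \<le> 1 / real M" by (simp add: power2_eq_square split: if_splits)
qed

lemma fejer_coeff_0: "M \<ge> 1 \<Longrightarrow> fejer_coeff M 0 = 1 / real M"
proof -
  assume "M \<ge> 1"
  have "{p\<in>{..<M} \<times> {..<M}. int (fst p) - int (snd p) = 0} = (\<lambda>i. (i,i)) ` {..<M}" by auto
  then have "card {p\<in>{..<M} \<times> {..<M}. int (fst p) - int (snd p) = 0} = M"
    by (simp add: card_image inj_on_def)
  then show ?thesis by (simp add: fejer_coeff_def power2_eq_square)
qed

lemma sum_cis_roots:
  assumes "M \<ge> 1" "\<bar>k\<bar> < int M"
  shows "(\<Sum>j<M. cis (2 * pi * (of_int k * (real j / real M)))) = (if k = 0 then of_nat M else 0)"
proof (cases "k = 0")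
  case False
  define z where "z = cis (2 * (pi * (of_int k / real M)))"
  have zj: "cis (2 * pi * (of_int k * (real j / real M))) = z ^ j" for j
    unfolding z_def Complex.DeMoivre by (rule arg_cong[where f = cis]) (simp add: field_simps)
  have "z ^ M = cis (2 * pi * of_int k)" using zj[of M] assms by simp
  then have zM: "z ^ M = 1" using cis_multiple_2pi[of "of_int k"] by simp
  have "z \<noteq> 1"
  proof
    assume "z = 1"
    then have "4 * (sin (pi * (of_int k / real M)))\<^sup>2 = 0"
      using norm_1_minus_cis[of "pi * (of_int k / real M)"] by (simp add: z_def)
    then have "sin (pi * (of_int k / real M)) = 0" by simp
    then obtain i :: int where "pi * (of_int k / real M) = of_int i * pi" using sin_zero_iff_int2 by blast
    then have "pi * (of_int k / real M) = pi * of_int i" by (simp only: mult.commute)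
    then have "of_int k / real M = of_int i" by (simp only: mult_left_cancel[OF pi_neq_zero])
    then have "real_of_int k = of_int i * real M" using assms by (simp add: field_simps)
    then have "k = i * int M" by (metis of_int_eq_iff of_int_mult of_int_of_nat_eq)
    then have "int M dvd k" by simp
    then show False using False assms(2) by (metis zdvd_not_zless abs_of_nonneg dvd_abs_iff of_nat_0_le_iff zero_less_abs_iff)
  qed
  then show ?thesis unfolding zj using False zM by (simp add: geometric_sum)
qed simp

text \<open>Expanding the square, the sum over the translates kills all frequencies not divisible by
  \<open>M\<close>. Differences of two indices are below \<open>M\<close> in modulus, so only the
  diagonal remains.\<close>

lemma fejer_partition:
  assumes "M \<ge> 1"
  shows "(\<Sum>j<M. fejer M (\<phi> - real j / real M)) = 1"
proof -
  have "complex_of_real (\<Sum>j<M. (norm (\<Sum>m<M. cis (2 * pi * real m * (\<phi> - real j / real M))))\<^sup>2)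
     = (\<Sum>j<M. \<Sum>p\<in>{..<M} \<times> {..<M}. cis (2 * pi * ((real (fst p) - real (snd p)) * (\<phi> - real j / real M))))"
    by (simp only: of_real_sum norm_sum_cis_square)
  also have "\<dots> = (\<Sum>p\<in>{..<M} \<times> {..<M}. \<Sum>j<M. cis (2 * pi * ((real (fst p) - real (snd p)) * (\<phi> - real j / real M))))"
    by (rule sum.swap)
  also have "\<dots> = (\<Sum>p\<in>{..<M} \<times> {..<M}. if fst p = snd p then of_nat M else 0)"
  proof (rule sum.cong[OF refl])
    fix p assume p: "p \<in> {..<M} \<times> {..<M}"
    define k where "k = int (snd p) - int (fst p)"
    have k: "\<bar>k\<bar> < int M" using p by (auto simp: k_def)
    have "cis (2 * pi * ((real (fst p) - real (snd p)) * (\<phi> - real j / real M)))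
       = cis (2 * pi * ((real (fst p) - real (snd p)) * \<phi>)) * cis (2 * pi * (of_int k * (real j / real M)))" for j
      unfolding cis_mult by (rule arg_cong[where f = cis]) (simp add: k_def algebra_simps)
    then have "(\<Sum>j<M. cis (2 * pi * ((real (fst p) - real (snd p)) * (\<phi> - real j / real M))))
       = cis (2 * pi * ((real (fst p) - real (snd p)) * \<phi>)) * (if k = 0 then of_nat M else 0)"
      by (simp only: sum_distrib_left[symmetric] sum_cis_roots[OF assms k])
    then show "(\<Sum>j<M. cis (2 * pi * ((real (fst p) - real (snd p)) * (\<phi> - real j / real M)))) = (if fst p = snd p then of_nat M else 0)"
      by (auto simp: k_def)
  qed
  also have "\<dots> = of_nat M * of_nat M"
  proof -
    have "(\<Sum>p\<in>{..<M} \<times> {..<M}. if fst p = snd p then of_nat M else (0::complex)) = (\<Sum>i<M. \<Sum>i'<M. if i = i' then of_nat M else 0)"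
      unfolding sum.cartesian_product by (rule sum.cong) auto
    also have "\<dots> = of_nat M * of_nat M" by simp
    finally show ?thesis .
  qed
  finally have "complex_of_real (\<Sum>j<M. (norm (\<Sum>m<M. cis (2 * pi * real m * (\<phi> - real j / real M))))\<^sup>2) = complex_of_real (real M * real M)"
    by simp
  then have "(\<Sum>j<M. (norm (\<Sum>m<M. cis (2 * pi * real m * (\<phi> - real j / real M))))\<^sup>2) = real M * real M"
    by (simp only: of_real_eq_iff)
  then show ?thesis using assms unfolding fejer_def sum_divide_distrib[symmetric] by (simp add: power2_eq_square)
qed

lemma fejer_partition_window:
  assumes "M \<ge> 1"
  shows "(\<Sum>j\<in>{w<..w + int M}. fejer M (\<phi> - of_int j / real M)) = 1"
proof -
  have "(\<Sum>j\<in>{w<..w + int M}. fejer M (\<phi> - of_int j / real M)) = (\<Sum>j<M. fejer M (\<phi> - of_int (w + 1 + int j) / real M))"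
    by (rule sum.reindex_bij_witness[of _ "\<lambda>j. w + 1 + int j" "\<lambda>j. nat (j - w - 1)"]) auto
  also have "\<dots> = (\<Sum>j<M. fejer M ((\<phi> - of_int (w + 1) / real M) - real j / real M))"
    by (intro sum.cong refl arg_cong[where f = "fejer M"]) (simp add: add_divide_distrib)
  finally show ?thesis using fejer_partition[OF assms] by simp
qed

lemma sum_inverse_square_tail:
  fixes S :: "int set" and x R :: real
  assumes "finite S" "R \<ge> 1" "\<And>j. j \<in> S \<Longrightarrow> \<bar>of_int j - x\<bar> > R"
  shows "(\<Sum>j\<in>S. 1 / (of_int j - x)\<^sup>2) \<le> 4 / R"
proof -
  have pos: "(\<Sum>j\<in>S. 1 / (of_int j - x)\<^sup>2) \<le> 2 / R" if S: "finite S" "\<And>j. j \<in> S \<Longrightarrow> of_int j - x > R" for S :: "int set" and x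
  proof -
    define a where "a = \<lfloor>x + R\<rfloor> + 1"
    have a: "of_int a - x > R" unfolding a_def by linarith
    obtain n :: nat where n: "S \<subseteq> {a..<a + int n}"
    proof -
      define b where "b = (\<Sum>j\<in>S. \<bar>j\<bar>) + 1"
      have "\<bar>j\<bar> \<le> (\<Sum>j\<in>S. \<bar>j\<bar>)" if "j \<in> S" for j using S(1) that by (intro member_le_sum) auto
      then have b: "\<forall>j\<in>S. j < b" unfolding b_def by fastforce
      have "S \<subseteq> {a..<a + int (nat (b - a))}"
      proof
        fix j assume j: "j \<in> S"
        have "x + R < of_int j" using S(2)[OF j] by simp
        then have "\<lfloor>x + R\<rfloor> < j" by (simp add: floor_less_iff)
        then show "j \<in> {a..<a + int (nat (b - a))}" using b j by (auto simp: a_def)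
      qed
      then show ?thesis using that by blast
    qed
    \<comment> \<open>Telescoping majorant:
      \<open>1 / (u - 1/2) - 1 / (u + 1/2) = 1 / (u^2 - 1/4)\<close>, which exceeds
      \<open>1 / u^2\<close>.\<close>
    define g where "g m = 1 / (of_int a + real m - x - 1 / 2)" for m :: nat
    have "(\<Sum>j\<in>S. 1 / (of_int j - x)\<^sup>2) \<le> (\<Sum>j\<in>{a..<a + int n}. 1 / (of_int j - x)\<^sup>2)"
      using n by (intro sum_mono2) auto
    also have "\<dots> = (\<Sum>m<n. 1 / (of_int (a + int m) - x)\<^sup>2)"
      by (rule sum.reindex_bij_witness[of _ "\<lambda>m. a + int m" "\<lambda>j. nat (j - a)"]) auto
    also have "\<dots> \<le> (\<Sum>m<n. g m - g (Suc m))"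
    proof (rule sum_mono)
      fix m
      define u where "u = of_int a + real m - x"
      have u: "u > 1" using a assms(2) by (simp add: u_def)
      have u2: "u\<^sup>2 > 1" using u by simp
      have "g m - g (Suc m) = 1 / (u - 1/2) - 1 / (u + 1/2)" by (simp add: g_def u_def algebra_simps)
      also have "\<dots> = 1 / (u\<^sup>2 - 1/4)" using u by (simp add: field_simps power2_eq_square)
      finally have "g m - g (Suc m) = 1 / (u\<^sup>2 - 1/4)" .
      moreover have "1 / u\<^sup>2 \<le> 1 / (u\<^sup>2 - 1/4)" using u2 by (intro divide_left_mono mult_pos_pos) auto
      ultimately show "1 / (of_int (a + int m) - x)\<^sup>2 \<le> g m - g (Suc m)" by (simp add: u_def)
    qed
    also have "\<dots> = g 0 - g n" by (rule sum_lessThan_telescope')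
    also have "\<dots> \<le> g 0" using a assms(2) by (simp add: g_def)
    also have "\<dots> \<le> 1 / (R / 2)" unfolding g_def using a assms(2) by (intro divide_left_mono mult_pos_pos) auto
    finally show ?thesis by simp
  qed
  let ?P = "{j\<in>S. of_int j - x > R}" and ?Q = "{j\<in>S. \<not> of_int j - x > R}"
  have "(\<Sum>j\<in>S. 1 / (of_int j - x)\<^sup>2) = (\<Sum>j\<in>?P. 1 / (of_int j - x)\<^sup>2) + (\<Sum>j\<in>?Q. 1 / (of_int j - x)\<^sup>2)"
    using assms(1) by (subst sum.union_disjoint[symmetric]) (auto intro!: sum.cong)
  also have "(\<Sum>j\<in>?P. 1 / (of_int j - x)\<^sup>2) \<le> 2 / R" using assms(1) by (intro pos) auto
  also have "(\<Sum>j\<in>?Q. 1 / (of_int j - x)\<^sup>2) = (\<Sum>j\<in>uminus ` ?Q. 1 / (of_int j - (- x))\<^sup>2)"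
    by (simp add: sum.reindex inj_on_def power2_eq_square algebra_simps)
  also have "\<dots> \<le> 2 / R"
  proof (rule pos)
    fix j assume "j \<in> uminus ` ?Q"
    then obtain i where "i \<in> S" "j = - i" "\<not> of_int i - x > R" by auto
    then show "of_int j - - x > R" using assms(3)[of i] by auto
  qed (use assms(1) in auto)
  finally show ?thesis by simp
qed

section \<open>Periodised test functions and their Fejer interpolation\<close>

definition per :: "nat \<Rightarrow> (real^'n::finite \<Rightarrow> real) \<Rightarrow> ('n \<Rightarrow> real) \<Rightarrow> real" where
  "per N f \<theta> = infsum (\<lambda>k::int^'n. f (\<chi> i. real N * (\<theta> i + of_int (k $ i)))) UNIV"

definition grid :: "nat \<Rightarrow> nat \<Rightarrow> ('n::finite \<Rightarrow> int) set" where
  "grid T A = PiE UNIV (\<lambda>_. {- int (T * A)..int (T * A)})"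

text \<open>Interpolation of the periodised function: in the rescaled variable the nodes have
  spacing \<open>1 / T\<close> and cover the support, and kernels of order \<open>T * N\<close>
  weight the values at the nodes.\<close>

definition fsum :: "nat \<Rightarrow> nat \<Rightarrow> nat \<Rightarrow> (real^'n::finite \<Rightarrow> real) \<Rightarrow> ('n \<Rightarrow> real) \<Rightarrow> real" where
  "fsum T A N f \<theta> = (\<Sum>j\<in>grid T A. f (\<chi> i. of_int (j i) / real T) *
      (\<Prod>i\<in>UNIV. fejer (T * N) (\<theta> i - of_int (j i) / real (T * N))))"

text \<open>Before rescaling, the support has coordinates of size at most 1/8, so only the
  representative of each coordinate nearest to 0 can contribute.\<close>

lemma per_eq_single:
  fixes f :: "real^'n::finite \<Rightarrow> real"
  assumes supp: "\<And>x. f x \<noteq> 0 \<Longrightarrow> (\<forall>i. \<bar>x $ i\<bar> \<le> real A)" and N: "N \<ge> 8 * A" "A \<ge> 1"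
    and r: "\<And>i. \<bar>\<theta> i - of_int (r i)\<bar> \<le> 1 / 2"
  shows "per N f \<theta> = f (\<chi> i. real N * (\<theta> i - of_int (r i)))"
proof -
  define k0 :: "int^'n" where "k0 = (\<chi> i. - r i)"
  let ?g = "\<lambda>k::int^'n. f (\<chi> i. real N * (\<theta> i + of_int (k $ i)))"
  have "?g k = 0" if "k \<noteq> k0" for k
  proof -
    have "\<exists>i. k $ i \<noteq> k0 $ i" using that by (simp add: vec_eq_iff)
    then obtain i where i: "k $ i \<noteq> k0 $ i" by blast
    define z where "z = k $ i + r i"
    have "z \<noteq> 0" using i by (simp add: z_def k0_def)
    then have "\<bar>real_of_int z\<bar> \<ge> 1" by linarith
    moreover have "\<theta> i + of_int (k $ i) = (\<theta> i - of_int (r i)) + of_int z" by (simp add: z_def)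
    ultimately have "\<bar>\<theta> i + of_int (k $ i)\<bar> \<ge> 1 / 2" using r[of i] by linarith
    then have "real N * (1 / 2) \<le> real N * \<bar>\<theta> i + of_int (k $ i)\<bar>" by (intro mult_left_mono) auto
    moreover have "real N * (1 / 2) > real A" using N by linarith
    ultimately have "real N * \<bar>\<theta> i + of_int (k $ i)\<bar> > real A" by linarith
    then have "\<bar>real N * (\<theta> i + of_int (k $ i))\<bar> > real A" by (simp only: abs_mult abs_of_nat)
    then have "\<not> (\<forall>i. \<bar>(\<chi> i. real N * (\<theta> i + of_int (k $ i))) $ i\<bar> \<le> real A)"
      by (simp only: vec_lambda_beta not_all not_le) blast
    then show ?thesis using supp by blast
  qed
  then have "infsum ?g UNIV = infsum ?g {k0}"
    by (intro infsum_cong_neutral) auto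
  then show ?thesis unfolding per_def by (simp add: k0_def)
qed

lemma uniform_continuity_coordinates:
  fixes f :: "real^'n::finite \<Rightarrow> real"
  assumes cont: "continuous_on UNIV f" and supp: "\<And>x. f x \<noteq> 0 \<Longrightarrow> (\<forall>i. \<bar>x $ i\<bar> \<le> real A)" and e: "\<epsilon> > 0"
  shows "\<exists>\<delta>>0. \<forall>x y::real^'n. (\<forall>i. \<bar>x $ i - y $ i\<bar> \<le> \<delta>) \<longrightarrow> \<bar>f x - f y\<bar> \<le> \<epsilon>"
proof -
  define K :: "(real^'n) set" where "K = cbox (\<chi> i. - (real A + 1)) (\<chi> i. real A + 1)"
  have "compact K" by (simp add: K_def)
  moreover have "continuous_on K f" using cont continuous_on_subset by blast
  ultimately have "uniformly_continuous_on K f" by (rule compact_uniformly_continuous[rotated])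
  from this[unfolded uniformly_continuous_on_def, rule_format, OF e] obtain d where
    d: "d > 0" "\<forall>x\<in>K. \<forall>x'\<in>K. dist x' x < d \<longrightarrow> dist (f x') (f x) < \<epsilon>" by blast
  define \<delta> where "\<delta> = min 1 (d / (2 * real CARD('n)))"
  have \<delta>: "\<delta> > 0" "\<delta> \<le> 1" using d by (auto simp: \<delta>_def)
  have "\<bar>f x - f y\<bar> \<le> \<epsilon>" if xy: "\<forall>i. \<bar>x $ i - y $ i\<bar> \<le> \<delta>" for x y :: "real^'n"
  proof (cases "f x = 0 \<and> f y = 0")
    case False
    have "x \<in> K \<and> y \<in> K"
    proof -
      have "\<bar>x $ i\<bar> \<le> real A + 1 \<and> \<bar>y $ i\<bar> \<le> real A + 1" for i
      proof -
        have "\<bar>x $ i - y $ i\<bar> \<le> 1" using xy \<delta>(2) order_trans by blast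
        moreover have "\<bar>x $ i\<bar> \<le> real A \<or> \<bar>y $ i\<bar> \<le> real A" using False supp[of x] supp[of y] by blast
        ultimately show ?thesis by linarith
      qed
      then have "- (real A + 1) \<le> x $ i \<and> x $ i \<le> real A + 1 \<and> - (real A + 1) \<le> y $ i \<and> y $ i \<le> real A + 1" for i
        by (smt (verit))
      then show ?thesis unfolding K_def by (simp add: mem_box_cart)
    qed
    moreover have "dist y x < d"
    proof -
      have "dist y x = norm (y - x)" by (rule dist_norm)
      also have "\<dots> \<le> (\<Sum>i\<in>UNIV. \<bar>(y - x) $ i\<bar>)" by (rule norm_le_l1_cart)
      also have "\<dots> \<le> (\<Sum>i\<in>(UNIV::'n set). \<delta>)" using xy by (intro sum_mono) (simp add: abs_minus_commute)
      also have "\<dots> = real CARD('n) * \<delta>" by simp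
      also have "\<dots> \<le> real CARD('n) * (d / (2 * real CARD('n)))" by (intro mult_left_mono) (auto simp: \<delta>_def)
      also have "\<dots> < d" using d(1) by simp
      finally show ?thesis .
    qed
    ultimately have "dist (f y) (f x) < \<epsilon>" using d(2) by blast
    then show ?thesis by (simp add: dist_real_def)
  qed (use e in auto)
  then show ?thesis using \<delta> by blast
qed

locale cc_fun =
  fixes f :: "real^'n::finite \<Rightarrow> real" and A :: nat
  assumes cont: "continuous_on UNIV f" and supp: "\<And>x. f x \<noteq> 0 \<Longrightarrow> (\<forall>i. \<bar>x $ i\<bar> \<le> real A)" and A: "A \<ge> 1"
begin

lemma bounded_f: "\<exists>F\<ge>0. \<forall>x. \<bar>f x\<bar> \<le> F"
proof -
  define K :: "(real^'n) set" where "K = cbox (\<chi> i. - real A) (\<chi> i. real A)"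
  have "compact (f ` K)" using cont continuous_on_subset[of UNIV f K]
    by (intro compact_continuous_image) (auto simp: K_def)
  then have "bounded (f ` K)" by (rule compact_imp_bounded)
  then obtain B where B: "\<forall>y\<in>f ` K. norm y \<le> B" by (auto simp: bounded_iff)
  have "\<bar>f x\<bar> \<le> max B 0" for x
  proof (cases "f x = 0")
    case False
    have "- real A \<le> x $ i \<and> x $ i \<le> real A" for i using supp[OF False] by (smt (verit))
    then have "x \<in> K" unfolding K_def by (simp add: mem_box_cart)
    then show ?thesis using B by auto
  qed simp
  then show ?thesis by (intro exI[of _ "max B 0"]) auto
qed

text \<open>Large enough for both regimes: \<open>16 * (2 * A + 1)^2\<close> from the lower bound
  for \<open>env\<close> near the origin, \<open>192 * A\<close> from the nodes in
  \<open>grid_mass_far\<close>.\<close>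

definition cA :: real where "cA = 200 * real A * (2 * real A + 1)\<^sup>2"

lemma cA1: "cA \<ge> 1"
proof -
  have "(1::real) * 1 \<le> 200 * real A * (2 * real A + 1)\<^sup>2" using A by (intro mult_mono) auto
  then show ?thesis by (simp add: cA_def)
qed

lemma env_cA:
  assumes "N \<ge> 1" "\<bar>real N * t\<bar> \<le> 2 * real A"
  shows "1 \<le> cA * env N t"
proof -
  have "pi * (\<bar>real N * t\<bar> + 1 / 2) \<le> 4 * (2 * real A + 1)"
    using assms(2) pi_less_4 A by (intro mult_mono) auto
  then have "(pi * (\<bar>real N * t\<bar> + 1 / 2))\<^sup>2 \<le> (4 * (2 * real A + 1))\<^sup>2" by (rule power_mono) simp
  also have "\<dots> = 16 * (2 * real A + 1)\<^sup>2" by (simp only: power_mult_distrib) simp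
  also have "\<dots> \<le> cA" unfolding cA_def using A by (intro mult_right_mono) auto
  finally have "env N t * (pi * (\<bar>real N * t\<bar> + 1 / 2))\<^sup>2 \<le> env N t * cA" by (rule mult_left_mono) simp
  then show ?thesis using env_lower[OF assms(1), of t] by (simp add: mult.commute)
qed

text \<open>From \<open>|N t| > 2\<close> follows \<open>|N t| + 1/2 \<le> 5/4 |N t|\<close>;
  together with pi below 3.2 this gives the factor 4, whose square is the 16.\<close>

lemma env_far:
  assumes "N \<ge> 1" "\<bar>real N * t\<bar> > 2 * real A"
  shows "1 / (real N * t)\<^sup>2 \<le> 16 * env N t"
proof -
  let ?y = "\<bar>real N * t\<bar>"
  have y: "?y > 2" using assms A by linarith
  have pi: "pi \<le> 3.2" using pi_approx by simp
  have "pi * (?y + 1 / 2) \<le> 3.2 * (5 / 4 * ?y)" using y pi by (intro mult_mono) auto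
  then have "(pi * (?y + 1 / 2))\<^sup>2 \<le> (4 * ?y)\<^sup>2" using y by (intro power_mono) auto
  then have "env N t * (pi * (?y + 1 / 2))\<^sup>2 \<le> env N t * (16 * (real N * t)\<^sup>2)"
    by (intro mult_left_mono) (auto simp: power_mult_distrib)
  then have "1 \<le> env N t * (16 * (real N * t)\<^sup>2)" using env_lower[OF assms(1), of t] by linarith
  moreover have "(real N * t)\<^sup>2 > 0"
  proof -
    have "real N * t \<noteq> 0"
    proof
      assume h: "real N * t = 0"
      show False using y unfolding h by simp
    qed
    then show ?thesis by (simp only: zero_less_power2 simp_thms)
  qed
  ultimately show ?thesis by (simp add: pos_divide_le_eq mult_ac)
qed

lemma grid_mass_le_1:
  assumes N: "N \<ge> 8 * A" and T: "T \<ge> 1"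
  shows "(\<Sum>j\<in>{- int (T * A)..int (T * A)}. fejer (T * N) (t - of_int j / real (T * N))) \<le> 1"
proof -
  let ?w = "- int (T * A) - 1"
  have "N \<ge> 1" using N A by simp
  then have M1: "T * N \<ge> 1" using T by simp
  have "T * A \<ge> 1" using A T by simp
  moreover have "8 * (T * A) \<le> T * N" using mult_left_mono[OF N, of T] by simp
  ultimately have "2 * (T * A) + 1 \<le> T * N" by linarith
  then have "int (2 * (T * A) + 1) \<le> int (T * N)" by (simp only: of_nat_le_iff)
  then have "{- int (T * A)..int (T * A)} \<subseteq> {?w<..?w + int (T * N)}" by auto
  then have "(\<Sum>j\<in>{- int (T * A)..int (T * A)}. fejer (T * N) (t - of_int j / real (T * N)))
     \<le> (\<Sum>j\<in>{?w<..?w + int (T * N)}. fejer (T * N) (t - of_int j / real (T * N)))"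
    by (intro sum_mono2) auto
  then show ?thesis unfolding fejer_partition_window[OF M1] .
qed

text \<open>Here \<open>t\<close> is more than twice as far out as the nodes, so each node has
  distance at least \<open>|t| / 2\<close> from \<open>t\<close> modulo 1 and its kernel is at most
  \<open>4 / (T * N * t)^2\<close>. There are at most \<open>3 * T * A\<close> nodes, which leaves a
  factor \<open>1 / T\<close>.\<close>

lemma grid_mass_far:
  assumes N: "N \<ge> 8 * A" and T: "T \<ge> 1" and t: "\<bar>t\<bar> \<le> 1 / 2" "\<bar>real N * t\<bar> > 2 * real A"
  shows "(\<Sum>j\<in>{- int (T * A)..int (T * A)}. fejer (T * N) (t - of_int j / real (T * N))) \<le> cA / real T * env N t"
proof -
  have N1: "N \<ge> 1" using N A by simp
  have M1: "T * N \<ge> 1" using T N1 by simp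
  have Ny: "real N * \<bar>t\<bar> > 2 * real A" using t(2) by (simp add: abs_mult)
  have t0: "t \<noteq> 0" using Ny A by auto
  have b: "fejer (T * N) (t - of_int j / real (T * N)) \<le> 4 / (real T)\<^sup>2 * (1 / (real N * t)\<^sup>2)"
    if j: "j \<in> {- int (T * A)..int (T * A)}" for j
  proof -
    let ?u = "of_int j / real (T * N)"
    have "real_of_int (- int (T * A)) \<le> real_of_int j" "real_of_int j \<le> real_of_int (int (T * A))"
      using j by (simp_all only: of_int_le_iff atLeastAtMost_iff)
    then have "\<bar>real_of_int j\<bar> \<le> real (T * A)" by (simp add: abs_le_iff)
    then have u: "\<bar>?u\<bar> * real N \<le> real A" using T N1 by (simp add: abs_divide field_simps)
    have "\<bar>?u\<bar> * real N \<le> \<bar>t\<bar> / 2 * real N" using u Ny by (simp add: mult.commute)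
    then have u1: "\<bar>?u\<bar> \<le> \<bar>t\<bar> / 2" by (rule mult_right_le_imp_le) (use N1 in simp)
    have "fejer (T * N) (t - ?u) * (real (T * N) * (\<bar>t\<bar> / 2))\<^sup>2 \<le> 1"
    proof (rule fejer_upper[OF M1])
      fix k :: int
      show "\<bar>t\<bar> / 2 \<le> \<bar>t - ?u - of_int k\<bar>"
      proof (cases "k = 0")
        case False
        then have "\<bar>real_of_int k\<bar> \<ge> 1" by linarith
        then show ?thesis using u1 t(1) by linarith
      next
        case True
        then have "\<bar>t - ?u - of_int k\<bar> = \<bar>t - ?u\<bar>" by simp
        moreover have "\<bar>t\<bar> / 2 \<le> \<bar>t - u\<bar>" if "\<bar>u\<bar> \<le> \<bar>t\<bar> / 2" for u :: real using that by linarith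
        ultimately show ?thesis using u1 by simp
      qed
    qed simp
    moreover have "(real (T * N) * (\<bar>t\<bar> / 2))\<^sup>2 = (real T)\<^sup>2 * (real N * t)\<^sup>2 / 4"
      by (simp add: power_mult_distrib power_divide)
    moreover have "(real T)\<^sup>2 * (real N * t)\<^sup>2 / 4 > 0" using T N1 t0 by simp
    ultimately have "fejer (T * N) (t - ?u) \<le> 1 / ((real T)\<^sup>2 * (real N * t)\<^sup>2 / 4)"
      by (simp only: pos_le_divide_eq)
    then show ?thesis by simp
  qed
  have "(\<Sum>j\<in>{- int (T * A)..int (T * A)}. fejer (T * N) (t - of_int j / real (T * N)))
     \<le> real (card {- int (T * A)..int (T * A)}) * (4 / (real T)\<^sup>2 * (1 / (real N * t)\<^sup>2))"
    by (rule sum_bounded_above) (rule b)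
  also have "\<dots> \<le> (3 * real T * real A) * (4 / (real T)\<^sup>2 * (16 * env N t))"
  proof (intro mult_mono)
    have "card {- int x..int x} = 2 * x + 1" for x by simp
    from this[of "T * A"] have "card {- int (T * A)..int (T * A)} = 2 * (T * A) + 1" .
    moreover have "2 * (T * A) + 1 \<le> 3 * (T * A)" using A T by simp
    ultimately have "real (card {- int (T * A)..int (T * A)}) \<le> real (3 * (T * A))" by (simp only: of_nat_le_iff)
    then show "real (card {- int (T * A)..int (T * A)}) \<le> 3 * real T * real A" by simp
    show "1 / (real N * t)\<^sup>2 \<le> 16 * env N t" by (rule env_far[OF N1 t(2)])
  qed auto
  also have "\<dots> = 192 * real A / real T * env N t" using T by (simp add: power2_eq_square)
  also have "\<dots> \<le> cA / real T * env N t"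
  proof (intro mult_right_mono divide_right_mono)
    have "192 * real A * 1 \<le> 200 * real A * (2 * real A + 1)\<^sup>2" using A by (intro mult_mono) auto
    then show "192 * real A \<le> cA" by (simp add: cA_def)
  qed auto
  finally show ?thesis .
qed

text \<open>Here \<open>f\<close> vanishes and the interpolant must be small. The sum over the grid
  factorises over the coordinates, and the far coordinate \<open>i0\<close> supplies the factor
  \<open>1 / T\<close>.\<close>

lemma approx_far:
  assumes F: "\<And>x. \<bar>f x\<bar> \<le> F" "F \<ge> 0" and N: "N \<ge> 8 * A" and T: "T \<ge> 1"
    and t: "\<And>i. \<bar>t i\<bar> \<le> 1 / 2" and far: "\<bar>real N * t i0\<bar> > 2 * real A"
  shows "\<bar>f (\<chi> i. real N * t i) - fsum T A N f t\<bar> \<le> F / real T * cA ^ CARD('n) * (\<Prod>i\<in>UNIV. env N (t i))"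
proof -
  define s where "s i = (\<Sum>j\<in>{- int (T * A)..int (T * A)}. fejer (T * N) (t i - of_int j / real (T * N)))" for i
  have N1: "N \<ge> 1" using N A by simp
  have f0: "f (\<chi> i. real N * t i) = 0"
  proof (rule ccontr)
    assume "f (\<chi> i. real N * t i) \<noteq> 0"
    from supp[OF this] have "\<bar>real N * t i0\<bar> \<le> real A" by simp
    then show False using far by linarith
  qed
  have "\<bar>fsum T A N f t\<bar> \<le> (\<Sum>j\<in>grid T A. F * (\<Prod>i\<in>UNIV. fejer (T * N) (t i - of_int (j i) / real (T * N))))"
    unfolding fsum_def
    by (rule order_trans[OF sum_abs], rule sum_mono) (simp add: abs_mult F mult_right_mono prod_nonneg)
  also have "\<dots> = F * (\<Prod>i\<in>UNIV. s i)"
    unfolding sum_distrib_left[symmetric] s_def grid_def by (subst prod_sum_PiE) auto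
  also have "(\<Prod>i\<in>UNIV. s i) = s i0 * (\<Prod>i\<in>UNIV - {i0}. s i)" by (rule prod.remove) auto
  also have "F * (s i0 * (\<Prod>i\<in>UNIV - {i0}. s i)) \<le> F * ((cA / real T * env N (t i0)) * (\<Prod>i\<in>UNIV - {i0}. cA * env N (t i)))"
  proof (intro mult_left_mono mult_mono prod_mono conjI)
    show "s i0 \<le> cA / real T * env N (t i0)" unfolding s_def by (rule grid_mass_far[OF N T t far])
    fix i
    show "0 \<le> s i" by (simp add: s_def sum_nonneg)
    show "s i \<le> cA * env N (t i)"
    proof (cases "\<bar>real N * t i\<bar> > 2 * real A")
      case True
      have "s i \<le> cA / real T * env N (t i)" unfolding s_def by (rule grid_mass_far[OF N T t True])
      also have "\<dots> \<le> cA * env N (t i)" using T cA1 by (intro mult_right_mono) (auto simp: divide_le_eq)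
      finally show ?thesis .
    next
      case False
      have "s i \<le> 1" unfolding s_def by (rule grid_mass_le_1[OF N T])
      then show ?thesis using env_cA[OF N1, of "t i"] False by linarith
    qed
  qed (use F cA1 in \<open>auto simp: s_def intro!: sum_nonneg prod_nonneg\<close>)
  also have "\<dots> = F / real T * (\<Prod>i\<in>UNIV. cA * env N (t i))"
    by (subst prod.remove[of UNIV i0]) auto
  also have "\<dots> = F / real T * cA ^ CARD('n) * (\<Prod>i\<in>UNIV. env N (t i))" by (simp add: prod.distrib)
  finally show ?thesis by (simp add: f0)
qed

text \<open>Fejer's argument: extend the nodes from the grid to a full period, where the weights sum
  to 1 and \<open>f\<close> is 0 at the added nodes. Nodes within \<delta> in every coordinate
  contribute at most \<epsilon>; the mass of the others is a tail of inverse squares.\<close>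

lemma approx_near:
  assumes F: "\<And>x. \<bar>f x\<bar> \<le> F" "F \<ge> 0" and N: "N \<ge> 8 * A" and T: "T \<ge> 1"
    and near: "\<And>i. \<bar>real N * t i\<bar> \<le> 2 * real A"
    and uc: "\<forall>x y::real^'n. (\<forall>i. \<bar>x $ i - y $ i\<bar> \<le> \<delta>) \<longrightarrow> \<bar>f x - f y\<bar> \<le> \<epsilon>" and \<delta>: "\<delta> > 0" "\<delta> * real T \<ge> 1" "\<epsilon> \<ge> 0"
  shows "\<bar>f (\<chi> i. real N * t i) - fsum T A N f t\<bar> \<le> (\<epsilon> + 8 * F * real CARD('n) / (\<delta> * real T)) * cA ^ CARD('n) * (\<Prod>i\<in>UNIV. env N (t i))"
proof -
  define M where "M = T * N"
  have N1: "N \<ge> 1" using N A by simp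
  have M1: "M \<ge> 1" using T N1 by (simp add: M_def)
  define y where "y i = real N * t i" for i
  define K where "K i j = fejer M (t i - of_int j / real M)" for i and j :: int
  \<comment> \<open>Start of a window of \<open>M\<close> consecutive nodes centred at
    \<open>t i\<close>, so that every node in it is within half a period.\<close>
  define w where "w i = \<lfloor>real T * y i - real M / 2\<rfloor>" for i
  define W where "W i = {w i<..w i + int M}" for i
  have sumW: "(\<Sum>j\<in>W i. K i j) = 1" for i unfolding W_def K_def by (rule fejer_partition_window[OF M1])
  have K0: "K i j \<ge> 0" for i j by (simp add: K_def)
  have Wn: "\<bar>of_int j - real T * y i\<bar> \<le> real M / 2" if "j \<in> W i" for i j
  proof -
    have "w i + 1 \<le> j" "j \<le> w i + int M" using that by (auto simp: W_def)
    then have "real_of_int (w i) + 1 \<le> of_int j" "real_of_int j \<le> of_int (w i) + real M" by linarith+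
    moreover have "real_of_int (w i) \<le> real T * y i - real M / 2" "real T * y i - real M / 2 < real_of_int (w i) + 1"
      unfolding w_def by linarith+
    ultimately show ?thesis by linarith
  qed
  have Kt: "K i j \<le> 1 / (of_int j - real T * y i)\<^sup>2" if j: "j \<in> W i" "of_int j \<noteq> real T * y i" for i j
  proof -
    let ?\<phi> = "t i - of_int j / real M"
    have e: "real M * ?\<phi> = - (of_int j - real T * y i)"
      using M1 by (simp add: M_def y_def field_simps)
    have "\<bar>real M * ?\<phi>\<bar> \<le> real M / 2" using Wn[OF j(1)] by (simp only: e abs_minus_cancel)
    then have "real M * \<bar>?\<phi>\<bar> \<le> real M * (1 / 2)" by (simp only: abs_mult abs_of_nat) 
    then have ph: "\<bar>?\<phi>\<bar> \<le> 1 / 2" using M1 by (simp only: mult_le_cancel_left_pos of_nat_0_less_iff)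
    have "fejer M ?\<phi> * (real M * \<bar>?\<phi>\<bar>)\<^sup>2 \<le> 1"
    proof (rule fejer_upper[OF M1])
      fix k :: int
      show "\<bar>?\<phi>\<bar> \<le> \<bar>?\<phi> - of_int k\<bar>"
      proof (cases "k = 0")
        case False
        then have "\<bar>real_of_int k\<bar> \<ge> 1" by linarith
        then show ?thesis using ph by linarith
      qed simp
    qed simp
    moreover have "(real M * \<bar>?\<phi>\<bar>)\<^sup>2 = (of_int j - real T * y i)\<^sup>2"
      by (metis e abs_mult abs_of_nat power2_abs power2_minus)
    moreover have "(of_int j - real T * y i)\<^sup>2 > 0" using j(2) by simp
    ultimately show ?thesis unfolding K_def by (simp only: pos_le_divide_eq)
  qed
  have fW: "finite (W i)" for i by (simp add: W_def)
  have sub: "{- int (T * A)..int (T * A)} \<subseteq> W i" for i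
  proof -
    have TA: "real (T * A) \<ge> 1" using A T by (simp add: mult_ge1_I)
    have "real M / 2 \<ge> 4 * real (T * A)"
    proof -
      have "8 * (T * A) \<le> T * N" using mult_le_mono2[OF N, of T] by (simp add: mult.left_commute)
      then have "real (8 * (T * A)) \<le> real (T * N)" by (simp only: of_nat_le_iff)
      then show ?thesis by (simp add: M_def)
    qed
    moreover have "\<bar>real T * y i\<bar> \<le> 2 * real (T * A)"
      using mult_left_mono[OF near[of i], of "real T"] by (simp add: y_def abs_mult mult_ac)
    ultimately have "real_of_int (w i) < - real (T * A)" "real_of_int (w i) + real M \<ge> real (T * A)"
      using TA unfolding w_def by linarith+
    then have "w i < - int (T * A)" "int (T * A) \<le> w i + int M" by linarith+
    then show ?thesis by (auto simp: W_def)
  qed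
  let ?P = "PiE UNIV W"
  have fP: "finite ?P" using fW by (simp add: finite_PiE)
  define X where "X j = ((\<chi> i. of_int (j i) / real T) :: real^'n)" for j :: "'n \<Rightarrow> int"
  define KK where "KK j = (\<Prod>i\<in>UNIV. K i (j i))" for j :: "'n \<Rightarrow> int"
  have KK0: "KK j \<ge> 0" for j using K0 by (simp add: KK_def prod_nonneg)
  have "fsum T A N f t = (\<Sum>j\<in>grid T A. f (X j) * KK j)"
    unfolding fsum_def X_def KK_def K_def M_def ..
  also have "\<dots> = (\<Sum>j\<in>?P. f (X j) * KK j)"
  proof (rule sum.mono_neutral_left[OF fP])
    show "grid T A \<subseteq> ?P" unfolding grid_def using sub by (intro PiE_mono) auto
    show "\<forall>j\<in>?P - grid T A. f (X j) * KK j = 0"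
    proof
      fix j assume "j \<in> ?P - grid T A"
      then have "j \<notin> grid T A" by simp
      then obtain i where "j i \<notin> {- int (T * A)..int (T * A)}" unfolding grid_def PiE_UNIV_domain Pi_iff by blast
      then have "\<bar>j i\<bar> > int (T * A)" unfolding atLeastAtMost_iff by linarith
      then have "\<bar>real_of_int (j i)\<bar> > real (T * A)" by linarith
      then have "\<bar>X j $ i\<bar> > real A" using T by (simp add: X_def abs_divide field_simps)
      then have "f (X j) = 0" using supp[of "X j"] by (meson not_le)
      then show "f (X j) * KK j = 0" by simp
    qed
  qed
  finally have fs: "fsum T A N f t = (\<Sum>j\<in>?P. f (X j) * KK j)" .
  have one: "(\<Sum>j\<in>?P. KK j) = 1"
    unfolding KK_def using prod_sum_PiE[of UNIV W K] fW sumW by simp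
  \<comment> \<open>Indicator of the nodes farther than \<delta> in coordinate \<open>i\<close>.
    Inserted into one factor of the product, it leaves the other factors with total mass 1.\<close>
  let ?b = "\<lambda>i j. if \<bar>of_int j - real T * y i\<bar> > \<delta> * real T then 1 else (0::real)"
  have tail: "(\<Sum>j\<in>W i. ?b i j * K i j) \<le> 4 / (\<delta> * real T)" for i
  proof -
    have "(\<Sum>j\<in>W i. ?b i j * K i j) = (\<Sum>j\<in>{j\<in>W i. \<bar>of_int j - real T * y i\<bar> > \<delta> * real T}. K i j)"
      using fW by (intro sum.mono_neutral_cong_right) auto
    also have "\<dots> \<le> (\<Sum>j\<in>{j\<in>W i. \<bar>of_int j - real T * y i\<bar> > \<delta> * real T}. 1 / (of_int j - real T * y i)\<^sup>2)"
      using \<delta> by (intro sum_mono Kt) auto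
    also have "\<dots> \<le> 4 / (\<delta> * real T)" using fW \<delta> by (intro sum_inverse_square_tail) auto
    finally show ?thesis .
  qed
  have tailP: "(\<Sum>j\<in>?P. ?b i (j i) * KK j) \<le> 4 / (\<delta> * real T)" for i
  proof -
    have "?b i (j i) * KK j = (\<Prod>i'\<in>UNIV. (if i' = i then ?b i (j i') else 1) * K i' (j i'))" for j
      unfolding prod.distrib KK_def by simp
    then have "(\<Sum>j\<in>?P. ?b i (j i) * KK j) = (\<Sum>j\<in>?P. \<Prod>i'\<in>UNIV. (if i' = i then ?b i (j i') else 1) * K i' (j i'))"
      by (simp only:)
    also have "\<dots> = (\<Prod>i'\<in>UNIV. \<Sum>j\<in>W i'. (if i' = i then ?b i j else 1) * K i' j)"
      by (rule prod_sum_PiE[symmetric]) (auto simp: fW)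
    also have "\<dots> = (\<Prod>i'\<in>UNIV. if i' = i then (\<Sum>j\<in>W i. ?b i j * K i j) else 1)"
      by (rule prod.cong[OF refl]) (auto simp: sumW)
    also have "\<dots> = (\<Sum>j\<in>W i. ?b i j * K i j)" by simp
    finally show ?thesis using tail by simp
  qed
  define Y :: "real^'n" where "Y = (\<chi> i. y i)"
  have pt: "\<bar>f Y - f (X j)\<bar> \<le> \<epsilon> + (\<Sum>i\<in>UNIV. 2 * F * ?b i (j i))" for j
  proof (cases "\<forall>i. \<bar>Y $ i - X j $ i\<bar> \<le> \<delta>")
    case True
    then have "\<bar>f Y - f (X j)\<bar> \<le> \<epsilon>" using uc by blast
    moreover have "0 \<le> (\<Sum>i\<in>UNIV. 2 * F * ?b i (j i))" using F by (intro sum_nonneg) auto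
    ultimately show ?thesis by linarith
  next
    case False
    then obtain i where "\<bar>Y $ i - X j $ i\<bar> > \<delta>" by (auto simp: not_le)
    then have "\<bar>y i - of_int (j i) / real T\<bar> * real T > \<delta> * real T" using T by (simp add: Y_def X_def)
    moreover have "\<bar>y i - of_int (j i) / real T\<bar> * real T = \<bar>(y i - of_int (j i) / real T) * real T\<bar>" by (simp add: abs_mult)
    moreover have "(y i - of_int (j i) / real T) * real T = - (of_int (j i) - real T * y i)" using T by (simp add: algebra_simps)
    ultimately have "?b i (j i) = 1" by (simp only: abs_minus_cancel) simp
    then have "2 * F \<le> (\<Sum>i\<in>UNIV. 2 * F * ?b i (j i))"
      using member_le_sum[of i UNIV "\<lambda>i. 2 * F * ?b i (j i)"] F by auto
    moreover have "\<bar>f Y - f (X j)\<bar> \<le> 2 * F" using F(1)[of Y] F(1)[of "X j"] by linarith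
    ultimately show ?thesis using \<delta>(3) by linarith
  qed
  have "f Y - fsum T A N f t = (\<Sum>j\<in>?P. (f Y - f (X j)) * KK j)"
    unfolding left_diff_distrib sum_subtractf fs sum_distrib_left[symmetric] one by simp
  also have "\<bar>\<dots>\<bar> \<le> (\<Sum>j\<in>?P. (\<epsilon> + (\<Sum>i\<in>UNIV. 2 * F * ?b i (j i))) * KK j)"
    by (rule order_trans[OF sum_abs], rule sum_mono) (simp add: abs_mult KK0 pt mult_right_mono)
  also have "\<dots> = \<epsilon> + (\<Sum>i\<in>UNIV. 2 * F * (\<Sum>j\<in>?P. ?b i (j i) * KK j))"
  proof -
    have "(\<Sum>j\<in>?P. (\<Sum>i\<in>UNIV. 2 * F * ?b i (j i)) * KK j) = (\<Sum>i\<in>UNIV. 2 * F * (\<Sum>j\<in>?P. ?b i (j i) * KK j))"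
      unfolding sum_distrib_right sum_distrib_left by (subst sum.swap) (simp only: mult.assoc)
    then show ?thesis by (simp only: distrib_right sum.distrib sum_distrib_left[symmetric] one mult_1_right)
  qed
  also have "\<dots> \<le> \<epsilon> + (\<Sum>i\<in>(UNIV::'n set). 2 * F * (4 / (\<delta> * real T)))"
    using tailP F by (intro add_left_mono sum_mono mult_left_mono) auto
  also have "\<dots> = \<epsilon> + 8 * F * real CARD('n) / (\<delta> * real T)" by simp
  finally have main: "\<bar>f Y - fsum T A N f t\<bar> \<le> \<epsilon> + 8 * F * real CARD('n) / (\<delta> * real T)" .
  \<comment> \<open>Near the origin the envelope is bounded below, so an absolute error may be
    written as a multiple of it.\<close>
  have "1 \<le> (\<Prod>i\<in>UNIV. cA * env N (t i))"
    by (rule prod_ge_1) (use env_cA[OF N1 near] in auto)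
  then have "1 \<le> cA ^ CARD('n) * (\<Prod>i\<in>UNIV. env N (t i))" by (simp add: prod.distrib)
  moreover have "0 \<le> \<epsilon> + 8 * F * real CARD('n) / (\<delta> * real T)" using F \<delta> by auto
  ultimately have "(\<epsilon> + 8 * F * real CARD('n) / (\<delta> * real T)) * 1
     \<le> (\<epsilon> + 8 * F * real CARD('n) / (\<delta> * real T)) * (cA ^ CARD('n) * (\<Prod>i\<in>UNIV. env N (t i)))" by (rule mult_left_mono)
  then show ?thesis using main unfolding Y_def y_def by (simp add: mult.assoc)
qed

text \<open>A uniform error would be useless: the averages divide sums over far more than
  \<open>N\<close> points by \<open>N\<close> alone. The error is therefore measured by the product
  of envelopes, itself a sum of Fejer products, whose average converges. \<open>T0\<close> is
  independent of \<open>N\<close>.\<close>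

theorem fejer_approximation:
  assumes \<eta>: "\<eta> > 0"
  shows "\<exists>T0\<ge>1. \<forall>T\<ge>T0. \<forall>N\<ge>8 * A. \<forall>\<theta>. \<bar>per N f \<theta> - fsum T A N f \<theta>\<bar> \<le> \<eta> * (\<Prod>i\<in>UNIV. env N (\<theta> i))"
proof -
  obtain F where F: "F \<ge> 0" "\<And>x. \<bar>f x\<bar> \<le> F" using bounded_f by blast
  define c where "c = cA ^ CARD('n)"
  have c1: "c \<ge> 1" unfolding c_def by (rule one_le_power[OF cA1])
  have "\<eta> / (2 * c) > 0" using \<eta> c1 by simp
  from uniform_continuity_coordinates[OF cont supp this] obtain \<delta> where \<delta>: "\<delta> > 0"
    "\<forall>x y::real^'n. (\<forall>i. \<bar>x $ i - y $ i\<bar> \<le> \<delta>) \<longrightarrow> \<bar>f x - f y\<bar> \<le> \<eta> / (2 * c)" by blast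
  \<comment> \<open>The three summands serve the condition \<open>\<delta> * T \<ge> 1\<close>, the
    tail mass in the near case, and the far case.\<close>
  define Tr where "Tr = 1 / \<delta> + 16 * F * real CARD('n) * c / (\<delta> * \<eta>) + F * c / \<eta>"
  have parts: "0 \<le> 1 / \<delta>" "0 \<le> 16 * F * real CARD('n) * c / (\<delta> * \<eta>)" "0 \<le> F * c / \<eta>" using \<delta> F c1 \<eta> by auto
  define T0 where "T0 = nat \<lceil>Tr\<rceil> + 1"
  have "\<bar>per N f \<theta> - fsum T A N f \<theta>\<bar> \<le> \<eta> * (\<Prod>i\<in>UNIV. env N (\<theta> i))" if T: "T \<ge> T0" and N: "N \<ge> 8 * A" for T N \<theta>
  proof -
    have Tb: "real T \<ge> Tr" "T \<ge> 1" using T unfolding T0_def by linarith+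
    have T1: "\<delta> * real T \<ge> 1"
    proof -
      have "1 / \<delta> \<le> real T" using Tb parts unfolding Tr_def by linarith
      then show ?thesis using \<delta>(1) by (simp add: divide_le_eq mult.commute)
    qed
    have T2: "8 * F * real CARD('n) / (\<delta> * real T) * c \<le> \<eta> / 2"
    proof -
      have "16 * F * real CARD('n) * c / (\<delta> * \<eta>) \<le> real T" using Tb parts unfolding Tr_def by linarith
      then have "16 * F * real CARD('n) * c \<le> real T * (\<delta> * \<eta>)" using \<delta>(1) \<eta> by (simp add: pos_divide_le_eq)
      then show ?thesis using \<delta>(1) Tb(2) by (simp add: field_simps)
    qed
    have T3: "F / real T * c \<le> \<eta>"
    proof -
      have "F * c / \<eta> \<le> real T" using Tb parts unfolding Tr_def by linarith
      then show ?thesis using \<eta> Tb(2) by (simp add: field_simps)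
    qed
    define r where "r i = round (\<theta> i)" for i
    define t where "t i = \<theta> i - of_int (r i)" for i
    have t: "\<bar>t i\<bar> \<le> 1 / 2" for i
      using of_int_round_abs_le[of "\<theta> i"] by (simp add: t_def r_def abs_minus_commute)
    have th: "\<theta> i = t i + of_int (r i)" for i by (simp add: t_def)
    have p: "per N f \<theta> = f (\<chi> i. real N * t i)"
      using per_eq_single[OF supp N A, where \<theta> = \<theta> and r = r] t by (simp add: t_def)
    have q: "fsum T A N f \<theta> = fsum T A N f t"
    proof -
      have "fejer (T * N) (\<theta> i - x) = fejer (T * N) (t i - x)" for i x
      proof -
        have "\<theta> i - x = (t i - x) + of_int (r i)" by (simp add: th)
        then show ?thesis by (simp only: fejer_periodic)
      qed
      then show ?thesis by (simp add: fsum_def)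
    qed
    have e: "(\<Prod>i\<in>UNIV. env N (\<theta> i)) = (\<Prod>i\<in>UNIV. env N (t i))"
      by (rule prod.cong[OF refl]) (simp only: th env_periodic)
    have e0: "(\<Prod>i\<in>UNIV. env N (t i)) \<ge> 0" by (simp add: prod_nonneg)
    show ?thesis
    proof (cases "\<forall>i. \<bar>real N * t i\<bar> \<le> 2 * real A")
      case True
      have "\<bar>f (\<chi> i. real N * t i) - fsum T A N f t\<bar>
        \<le> (\<eta> / (2 * c) + 8 * F * real CARD('n) / (\<delta> * real T)) * cA ^ CARD('n) * (\<Prod>i\<in>UNIV. env N (t i))"
        by (rule approx_near[OF F(2,1) N Tb(2) _ \<delta>(2,1) T1]) (use True \<eta> c1 in auto)
      also have "\<dots> \<le> \<eta> * (\<Prod>i\<in>UNIV. env N (t i))"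
      proof (rule mult_right_mono[OF _ e0])
        have "\<eta> / (2 * c) * c = \<eta> / 2" using c1 by simp
        then show "(\<eta> / (2 * c) + 8 * F * real CARD('n) / (\<delta> * real T)) * cA ^ CARD('n) \<le> \<eta>"
          using T2 unfolding c_def[symmetric] distrib_right by linarith
      qed
      finally show ?thesis unfolding p q e .
    next
      case False
      then obtain i0 where i0: "\<bar>real N * t i0\<bar> > 2 * real A" by (auto simp: not_le)
      have "\<bar>f (\<chi> i. real N * t i) - fsum T A N f t\<bar> \<le> F / real T * cA ^ CARD('n) * (\<Prod>i\<in>UNIV. env N (t i))"
        by (rule approx_far[where t = t, OF F(2,1) N Tb(2) t i0])
      also have "\<dots> \<le> \<eta> * (\<Prod>i\<in>UNIV. env N (t i))"
        using T3 by (intro mult_right_mono[OF _ e0]) (simp add: c_def)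
      finally show ?thesis unfolding p q e .
    qed
  qed
  then show ?thesis by (intro exI[of _ T0]) (auto simp: T0_def)
qed

lemma f_eq_0: "\<bar>x $ i\<bar> > real A \<Longrightarrow> f x = 0"
  using supp[of x] by (meson not_le)

section \<open>Riemann sums over the nodes\<close>

lemma integrable_f: "integrable lborel f"
proof -
  define K :: "(real^'n) set" where "K = cbox (\<chi> i. - real A) (\<chi> i. real A)"
  have "integrable lborel (\<lambda>x. indicator K x *\<^sub>R f x)"
    by (rule borel_integrable_compact) (use cont continuous_on_subset in \<open>auto simp: K_def\<close>)
  moreover have "indicator K x *\<^sub>R f x = f x" for x
  proof (cases "f x = 0")
    case False
    have "- real A \<le> x $ i \<and> x $ i \<le> real A" for i using supp[OF False] by (smt (verit))
    then have "x \<in> K" unfolding K_def by (simp add: mem_box_cart)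
    then show ?thesis by simp
  qed simp
  ultimately show ?thesis by (simp only:)
qed

text \<open>Half-open, so that the cells partition space and every point lies in the cell of its
  rounded-down coordinates.\<close>

definition cell :: "nat \<Rightarrow> ('n \<Rightarrow> int) \<Rightarrow> (real^'n) set" where
  "cell T j = {x. \<forall>i. of_int (j i) / real T \<le> x $ i \<and> x $ i < (of_int (j i) + 1) / real T}"

lemma cell_measure:
  assumes "T \<ge> 1"
  shows "cell T j \<in> sets lborel" "measure lborel (cell T j) = 1 / real T ^ CARD('n)" "emeasure lborel (cell T j) < \<infinity>"
proof -
  define a b :: "real^'n" where "a = (\<chi> i. of_int (j i) / real T)" and "b = (\<chi> i. (of_int (j i) + 1) / real T)"
  have ab: "a $ i \<le> b $ i" "b $ i - a $ i = 1 / real T" for i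
    using assms by (auto simp: a_def b_def divide_right_mono diff_divide_distrib[symmetric])
  have "cell T j = (\<Inter>i\<in>UNIV. {x. a $ i \<le> x $ i} \<inter> {x. x $ i < b $ i})"
    by (auto simp: cell_def a_def b_def)
  also have "\<dots> \<in> sets borel"
    by (intro sets.finite_INT sets.Int borel_closed borel_open closed_halfspace_component_ge_cart open_halfspace_component_lt_cart) auto
  finally show m: "cell T j \<in> sets lborel" by simp
  have sub: "box a b \<subseteq> cell T j" "cell T j \<subseteq> cbox a b"
    by (auto simp: cell_def a_def b_def mem_box_cart less_imp_le)
  have eq: "emeasure lborel (box a b) = emeasure lborel (cbox a b)"
    by (simp add: emeasure_lborel_box_eq emeasure_lborel_cbox_eq)
  have "emeasure lborel (cell T j) \<le> emeasure lborel (cbox a b)" using sub by (intro emeasure_mono) auto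
  moreover have "emeasure lborel (box a b) \<le> emeasure lborel (cell T j)" using sub m by (intro emeasure_mono) auto
  ultimately have e: "emeasure lborel (cell T j) = emeasure lborel (cbox a b)" using eq by simp
  then show "emeasure lborel (cell T j) < \<infinity>" using emeasure_lborel_cbox_finite[of a b] by simp
  have "cbox a b \<noteq> {}" using ab(1) by (auto simp: interval_ne_empty_cart)
  then have "measure lborel (cbox a b) = (\<Prod>i\<in>UNIV. b $ i - a $ i)" by (rule content_cbox_cart)
  then show "measure lborel (cell T j) = 1 / real T ^ CARD('n)"
    using e ab(2) by (simp add: measure_def power_divide)
qed

lemma riemann_sum_bound:
  assumes \<eta>: "\<eta> > 0"
  shows "\<exists>T0\<ge>1. \<forall>T\<ge>T0. \<bar>(\<Sum>j\<in>grid T A. f (\<chi> i. of_int (j i) / real T)) / real T ^ CARD('n) - integral UNIV f\<bar> \<le> \<eta>"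
proof -
  define V where "V = (2 * (real A + 1)) ^ CARD('n)"
  have V: "V > 0" by (simp add: V_def)
  have "\<eta> / V > 0" using \<eta> V by simp
  from uniform_continuity_coordinates[OF cont supp this] obtain \<delta> where \<delta>: "\<delta> > 0"
    "\<forall>x y::real^'n. (\<forall>i. \<bar>x $ i - y $ i\<bar> \<le> \<delta>) \<longrightarrow> \<bar>f x - f y\<bar> \<le> \<eta> / V" by blast
  define T0 where "T0 = nat \<lceil>1 / \<delta>\<rceil> + 1"
  have "\<bar>(\<Sum>j\<in>grid T A. f (\<chi> i. of_int (j i) / real T)) / real T ^ CARD('n) - integral UNIV f\<bar> \<le> \<eta>" if T: "T \<ge> T0" for T
  proof -
    have T1: "T \<ge> 1" and T\<delta>: "1 / \<delta> \<le> real T" using T unfolding T0_def by linarith+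
    have Tp: "real T > 0" using T1 by simp
    have d: "1 / real T \<le> \<delta>" using T\<delta> \<delta>(1) Tp by (simp add: field_simps)
    \<comment> \<open>One unit beyond the support, so that the cells in \<open>H\<close> reach every
      point where \<open>f\<close> or its step approximation is nonzero.\<close>
    define B where "B = T * (A + 1)"
    define H :: "('n \<Rightarrow> int) set" where "H = PiE UNIV (\<lambda>_. {- int B..<int B})"
    have fH: "finite H" by (simp add: H_def finite_PiE)
    define X where "X j = ((\<chi> i. of_int (j i) / real T) :: real^'n)" for j :: "'n \<Rightarrow> int"
    define J where "J x = (\<lambda>i. \<lfloor>real T * x $ i\<rfloor>)" for x :: "real^'n"
    define g where "g x = (\<Sum>j\<in>H. f (X j) * indicator (cell T j) x)" for x
    have Jcell: "x \<in> cell T j \<longleftrightarrow> j = J x" for x j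
    proof
      assume x: "x \<in> cell T j"
      show "j = J x"
      proof
        fix i
        have "of_int (j i) \<le> real T * x $ i" "real T * x $ i < of_int (j i) + 1"
          using x Tp by (auto simp: cell_def divide_le_eq less_divide_eq mult.commute)
        then show "j i = J x i" unfolding J_def by linarith
      qed
    next
      assume j: "j = J x"
      have "of_int (J x i) \<le> real T * x $ i" "real T * x $ i < of_int (J x i) + 1" for i unfolding J_def by linarith+
      then show "x \<in> cell T j" unfolding cell_def j using Tp by (auto simp: divide_le_eq less_divide_eq mult.commute)
    qed
    have gJ: "g x = (if J x \<in> H then f (X (J x)) else 0)" for x
    proof -
      have "g x = (\<Sum>j\<in>H. if j = J x then f (X j) else 0)" unfolding g_def by (intro sum.cong refl) (auto simp: Jcell)
      then show ?thesis using fH by simp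
    qed
    have int1: "integrable lborel (\<lambda>x. f (X j) * indicator (cell T j) x)" for j
      using cell_measure[OF T1, of j] by (intro integrable_mult_right integrable_real_indicator) auto
    have intg: "integrable lborel g" unfolding g_def using int1 by (intro Bochner_Integration.integrable_sum) auto
    have "integral\<^sup>L lborel g = (\<Sum>j\<in>H. f (X j) * measure lborel (cell T j))"
      unfolding g_def using int1 cell_measure(1)[OF T1] by (subst Bochner_Integration.integral_sum) auto
    also have "\<dots> = (\<Sum>j\<in>H. f (X j)) / real T ^ CARD('n)"
      by (simp add: cell_measure(2)[OF T1] sum_divide_distrib)
    also have "(\<Sum>j\<in>H. f (X j)) = (\<Sum>j\<in>grid T A. f (X j))"
    proof (rule sum.mono_neutral_right[OF fH])
      have "T * A < B" using T1 by (simp add: B_def)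
      then have "int (T * A) < int B" by (simp only: of_nat_less_iff)
      then show "grid T A \<subseteq> H" unfolding grid_def H_def by (intro PiE_mono) (auto simp del: of_nat_mult)
      show "\<forall>j\<in>H - grid T A. f (X j) = 0"
      proof
        fix j assume "j \<in> H - grid T A"
        then have "j \<notin> grid T A" by simp
        then obtain i where "j i \<notin> {- int (T * A)..int (T * A)}" unfolding grid_def PiE_UNIV_domain Pi_iff by blast
        then have "\<bar>j i\<bar> > int (T * A)" unfolding atLeastAtMost_iff by linarith
        then have "\<bar>real_of_int (j i)\<bar> > real (T * A)" by linarith
        then have "\<bar>X j $ i\<bar> > real A" using Tp by (simp add: X_def abs_divide field_simps)
        then show "f (X j) = 0" by (rule f_eq_0)
      qed
    qed
    finally have ig: "integral\<^sup>L lborel g = (\<Sum>j\<in>grid T A. f (X j)) / real T ^ CARD('n)" .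
    define K :: "(real^'n) set" where "K = cbox (\<chi> i. - (real A + 1)) (\<chi> i. real A + 1)"
    have pt: "\<bar>g x - f x\<bar> \<le> \<eta> / V * indicator K x" for x
    proof (cases "x \<in> K")
      case True
      have near: "\<bar>X (J x) $ i - x $ i\<bar> \<le> \<delta>" for i
      proof -
        have "x \<in> cell T (J x)" using Jcell by blast
        then have "of_int (J x i) / real T \<le> x $ i" "x $ i < of_int (J x i) / real T + 1 / real T"
          by (auto simp: cell_def add_divide_distrib)
        then show ?thesis using d by (simp add: X_def)
      qed
      then have "\<bar>f (X (J x)) - f x\<bar> \<le> \<eta> / V" using \<delta>(2) by blast
      moreover have "g x = f (X (J x))"
      proof (cases "J x \<in> H")
        case False
        then obtain i where "J x i \<notin> {- int B..<int B}" unfolding H_def PiE_UNIV_domain Pi_iff by blast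
        then have "J x i < - int B \<or> J x i \<ge> int B" unfolding atLeastLessThan_iff by linarith
        then have "\<bar>J x i\<bar> \<ge> int B" by linarith
        then have "\<bar>real_of_int (J x i)\<bar> \<ge> real B" by linarith
        moreover have "real B > real A * real T" using Tp by (simp add: B_def algebra_simps)
        ultimately have "\<bar>X (J x) $ i\<bar> > real A" using Tp by (simp add: X_def abs_divide field_simps)
        then show ?thesis using False gJ f_eq_0 by simp
      qed (simp add: gJ)
      ultimately show ?thesis using True by simp
    next
      case False
      then have "\<exists>i. \<not> (- (real A + 1) \<le> x $ i \<and> x $ i \<le> real A + 1)" by (simp add: K_def mem_box_cart)
      then obtain i where "\<not> (- (real A + 1) \<le> x $ i \<and> x $ i \<le> real A + 1)" by blast
      then have i: "\<bar>x $ i\<bar> > real A + 1" by linarith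
      have "J x \<notin> H"
      proof
        assume "J x \<in> H"
        then have "J x i \<in> {- int B..<int B}" unfolding H_def by blast
        then have "- real B \<le> of_int (J x i)" "real_of_int (J x i) + 1 \<le> real B" unfolding atLeastLessThan_iff by linarith+
        moreover have "of_int (J x i) \<le> real T * x $ i" "real T * x $ i < of_int (J x i) + 1" unfolding J_def by linarith+
        ultimately have "\<bar>real T * x $ i\<bar> \<le> real B" by linarith
        then have "real T * \<bar>x $ i\<bar> \<le> real T * (real A + 1)" by (simp add: abs_mult B_def algebra_simps)
        then have "\<bar>x $ i\<bar> \<le> real A + 1" by (rule mult_left_le_imp_le) (use Tp in simp)
        then show False using i by simp
      qed
      moreover have "f x = 0" using i by (intro f_eq_0[of x i]) simp
      ultimately show ?thesis using False by (simp add: gJ)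
    qed
    have Kfin: "emeasure lborel K < \<infinity>" unfolding K_def by (rule emeasure_lborel_cbox_finite)
    have intK: "integrable lborel (\<lambda>x. \<eta> / V * indicator K x :: real)"
      by (intro integrable_mult_right integrable_real_indicator) (use Kfin in \<open>auto simp: K_def\<close>)
    have "\<bar>integral\<^sup>L lborel g - integral\<^sup>L lborel f\<bar> = \<bar>integral\<^sup>L lborel (\<lambda>x. g x - f x)\<bar>"
      using intg integrable_f by simp
    also have "\<dots> \<le> integral\<^sup>L lborel (\<lambda>x. \<bar>g x - f x\<bar>)" by (rule integral_abs_bound)
    also have "\<dots> \<le> integral\<^sup>L lborel (\<lambda>x. \<eta> / V * indicator K x)"
      using intg integrable_f intK pt by (intro integral_mono) auto
    also have "\<dots> = \<eta> / V * measure lborel K" by (simp add: K_def)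
    also have "measure lborel K = V"
    proof -
      have "(cbox (\<chi> i. - (real A + 1)) (\<chi> i. real A + 1) :: (real^'n) set) \<noteq> {}" by (auto simp: interval_ne_empty_cart)
      from content_cbox_cart[OF this] show ?thesis unfolding K_def V_def by simp
    qed
    also have "\<eta> / V * V = \<eta>" using V by simp
    finally have "\<bar>integral\<^sup>L lborel g - integral\<^sup>L lborel f\<bar> \<le> \<eta>" .
    then show ?thesis using integral_lborel[OF integrable_f] by (simp add: ig X_def)
  qed
  then show ?thesis by (intro exI[of _ T0]) (auto simp: T0_def)
qed

end

section \<open>From Fejer products to test functions\<close>

text \<open>All that the passage from Fejer products to test functions needs of the sequence: an
  increasing family of finite point sets with phases. Monotonicity serves the comparison of
  neighbouring \<open>N\<close>.\<close>

locale point_system =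
  fixes \<Omega> :: "nat \<Rightarrow> 'p set" and \<theta> :: "'p \<Rightarrow> 'n::finite \<Rightarrow> real"
  assumes fin: "\<And>N. finite (\<Omega> N)" and mono: "\<And>N M. N \<le> M \<Longrightarrow> \<Omega> N \<subseteq> \<Omega> M"
begin

definition avg :: "nat \<Rightarrow> (('n \<Rightarrow> real) \<Rightarrow> real) \<Rightarrow> real" where
  "avg N F = (\<Sum>p\<in>\<Omega> N. F (\<theta> p)) / real N"

text \<open>Shifts in half-steps cover both uses: even \<sigma> give the grid nodes of
  \<open>fsum\<close>, while \<open>T = 1\<close> and values 0, -1 of \<sigma> give the two kernels
  in \<open>env\<close>.\<close>

definition fprod :: "nat \<Rightarrow> ('n \<Rightarrow> int) \<Rightarrow> nat \<Rightarrow> ('n \<Rightarrow> real) \<Rightarrow> real" where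
  "fprod T \<sigma> N t = (\<Prod>i\<in>UNIV. fejer (T * N) (t i - of_int (\<sigma> i) / (2 * real (T * N))))"

lemma avg_sum: "avg N (\<lambda>t. \<Sum>j\<in>S. c j * F j t) = (\<Sum>j\<in>S. c j * avg N (F j))"
  unfolding avg_def sum_divide_distrib sum_distrib_left by (subst sum.swap) simp

lemma avg_diff_bound:
  assumes "\<And>t. \<bar>F t - G t\<bar> \<le> \<eta> * E t"
  shows "\<bar>avg N F - avg N G\<bar> \<le> \<eta> * avg N E"
proof -
  have "avg N F - avg N G = (\<Sum>p\<in>\<Omega> N. F (\<theta> p) - G (\<theta> p)) / real N"
    by (simp add: avg_def sum_subtractf diff_divide_distrib)
  also have "\<bar>\<dots>\<bar> \<le> (\<Sum>p\<in>\<Omega> N. \<eta> * E (\<theta> p)) / real N"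
    unfolding abs_divide using assms by (auto intro!: divide_right_mono order_trans[OF sum_abs] sum_mono)
  finally show ?thesis by (simp add: avg_def sum_distrib_left)
qed

lemma fsum_fprod:
  assumes "T \<ge> 1"
  shows "fsum T A N f t = (\<Sum>j\<in>grid T A. f (\<chi> i. of_int (j i) / real T) * fprod T (\<lambda>i. 2 * j i) N t)"
  unfolding fsum_def fprod_def by simp

lemma env_fprod:
  "(\<Prod>i\<in>UNIV. env N (t i)) = (\<Sum>\<sigma>\<in>PiE UNIV (\<lambda>_. {0, -1}). 1 * fprod 1 \<sigma> N t)"
proof -
  have "(\<Prod>i\<in>UNIV. env N (t i)) = (\<Prod>i\<in>UNIV. \<Sum>s\<in>{0, -1::int}. fejer N (t i - of_int s / (2 * real N)))"
    by (rule prod.cong[OF refl]) (simp add: env_def)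
  also have "\<dots> = (\<Sum>\<sigma>\<in>PiE UNIV (\<lambda>_. {0, -1}). \<Prod>i\<in>UNIV. fejer N (t i - of_int (\<sigma> i) / (2 * real N)))"
    by (rule prod_sum_PiE) auto
  finally show ?thesis by (simp add: fprod_def)
qed

text \<open>The limit is known for Fejer products, hence for \<open>fsum\<close> and for the product
  of envelopes; the latter bounds the approximation error on average by \<eta> times a convergent
  sequence.\<close>

lemma subsequence_limit:
  fixes f :: "real^'n \<Rightarrow> real" and Ns :: "nat \<Rightarrow> nat"
  assumes f: "cc_fun f A" and Ns: "filterlim Ns at_top sequentially"
    and lim: "\<And>T \<sigma>. T \<ge> 1 \<Longrightarrow> (\<lambda>j. avg (Ns j) (fprod T \<sigma> (Ns j))) \<longlonglongrightarrow> 1 / real T ^ CARD('n)"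
  shows "(\<lambda>j. avg (Ns j) (per (Ns j) f)) \<longlonglongrightarrow> integral UNIV f"
proof -
  interpret cc_fun f A by (rule f)
  define E where "E N t = (\<Prod>i\<in>UNIV. env N (t i))" for N and t :: "'n \<Rightarrow> real"
  have limE: "(\<lambda>j. avg (Ns j) (E (Ns j))) \<longlonglongrightarrow> (\<Sum>\<sigma>\<in>PiE (UNIV::'n set) (\<lambda>_. {0, -1::int}). 1 * (1 / real 1 ^ CARD('n)))"
    unfolding E_def env_fprod avg_sum by (intro tendsto_sum tendsto_mult tendsto_const lim) auto
  define c where "c = (\<Sum>\<sigma>\<in>PiE (UNIV::'n set) (\<lambda>_. {0, -1::int}). 1 * (1 / real 1 ^ CARD('n)))"
  have c0: "c \<ge> 0" unfolding c_def by (intro sum_nonneg) auto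
  show ?thesis
  proof (rule tendstoI)
    fix e :: real assume e: "e > 0"
    \<comment> \<open>The approximation costs at most \<open>\<eta> * (c + 1)\<close>, the Riemann
      sum and the convergence of the averages one \<eta> each.\<close>
    define \<eta> where "\<eta> = e / (c + 4)"
    have \<eta>: "\<eta> > 0" using e c0 by (simp add: \<eta>_def)
    from fejer_approximation[OF \<eta>] obtain T1 where T1: "T1 \<ge> 1"
      "\<forall>T\<ge>T1. \<forall>N\<ge>8 * A. \<forall>t. \<bar>per N f t - fsum T A N f t\<bar> \<le> \<eta> * (\<Prod>i\<in>UNIV. env N (t i))" by blast
    from riemann_sum_bound[OF \<eta>] obtain T2 where T2: "T2 \<ge> 1"
      "\<forall>T\<ge>T2. \<bar>(\<Sum>j\<in>grid T A. f (\<chi> i. of_int (j i) / real T)) / real T ^ CARD('n) - integral UNIV f\<bar> \<le> \<eta>" by blast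
    define T where "T = max T1 T2"
    have T: "T \<ge> T1" "T \<ge> T2" "T \<ge> 1" using T1(1) by (auto simp: T_def)
    define L where "L = (\<Sum>j\<in>grid T A. f (\<chi> i. of_int (j i) / real T)) / real T ^ CARD('n)"
    have "(\<lambda>j. avg (Ns j) (fsum T A (Ns j) f)) \<longlonglongrightarrow> (\<Sum>j\<in>grid T A. f (\<chi> i. of_int (j i) / real T) * (1 / real T ^ CARD('n)))"
      unfolding fsum_fprod[OF T(3)] avg_sum by (intro tendsto_sum tendsto_mult tendsto_const lim T(3))
    then have limF: "(\<lambda>j. avg (Ns j) (fsum T A (Ns j) f)) \<longlonglongrightarrow> L" by (simp add: L_def sum_divide_distrib)
    have ev1: "\<forall>\<^sub>F j in sequentially. Ns j \<ge> 8 * A"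
      using Ns by (auto simp: filterlim_at_top)
    have ev2: "\<forall>\<^sub>F j in sequentially. dist (avg (Ns j) (E (Ns j))) c < 1"
      using tendstoD[OF limE, of 1] by (simp add: c_def)
    have ev3: "\<forall>\<^sub>F j in sequentially. dist (avg (Ns j) (fsum T A (Ns j) f)) L < \<eta>"
      using tendstoD[OF limF \<eta>] .
    show "\<forall>\<^sub>F j in sequentially. dist (avg (Ns j) (per (Ns j) f)) (integral UNIV f) < e"
      using ev1 ev2 ev3
    proof eventually_elim
      case (elim j)
      have "\<bar>avg (Ns j) (per (Ns j) f) - avg (Ns j) (fsum T A (Ns j) f)\<bar> \<le> \<eta> * avg (Ns j) (E (Ns j))"
        unfolding E_def using T1(2) T(1) elim(1) by (intro avg_diff_bound) blast
      also have "\<dots> \<le> \<eta> * (c + 1)" using elim(2) \<eta> by (intro mult_left_mono) (auto simp: dist_real_def)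
      finally have a: "\<bar>avg (Ns j) (per (Ns j) f) - avg (Ns j) (fsum T A (Ns j) f)\<bar> \<le> \<eta> * (c + 1)" .
      have b: "\<bar>L - integral UNIV f\<bar> \<le> \<eta>" unfolding L_def using T2(2) T(2) by blast
      have "\<eta> * (c + 1) + \<eta> + \<eta> < \<eta> * (c + 4)" using \<eta> by (simp add: algebra_simps)
      also have "\<dots> = e" using c0 by (simp add: \<eta>_def)
      finally show ?case using a b elim(3) unfolding dist_real_def by linarith
    qed
  qed
qed

end

section \<open>From the subsequence of powers to all N\<close>

definition bump :: "nat \<Rightarrow> real^'n::finite \<Rightarrow> real" where
  "bump A x = (\<Prod>i\<in>UNIV. max 0 (min 1 (2 * real A + 1 - \<bar>x $ i\<bar>)))"

lemma bump_props:
  "cc_fun (bump A :: real^'n::finite \<Rightarrow> real) (2 * A + 1)" "bump A x \<ge> 0" "(\<And>i. \<bar>x $ i\<bar> \<le> 2 * real A) \<Longrightarrow> bump A x = 1"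
proof -
  show "cc_fun (bump A :: real^'n \<Rightarrow> real) (2 * A + 1)"
  proof
    show "continuous_on UNIV (bump A :: real^'n \<Rightarrow> real)" unfolding bump_def by (intro continuous_intros)
    show "\<forall>i. \<bar>x $ i\<bar> \<le> real (2 * A + 1)" if "bump A x \<noteq> 0" for x :: "real^'n"
    proof (rule ccontr)
      assume "\<not> ?thesis"
      then obtain i where "\<bar>x $ i\<bar> > 2 * real A + 1" by (auto simp: not_le add.commute)
      then have "max 0 (min 1 (2 * real A + 1 - \<bar>x $ i\<bar>)) = 0" by simp
      then have "bump A x = 0" unfolding bump_def by (intro prod_zero) auto
      then show False using that by simp
    qed
  qed simp
  show "bump A x \<ge> 0" by (simp add: bump_def prod_nonneg)
  assume "\<And>i. \<bar>x $ i\<bar> \<le> 2 * real A"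
  then have "max 0 (min 1 (2 * real A + 1 - \<bar>x $ i\<bar>)) = 1" for i
    using \<open>\<And>i. \<bar>x $ i\<bar> \<le> 2 * real A\<close>[of i] by (simp add: min_def max_def)
  then show "bump A x = 1" by (simp add: bump_def)
qed

text \<open>A dilation close to 1 moves the relevant points only a little, and since
  \<open>s \<ge> 1/2\<close> both functions vanish outside the cube where \<open>bump A\<close> is
  1. The bump takes the part of the envelope: its averages along the subsequence are known to
  converge.\<close>

lemma (in cc_fun) scaling_bound:
  assumes e: "\<epsilon> > 0"
  shows "\<exists>\<kappa>>0. \<kappa> \<le> 1 / 2 \<and> (\<forall>s x. \<bar>s - 1\<bar> \<le> \<kappa> \<longrightarrow> \<bar>f (s *\<^sub>R x) - f x\<bar> \<le> \<epsilon> * bump A x)"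
proof -
  from uniform_continuity_coordinates[OF cont supp e] obtain \<delta> where \<delta>: "\<delta> > 0"
    "\<forall>x y::real^'n. (\<forall>i. \<bar>x $ i - y $ i\<bar> \<le> \<delta>) \<longrightarrow> \<bar>f x - f y\<bar> \<le> \<epsilon>" by blast
  define \<kappa> where "\<kappa> = min (1 / 2) (\<delta> / (2 * real A))"
  have \<kappa>: "\<kappa> > 0" "\<kappa> \<le> 1 / 2" "\<kappa> * (2 * real A) \<le> \<delta>" using \<delta>(1) A by (auto simp: \<kappa>_def min_def field_simps)
  have "\<bar>f (s *\<^sub>R x) - f x\<bar> \<le> \<epsilon> * bump A x" if s: "\<bar>s - 1\<bar> \<le> \<kappa>" for s x
  proof (cases "\<forall>i. \<bar>x $ i\<bar> \<le> 2 * real A")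
    case True
    have "\<bar>(s *\<^sub>R x) $ i - x $ i\<bar> \<le> \<delta>" for i
    proof -
      have "(s *\<^sub>R x) $ i - x $ i = (s - 1) * x $ i" by (simp add: left_diff_distrib)
      then have "\<bar>(s *\<^sub>R x) $ i - x $ i\<bar> = \<bar>s - 1\<bar> * \<bar>x $ i\<bar>" by (simp only: abs_mult)
      also have "\<dots> \<le> \<kappa> * (2 * real A)" using s True \<kappa> by (intro mult_mono) auto
      finally show ?thesis using \<kappa>(3) by linarith
    qed
    then have "\<bar>f (s *\<^sub>R x) - f x\<bar> \<le> \<epsilon>" using \<delta>(2) by blast
    then show ?thesis using bump_props(3)[of x A] True by simp
  next
    case False
    then obtain i where i: "\<bar>x $ i\<bar> > 2 * real A" by (auto simp: not_le)
    have "f x = 0" using i by (intro f_eq_0[of x i]) simp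
    moreover have "f (s *\<^sub>R x) = 0"
    proof (rule f_eq_0[of _ i])
      have "1 / 2 \<le> \<bar>s\<bar>" using s \<kappa>(2) by linarith
      then have "1 / 2 * \<bar>x $ i\<bar> \<le> \<bar>s\<bar> * \<bar>x $ i\<bar>" by (rule mult_right_mono) simp
      then show "\<bar>(s *\<^sub>R x) $ i\<bar> > real A" using i by (simp add: abs_mult)
    qed
    ultimately show ?thesis using e bump_props(2)[of A x] by simp
  qed
  then show ?thesis using \<kappa> by blast
qed

definition fpart :: "('n::finite \<Rightarrow> real) \<Rightarrow> real^'n" where
  "fpart t = (\<chi> i. t i - of_int (round (t i)))"

text \<open>For large \<open>N\<close> the periodised sum depends on \<open>N\<close> only through a
  dilation, so passing to a neighbouring \<open>N\<close> amounts to dilating the test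
  function.\<close>

lemma per_fpart:
  assumes "cc_fun f A" "N \<ge> 8 * A"
  shows "per N f t = f (real N *\<^sub>R fpart t)"
proof -
  interpret cc_fun f A by (rule assms)
  have "per N f t = f (\<chi> i. real N * (t i - of_int (round (t i))))"
    using of_int_round_abs_le by (intro per_eq_single[OF supp assms(2) A]) (auto simp: abs_minus_commute)
  also have "(\<chi> i. real N * (t i - of_int (round (t i)))) = real N *\<^sub>R fpart t"
    by (simp add: fpart_def vec_eq_iff)
  finally show ?thesis .
qed

definition proot :: "nat \<Rightarrow> nat \<Rightarrow> nat" where
  "proot q N = (GREATEST j. j ^ q \<le> N)"

lemma proot_bounds:
  assumes "q \<ge> 1"
  shows "proot q N ^ q \<le> N" "N < Suc (proot q N) ^ q" "k ^ q \<le> N \<Longrightarrow> k \<le> proot q N"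
proof -
  have bd: "j \<le> N" if "j ^ q \<le> N" for j
  proof (cases "j = 0")
    case False
    then have "j ^ 1 \<le> j ^ q" using assms by (intro power_increasing) auto
    then show ?thesis using that by simp
  qed simp
  show "proot q N ^ q \<le> N" unfolding proot_def
    by (rule GreatestI_nat[where k = 0 and b = N]) (use assms bd in \<open>auto simp: power_0_left\<close>)
  show *: "k \<le> proot q N" if "k ^ q \<le> N" for k unfolding proot_def
    by (rule Greatest_le_nat[where b = N]) (use that bd in auto)
  show "N < Suc (proot q N) ^ q"
  proof (rule ccontr)
    assume "\<not> ?thesis"
    then have "Suc (proot q N) \<le> proot q N" by (intro *) simp
    then show False by simp
  qed
qed

lemma filterlim_proot: "q \<ge> 1 \<Longrightarrow> filterlim (proot q) at_top sequentially"
  unfolding filterlim_at_top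
proof
  fix k assume q: "q \<ge> 1"
  show "\<forall>\<^sub>F N in sequentially. k \<le> proot q N"
    using eventually_ge_at_top[of "k ^ q"] by eventually_elim (rule proot_bounds(3)[OF q])
qed

context point_system
begin

abbreviation R :: "nat \<Rightarrow> (real^'n \<Rightarrow> real) \<Rightarrow> real" where "R N f \<equiv> avg N (per N f)"

text \<open>Squeeze \<open>N\<close> between consecutive powers \<open>a N\<close> and
  \<open>b N\<close>. For nonnegative \<open>f\<close> the sum grows with the point set, the
  dilation error is \<epsilon> times the average of a bump, and the quotient
  \<open>b N / a N\<close> tends to 1.\<close>

lemma limit_nonneg:
  fixes f :: "real^'n \<Rightarrow> real"
  assumes f: "cc_fun f A" and f0: "\<And>x. f x \<ge> 0" and q: "q \<ge> 1"
    and sub: "\<And>g B. cc_fun (g::real^'n \<Rightarrow> real) B \<Longrightarrow> (\<lambda>j. R (j ^ q) g) \<longlonglongrightarrow> integral UNIV g"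
  shows "(\<lambda>N. R N f) \<longlonglongrightarrow> integral UNIV f"
proof -
  interpret cc_fun f A by (rule f)
  define g :: "real^'n \<Rightarrow> real" where "g = bump A"
  have g: "cc_fun g (2 * A + 1)" and g0: "\<And>x. g x \<ge> 0" unfolding g_def by (rule bump_props)+
  define a b where "a N = proot q N ^ q" and "b N = Suc (proot q N) ^ q" for N
  have ab: "a N \<le> N" "N \<le> b N" for N using proot_bounds(1,2)[OF q, of N] by (auto simp: a_def b_def)
  have sp: "filterlim (\<lambda>N. Suc (proot q N)) at_top sequentially"
    by (rule filterlim_compose[OF filterlim_Suc filterlim_proot[OF q]])
  have la: "(\<lambda>N. R (a N) h) \<longlonglongrightarrow> integral UNIV h" "(\<lambda>N. R (b N) h) \<longlonglongrightarrow> integral UNIV h" if "cc_fun h B" for h B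
    unfolding a_def b_def
    by (rule filterlim_compose[OF sub[OF that] filterlim_proot[OF q]],
        rule filterlim_compose[OF sub[OF that] sp])
  have ratio: "(\<lambda>N. real (b N) / real (a N)) \<longlonglongrightarrow> 1"
  proof -
    have "(\<lambda>j. (1 + 1 / real j) ^ q) \<longlonglongrightarrow> (1 + 0) ^ q"
      by (intro tendsto_intros lim_1_over_n)
    then have "(\<lambda>N. (1 + 1 / real (proot q N)) ^ q) \<longlonglongrightarrow> 1"
      using filterlim_compose[OF _ filterlim_proot[OF q], of "\<lambda>j. (1 + 1 / real j) ^ q"] by simp
    moreover have "\<forall>\<^sub>F N in sequentially. (1 + 1 / real (proot q N)) ^ q = real (b N) / real (a N)"
      using filterlim_proot[OF q, unfolded filterlim_at_top, rule_format, of 1]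
    proof eventually_elim
      case (elim N)
      then have "1 + 1 / real (proot q N) = real (Suc (proot q N)) / real (proot q N)" by (simp add: field_simps)
      then show ?case by (simp add: a_def b_def power_divide del: of_nat_Suc)
    qed
    ultimately show ?thesis by (rule Lim_transform_eventually)
  qed
  have evA: "\<forall>\<^sub>F N in sequentially. a N \<ge> 8 * (2 * A + 1)"
  proof -
    have "\<forall>\<^sub>F N in sequentially. 8 * (2 * A + 1) \<le> proot q N"
      using filterlim_proot[OF q] by (simp only: filterlim_at_top)
    then show ?thesis
    proof eventually_elim
      case (elim N)
      have "proot q N ^ 1 \<le> proot q N ^ q" using elim q by (intro power_increasing) auto
      then show ?case using elim by (simp add: a_def)
    qed
  qed
  define I G where "I = integral UNIV f" and "G = integral UNIV g"
  show ?thesis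
  proof (rule tendstoI)
    fix e :: real assume e: "e > 0"
    define \<epsilon> where "\<epsilon> = e / (2 * (\<bar>G\<bar> + 1))"
    have \<epsilon>: "\<epsilon> > 0" using e by (simp add: \<epsilon>_def)
    have "\<epsilon> * \<bar>G\<bar> \<le> \<epsilon> * (\<bar>G\<bar> + 1)" using \<epsilon> by (intro mult_left_mono) auto
    also have "\<dots> = e / 2" by (simp add: \<epsilon>_def field_simps)
    finally have \<epsilon>G: "\<epsilon> * \<bar>G\<bar> \<le> e / 2" .
    have \<epsilon>G': "\<epsilon> * G \<le> e / 2" "- (e / 2) \<le> \<epsilon> * G"
    proof -
      have "\<bar>\<epsilon> * G\<bar> \<le> e / 2" using \<epsilon>G \<epsilon> by (simp only: abs_mult abs_of_pos)
      then show "\<epsilon> * G \<le> e / 2" "- (e / 2) \<le> \<epsilon> * G" by linarith+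
    qed
    from scaling_bound[OF \<epsilon>] obtain \<kappa> where \<kappa>: "\<kappa> > 0" "\<kappa> \<le> 1 / 2"
      "\<forall>s x. \<bar>s - 1\<bar> \<le> \<kappa> \<longrightarrow> \<bar>f (s *\<^sub>R x) - f x\<bar> \<le> \<epsilon> * g x" unfolding g_def by blast
    have lu: "(\<lambda>N. real (b N) / real (a N) * (R (b N) f + \<epsilon> * R (b N) g)) \<longlonglongrightarrow> 1 * (I + \<epsilon> * G)"
      unfolding I_def G_def by (intro tendsto_mult ratio tendsto_add tendsto_const la(2)[OF f] la(2)[OF g])
    have ll: "(\<lambda>N. R (a N) f / (real (b N) / real (a N)) - \<epsilon> * R (a N) g) \<longlonglongrightarrow> I / 1 - \<epsilon> * G"
      unfolding I_def G_def by (intro tendsto_diff tendsto_divide ratio tendsto_mult tendsto_const la(1)[OF f] la(1)[OF g]) simp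
    have e2: "e / 2 > 0" using e by simp
    have evu: "\<forall>\<^sub>F N in sequentially. real (b N) / real (a N) * (R (b N) f + \<epsilon> * R (b N) g) < I + \<epsilon> * G + e / 2"
      using order_tendstoD(2)[OF lu, of "I + \<epsilon> * G + e / 2"] e2 by simp
    have evl: "\<forall>\<^sub>F N in sequentially. R (a N) f / (real (b N) / real (a N)) - \<epsilon> * R (a N) g > I - \<epsilon> * G - e / 2"
      using order_tendstoD(1)[OF ll, of "I - \<epsilon> * G - e / 2"] e2 by simp
    have evr: "\<forall>\<^sub>F N in sequentially. real (b N) / real (a N) < 1 + \<kappa>"
      using order_tendstoD(2)[OF ratio, of "1 + \<kappa>"] \<kappa>(1) by simp
    show "\<forall>\<^sub>F N in sequentially. dist (R N f) (integral UNIV f) < e"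
      using evA evu evl evr
    proof eventually_elim
      case (elim N)
      have a1: "real (a N) > 0" and N1: "real N > 0" and b1: "real (b N) > 0" using elim(1) ab[of N] by auto
      have aN: "real (a N) \<le> real N" "real N \<le> real (b N)" using ab[of N] by auto
      have big: "a N \<ge> 8 * A" "N \<ge> 8 * A" "b N \<ge> 8 * A" "a N \<ge> 8 * (2 * A + 1)" "b N \<ge> 8 * (2 * A + 1)"
        using elim(1) ab[of N] by auto
      have pf: "per M f t = f (real M *\<^sub>R fpart t)" if "M \<ge> 8 * A" for M t by (rule per_fpart[OF f that])
      have pg: "per M g t = g (real M *\<^sub>R fpart t)" if "M \<ge> 8 * (2 * A + 1)" for M t by (rule per_fpart[OF g that])
      have sc: "\<bar>f (real N *\<^sub>R x) - f (real M *\<^sub>R x)\<bar> \<le> \<epsilon> * g (real M *\<^sub>R x)"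
        if M: "real M > 0" "\<bar>real N / real M - 1\<bar> \<le> \<kappa>" for M x
        using \<kappa>(3)[rule_format, OF M(2), of "real M *\<^sub>R x"] M(1) by simp
      have rb: "\<bar>real N / real (b N) - 1\<bar> \<le> \<kappa>"
      proof -
        have "real (b N) < (1 + \<kappa>) * real (a N)" using elim(4) a1 by (simp add: pos_divide_less_eq)
        also have "\<dots> \<le> (1 + \<kappa>) * real N" using aN \<kappa> by (intro mult_left_mono) auto
        finally have "real (b N) - real N < \<kappa> * real N" by (simp add: algebra_simps)
        also have "\<dots> \<le> \<kappa> * real (b N)" using aN \<kappa> by (intro mult_left_mono) auto
        finally have "(1 - \<kappa>) * real (b N) \<le> real N" by (simp add: algebra_simps)
        then have "1 - \<kappa> \<le> real N / real (b N)" by (simp only: pos_le_divide_eq[OF b1])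
        moreover have "real N / real (b N) \<le> 1" using aN b1 by simp
        ultimately show ?thesis using \<kappa> by (simp add: abs_le_iff)
      qed
      have ra: "\<bar>real N / real (a N) - 1\<bar> \<le> \<kappa>"
      proof -
        have "real N / real (a N) \<le> real (b N) / real (a N)" using aN a1 by (intro divide_right_mono) auto
        moreover have "1 \<le> real N / real (a N)" using aN a1 by simp
        ultimately show ?thesis using elim(4) by (simp add: abs_le_iff)
      qed
      have up: "R N f \<le> real (b N) / real (a N) * (R (b N) f + \<epsilon> * R (b N) g)"
      proof -
        let ?h = "\<lambda>p. per (b N) f (\<theta> p) + \<epsilon> * per (b N) g (\<theta> p)"
        have h0: "?h p \<ge> 0" for p using pf[OF big(3)] pg[OF big(5)] f0 g0 \<epsilon> by simp
        have "(\<Sum>p\<in>\<Omega> N. per N f (\<theta> p)) \<le> (\<Sum>p\<in>\<Omega> N. ?h p)"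
        proof (rule sum_mono)
          fix p
          show "per N f (\<theta> p) \<le> ?h p"
            using sc[OF b1 rb, of "fpart (\<theta> p)"] unfolding pf[OF big(2)] pf[OF big(3)] pg[OF big(5)] by linarith
        qed
        also have "\<dots> \<le> (\<Sum>p\<in>\<Omega> (b N). ?h p)" using h0 fin mono[OF ab(2)] by (intro sum_mono2) auto
        also have "\<dots> = real (b N) * (R (b N) f + \<epsilon> * R (b N) g)"
          using b1 by (simp add: avg_def sum.distrib sum_distrib_left field_simps)
        finally have "R N f \<le> real (b N) * (R (b N) f + \<epsilon> * R (b N) g) / real N"
          unfolding avg_def[of N] using N1 by (intro divide_right_mono) auto
        also have "\<dots> \<le> real (b N) * (R (b N) f + \<epsilon> * R (b N) g) / real (a N)"
        proof -
          have "R (b N) f + \<epsilon> * R (b N) g = (\<Sum>p\<in>\<Omega> (b N). ?h p) / real (b N)"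
            by (simp add: avg_def sum.distrib sum_distrib_left add_divide_distrib)
          also have "\<dots> \<ge> 0" using h0 by (intro divide_nonneg_nonneg sum_nonneg) auto
          finally show ?thesis using aN a1 N1 by (intro divide_left_mono mult_nonneg_nonneg) auto
        qed
        finally show ?thesis by simp
      qed
      have lo: "R N f \<ge> R (a N) f / (real (b N) / real (a N)) - \<epsilon> * R (a N) g"
      proof -
        let ?F = "\<Sum>p\<in>\<Omega> (a N). per (a N) f (\<theta> p)" and ?G = "\<Sum>p\<in>\<Omega> (a N). per (a N) g (\<theta> p)"
        have F0: "?F \<ge> 0" "?G \<ge> 0" using pf[OF big(1)] pg[OF big(4)] f0 g0 by (auto intro: sum_nonneg)
        have "?F - \<epsilon> * ?G = (\<Sum>p\<in>\<Omega> (a N). per (a N) f (\<theta> p) - \<epsilon> * per (a N) g (\<theta> p))"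
          by (simp add: sum_subtractf sum_distrib_left)
        also have "\<dots> \<le> (\<Sum>p\<in>\<Omega> (a N). per N f (\<theta> p))"
        proof (rule sum_mono)
          fix p
          show "per (a N) f (\<theta> p) - \<epsilon> * per (a N) g (\<theta> p) \<le> per N f (\<theta> p)"
            using sc[OF a1 ra, of "fpart (\<theta> p)"] unfolding pf[OF big(2)] pf[OF big(1)] pg[OF big(4)] by linarith
        qed
        also have "\<dots> \<le> (\<Sum>p\<in>\<Omega> N. per N f (\<theta> p))"
          using fin mono[OF ab(1)] pf[OF big(2)] f0 by (intro sum_mono2) auto
        finally have "(?F - \<epsilon> * ?G) / real N \<le> R N f" unfolding avg_def[of N] using N1 by (intro divide_right_mono) auto
        moreover have "?F / real (b N) \<le> ?F / real N" using F0 aN N1 b1 by (intro divide_left_mono) auto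
        moreover have "\<epsilon> * ?G / real N \<le> \<epsilon> * ?G / real (a N)" using F0 \<epsilon> aN N1 a1 by (intro divide_left_mono) auto
        moreover have "R (a N) f / (real (b N) / real (a N)) = ?F / real (b N)" using a1 b1 by (simp add: avg_def)
        moreover have "\<epsilon> * R (a N) g = \<epsilon> * ?G / real (a N)" by (simp add: avg_def)
        ultimately show ?thesis unfolding diff_divide_distrib by linarith
      qed
      show ?case using up lo elim(2,3) \<epsilon>G' unfolding I_def dist_real_def by linarith
    qed
  qed
qed

text \<open>Split into positive and negative parts. They are continuous but in general not smooth,
  which is why \<open>cc_fun\<close> asks for continuity only.\<close>

theorem full_limit:
  fixes f :: "real^'n \<Rightarrow> real"
  assumes f: "cc_fun f A" and q: "q \<ge> 1"
    and lim: "\<And>T \<sigma>. T \<ge> 1 \<Longrightarrow> (\<lambda>j. avg (j ^ q) (fprod T \<sigma> (j ^ q))) \<longlonglongrightarrow> 1 / real T ^ CARD('n)"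
  shows "(\<lambda>N. R N f) \<longlonglongrightarrow> integral UNIV f"
proof -
  interpret cc_fun f A by (rule f)
  have Ns: "filterlim (\<lambda>j::nat. j ^ q) at_top sequentially"
  proof (rule filterlim_at_top_mono[OF filterlim_ident], intro always_eventually allI)
    fix j :: nat
    show "j \<le> j ^ q" using q by (cases "j = 0") (auto intro: self_le_power)
  qed
  have sub: "(\<lambda>j. R (j ^ q) g) \<longlonglongrightarrow> integral UNIV g" if "cc_fun (g::real^'n \<Rightarrow> real) B" for g B
    by (rule subsequence_limit[OF that Ns lim])
  define fp fn where "fp x = max 0 (f x)" and "fn x = max 0 (- f x)" for x
  have cp: "cc_fun fp A" "cc_fun fn A"
    unfolding fp_def fn_def by (unfold_locales; use cont supp A in \<open>auto intro!: continuous_intros\<close>)+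
  have "(\<lambda>N. R N fp - R N fn) \<longlonglongrightarrow> integral UNIV fp - integral UNIV fn"
    by (intro tendsto_diff limit_nonneg[OF cp(1) _ q sub] limit_nonneg[OF cp(2) _ q sub]) (auto simp: fp_def fn_def)
  moreover have "integral UNIV fp - integral UNIV fn = integral UNIV f"
  proof -
    have "integral UNIV fp - integral UNIV fn = integral UNIV (\<lambda>x. fp x - fn x)"
      by (intro integral_diff[symmetric] integrable_on_lborel cc_fun.integrable_f[OF cp(1)] cc_fun.integrable_f[OF cp(2)])
    also have "(\<lambda>x. fp x - fn x) = f" by (auto simp: fp_def fn_def max_def)
    finally show ?thesis .
  qed
  moreover have "\<forall>\<^sub>F N in sequentially. R N fp - R N fn = R N f"
    using eventually_ge_at_top[of "8 * A"]
  proof eventually_elim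
    case (elim N)
    have "fp x - fn x = f x" for x by (auto simp: fp_def fn_def max_def)
    then show ?case
      unfolding avg_def diff_divide_distrib[symmetric] sum_subtractf[symmetric]
      by (simp add: per_fpart[OF f elim] per_fpart[OF cp(1) elim] per_fpart[OF cp(2) elim])
  qed
  ultimately show ?thesis using Lim_transform_eventually by fastforce
qed

end

section \<open>Mean squares and almost sure convergence\<close>

lemma cis_period_integral:
  fixes C :: complex and k :: int
  shows "((\<lambda>\<alpha>. Re (C * cis (2 * pi * (of_int k * \<alpha>)))) has_integral (if k = 0 then Re C else 0)) {a..a + 1}"
proof (cases "k = 0")
  case True
  then show ?thesis using has_integral_const_real[of "Re C" a "a + 1"] by simp
next
  case False
  let ?c = "2 * pi * of_int k"
  define F where "F \<alpha> = (Re C * sin (?c * \<alpha>) + Im C * cos (?c * \<alpha>)) / ?c" for \<alpha>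
  have c0: "?c \<noteq> 0" using False by simp
  have "(F has_vector_derivative Re (C * cis (2 * pi * (of_int k * \<alpha>)))) (at \<alpha> within {a..a + 1})" for \<alpha>
  proof -
    have "(F has_real_derivative (Re C * (cos (?c * \<alpha>) * ?c) + Im C * (- sin (?c * \<alpha>) * ?c)) / ?c) (at \<alpha> within {a..a + 1})"
      unfolding F_def by (intro DERIV_cdivide) (auto intro!: derivative_eq_intros)
    moreover have "(Re C * (cos (?c * \<alpha>) * ?c) + Im C * (- sin (?c * \<alpha>) * ?c)) / ?c = Re (C * cis (2 * pi * (of_int k * \<alpha>)))"
      using c0 by (simp add: field_simps)
    ultimately show ?thesis by (simp add: has_real_derivative_iff_has_vector_derivative)
  qed
  then have "((\<lambda>\<alpha>. Re (C * cis (2 * pi * (of_int k * \<alpha>)))) has_integral (F (a + 1) - F a)) {a..a + 1}"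
    by (intro fundamental_theorem_of_calculus) auto
  moreover have "cis (?c * (a + 1)) = cis (?c * a)"
    using cis_2pi_int_add[of "of_int k * a" k] by (simp add: algebra_simps)
  then have "sin (?c * (a + 1)) = sin (?c * a)" "cos (?c * (a + 1)) = cos (?c * a)" by (simp_all add: complex_eq_iff)
  ultimately show ?thesis using False by (simp add: F_def)
qed

definition trig_sum :: "'s set \<Rightarrow> ('s \<Rightarrow> complex) \<Rightarrow> ('s \<Rightarrow> int) \<Rightarrow> real \<Rightarrow> complex" where
  "trig_sum S c Z \<alpha> = (\<Sum>s\<in>S. c s * cis (2 * pi * (of_int (Z s) * \<alpha>)))"

text \<open>Integer frequencies are orthogonal on every interval of length 1, so only pairs with
  equal frequency contribute. Different indices may share a frequency, hence the count of
  coincidences.\<close>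

lemma trig_sum_mean_square:
  assumes "finite S" and W: "\<And>s. s \<in> S \<Longrightarrow> norm (c s) \<le> W" "W \<ge> 0"
  shows "(\<integral>\<^sup>+\<alpha>. ennreal ((norm (trig_sum S c Z \<alpha>))\<^sup>2 * indicator {a..a + 1} \<alpha>) \<partial>lborel)
     \<le> ennreal (W\<^sup>2 * real (card {p\<in>S \<times> S. Z (fst p) = Z (snd p)}))"
proof -
  let ?\<phi> = "\<lambda>\<alpha>. (norm (trig_sum S c Z \<alpha>))\<^sup>2"
  let ?C = "\<lambda>p. c (fst p) * cnj (c (snd p))"
  define I where "I = (\<Sum>p\<in>S \<times> S. if Z (fst p) - Z (snd p) = 0 then Re (?C p) else 0)"
  have eq: "?\<phi> \<alpha> = (\<Sum>p\<in>S \<times> S. Re (?C p * cis (2 * pi * (of_int (Z (fst p) - Z (snd p)) * \<alpha>))))" for \<alpha>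
  proof -
    have "complex_of_real (?\<phi> \<alpha>) = trig_sum S c Z \<alpha> * cnj (trig_sum S c Z \<alpha>)" by (rule complex_norm_square)
    also have "\<dots> = (\<Sum>p\<in>S \<times> S. (c (fst p) * cis (2 * pi * (of_int (Z (fst p)) * \<alpha>))) *
        (cnj (c (snd p)) * cnj (cis (2 * pi * (of_int (Z (snd p)) * \<alpha>)))))"
      unfolding trig_sum_def cnj_sum complex_cnj_mult sum_product sum.cartesian_product by (simp add: case_prod_beta)
    also have "\<dots> = (\<Sum>p\<in>S \<times> S. ?C p * cis (2 * pi * (of_int (Z (fst p) - Z (snd p)) * \<alpha>)))"
    proof (rule sum.cong[OF refl])
      fix p
      have "cis (2 * pi * (of_int (Z (fst p)) * \<alpha>)) * cnj (cis (2 * pi * (of_int (Z (snd p)) * \<alpha>)))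
         = cis (2 * pi * (of_int (Z (fst p) - Z (snd p)) * \<alpha>))"
        unfolding cis_cnj cis_mult by (rule arg_cong[where f = cis]) (simp add: algebra_simps)
      then show "(c (fst p) * cis (2 * pi * (of_int (Z (fst p)) * \<alpha>))) * (cnj (c (snd p)) * cnj (cis (2 * pi * (of_int (Z (snd p)) * \<alpha>))))
         = ?C p * cis (2 * pi * (of_int (Z (fst p) - Z (snd p)) * \<alpha>))"
        by (simp only: mult_ac)
    qed
    finally have "Re (complex_of_real (?\<phi> \<alpha>)) = Re (\<Sum>p\<in>S \<times> S. ?C p * cis (2 * pi * (of_int (Z (fst p) - Z (snd p)) * \<alpha>)))"
      by (rule arg_cong)
    then show ?thesis by (simp only: Re_complex_of_real Re_sum)
  qed
  have "(?\<phi> has_integral I) {a..a + 1}"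
    unfolding eq I_def using assms(1) by (intro has_integral_sum cis_period_integral) auto
  then have "((\<lambda>\<alpha>. if \<alpha> \<in> {a..a + 1} then ?\<phi> \<alpha> else 0) has_integral I) UNIV" by (simp only: has_integral_restrict_UNIV)
  moreover have "(\<lambda>\<alpha>. if \<alpha> \<in> {a..a + 1} then ?\<phi> \<alpha> else 0) = (\<lambda>\<alpha>. ?\<phi> \<alpha> * indicator {a..a + 1} \<alpha>)"
    by (auto simp: indicator_def)
  ultimately have hi: "((\<lambda>\<alpha>. ?\<phi> \<alpha> * indicator {a..a + 1} \<alpha>) has_integral I) UNIV" by simp
  have "continuous_on UNIV ?\<phi>" unfolding trig_sum_def by (intro continuous_intros)
  then have meas: "?\<phi> \<in> borel_measurable lborel" by (simp add: borel_measurable_continuous_onI)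
  have "(\<integral>\<^sup>+\<alpha>. ennreal (?\<phi> \<alpha> * indicator {a..a + 1} \<alpha>) \<partial>lborel) = ennreal I"
    by (rule nn_integral_has_integral_lborel[OF _ _ hi]) (use meas in auto)
  also have "I \<le> W\<^sup>2 * real (card {p\<in>S \<times> S. Z (fst p) = Z (snd p)})"
  proof -
    have "I \<le> (\<Sum>p\<in>S \<times> S. if Z (fst p) = Z (snd p) then W\<^sup>2 else 0)"
      unfolding I_def
    proof (rule sum_mono)
      fix p assume p: "p \<in> S \<times> S"
      have "Re (?C p) \<le> norm (?C p)" by (rule complex_Re_le_cmod)
      also have "\<dots> = norm (c (fst p)) * norm (c (snd p))" by (simp add: norm_mult)
      also have "\<dots> \<le> W * W" using p W by (intro mult_mono) auto
      finally show "(if Z (fst p) - Z (snd p) = 0 then Re (?C p) else 0) \<le> (if Z (fst p) = Z (snd p) then W\<^sup>2 else 0)"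
        by (simp add: power2_eq_square)
    qed
    also have "\<dots> = W\<^sup>2 * real (card {p\<in>S \<times> S. Z (fst p) = Z (snd p)})"
      using assms(1) by (simp add: sum.If_cases Int_def)
    finally show ?thesis .
  qed
  finally show ?thesis by (simp add: ennreal_leI)
qed

text \<open>The integral of the series is finite, so the series converges almost everywhere and its
  terms tend to 0.\<close>

lemma AE_tendsto_0_of_summable:
  fixes \<phi> :: "nat \<Rightarrow> real \<Rightarrow> real"
  assumes meas: "\<And>j. \<phi> j \<in> borel_measurable lborel" and nn: "\<And>j \<alpha>. \<phi> j \<alpha> \<ge> 0"
    and bd: "\<And>j. (\<integral>\<^sup>+\<alpha>. ennreal (\<phi> j \<alpha>) \<partial>lborel) \<le> ennreal (u j)" and u: "summable u" "\<And>j. u j \<ge> 0"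
  shows "AE \<alpha> in lborel. (\<lambda>j. \<phi> j \<alpha>) \<longlonglongrightarrow> 0"
proof -
  have "(\<integral>\<^sup>+\<alpha>. (\<Sum>j. ennreal (\<phi> j \<alpha>)) \<partial>lborel) = (\<Sum>j. \<integral>\<^sup>+\<alpha>. ennreal (\<phi> j \<alpha>) \<partial>lborel)"
    using meas by (intro nn_integral_suminf) auto
  also have "\<dots> \<le> (\<Sum>j. ennreal (u j))" by (intro suminf_le bd) auto
  also have "\<dots> = ennreal (\<Sum>j. u j)" using u by (intro suminf_ennreal2) auto
  also have "\<dots> < \<infinity>" by simp
  finally have "(\<integral>\<^sup>+\<alpha>. (\<Sum>j. ennreal (\<phi> j \<alpha>)) \<partial>lborel) \<noteq> \<infinity>" by simp
  then have "AE \<alpha> in lborel. (\<Sum>j. ennreal (\<phi> j \<alpha>)) \<noteq> \<infinity>"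
    using meas by (intro nn_integral_noteq_infinite) auto
  then show ?thesis
  proof eventually_elim
    case (elim \<alpha>)
    then have "summable (\<lambda>j. \<phi> j \<alpha>)" using nn by (intro summable_suminf_not_top) (auto simp: top_ennreal_def)
    then show ?case by (rule summable_LIMSEQ_zero)
  qed
qed

section \<open>Correlations of power sequences\<close>

lemma sum_split_half: "(\<Sum>i<2*l. F i) = (\<Sum>i<l. F i) + (\<Sum>i<l. F (i + l))" for F :: "nat \<Rightarrow> 'a::comm_monoid_add"
proof -
  have "(\<Sum>i<2*l. F i) = (\<Sum>i<l. F i) + (\<Sum>i=l..<2*l. F i)"
    by (simp add: sum.atLeastLessThan_concat lessThan_atLeast0)
  also have "(\<Sum>i=l..<2*l. F i) = (\<Sum>i=0+l..<l+l. F i)" by (simp add: mult_2)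
  also have "\<dots> = (\<Sum>i=0..<l. F (i + l))" by (rule sum.shift_bounds_nat_ivl)
  finally show ?thesis by (simp add: lessThan_atLeast0)
qed

locale correlation_setup =
  fixes l :: nat and b :: "nat \<Rightarrow> 'n::finite"
  assumes l: "l \<ge> 3" and card_n: "CARD('n) = l - 1" and bij: "bij_betw b {..<l-1} UNIV"
begin

abbreviation p :: nat where "p \<equiv> l - 1"

definition \<Omega> :: "nat \<Rightarrow> (nat \<Rightarrow> nat) set" where
  "\<Omega> N = {n \<in> {0..<l} \<rightarrow>\<^sub>E {1..N}. inj_on n {0..<l}}"

definition \<iota> :: "'n \<Rightarrow> nat" where "\<iota> i = inv_into {..<l-1} b i"

definition \<theta> :: "real \<Rightarrow> nat \<Rightarrow> (nat \<Rightarrow> nat) \<Rightarrow> 'n \<Rightarrow> real" where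
  "\<theta> \<alpha> d n i = xseq \<alpha> d (n (\<iota> i)) - xseq \<alpha> d (n (\<iota> i + 1))"

lemma finite_\<Omega>: "finite (\<Omega> N)"
  by (rule finite_subset[of _ "{0..<l} \<rightarrow>\<^sub>E {1..N}"]) (auto simp: \<Omega>_def finite_PiE)

sublocale point_system \<Omega> "\<theta> \<alpha> d" for \<alpha> d
proof
  show "finite (\<Omega> N)" for N by (rule finite_\<Omega>)
  fix N M :: nat assume "N \<le> M"
  then have "({0..<l} \<rightarrow>\<^sub>E {1..N}) \<subseteq> ({0..<l} \<rightarrow>\<^sub>E {1..M})" by (intro PiE_mono) auto
  then show "\<Omega> N \<subseteq> \<Omega> M" unfolding \<Omega>_def by blast
qed

lemma corr_R_eq: "corr_R l b \<alpha> d f N = avg \<alpha> d N (per N f)"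
  unfolding corr_R_def avg_def per_def \<theta>_def \<Omega>_def \<iota>_def by simp

lemma \<iota>_b: "j < p \<Longrightarrow> \<iota> (b j) = j"
  unfolding \<iota>_def using bij by (simp add: bij_betw_def inv_into_f_f)

text \<open>Summation by parts: the coefficient of \<open>x(n\<^sub>i)\<close> in \<open>\<Sum> m\<^sub>i (x(n\<^sub>i) - x(n\<^bsub>i+1\<^esub>))\<close>.\<close>

definition H :: "('n \<Rightarrow> int) \<Rightarrow> nat \<Rightarrow> int" where
  "H m i = (if i < p then m (b i) else 0) - (if 0 < i then m (b (i - 1)) else 0)"

definition Z :: "nat \<Rightarrow> (nat \<Rightarrow> nat) \<times> ('n \<Rightarrow> int) \<Rightarrow> int" where
  "Z d s = (\<Sum>i<l. H (snd s) i * int (fst s i) ^ d)"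

lemma sum_H: "(\<Sum>i<l. H m i * w i) = (\<Sum>i<p. m (b i) * (w i - w (Suc i)))" for w :: "nat \<Rightarrow> int"
proof -
  have lp: "l = Suc p" using l by simp
  have "(\<Sum>i<l. H m i * w i) = (\<Sum>i<l. (if i < p then m (b i) * w i else 0)) - (\<Sum>i<l. (if 0 < i then m (b (i - 1)) * w i else 0))"
    unfolding sum_subtractf[symmetric] by (intro sum.cong refl) (simp add: H_def left_diff_distrib)
  also have "(\<Sum>i<l. (if i < p then m (b i) * w i else 0)) = (\<Sum>i<p. m (b i) * w i)"
    by (subst lp, subst sum.lessThan_Suc) simp
  also have "(\<Sum>i<l. (if 0 < i then m (b (i - 1)) * w i else 0)) = (\<Sum>i<p. m (b i) * w (Suc i))"
    by (subst lp, subst sum.lessThan_Suc_shift) simp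
  finally show ?thesis by (simp add: right_diff_distrib sum_subtractf)
qed

lemma sum_H_0: "(\<Sum>i<l. H m i) = 0"
  using sum_H[of m "\<lambda>_. 1"] by simp

lemma H_partial_sum: "j < p \<Longrightarrow> (\<Sum>i\<le>j. H m i) = m (b j)"
  by (induction j) (auto simp: H_def)

text \<open>The partial sums of \<open>H m\<close> return \<open>m\<close>, so nothing is lost in
  passing from frequencies to coefficients.\<close>

lemma H_inj:
  assumes "\<And>i. i < l \<Longrightarrow> H m i = H m' i"
  shows "m = m'"
proof
  fix i
  obtain j where j: "j < p" "b j = i" using bij by (metis UNIV_I bij_betw_def imageE lessThan_iff)
  have "m (b j) = m' (b j)"
    unfolding H_partial_sum[OF j(1), symmetric] using assms j(1) by (intro sum.cong) auto
  then show "m i = m' i" using j by simp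
qed

text \<open>Integer parts change the phase by multiples of 2 pi, so the fractional parts may be
  replaced by the numbers themselves; summation by parts collects the coefficients.\<close>

lemma sum_\<theta>:
  "cis (2 * pi * (\<Sum>i\<in>UNIV. of_int (m i) * \<theta> \<alpha> d n i)) = cis (2 * pi * (of_int (Z d (n, m)) * \<alpha>))"
proof -
  define fl where "fl k = \<lfloor>\<alpha> * real k ^ d\<rfloor>" for k :: nat
  have x: "xseq \<alpha> d k = \<alpha> * real k ^ d - of_int (fl k)" for k by (simp add: xseq_def frac_def fl_def)
  have "(\<Sum>i\<in>UNIV. of_int (m i) * \<theta> \<alpha> d n i) = (\<Sum>j<p. of_int (m (b j)) * \<theta> \<alpha> d n (b j))"
    by (rule sum.reindex_bij_betw[OF bij, symmetric])
  also have "\<dots> = (\<Sum>j<p. of_int (m (b j)) * (\<alpha> * real (n j) ^ d - \<alpha> * real (n (Suc j)) ^ d) - of_int (m (b j) * (fl (n j) - fl (n (Suc j)))))"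
    by (intro sum.cong refl) (simp add: \<theta>_def \<iota>_b x algebra_simps)
  also have "\<dots> = (\<Sum>j<p. of_int (m (b j)) * (\<alpha> * real (n j) ^ d - \<alpha> * real (n (Suc j)) ^ d)) + of_int (- (\<Sum>j<p. m (b j) * (fl (n j) - fl (n (Suc j)))))"
    by (simp add: sum_subtractf)
  also have "(\<Sum>j<p. of_int (m (b j)) * (\<alpha> * real (n j) ^ d - \<alpha> * real (n (Suc j)) ^ d)) = of_int (Z d (n, m)) * \<alpha>"
    unfolding Z_def fst_conv snd_conv sum_H of_int_sum sum_distrib_right
    by (intro sum.cong refl) (simp add: algebra_simps)
  finally show ?thesis by (simp only: cis_2pi_int_add)
qed

abbreviation freqs :: "nat \<Rightarrow> ('n \<Rightarrow> int) set" where
  "freqs M \<equiv> PiE UNIV (\<lambda>_. {- int M..int M})"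

definition wt :: "('n \<Rightarrow> int) \<Rightarrow> nat \<Rightarrow> ('n \<Rightarrow> int) \<Rightarrow> complex" where
  "wt \<sigma> M m = of_real (\<Prod>i\<in>UNIV. fejer_coeff M (m i)) *
     cis (- (2 * pi * (\<Sum>i\<in>UNIV. of_int (m i) * (of_int (\<sigma> i) / (2 * real M)))))"

lemma fprod_expansion:
  "complex_of_real (fprod T \<sigma> N (\<theta> \<alpha> d n)) =
     (\<Sum>m\<in>freqs (T * N). wt \<sigma> (T * N) m * cis (2 * pi * (of_int (Z d (n, m)) * \<alpha>)))"
proof -
  let ?M = "T * N"
  define s where "s i = of_int (\<sigma> i) / (2 * real ?M)" for i
  have "complex_of_real (fprod T \<sigma> N (\<theta> \<alpha> d n)) = (\<Prod>i\<in>UNIV. complex_of_real (fejer ?M (\<theta> \<alpha> d n i - s i)))"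
    by (simp add: fprod_def s_def)
  also have "\<dots> = (\<Prod>i\<in>UNIV. \<Sum>k\<in>{- int ?M..int ?M}. fejer_coeff ?M k * cis (2 * pi * (of_int k * (\<theta> \<alpha> d n i - s i))))"
    by (simp only: fejer_expansion)
  also have "\<dots> = (\<Sum>m\<in>freqs ?M. \<Prod>i\<in>UNIV. fejer_coeff ?M (m i) * cis (2 * pi * (of_int (m i) * (\<theta> \<alpha> d n i - s i))))"
    by (rule prod_sum_PiE) auto
  also have "\<dots> = (\<Sum>m\<in>freqs ?M. wt \<sigma> ?M m * cis (2 * pi * (of_int (Z d (n, m)) * \<alpha>)))"
  proof (rule sum.cong[OF refl])
    fix m :: "'n \<Rightarrow> int"
    have cp: "(\<Prod>i\<in>A. cis (g i)) = cis (\<Sum>i\<in>A. g i)" if "finite A" for A :: "'n set" and g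
      using that by (induction A rule: finite_induct) (auto simp: cis_mult)
    have "(\<Prod>i\<in>UNIV. fejer_coeff ?M (m i) * cis (2 * pi * (of_int (m i) * (\<theta> \<alpha> d n i - s i))))
      = of_real (\<Prod>i\<in>UNIV. fejer_coeff ?M (m i)) * cis (\<Sum>i\<in>UNIV. 2 * pi * (of_int (m i) * (\<theta> \<alpha> d n i - s i)))"
      by (simp add: prod.distrib cp)
    also have "(\<Sum>i\<in>UNIV. 2 * pi * (of_int (m i) * (\<theta> \<alpha> d n i - s i)))
      = - (2 * pi * (\<Sum>i\<in>UNIV. of_int (m i) * s i)) + 2 * pi * (\<Sum>i\<in>UNIV. of_int (m i) * \<theta> \<alpha> d n i)"
      by (simp add: sum_distrib_left[symmetric] right_diff_distrib sum_subtractf)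
    also have "cis \<dots> = cis (- (2 * pi * (\<Sum>i\<in>UNIV. of_int (m i) * s i))) * cis (2 * pi * (of_int (Z d (n, m)) * \<alpha>))"
      by (simp only: cis_mult[symmetric] sum_\<theta>)
    finally show "(\<Prod>i\<in>UNIV. fejer_coeff ?M (m i) * cis (2 * pi * (of_int (m i) * (\<theta> \<alpha> d n i - s i))))
      = wt \<sigma> ?M m * cis (2 * pi * (of_int (Z d (n, m)) * \<alpha>))"
      by (simp add: wt_def s_def mult.assoc)
  qed
  finally show ?thesis .
qed

lemma norm_wt_le: "norm (wt \<sigma> M m) \<le> (1 / real M) ^ p"
proof -
  have "norm (wt \<sigma> M m) = (\<Prod>i\<in>UNIV. fejer_coeff M (m i))"
    using fejer_coeff_bound(1) by (simp add: wt_def norm_mult prod_norm[symmetric])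
  also have "\<dots> \<le> (\<Prod>i\<in>(UNIV::'n set). 1 / real M)" using fejer_coeff_bound by (intro prod_mono) auto
  finally show ?thesis by (simp add: card_n)
qed

lemma wt_0: "M \<ge> 1 \<Longrightarrow> wt \<sigma> M (\<lambda>_. 0) = of_real ((1 / real M) ^ p)"
  by (simp add: wt_def fejer_coeff_0 card_n)

definition idx :: "nat \<Rightarrow> nat \<Rightarrow> ((nat \<Rightarrow> nat) \<times> ('n \<Rightarrow> int)) set" where
  "idx T N = \<Omega> N \<times> (freqs (T * N) - {\<lambda>_. 0})"

lemma finite_idx: "finite (idx T N)"
  unfolding idx_def using finite_\<Omega> by (auto simp: finite_PiE)

lemma avg_expansion:
  assumes "T \<ge> 1" "N \<ge> 1"
  shows "complex_of_real (avg \<alpha> d N (fprod T \<sigma> N)) =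
    of_real (real (card (\<Omega> N)) * (1 / real (T * N)) ^ p / real N) +
    trig_sum (idx T N) (\<lambda>s. wt \<sigma> (T * N) (snd s) / of_nat N) (Z d) \<alpha>"
proof -
  let ?M = "T * N" and ?z = "(\<lambda>_. 0) :: 'n \<Rightarrow> int"
  let ?t = "\<lambda>n m. wt \<sigma> ?M m * cis (2 * pi * (of_int (Z d (n, m)) * \<alpha>))"
  have z: "?z \<in> freqs ?M" by auto
  have ff: "finite (freqs ?M)" by (simp add: finite_PiE)
  have M1: "?M \<ge> 1" using assms by simp
  have Z0: "Z d (n, ?z) = 0" for n by (simp add: Z_def H_def)
  have "complex_of_real (avg \<alpha> d N (fprod T \<sigma> N)) = (\<Sum>n\<in>\<Omega> N. \<Sum>m\<in>freqs ?M. ?t n m) / of_nat N"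
    by (simp add: avg_def fprod_expansion)
  also have "(\<Sum>n\<in>\<Omega> N. \<Sum>m\<in>freqs ?M. ?t n m) = (\<Sum>n\<in>\<Omega> N. of_real ((1 / real ?M) ^ p) + (\<Sum>m\<in>freqs ?M - {?z}. ?t n m))"
  proof (rule sum.cong[OF refl])
    fix n
    have "(\<Sum>m\<in>freqs ?M. ?t n m) = ?t n ?z + (\<Sum>m\<in>freqs ?M - {?z}. ?t n m)" by (rule sum.remove[OF ff z])
    then show "(\<Sum>m\<in>freqs ?M. ?t n m) = of_real ((1 / real ?M) ^ p) + (\<Sum>m\<in>freqs ?M - {?z}. ?t n m)"
      unfolding wt_0[OF M1] Z0 by simp
  qed
  also have "\<dots> = of_nat (card (\<Omega> N)) * of_real ((1 / real ?M) ^ p) + (\<Sum>s\<in>idx T N. ?t (fst s) (snd s))"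
    unfolding idx_def by (simp add: sum.distrib sum.cartesian_product case_prod_beta)
  finally show ?thesis
    by (simp add: add_divide_distrib trig_sum_def sum_divide_distrib)
qed

text \<open>A coincidence of two frequencies becomes one vector of length \<open>2 * l\<close>: the
  tuples are concatenated and the second \<open>H\<close> is negated. Both half sums vanish by
  \<open>sum_H_0\<close>, entries are at most \<open>2 * T * N\<close> because \<open>H\<close> is a
  difference of two frequencies, and the first half is nonzero because the zero frequency was
  removed.\<close>

lemma coincidences_le:
  assumes T: "T \<ge> 1" and N: "N \<ge> 1"
  shows "card {q\<in>idx T N \<times> idx T N. Z d (fst q) = Z d (snd q)}
    \<le> card (SIGMA n:adm l N. {h\<in>lat l d (2 * T * N) n. \<exists>i<2*l. h i \<noteq> 0})"
proof -
  define \<Psi> where "\<Psi> q = ((\<lambda>i\<in>{..<2*l}. if i < l then fst (fst q) i else fst (snd q) (i - l)),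
     (\<lambda>i\<in>{..<2*l}. if i < l then H (snd (fst q)) i else - H (snd (snd q)) (i - l)))"
    for q :: "((nat \<Rightarrow> nat) \<times> ('n \<Rightarrow> int)) \<times> ((nat \<Rightarrow> nat) \<times> ('n \<Rightarrow> int))"
  let ?Q = "{q\<in>idx T N \<times> idx T N. Z d (fst q) = Z d (snd q)}"
  let ?S = "SIGMA n:adm l N. {h\<in>lat l d (2 * T * N) n. \<exists>i<2*l. h i \<noteq> 0}"
  have "inj_on \<Psi> ?Q"
  proof (rule inj_onI)
    fix q q' assume q: "q \<in> ?Q" "q' \<in> ?Q" "\<Psi> q = \<Psi> q'"
    obtain n1 m1 n2 m2 where e: "q = ((n1,m1),(n2,m2))" by (metis surj_pair)
    obtain n1' m1' n2' m2' where e': "q' = ((n1',m1'),(n2',m2'))" by (metis surj_pair)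
    have f: "fst (\<Psi> q) i = fst (\<Psi> q') i" "snd (\<Psi> q) i = snd (\<Psi> q') i" for i using q(3) by simp_all
    have n: "n1 i = n1' i" "n2 i = n2' i" "H m1 i = H m1' i" "H m2 i = H m2' i" if "i < l" for i
      using f[of i] f[of "i + l"] that by (simp_all add: \<Psi>_def e e')
    have O: "n1 \<in> {0..<l} \<rightarrow>\<^sub>E {1..N}" "n1' \<in> {0..<l} \<rightarrow>\<^sub>E {1..N}" "n2 \<in> {0..<l} \<rightarrow>\<^sub>E {1..N}" "n2' \<in> {0..<l} \<rightarrow>\<^sub>E {1..N}"
      using q(1,2) by (auto simp: e e' idx_def \<Omega>_def)
    have "n1 = n1'" by (rule PiE_ext[OF O(1,2)]) (use n(1) in simp)
    moreover have "n2 = n2'" by (rule PiE_ext[OF O(3,4)]) (use n(2) in simp)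
    ultimately show "q = q'" using H_inj[OF n(3)] H_inj[OF n(4)] by (simp add: e e')
  qed
  moreover have "\<Psi> ` ?Q \<subseteq> ?S"
  proof
    fix s assume "s \<in> \<Psi> ` ?Q"
    then obtain q where q: "q \<in> ?Q" "s = \<Psi> q" by auto
    obtain n1 m1 n2 m2 where e: "q = ((n1,m1),(n2,m2))" by (metis surj_pair)
    have O: "n1 \<in> \<Omega> N" "n2 \<in> \<Omega> N" and m: "m1 \<in> freqs (T * N)" "m2 \<in> freqs (T * N)" "m1 \<noteq> (\<lambda>_. 0)"
      and ZZ: "Z d (n1,m1) = Z d (n2,m2)" using q(1) by (auto simp: e idx_def)
    define \<nu> where "\<nu> = fst s"
    define h where "h = snd s"
    have \<nu>: "\<nu> i = n1 i" "\<nu> (i + l) = n2 i" "h i = H m1 i" "h (i + l) = - H m2 i" if "i < l" for i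
      using that by (simp_all add: \<nu>_def h_def q(2) \<Psi>_def e)
    have ext: "\<nu> \<in> extensional {..<2*l}" "h \<in> extensional {..<2*l}" by (simp_all add: \<nu>_def h_def q(2) \<Psi>_def)
    have two: "P i" if "\<And>i. i < l \<Longrightarrow> P i" "\<And>i. i < l \<Longrightarrow> P (i + l)" "i < 2 * l" for P and i :: nat
      using that(1)[of i] that(2)[of "i - l"] that(3) by (cases "i < l") auto
    have n1P: "n1 i \<in> {1..N}" "n2 i \<in> {1..N}" if "i < l" for i using O that by (auto simp: \<Omega>_def PiE_def Pi_def)
    have "\<nu> \<in> adm l N"
    proof -
      have "\<nu> i \<in> {1..N}" if "i < 2 * l" for i
        by (rule two[OF _ _ that]) (use n1P \<nu> in auto)
      then have "\<nu> \<in> PiE {..<2*l} (\<lambda>_. {1..N})" using ext(1) by (auto simp: PiE_def)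
      moreover have "inj_on \<nu> {..<l}"
      proof (rule inj_onI)
        fix i j assume "i \<in> {..<l}" "j \<in> {..<l}" "\<nu> i = \<nu> j"
        then show "i = j" using O(1) \<nu>(1) by (auto simp: \<Omega>_def inj_on_def)
      qed
      moreover have "inj_on \<nu> {l..<2*l}"
      proof (rule inj_onI)
        fix i j assume ij: "i \<in> {l..<2*l}" "j \<in> {l..<2*l}" "\<nu> i = \<nu> j"
        have "n2 (i - l) = n2 (j - l)" using \<nu>(2)[of "i - l"] \<nu>(2)[of "j - l"] ij by auto
        moreover have "i - l < l" "j - l < l" using ij by auto
        ultimately have "i - l = j - l" using O(2) by (auto simp: \<Omega>_def inj_on_def)
        then show "i = j" using ij by auto
      qed
      ultimately show ?thesis by (simp add: adm_def)
    qed
    moreover have "h \<in> lat l d (2 * T * N) \<nu>"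
    proof -
      have mb: "\<bar>m1 k\<bar> \<le> int (T * N)" "\<bar>m2 k\<bar> \<le> int (T * N)" for k
        using m(1,2) unfolding PiE_UNIV_domain Pi_iff atLeastAtMost_iff by (metis UNIV_I abs_le_iff minus_le_iff)+
      have Hb: "\<bar>H m i\<bar> \<le> int (2 * T * N)" if "\<And>k. \<bar>m k\<bar> \<le> int (T * N)" for m i
      proof -
        have "\<bar>H m i\<bar> \<le> int (T * N) + int (T * N)" unfolding H_def using that[of "b i"] that[of "b (i - 1)"] by (smt (verit) of_nat_0_le_iff)
        then show ?thesis by (simp add: mult.commute)
      qed
      have "h i \<in> {- int (2 * T * N)..int (2 * T * N)}" if "i < 2 * l" for i
      proof (rule two[OF _ _ that])
        fix i assume i: "i < l"
        show "h i \<in> {- int (2 * T * N)..int (2 * T * N)}" using Hb[of m1 i, OF mb(1)] \<nu>(3)[OF i] unfolding atLeastAtMost_iff by linarith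
        show "h (i + l) \<in> {- int (2 * T * N)..int (2 * T * N)}" using Hb[of m2 i, OF mb(2)] \<nu>(4)[OF i] unfolding atLeastAtMost_iff by linarith
      qed
      then have "h \<in> PiE {..<2*l} (\<lambda>_. {- int (2 * T * N)..int (2 * T * N)})" using ext(2) unfolding PiE_def by blast
      moreover have "sol_eqs l d \<nu> h"
      proof -
        have 1: "(\<Sum>i<l. h i) = 0" using \<nu>(3) sum_H_0[of m1] by simp
        have "(\<Sum>i<2*l. h i) = (\<Sum>i<l. h i) + (\<Sum>i=l..<2*l. h i)"
          by (simp add: sum.atLeastLessThan_concat lessThan_atLeast0)
        moreover have "(\<Sum>i<2*l. h i) = (\<Sum>i<l. h i) + (\<Sum>i<l. h (i + l))" by (rule sum_split_half)
        moreover have "(\<Sum>i<l. h (i + l)) = 0" using \<nu>(4) sum_H_0[of m2] by (simp add: sum_negf)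
        ultimately have 2: "(\<Sum>i=l..<2*l. h i) = 0" by simp
        have "(\<Sum>i<2*l. h i * int (\<nu> i) ^ d) = (\<Sum>i<l. h i * int (\<nu> i) ^ d) + (\<Sum>i<l. h (i + l) * int (\<nu> (i + l)) ^ d)"
          by (rule sum_split_half)
        also have "\<dots> = Z d (n1,m1) - Z d (n2,m2)" using \<nu> by (simp add: Z_def sum_negf)
        finally show ?thesis using 1 2 ZZ by (simp add: sol_eqs_def)
      qed
      ultimately show ?thesis by (simp add: lat_def)
    qed
    moreover have "\<exists>i<2*l. h i \<noteq> 0"
    proof (rule ccontr)
      assume "\<not> ?thesis"
      then have "H m1 i = H (\<lambda>_. 0) i" if "i < l" for i using \<nu>(3)[OF that] that by (auto simp: H_def[of "\<lambda>_. 0"])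
      then show False using H_inj m(3) by blast
    qed
    ultimately show "s \<in> ?S" unfolding \<nu>_def h_def by (cases s) auto
  qed
  moreover have "finite ?S" using finite_adm finite_lat by (intro finite_SigmaI) auto
  ultimately show ?thesis by (rule card_inj_on_le)
qed

text \<open>Tuples with a repetition lie in the sets \<open>D r\<close>; there are at most
  \<open>l\<^sup>2\<close> pairs of positions \<open>r\<close>, and one entry is determined in
  each.\<close>

lemma card_\<Omega>_bounds:
  assumes "N \<ge> 1"
  shows "real (card (\<Omega> N)) \<le> real N ^ l" "real N ^ l - real (l\<^sup>2) * real N ^ p \<le> real (card (\<Omega> N))"
proof -
  let ?P = "{0..<l} \<rightarrow>\<^sub>E {1..N}"
  have fP: "finite ?P" by (simp add: finite_PiE)
  have cP: "card ?P = N ^ l" by (simp add: card_PiE)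
  have sub: "\<Omega> N \<subseteq> ?P" by (auto simp: \<Omega>_def)
  then have "card (\<Omega> N) \<le> N ^ l" using card_mono[OF fP sub] cP by simp
  then show "real (card (\<Omega> N)) \<le> real N ^ l" by (metis of_nat_le_iff of_nat_power)
  define D where "D r = {n \<in> ?P. n (fst r) = n (snd r)}" for r
  have cD: "card (D r) \<le> N ^ p" if r: "fst r < l" "snd r < l" "fst r \<noteq> snd r" for r
  proof -
    let ?I = "{0..<l} - {snd r}"
    have "inj_on (\<lambda>n. restrict n ?I) (D r)"
    proof (rule inj_onI)
      fix n n' assume n: "n \<in> D r" "n' \<in> D r" "restrict n ?I = restrict n' ?I"
      have a: "n i = n' i" if "i \<in> ?I" for i using fun_cong[OF n(3), of i] that by simp
      then have "n (snd r) = n' (snd r)" using a[of "fst r"] n(1,2) r by (auto simp: D_def)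
      then have "n i = n' i" if "i \<in> {0..<l}" for i using a[of i] that by (cases "i = snd r") auto
      then show "n = n'" using n(1,2) unfolding D_def by (intro PiE_ext[of n "{0..<l}" _ n']) auto
    qed
    moreover have "(\<lambda>n. restrict n ?I) ` D r \<subseteq> ?I \<rightarrow>\<^sub>E {1..N}" unfolding D_def using r by (intro image_subsetI) (auto simp: restrict_PiE_iff PiE_def Pi_def)
    moreover have "finite (?I \<rightarrow>\<^sub>E {1..N})" by (simp add: finite_PiE)
    ultimately have "card (D r) \<le> card (?I \<rightarrow>\<^sub>E {1..N})" by (rule card_inj_on_le)
    then show ?thesis using r by (simp add: card_PiE)
  qed
  define Rr where "Rr = {r\<in>{..<l} \<times> {..<l}. fst r \<noteq> snd r}"
  have fR: "finite Rr" by (simp add: Rr_def)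
  have "card Rr \<le> card ({..<l} \<times> {..<l})" unfolding Rr_def by (intro card_mono) auto
  then have cR: "card Rr \<le> l\<^sup>2" by (simp add: card_cartesian_product power2_eq_square)
  have "?P \<subseteq> \<Omega> N \<union> (\<Union>r\<in>Rr. D r)"
    by (fastforce simp: \<Omega>_def D_def Rr_def inj_on_def)
  then have "card ?P \<le> card (\<Omega> N \<union> (\<Union>r\<in>Rr. D r))"
    using finite_\<Omega> fR fP by (intro card_mono) (auto simp: D_def)
  also have "\<dots> \<le> card (\<Omega> N) + card (\<Union>r\<in>Rr. D r)" by (rule card_Un_le)
  also have "card (\<Union>r\<in>Rr. D r) \<le> (\<Sum>r\<in>Rr. card (D r))" by (rule card_UN_le[OF fR])
  also have "\<dots> \<le> (\<Sum>r\<in>Rr. N ^ p)" using cD by (intro sum_mono) (auto simp: Rr_def)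
  also have "\<dots> \<le> l\<^sup>2 * N ^ p" using cR by simp
  finally have "N ^ l \<le> card (\<Omega> N) + l\<^sup>2 * N ^ p" unfolding cP by simp
  then have "real (N ^ l) \<le> real (card (\<Omega> N) + l\<^sup>2 * N ^ p)" by (simp only: of_nat_le_iff)
  then show "real N ^ l - real (l\<^sup>2) * real N ^ p \<le> real (card (\<Omega> N))" by simp
qed

lemma main_term_limit:
  assumes T: "T \<ge> 1"
  shows "(\<lambda>N. real (card (\<Omega> N)) * (1 / real (T * N)) ^ p / real N) \<longlonglongrightarrow> 1 / real T ^ p"
proof -
  have lp: "l = Suc p" using l by simp
  have eq: "real (card (\<Omega> N)) * (1 / real (T * N)) ^ p / real N = 1 / real T ^ p * (real (card (\<Omega> N)) / real N ^ l)" for N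
    by (subst lp) (simp add: power_mult_distrib power_divide)
  have "(\<lambda>N. real (card (\<Omega> N)) / real N ^ l) \<longlonglongrightarrow> 1"
  proof (rule tendsto_sandwich)
    have "(\<lambda>N. 1 - real (l\<^sup>2) * (1 / real N)) \<longlonglongrightarrow> 1 - real (l\<^sup>2) * 0"
      by (intro tendsto_intros lim_1_over_n)
    then show "(\<lambda>N. 1 - real (l\<^sup>2) * (1 / real N)) \<longlonglongrightarrow> 1" by simp
    show "\<forall>\<^sub>F N in sequentially. 1 - real (l\<^sup>2) * (1 / real N) \<le> real (card (\<Omega> N)) / real N ^ l"
      using eventually_ge_at_top[of 1]
    proof eventually_elim
      case (elim N)
      have "real N ^ l = real N * real N ^ p" by (subst lp) simp
      then have "1 - real (l\<^sup>2) * (1 / real N) = (real N ^ l - real (l\<^sup>2) * real N ^ p) / real N ^ l"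
        using elim by (simp add: field_simps)
      also have "\<dots> \<le> real (card (\<Omega> N)) / real N ^ l" using card_\<Omega>_bounds(2)[OF elim] by (intro divide_right_mono) auto
      finally show ?case .
    qed
    show "\<forall>\<^sub>F N in sequentially. real (card (\<Omega> N)) / real N ^ l \<le> 1"
      using eventually_ge_at_top[of 1]
    proof eventually_elim
      case (elim N)
      then show ?case using card_\<Omega>_bounds(1)[OF elim] by simp
    qed
  qed simp
  then have "(\<lambda>N. 1 / real T ^ p * (real (card (\<Omega> N)) / real N ^ l)) \<longlonglongrightarrow> 1 / real T ^ p * 1"
    by (intro tendsto_mult tendsto_const)
  then show ?thesis unfolding eq by simp
qed

text \<open>Chosen so that the saving \<open>N powr (- 1 / (20 * (2 * l)^2))\<close> becomes
  \<open>j powr (- 2)\<close> at \<open>N = j ^ qq\<close>, which is summable.\<close>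

abbreviation qq :: nat where "qq \<equiv> 40 * (2 * l)\<^sup>2"

text \<open>The coefficients are at most \<open>1 / N ^ l\<close>, and the coincidences number at
  most a constant times \<open>N powr (2 * l)\<close> reduced by the saving of
  \<open>card_additive_relations\<close>. So the mean square over a unit interval is at most a
  constant times that saving.\<close>

lemma AE_test_limit:
  fixes a :: int
  assumes T: "T \<ge> 1" and d: "d > (2 * l) ^ (4 * l)"
  shows "AE \<alpha> in lborel. \<alpha> \<in> {of_int a..of_int a + 1} \<longrightarrow>
     (\<lambda>j. avg \<alpha> d (j ^ qq) (fprod T \<sigma> (j ^ qq))) \<longlonglongrightarrow> 1 / real T ^ CARD('n)"
proof -
  interpret relation_count l d "2 * T" using l d T by unfold_locales auto
  define I where "I = {real_of_int a..of_int a + 1}"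
  obtain C where C: "C \<ge> 0" "\<forall>N\<ge>1. real (card (SIGMA n:adm l N. {h\<in>lat l d (2 * T * N) n. \<exists>i<2*l. h i \<noteq> 0}))
      \<le> C * real N powr (real (2 * l) - 1 / (20 * (real (2 * l))\<^sup>2))"
    using card_additive_relations by blast
  define S where "S N \<alpha> = trig_sum (idx T N) (\<lambda>s. wt \<sigma> (T * N) (snd s) / of_nat N) (Z d) \<alpha>" for N \<alpha>
  define \<phi> where "\<phi> j \<alpha> = (norm (S (Suc j ^ qq) \<alpha>))\<^sup>2 * indicator I \<alpha>" for j \<alpha>
  have q1: "qq \<ge> 1" using l by simp
  have bound: "(\<integral>\<^sup>+\<alpha>. ennreal ((norm (S N \<alpha>))\<^sup>2 * indicator I \<alpha>) \<partial>lborel) \<le> ennreal (C * real N powr (- 1 / (20 * (real (2 * l))\<^sup>2)))"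
    if N: "N \<ge> 1" for N
  proof -
    define W where "W = (1 / real (T * N)) ^ p / real N"
    have W0: "W \<ge> 0" by (simp add: W_def)
    have "(\<integral>\<^sup>+\<alpha>. ennreal ((norm (S N \<alpha>))\<^sup>2 * indicator I \<alpha>) \<partial>lborel)
      \<le> ennreal (W\<^sup>2 * real (card {q\<in>idx T N \<times> idx T N. Z d (fst q) = Z d (snd q)}))"
      unfolding S_def I_def
    proof (rule trig_sum_mean_square[OF finite_idx _ W0])
      fix s
      show "norm (wt \<sigma> (T * N) (snd s) / of_nat N) \<le> W"
        unfolding W_def norm_divide using norm_wt_le[of \<sigma> "T * N" "snd s"] by (simp add: divide_right_mono)
    qed
    also have "W\<^sup>2 * real (card {q\<in>idx T N \<times> idx T N. Z d (fst q) = Z d (snd q)})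
      \<le> (1 / real N ^ l)\<^sup>2 * (C * real N powr (real (2 * l) - 1 / (20 * (real (2 * l))\<^sup>2)))"
    proof (intro mult_mono)
      have "real N \<le> real (T * N)" using T by (simp only: of_nat_le_iff) simp
      then have "(1 / real (T * N)) ^ p \<le> (1 / real N) ^ p" using N by (intro power_mono divide_left_mono) auto
      then have "W \<le> (1 / real N) ^ p / real N" unfolding W_def by (rule divide_right_mono) simp
      also have "\<dots> = 1 / real N ^ l"
      proof -
        have "l = Suc p" using l by simp
        then have "real N ^ l = real N ^ p * real N" by (metis power_Suc2)
        then show ?thesis by (simp add: power_divide)
      qed
      finally show "W\<^sup>2 \<le> (1 / real N ^ l)\<^sup>2" using W0 by (rule power_mono)
      have "real (card {q\<in>idx T N \<times> idx T N. Z d (fst q) = Z d (snd q)})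
        \<le> real (card (SIGMA n:adm l N. {h\<in>lat l d (2 * T * N) n. \<exists>i<2*l. h i \<noteq> 0}))"
        using coincidences_le[OF T N, of d] by (simp only: of_nat_le_iff)
      also have "\<dots> \<le> C * real N powr (real (2 * l) - 1 / (20 * (real (2 * l))\<^sup>2))" using C(2) N by blast
      finally show "real (card {q\<in>idx T N \<times> idx T N. Z d (fst q) = Z d (snd q)}) \<le> C * real N powr (real (2 * l) - 1 / (20 * (real (2 * l))\<^sup>2))" .
    qed auto
    also have "\<dots> = C * real N powr (- 1 / (20 * (real (2 * l))\<^sup>2))"
    proof -
      have "(1 / real N ^ l)\<^sup>2 = 1 / real N powr (real (2 * l))"
        using N by (simp add: power_divide powr_realpow[symmetric] powr_powr power2_eq_square powr_add[symmetric])
      moreover have "real N powr (real (2 * l) - 1 / (20 * (real (2 * l))\<^sup>2)) = real N powr (real (2 * l)) * real N powr (- 1 / (20 * (real (2 * l))\<^sup>2))"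
        by (simp add: powr_add[symmetric])
      ultimately show ?thesis using N by simp
    qed
    finally show ?thesis by (simp add: ennreal_leI)
  qed
  have "AE \<alpha> in lborel. (\<lambda>j. \<phi> j \<alpha>) \<longlonglongrightarrow> 0"
  proof (rule AE_tendsto_0_of_summable[where u = "\<lambda>j. C * (1 / real (Suc j) ^ 2)"])
    show "\<phi> j \<in> borel_measurable lborel" for j
    proof -
      have "continuous_on UNIV (\<lambda>\<alpha>. (norm (S (Suc j ^ qq) \<alpha>))\<^sup>2)" unfolding S_def trig_sum_def by (intro continuous_intros)
      then have "(\<lambda>\<alpha>. (norm (S (Suc j ^ qq) \<alpha>))\<^sup>2) \<in> borel_measurable lborel" by (simp add: borel_measurable_continuous_onI)
      then show ?thesis unfolding \<phi>_def I_def by (intro borel_measurable_times borel_measurable_indicator) auto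
    qed
    show "\<phi> j \<alpha> \<ge> 0" for j \<alpha> by (simp add: \<phi>_def)
    show "summable (\<lambda>j. C * (1 / real (Suc j) ^ 2))"
    proof (rule summable_mult)
      have "summable (\<lambda>n. 1 / real n ^ 2)" using inverse_power_summable[of 2, where 'a = real] by (simp add: field_simps)
      then show "summable (\<lambda>j. 1 / real (Suc j) ^ 2)" by (subst (asm) summable_Suc_iff[symmetric])
    qed
    show "C * (1 / real (Suc j) ^ 2) \<ge> 0" for j using C(1) by simp
    show "(\<integral>\<^sup>+\<alpha>. ennreal (\<phi> j \<alpha>) \<partial>lborel) \<le> ennreal (C * (1 / real (Suc j) ^ 2))" for j
    proof -
      have e: "real qq * (- 1 / (20 * (real (2 * l))\<^sup>2)) = - 2" using l by simp
      have "real (Suc j ^ qq) = real (Suc j) powr real qq"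
        unfolding of_nat_power by (rule powr_realpow[symmetric]) simp
      then have "real (Suc j ^ qq) powr (- 1 / (20 * (real (2 * l))\<^sup>2)) = real (Suc j) powr - 2"
        unfolding e[symmetric] by (simp only: powr_powr)
      also have "\<dots> = 1 / real (Suc j) ^ 2"
        using powr_realpow[of "real (Suc j)" 2] by (simp add: powr_minus divide_inverse del: of_nat_Suc)
      finally have "real (Suc j ^ qq) powr (- 1 / (20 * (real (2 * l))\<^sup>2)) = 1 / real (Suc j) ^ 2" .
      moreover have "Suc j ^ qq \<ge> 1" by (rule one_le_power) simp
      ultimately show ?thesis using bound[of "Suc j ^ qq"] unfolding \<phi>_def by (simp only:)
    qed
  qed
  then show ?thesis
  proof eventually_elim
    case (elim \<alpha>)
    show ?case
    proof
      assume "\<alpha> \<in> {of_int a..of_int a + 1}"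
      then have "(\<lambda>j. (norm (S (Suc j ^ qq) \<alpha>))\<^sup>2) \<longlonglongrightarrow> 0" using elim by (simp add: \<phi>_def I_def)
      then have "(\<lambda>j. sqrt ((norm (S (Suc j ^ qq) \<alpha>))\<^sup>2)) \<longlonglongrightarrow> sqrt 0" by (rule tendsto_real_sqrt)
      then have "(\<lambda>j. norm (S (Suc j ^ qq) \<alpha>)) \<longlonglongrightarrow> 0" by simp
      then have "(\<lambda>j. S (Suc j ^ qq) \<alpha>) \<longlonglongrightarrow> 0" by (rule tendsto_norm_zero_cancel)
      then have "(\<lambda>j. Re (S (Suc j ^ qq) \<alpha>)) \<longlonglongrightarrow> 0" using tendsto_Re by fastforce
      moreover have "filterlim (\<lambda>j::nat. Suc j ^ qq) at_top sequentially"
      proof (rule filterlim_at_top_mono[OF filterlim_ident], intro always_eventually allI)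
        fix j :: nat
        have "Suc j ^ 1 \<le> Suc j ^ qq" using q1 by (intro power_increasing) auto
        then show "j \<le> Suc j ^ qq" by simp
      qed
      then have "(\<lambda>j. real (card (\<Omega> (Suc j ^ qq))) * (1 / real (T * (Suc j ^ qq))) ^ p / real (Suc j ^ qq)) \<longlonglongrightarrow> 1 / real T ^ p"
        by (rule filterlim_compose[OF main_term_limit[OF T]])
      ultimately have "(\<lambda>j. real (card (\<Omega> (Suc j ^ qq))) * (1 / real (T * (Suc j ^ qq))) ^ p / real (Suc j ^ qq) + Re (S (Suc j ^ qq) \<alpha>)) \<longlonglongrightarrow> 1 / real T ^ p + 0"
        by (intro tendsto_add)
      moreover have "avg \<alpha> d N (fprod T \<sigma> N) = real (card (\<Omega> N)) * (1 / real (T * N)) ^ p / real N + Re (S N \<alpha>)" if "N \<ge> 1" for N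
      proof -
        have "Re (complex_of_real (avg \<alpha> d N (fprod T \<sigma> N))) = Re (of_real (real (card (\<Omega> N)) * (1 / real (T * N)) ^ p / real N) + S N \<alpha>)"
          unfolding S_def by (rule arg_cong[OF avg_expansion[OF T that]])
        then show ?thesis by (simp only: Re_complex_of_real plus_complex.sel)
      qed
      ultimately have "(\<lambda>j. avg \<alpha> d (Suc j ^ qq) (fprod T \<sigma> (Suc j ^ qq))) \<longlonglongrightarrow> 1 / real T ^ p" by simp
      then show "(\<lambda>j. avg \<alpha> d (j ^ qq) (fprod T \<sigma> (j ^ qq))) \<longlonglongrightarrow> 1 / real T ^ CARD('n)"
        unfolding card_n by (rule LIMSEQ_imp_Suc)
    qed
  qed
qed

text \<open>The parameters \<open>d\<close>, \<open>T\<close>, \<sigma> and the unit intervals are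
  countably many, so one null set serves them all. The uncountably many test functions are then
  reached by deterministic approximation.\<close>

lemma AE_test_limit_all:
  "AE \<alpha> in lborel. \<forall>d. d > (2 * l) ^ (4 * l) \<longrightarrow> (\<forall>T\<ge>1. \<forall>\<sigma>.
     (\<lambda>j. avg \<alpha> d (j ^ qq) (fprod T \<sigma> (j ^ qq))) \<longlonglongrightarrow> 1 / real T ^ CARD('n))"
proof -
  have "AE \<alpha> in lborel. \<forall>(d::nat) (T::nat) (\<sigma>::'n \<Rightarrow> int) (a::int). d > (2 * l) ^ (4 * l) \<longrightarrow> T \<ge> 1 \<longrightarrow> \<alpha> \<in> {of_int a..of_int a + 1} \<longrightarrow>
     (\<lambda>j. avg \<alpha> d (j ^ qq) (fprod T \<sigma> (j ^ qq))) \<longlonglongrightarrow> 1 / real T ^ CARD('n)"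
    unfolding AE_all_countable
  proof (intro allI)
    fix d T \<sigma> a
    show "AE \<alpha> in lborel. d > (2 * l) ^ (4 * l) \<longrightarrow> T \<ge> 1 \<longrightarrow> \<alpha> \<in> {of_int a..of_int a + 1} \<longrightarrow>
     (\<lambda>j. avg \<alpha> d (j ^ qq) (fprod T \<sigma> (j ^ qq))) \<longlonglongrightarrow> 1 / real T ^ CARD('n)"
      using AE_test_limit[of T d a \<sigma>] by (cases "d > (2 * l) ^ (4 * l) \<and> T \<ge> 1") auto
  qed
  then show ?thesis
  proof eventually_elim
    case (elim \<alpha>)
    have "\<alpha> \<in> {of_int \<lfloor>\<alpha>\<rfloor>..of_int \<lfloor>\<alpha>\<rfloor> + 1}" by simp
    then show ?case using elim by blast
  qed
qed

end

lemma Cc_infty_cc_fun: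
  fixes f :: "real^'n::finite \<Rightarrow> real"
  assumes "f \<in> Cc_infty"
  shows "\<exists>A. cc_fun f A"
proof -
  have sm: "smooth_fun f" and cp: "compact (closure {x. f x \<noteq> 0})" using assms by (auto simp: Cc_infty_def)
  from sm obtain Df where "\<forall>x. (f has_derivative (\<lambda>v. \<Sum>i\<in>Basis. (v \<bullet> i) * Df i x)) (at x)"
    unfolding smooth_fun_def by blast
  then have c: "continuous_on UNIV f" by (intro continuous_at_imp_continuous_on) (auto intro: has_derivative_continuous)
  have "bounded (closure {x. f x \<noteq> 0})" using cp by (rule compact_imp_bounded)
  then have "bounded {x. f x \<noteq> 0}" using bounded_subset closure_subset by blast
  then obtain B where B: "\<forall>x\<in>{x. f x \<noteq> 0}. norm x \<le> B" by (auto simp: bounded_iff)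
  define A where "A = nat \<lceil>B\<rceil> + 1"
  have AB: "B \<le> real A" unfolding A_def by linarith
  have "cc_fun f A"
  proof
    show "continuous_on UNIV f" by (rule c)
    show "\<forall>i. \<bar>x $ i\<bar> \<le> real A" if "f x \<noteq> 0" for x :: "real^'n"
    proof
      fix i
      have "\<bar>x $ i\<bar> \<le> norm x" by (rule component_le_norm_cart)
      also have "\<dots> \<le> B" using B that by blast
      finally show "\<bar>x $ i\<bar> \<le> real A" using AB by linarith
    qed
    show "A \<ge> 1" by (simp add: A_def)
  qed
  then show ?thesis ..
qed

theorem theorem1p2:
  fixes l :: nat and b :: "nat \<Rightarrow> 'n::finite"
  assumes "l \<ge> 3" and "CARD('n) = l - 1" and "bij_betw b {..<l-1} UNIV"
  shows "AE \<alpha> in lborel. \<forall>d::nat. d > (2 * l) ^ (4 * l) \<longrightarrow> poissonian_corr l b \<alpha> d"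
proof -
  interpret correlation_setup l b using assms by unfold_locales
  have q: "40 * (2 * l)\<^sup>2 \<ge> 1" using assms(1) by simp
  show ?thesis
    using AE_test_limit_all
  proof eventually_elim
    case (elim \<alpha>)
    show ?case
      unfolding poissonian_corr_def
    proof (intro allI impI)
      fix d and f :: "real^'n \<Rightarrow> real" assume d: "d > (2 * l) ^ (4 * l)" and f: "f \<in> Cc_infty"
      obtain A where A: "cc_fun f A" using Cc_infty_cc_fun[OF f] by blast
      have "(\<lambda>N. avg \<alpha> d N (per N f)) \<longlonglongrightarrow> integral UNIV f"
        by (rule full_limit[OF A q]) (use elim d in blast)
      then show "(\<lambda>N. corr_R l b \<alpha> d f N) \<longlonglongrightarrow> integral UNIV f" by (simp only: corr_R_eq)
    qed
  qed
qed

end
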